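(* Let $\Omega\subset\mathbb{R}^p$ be a domain, $f\in AP(T_\Omega)$, $f\not\equiv0$, and let $D\Subset\Omega$ be a convex domain. Then there exist $k\in\mathbb{N}$ and vectors $\lambda^1,\dots,\lambda^k\in G(f)$, linearly independent over $\mathbb{Z}$, such that for any two connected components $D_0,D_1$ of $D\setminus A_f$, $$c(D_1)-c(D_0)=\sum_{j=1}^k r_j\lambda^j,\qquad r(D_1,D_0)=(r_1,\dots,r_k)\in\mathbb{Q}^k.$$ Moreover, for every $\beta>0$ there is a constant $K=K(f,D,\beta)<\infty$ such that $$\|r(D_1,D_0)\|\le K\,\|c(D_1)-c(D_0)\|$$ for all pairs of connected components $D_0,D_1$ of $D\setminus A_f$ with $\operatorname{mes}_{p-1}\{(y^1-y^0)/\|y^1-y^0\|:\ y^1\in D_1,\ y^0\in D_0\}\ge\beta$ (where $\operatorname{mes}_{p-1}$ is surface Lebesgue measure on the unit sphere of $\mathbb{R}^p$). Furthermore, for each fixed component $D_0$ there is a single constant $K(D_0)<\infty$ such that the last inequality holds for all components $D_1$ of $D\setminus A_f$.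
   Context: For a domain $\Omega\subset\mathbb{R}^p$, $T_\Omega=\{x+iy:\ x\in\mathbb{R}^p,\ y\in\Omega\}$. $\tau(T_\Omega)$ is the topology of uniform convergence on every $T_D$, $D\Subset\Omega$. $AP(T_\Omega)$ is the class of holomorphic $f$ on $T_\Omega$ whose translates $\{f(z+t)\}_{t\in\mathbb{R}^p}$ form a relatively compact family in $\tau(T_\Omega)$. The amoeba $A_f$ is the closure in $\Omega$ of $\{y\in\Omega:\ \exists x\in\mathbb{R}^p,\ f(x+iy)=0\}$. $\operatorname{sp}f=\{\lambda\in\mathbb{R}^p:\ \lim_{s\to\infty}(2s)^{-p}\int_{|x_j|<s}e^{-i\langle x+iy,\lambda\rangle}f(x+iy)\,dx\ne0\}$, and $G(f)$ is the additive subgroup of $\mathbb{R}^p$ generated by $\operatorname{sp}f$. The Jessen function $J_f(y)=\lim_{s\to\infty}(2s)^{-p}\int_{|x_j|<s}\log|f(x+iy)|\,dx$ exists, is convex, and is affine on every domain $U$ with $f\ne0$ on $T_U$; for such $U$ (e.g. a connected component of $D\setminus A_f$) the mean motion is $c(U)=-\operatorname{grad}J_f(y)$, $y\in U$, equivalently the unique $c\in\mathbb{R}^p$ such that on each $T_{U'}$, $U'\Subset U$, $f=\exp\{g+i\langle z,c\rangle\}$ with $g$ holomorphic and bounded. *)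

theory Defs
  imports "HOL-Analysis.Analysis" "HOL-Computational_Algebra.Group_Closure"
begin

definition cvec :: "real^'p \<Rightarrow> real^'p \<Rightarrow> complex^'p" where
  "cvec x y = (\<chi> j. Complex (x $ j) (y $ j))"

definition rvec :: "real^'p \<Rightarrow> complex^'p" where
  "rvec t = (\<chi> j. complex_of_real (t $ j))"

definition tube :: "(real^'p) set \<Rightarrow> (complex^'p) set" where
  "tube \<Omega> = {cvec x y | x y. y \<in> \<Omega>}"

definition domain :: "(real^'p) set \<Rightarrow> bool" where
  "domain \<Omega> \<longleftrightarrow> open \<Omega> \<and> connected \<Omega> \<and> \<Omega> \<noteq> {}"

definition compactly_in :: "(real^'p) set \<Rightarrow> (real^'p) set \<Rightarrow> bool" where
  "compactly_in D \<Omega> \<longleftrightarrow> bounded D \<and> closure D \<subseteq> \<Omega>"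

definition holo_on :: "(complex^'p \<Rightarrow> complex) \<Rightarrow> (complex^'p) set \<Rightarrow> bool" where
  "holo_on f S \<longleftrightarrow> open S \<and> (\<forall>z\<in>S. \<exists>L. (f has_derivative L) (at z) \<and>
       (\<forall>h. L (\<i> *s h) = \<i> * L h))"

text \<open>Almost periodic holomorphic functions: the family of real translates is relatively
  compact in the (metrizable) topology of uniform convergence on every T_D, D compactly
  contained in Omega, i.e. every sequence of translates has a subsequence converging
  in that topology.\<close>
definition AP :: "(real^'p) set \<Rightarrow> (complex^'p \<Rightarrow> complex) set" where
  "AP \<Omega> = {f. holo_on f (tube \<Omega>) \<and>
     (\<forall>t :: nat \<Rightarrow> real^'p. \<exists>r g. strict_mono r \<and>
        (\<forall>D. compactly_in D \<Omega> \<longrightarrow>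
           uniform_limit (tube D) (\<lambda>n z. f (z + rvec (t (r n)))) g sequentially))}"

definition amoeba :: "(real^'p) set \<Rightarrow> (complex^'p \<Rightarrow> complex) \<Rightarrow> (real^'p) set" where
  "amoeba \<Omega> f = \<Omega> \<inter> closure {y \<in> \<Omega>. \<exists>x. f (cvec x y) = 0}"

definition cube_mean :: "(real^'p \<Rightarrow> 'a::euclidean_space) \<Rightarrow> real \<Rightarrow> 'a" where
  "cube_mean g s = (1 / (2 * s) ^ CARD('p)) *\<^sub>R
      integral (box (- (s *\<^sub>R One)) (s *\<^sub>R One)) g"

definition cinner :: "complex^'p \<Rightarrow> real^'p \<Rightarrow> complex" where
  "cinner z l = (\<Sum>j\<in>UNIV. z $ j * complex_of_real (l $ j))"

definition spec :: "(real^'p) set \<Rightarrow> (complex^'p \<Rightarrow> complex) \<Rightarrow> (real^'p) set" where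
  "spec \<Omega> f = {l. \<exists>y\<in>\<Omega>. \<exists>a. a \<noteq> 0 \<and>
      ((\<lambda>s. cube_mean (\<lambda>x. exp (- \<i> * cinner (cvec x y) l) * f (cvec x y)) s) \<longlongrightarrow> a) at_top}"

definition Gf :: "(real^'p) set \<Rightarrow> (complex^'p \<Rightarrow> complex) \<Rightarrow> (real^'p) set" where
  "Gf \<Omega> f = group_closure (spec \<Omega> f)"

definition jessen :: "(complex^'p \<Rightarrow> complex) \<Rightarrow> real^'p \<Rightarrow> real" where
  "jessen f y = Lim at_top (\<lambda>s. cube_mean (\<lambda>x. ln (norm (f (cvec x y)))) s)"

definition mean_motion :: "(complex^'p \<Rightarrow> complex) \<Rightarrow> (real^'p) set \<Rightarrow> real^'p" where
  "mean_motion f U = (THE c. \<forall>y\<in>U. (jessen f has_derivative (\<lambda>h. - (c \<bullet> h))) (at y))"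

text \<open>Surface Lebesgue measure of a subset of the unit sphere, via the cone
  over it: sigma(S) = p * |{t s : 0 < t <= 1, s in S}|.\<close>
definition sphere_mes :: "(real^'p) set \<Rightarrow> real" where
  "sphere_mes S = real CARD('p) * measure lebesgue {t *\<^sub>R s | t s. 0 < t \<and> t \<le> 1 \<and> s \<in> S}"

definition directions :: "(real^'p) set \<Rightarrow> (real^'p) set \<Rightarrow> (real^'p) set" where
  "directions D1 D0 = {(1 / norm (y1 - y0)) *\<^sub>R (y1 - y0) | y1 y0.
      y1 \<in> D1 \<and> y0 \<in> D0 \<and> y1 \<noteq> y0}"

end

theory Submission
  imports Defs "HOL-Complex_Analysis.Complex_Analysis"
begin

text \<open>Over a zero-free fibre \<open>y\<close> the phase of \<open>x \<mapsto> f (x + i y)\<close> stays at bounded distance from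
  \<open>c(y) \<bullet> x\<close>, and \<open>c(y)\<close> is the mean motion. Approximate \<open>f\<close> uniformly over \<open>D\<close> by an exponential
  polynomial with finite spectrum \<open>\<Lambda>\<close> inside \<open>sp f\<close>. If \<open>\<psi>\<close> is an additive functional that is small
  on \<open>\<Lambda>\<close>, then Kronecker's theorem, applied to \<open>\<psi> / m\<close> with \<open>m\<close> large and iterated \<open>m\<close> times, gives an
  almost period \<open>a\<close> of \<open>f\<close> along which the phase over \<open>y\<close> winds \<open>J(y)\<close> times while \<open>c(y) \<bullet> a\<close> is
  \<open>\<psi>(c(y)) + 2 \<pi> J(y)\<close> up to a small error. A mean motion outside the rational span of \<open>\<Lambda>\<close> would admit
  a \<open>\<psi>\<close> that vanishes on \<open>\<Lambda>\<close> and is huge at \<open>c(y)\<close>, which is impossible; so all mean motions are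
  rational combinations of a maximal independent subset \<open>\<lambda>\<^sup>1, \<dots>, \<lambda>\<^sup>k\<close> of \<open>\<Lambda>\<close>, and the coefficients
  are given by additive functionals \<open>\<psi>\<^sub>j\<close>.

  For the estimate join \<open>y\<^sub>0 \<in> D\<^sub>0\<close> to \<open>y\<^sub>1 = y\<^sub>0 + L e \<in> D\<^sub>1\<close>. By the argument principle on rectangles
  the difference of the phases over \<open>y\<^sub>1\<close> and \<open>y\<^sub>0\<close>, transported along columns in direction \<open>e\<close> on which
  \<open>f\<close> is bounded below, is monotone in direction \<open>e\<close>. Such columns occur with gaps at most \<open>R\<close>; comparing
  the translates by \<open>n a + 3 R n e\<close> yields \<open>\<bar>\<psi>(c\<^sub>1 - c\<^sub>0)\<bar> \<le> 3 R \<bar>(c\<^sub>1 - c\<^sub>0) \<bullet> e\<bar>\<close>. The constant \<open>R\<close> depends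
  only on the distance of \<open>e\<close> from finitely many hyperplanes, and a set of directions of measure at
  least \<open>\<beta>\<close> cannot lie in thin neighbourhoods of these. A fixed component \<open>D\<^sub>0\<close> contains a ball, which
  bounds the measure of its sets of directions from below.\<close>

subsection \<open>Cube means\<close>

text \<open>Uniformity is the obstacle. D minus the amoeba may have infinitely many components; over
  their fibres the lower bound \<open>\<delta>\<close> of |f| may be arbitrarily small and the bound
  \<open>C\<close> on the distance of the phase from c . x arbitrarily large, so neither may enter
  the final constant. Two scales are therefore kept apart. \<open>\<epsilon>\<close> and
  \<open>R\<close> come from columns, depend only on f, D and the admissible directions, and
  determine the constant. \<open>\<delta>\<close> only decides into how many steps \<open>m\<close>
  an almost period is cut, so that the logarithm over a fibre can be followed step by step;
  \<open>C\<close> disappears when n translates are compared and n tends to infinity. The spectrum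
  may also fail to be finitely generated, and the coefficients r_j depend on c rationally linearly,
  in general not continuously. A functional is only ever required to be small on the finite spectrum
  of an approximant, which can be reached by scaling it; this is why discontinuous additive
  functionals are admissible throughout.\<close>

abbreviation cube :: "real \<Rightarrow> (real^'p) set" where
  "cube s \<equiv> cbox (- (s *\<^sub>R One)) (s *\<^sub>R One)"

lemma cube_mean_cbox:
  fixes g :: "real^'p \<Rightarrow> 'a::euclidean_space"
  shows "cube_mean g s = (1 / (2 * s) ^ CARD('p)) *\<^sub>R integral (cube s) g"
  by (simp add: cube_mean_def integral_open_interval)

lemma content_cube:
  assumes "s \<ge> 0" shows "measure lborel (cube s :: (real^'p) set) = (2 * s) ^ CARD('p)"
proof -
  have "measure lborel (cube s :: (real^'p) set) = (\<Prod>i\<in>(Basis::(real^'p) set). 2 * s)"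
    using assms by (subst content_cbox) (auto simp: inner_sum_left_Basis)
  then show ?thesis by simp
qed

lemma cube_mono: "s \<le> s' \<Longrightarrow> (cube s :: (real^'p) set) \<subseteq> cube s'"
  by (rule subset_box_imp) (auto simp: inner_sum_left_Basis)

lemma cube_mean_add:
  fixes u v :: "real^'p \<Rightarrow> 'a::euclidean_space"
  assumes "continuous_on UNIV u" "continuous_on UNIV v"
  shows "cube_mean (\<lambda>x. u x + v x) s = cube_mean u s + cube_mean v s"
  unfolding cube_mean_cbox
  by (subst integral_add)
     (auto intro!: integrable_continuous continuous_on_subset[OF assms(1)]
        continuous_on_subset[OF assms(2)] simp: scaleR_right_distrib)

lemma cube_mean_diff:
  fixes u v :: "real^'p \<Rightarrow> 'a::euclidean_space"
  assumes "continuous_on UNIV u" "continuous_on UNIV v"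
  shows "cube_mean (\<lambda>x. u x - v x) s = cube_mean u s - cube_mean v s"
  unfolding cube_mean_cbox
  by (subst integral_diff)
     (auto intro!: integrable_continuous continuous_on_subset[OF assms(1)]
        continuous_on_subset[OF assms(2)] simp: scaleR_right_diff_distrib)

lemma cube_mean_const:
  assumes "s > 0" shows "cube_mean (\<lambda>x::real^'p. c::'a::euclidean_space) s = c"
  unfolding cube_mean_cbox integral_const using assms
  by (subst content_cube) auto

lemma cube_mean_linear:
  fixes u :: "real^'p \<Rightarrow> 'a::euclidean_space" and h :: "'a \<Rightarrow> 'b::euclidean_space"
  assumes "continuous_on UNIV u" "bounded_linear h"
  shows "cube_mean (\<lambda>x. h (u x)) s = h (cube_mean u s)"
proof -
  interpret bounded_linear h by fact
  have "integral (cube s) (h \<circ> u) = h (integral (cube s) u)"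
    by (intro integral_linear integrable_continuous continuous_on_subset[OF assms(1)] assms) auto
  then show ?thesis by (simp add: cube_mean_cbox o_def scaleR)
qed

lemma cube_mean_cmult:
  fixes u :: "real^'p \<Rightarrow> complex"
  assumes "continuous_on UNIV u"
  shows "cube_mean (\<lambda>x. c * u x) s = c * cube_mean u s"
  by (rule cube_mean_linear[OF assms]) (rule bounded_linear_mult_right)

lemma cube_mean_sum:
  fixes u :: "'i \<Rightarrow> real^'p \<Rightarrow> 'a::euclidean_space"
  assumes "finite I" "\<And>i. i \<in> I \<Longrightarrow> continuous_on UNIV (u i)"
  shows "cube_mean (\<lambda>x. \<Sum>i\<in>I. u i x) s = (\<Sum>i\<in>I. cube_mean (u i) s)"
  unfolding cube_mean_cbox using assms
  by (subst integral_sum) (auto intro!: integrable_continuous intro: continuous_on_subset simp: scaleR_sum_right)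

lemma cube_mean_mono_norm:
  fixes u :: "real^'p \<Rightarrow> 'a::euclidean_space" and v :: "real^'p \<Rightarrow> real"
  assumes "continuous_on UNIV u" "continuous_on UNIV v" "\<And>x. norm (u x) \<le> v x" "s > 0"
  shows "norm (cube_mean u s) \<le> cube_mean v s"
proof -
  have "norm (integral (cube s) u) \<le> integral (cube s) v"
    by (intro integral_norm_bound_integral integrable_continuous continuous_on_subset[OF assms(1)]
        continuous_on_subset[OF assms(2)] assms(3)) auto
  then show ?thesis using assms(4) by (simp add: cube_mean_cbox divide_right_mono)
qed

lemma norm_cube_mean_le:
  fixes u :: "real^'p \<Rightarrow> 'a::euclidean_space"
  assumes "continuous_on UNIV u" "\<And>x. norm (u x) \<le> B" "s > 0"
  shows "norm (cube_mean u s) \<le> B"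
  using cube_mean_mono_norm[of u "\<lambda>_. B" s] assms by (simp add: cube_mean_const)

lemma norm_integral_diff_cbox_le:
  fixes u :: "'n::euclidean_space \<Rightarrow> 'a::euclidean_space"
  assumes "continuous_on UNIV u" "\<And>x. norm (u x) \<le> B" "cbox a b \<subseteq> cbox c d"
  shows "norm (integral (cbox c d) u - integral (cbox a b) u) \<le> B * (measure lborel (cbox c d) - measure lborel (cbox a b))"
proof -
  have i: "u integrable_on cbox p q" for p q
    by (intro integrable_continuous continuous_on_subset[OF assms(1)]) auto
  have n: "negligible (cbox a b - cbox c d)" using assms(3) by (simp add: Diff_eq_empty_iff[THEN iffD2])
  have 1: "integral (cbox c d - cbox a b) u = integral (cbox c d) u - integral (cbox a b) u"
    by (rule integral_setdiff[OF i i n])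
  have 2: "integral (cbox c d - cbox a b) (\<lambda>_. B) = integral (cbox c d) (\<lambda>_. B) - integral (cbox a b) (\<lambda>_. B)"
    by (rule integral_setdiff[OF _ _ n]) auto
  have "norm (integral (cbox c d - cbox a b) u) \<le> integral (cbox c d - cbox a b) (\<lambda>_. B)"
    by (rule integral_norm_bound_integral)
       (use i n assms(2) in \<open>auto intro!: integrable_setdiff[OF integrable_integral integrable_integral]\<close>)
  then show ?thesis unfolding 1 2 by (simp add: algebra_simps)
qed

lemma integral_cube_shift:
  fixes u :: "real^'p \<Rightarrow> 'a::euclidean_space"
  shows "integral (cube s) (\<lambda>x. u (x + t)) = integral (cbox (- (s *\<^sub>R One) + t) (s *\<^sub>R One + t)) u"
proof -
  have "((\<lambda>x. u (x + t)) has_integral I) (cube s) \<longleftrightarrow> (u has_integral I) (cbox (- (s *\<^sub>R One) + t) (s *\<^sub>R One + t))" for I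
    using has_integral_shift_cbox_iff[of u t I "- (s *\<^sub>R One)" "s *\<^sub>R One"] by (simp add: o_def add.commute)
  then show ?thesis unfolding integral_def integrable_on_def by simp
qed

text \<open>The cube and its translate by \<open>t\<close> both lie in the cube of half side
  \<open>s + norm t\<close>, and each of them covers all but a fraction O(1/s) of its
  volume.\<close>

lemma cube_mean_shift:
  fixes u :: "real^'p \<Rightarrow> 'a::euclidean_space"
  assumes "continuous_on UNIV u" "\<And>x. norm (u x) \<le> B"
  shows "((\<lambda>s. cube_mean (\<lambda>x. u (x + t)) s - cube_mean u s) \<longlongrightarrow> 0) at_top"
proof (rule Lim_null_comparison)
  define \<tau> where "\<tau> = norm t"
  have B: "B \<ge> 0" using assms(2)[of 0] norm_ge_zero order_trans by blast
  show "\<forall>\<^sub>F s in at_top. norm (cube_mean (\<lambda>x. u (x + t)) s - cube_mean u s)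
        \<le> 2 * B * (((2 * (s + \<tau>)) ^ CARD('p)) / (2 * s) ^ CARD('p) - 1)"
    using eventually_gt_at_top[of 0]
  proof eventually_elim
    case (elim s)
    let ?A = "cbox (- (s *\<^sub>R One) + t) (s *\<^sub>R One + t)" and ?C = "cube (s + \<tau>) :: (real^'p) set"
    have tb: "\<bar>t \<bullet> i\<bar> \<le> \<tau>" if "i \<in> Basis" for i using Basis_le_norm[OF that] by (simp add: \<tau>_def)
    have sub: "?A \<subseteq> ?C"
    proof (rule subset_box_imp, intro ballI)
      fix i :: "real^'p" assume i: "i \<in> Basis"
      then show "- ((s + \<tau>) *\<^sub>R One) \<bullet> i \<le> (- (s *\<^sub>R One) + t) \<bullet> i \<and> (s *\<^sub>R One + t) \<bullet> i \<le> ((s + \<tau>) *\<^sub>R One) \<bullet> i"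
        using tb[OF i] by (auto simp: inner_add_left inner_diff_left inner_sum_left_Basis abs_le_iff)
    qed
    have sub2: "(cube s :: (real^'p) set) \<subseteq> ?C" by (rule cube_mono) (simp add: \<tau>_def)
    have cA: "measure lborel ?A = (2 * s) ^ CARD('p)"
    proof -
      have ne: "(cube s :: (real^'p) set) \<noteq> {}" using elim by (simp add: box_ne_empty inner_sum_left_Basis)
      have "?A = (+) t ` cube s" using cbox_translation[of t "- (s *\<^sub>R One)" "s *\<^sub>R One"] by (simp add: add.commute)
      then have "?A \<noteq> {}" using ne by simp
      then have "measure lborel ?A = (\<Prod>i\<in>(Basis::(real^'p) set). 2 * s)"
        by (subst content_cbox') (auto simp: inner_add_left inner_diff_left inner_sum_left_Basis intro!: prod.cong)
      then show ?thesis by simp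
    qed
    have cC: "measure lborel ?C = (2 * (s + \<tau>)) ^ CARD('p)"
      by (rule content_cube) (use elim in \<open>simp add: \<tau>_def\<close>)
    have a: "norm (integral ?C u - integral ?A u) \<le> B * ((2 * (s + \<tau>)) ^ CARD('p) - (2 * s) ^ CARD('p))"
      using norm_integral_diff_cbox_le[OF assms sub] unfolding cA cC .
    have b: "norm (integral ?C u - integral (cube s) u) \<le> B * ((2 * (s + \<tau>)) ^ CARD('p) - (2 * s) ^ CARD('p))"
      using norm_integral_diff_cbox_le[OF assms sub2] content_cube[of s, where 'p='p] elim by (simp add: cC)
    have "norm (integral ?A u - integral (cube s) u) \<le> 2 * B * ((2 * (s + \<tau>)) ^ CARD('p) - (2 * s) ^ CARD('p))"
      using norm_triangle_ineq4[of "integral ?C u - integral (cube s) u" "integral ?C u - integral ?A u"] a b by simp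
    moreover have "norm (cube_mean (\<lambda>x. u (x + t)) s - cube_mean u s) =
        norm (integral ?A u - integral (cube s) u) / (2 * s) ^ CARD('p)"
      using elim by (simp add: cube_mean_cbox integral_cube_shift scaleR_right_diff_distrib[symmetric])
    ultimately have "norm (cube_mean (\<lambda>x. u (x + t)) s - cube_mean u s) \<le>
       2 * B * ((2 * (s + \<tau>)) ^ CARD('p) - (2 * s) ^ CARD('p)) / (2 * s) ^ CARD('p)"
      using elim by (simp add: divide_right_mono)
    also have "\<dots> = 2 * B * (((2 * (s + \<tau>)) ^ CARD('p)) / (2 * s) ^ CARD('p) - 1)"
      using elim by (simp add: field_simps)
    finally show ?case .
  qed
  have "((\<lambda>s. (1 + \<tau> / s) ^ CARD('p)) \<longlongrightarrow> (1 + 0) ^ CARD('p)) at_top"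
    by (intro tendsto_intros tendsto_divide_0[OF tendsto_const] filterlim_at_top_imp_at_infinity filterlim_ident)
  then have "((\<lambda>s. 2 * B * ((1 + \<tau> / s) ^ CARD('p) - 1)) \<longlongrightarrow> 2 * B * ((1 + 0) ^ CARD('p) - 1)) at_top"
    by (intro tendsto_mult tendsto_diff tendsto_const)
  moreover have "\<forall>\<^sub>F s in at_top. 2 * B * ((1 + \<tau> / s) ^ CARD('p) - 1) =
     2 * B * (((2 * (s + \<tau>)) ^ CARD('p)) / (2 * s) ^ CARD('p) - 1)"
    using eventually_gt_at_top[of 0]
  proof eventually_elim
    case (elim s)
    then have "1 + \<tau> / s = (2 * (s + \<tau>)) / (2 * s)" by (simp add: field_simps)
    then show ?case by (simp only: power_divide)
  qed
  ultimately show "((\<lambda>s. 2 * B * (((2 * (s + \<tau>)) ^ CARD('p)) / (2 * s) ^ CARD('p) - 1)) \<longlongrightarrow> 0) at_top"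
    by (simp add: tendsto_cong)
qed

lemma cube_mean_swap:
  fixes u :: "real^'p \<Rightarrow> 'a::euclidean_space"
  assumes "continuous_on UNIV u"
  shows "cube_mean (\<lambda>t. cube_mean (\<lambda>x. u (x + t)) s) s' = cube_mean (\<lambda>x. cube_mean (\<lambda>t. u (x + t)) s') s"
proof -
  have c: "continuous_on (cbox (a, c) (b, d)) (\<lambda>(x, t). u (x + t))" for a b c d
    unfolding split_def by (intro continuous_on_compose2[OF assms] continuous_intros) auto
  have "integral (cube s') (\<lambda>t. integral (cube s) (\<lambda>x. u (x + t))) =
        integral (cube s) (\<lambda>x. integral (cube s') (\<lambda>t. u (x + t)))"
    using integral_swap_continuous[OF c[of "- (s *\<^sub>R One)" "- (s' *\<^sub>R One)" "s *\<^sub>R One" "s' *\<^sub>R One"]]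
    by simp
  then show ?thesis by (simp add: cube_mean_cbox)
qed

lemma continuous_cube_mean_shift:
  fixes u :: "real^'p \<Rightarrow> 'a::euclidean_space"
  assumes "continuous_on UNIV u"
  shows "continuous_on UNIV (\<lambda>t. cube_mean (\<lambda>x. u (x + t)) s)"
proof -
  have "continuous_on UNIV (\<lambda>t. integral (cube s) (\<lambda>x. u (x + t)))"
    by (rule integral_continuous_on_param)
       (auto simp: split_def intro!: continuous_on_compose2[OF assms] continuous_intros)
  then show ?thesis by (simp add: cube_mean_cbox continuous_intros)
qed

lemma continuous_shift:
  fixes u :: "'a::real_normed_vector \<Rightarrow> 'b::real_normed_vector"
  shows "continuous_on UNIV u \<Longrightarrow> continuous_on UNIV (\<lambda>x. u (x + t))"
  by (rule continuous_on_compose2[of UNIV u]) (auto intro!: continuous_intros)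

subsection \<open>Almost periodic functions on Euclidean space\<close>

text \<open>Bochner's criterion for almost periodicity, with uniformly Cauchy sequences of
  translates in place of uniform limits, so that no limit function has to be carried along.\<close>

definition ap_fun :: "(real^'p \<Rightarrow> 'a::euclidean_space) \<Rightarrow> bool" where
  "ap_fun u \<longleftrightarrow> continuous_on UNIV u \<and> (\<forall>t::nat \<Rightarrow> real^'p. \<exists>r::nat \<Rightarrow> nat. strict_mono r \<and>
     (\<forall>e>0. \<exists>N. \<forall>m\<ge>N. \<forall>n\<ge>N. \<forall>x. norm (u (x + t (r m)) - u (x + t (r n))) \<le> e))"

lemma ap_fun_continuous: "ap_fun u \<Longrightarrow> continuous_on UNIV u" by (simp add: ap_fun_def)

lemma ap_fun_subseq:
  fixes t :: "nat \<Rightarrow> real^'p" and u :: "real^'p \<Rightarrow> 'a::euclidean_space"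
  assumes "ap_fun u"
  obtains r :: "nat \<Rightarrow> nat" where "strict_mono r"
    "\<And>e. e > 0 \<Longrightarrow> \<exists>N. \<forall>m\<ge>N. \<forall>n\<ge>N. \<forall>x. norm (u (x + t (r m)) - u (x + t (r n))) \<le> e"
  using assms unfolding ap_fun_def by meson

lemma ap_fun_bounded:
  fixes u :: "real^'p \<Rightarrow> 'a::euclidean_space"
  assumes "ap_fun u" obtains B where "\<And>x. norm (u x) \<le> B"
proof (rule ccontr)
  assume "\<not> thesis"
  then have "\<forall>n::nat. \<exists>x. norm (u x) > real n" using that by (meson not_le)
  then obtain t where t: "\<And>n. norm (u (t n)) > real n" by metis
  obtain r :: "nat \<Rightarrow> nat" where r: "strict_mono r"
    "\<And>e. e > 0 \<Longrightarrow> \<exists>N. \<forall>m\<ge>N. \<forall>n\<ge>N. \<forall>x. norm (u (x + t (r m)) - u (x + t (r n))) \<le> e"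
    using ap_fun_subseq[OF assms, of "t"] by blast
  obtain N where N: "\<forall>m\<ge>N. \<forall>n\<ge>N. \<forall>x. norm (u (x + t (r m)) - u (x + t (r n))) \<le> 1" using r(2)[of 1] by auto
  obtain M :: nat where M: "real M > norm (u (t (r N))) + 1" using reals_Archimedean2 by blast
  have "norm (u (0 + t (r (max M N))) - u (0 + t (r N))) \<le> 1" using N by (metis max.cobounded2 order_refl)
  then have "norm (u (t (r (max M N)))) \<le> norm (u (t (r N))) + 1"
    using norm_triangle_ineq2[of "u (t (r (max M N)))" "u (t (r N))"] by simp
  moreover have "norm (u (t (r (max M N)))) > real (r (max M N))" by (rule t)
  moreover have "r (max M N) \<ge> M" using seq_suble[OF r(1), of "max M N"] by simp
  ultimately show False using M by linarith
qed

text \<open>For a single translate this is \<open>cube_mean_shift\<close>. Uniformity in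
  \<open>t\<close> is a matter of compactness: a sequence of bad translates would have a subsequence
  whose members are all close to one fixed translate.\<close>

lemma ap_fun_shift_uniform:
  fixes u :: "real^'p \<Rightarrow> 'a::euclidean_space"
  assumes u: "ap_fun u" and e: "e > 0"
  shows "\<exists>s0. \<forall>s\<ge>s0. \<forall>t. norm (cube_mean (\<lambda>x. u (x + t)) s - cube_mean u s) \<le> e"
proof (rule ccontr)
  assume "\<not> ?thesis"
  then have "\<forall>n::nat. \<exists>s t. s \<ge> real n + 1 \<and> norm (cube_mean (\<lambda>x. u (x + t)) s - cube_mean u s) > e"
    by (meson not_le)
  then obtain s t where st: "\<And>n. s n \<ge> real n + 1" "\<And>n. norm (cube_mean (\<lambda>x. u (x + t n)) (s n) - cube_mean u (s n)) > e"
    by metis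
  obtain r :: "nat \<Rightarrow> nat" where r: "strict_mono r"
    "\<And>e. e > 0 \<Longrightarrow> \<exists>N. \<forall>m\<ge>N. \<forall>n\<ge>N. \<forall>x. norm (u (x + t (r m)) - u (x + t (r n))) \<le> e"
    using ap_fun_subseq[OF u, of "t"] by blast
  obtain N where N: "\<forall>m\<ge>N. \<forall>n\<ge>N. \<forall>x. norm (u (x + t (r m)) - u (x + t (r n))) \<le> e/2"
    using r(2)[of "e/2"] e by auto
  obtain B where B: "\<And>x. norm (u x) \<le> B" using ap_fun_bounded[OF u] by blast
  note c = ap_fun_continuous[OF u]
  have "filterlim (\<lambda>n. s (r n)) at_top sequentially"
  proof (rule filterlim_at_top_mono[OF filterlim_real_sequentially])
    show "\<forall>\<^sub>F n in sequentially. real n \<le> s (r n)"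
    proof (intro always_eventually allI)
      fix n show "real n \<le> s (r n)" using st(1)[of "r n"] seq_suble[OF r(1), of n] by linarith
    qed
  qed
  then have z: "(\<lambda>n. cube_mean (\<lambda>x. u (x + t (r N))) (s (r n)) - cube_mean u (s (r n))) \<longlonglongrightarrow> 0"
    using filterlim_compose[OF cube_mean_shift[OF c B, of "t (r N)"]] by blast
  have "\<forall>\<^sub>F n in sequentially. norm (cube_mean (\<lambda>x. u (x + t (r N))) (s (r n)) - cube_mean u (s (r n))) < e/2"
    using tendstoD[OF z, of "e/2"] e by (simp add: dist_norm)
  then have "\<forall>\<^sub>F n in sequentially. n \<ge> N \<and> norm (cube_mean (\<lambda>x. u (x + t (r N))) (s (r n)) - cube_mean u (s (r n))) < e/2"
    using eventually_ge_at_top[of N] by eventually_elim auto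
  then obtain n where n: "n \<ge> N" "norm (cube_mean (\<lambda>x. u (x + t (r N))) (s (r n)) - cube_mean u (s (r n))) < e/2"
    by (auto simp: eventually_sequentially)
  have "norm (cube_mean (\<lambda>x. u (x + t (r n)) - u (x + t (r N))) (s (r n))) \<le> e/2"
    using N n(1) st(1)[of "r n"] by (intro norm_cube_mean_le continuous_intros continuous_shift c) (auto simp: add.commute)
  then have "norm (cube_mean (\<lambda>x. u (x + t (r n))) (s (r n)) - cube_mean (\<lambda>x. u (x + t (r N))) (s (r n))) \<le> e/2"
    by (simp add: cube_mean_diff continuous_shift c)
  then have "norm (cube_mean (\<lambda>x. u (x + t (r n))) (s (r n)) - cube_mean u (s (r n))) < e"
    using n(2) norm_triangle_ineq[of "cube_mean (\<lambda>x. u (x + t (r n))) (s (r n)) - cube_mean (\<lambda>x. u (x + t (r N))) (s (r n))"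
      "cube_mean (\<lambda>x. u (x + t (r N))) (s (r n)) - cube_mean u (s (r n))"] by simp
  then show False using st(2)[of "r n"] by simp
qed

lemma Cauchy_at_top_limit:
  fixes g :: "real \<Rightarrow> 'a::euclidean_space"
  assumes "\<And>e. e > 0 \<Longrightarrow> \<exists>s0. \<forall>s\<ge>s0. \<forall>s'\<ge>s0. norm (g s - g s') \<le> e"
  shows "\<exists>l. (g \<longlongrightarrow> l) at_top"
proof -
  have "Cauchy (\<lambda>n. g (real n))"
  proof (rule metric_CauchyI)
    fix e :: real assume "e > 0"
    then obtain s0 where s0: "\<forall>s\<ge>s0. \<forall>s'\<ge>s0. norm (g s - g s') \<le> e/2" using assms[of "e/2"] by auto
    obtain M :: nat where "real M \<ge> s0" using real_arch_simple by blast
    then have "\<forall>m\<ge>M. \<forall>n\<ge>M. dist (g (real m)) (g (real n)) < e"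
    proof (intro allI impI)
      fix m n assume "M \<le> m" "M \<le> n"
      then have "real m \<ge> s0" "real n \<ge> s0" using \<open>real M \<ge> s0\<close> by linarith+
      then have "norm (g (real m) - g (real n)) \<le> e / 2" using s0 by blast
      then show "dist (g (real m)) (g (real n)) < e" using \<open>e > 0\<close> by (simp add: dist_norm)
    qed
    then show "\<exists>M. \<forall>m\<ge>M. \<forall>n\<ge>M. dist (g (real m)) (g (real n)) < e" by blast
  qed
  then obtain l where l: "(\<lambda>n. g (real n)) \<longlonglongrightarrow> l" using Cauchy_convergent_iff convergent_def by blast
  have "(g \<longlongrightarrow> l) at_top"
  proof (rule tendstoI)
    fix e :: real assume "e > 0"
    then obtain s0 where s0: "\<forall>s\<ge>s0. \<forall>s'\<ge>s0. norm (g s - g s') \<le> e/2" using assms[of "e/2"] by auto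
    obtain M :: nat where M: "real M \<ge> s0" using real_arch_simple by blast
    have "\<forall>\<^sub>F n in sequentially. dist (g (real n)) l < e/2 \<and> n \<ge> M"
      using tendstoD[OF l, of "e/2"] \<open>e > 0\<close> eventually_ge_at_top[of M] by (auto simp: eventually_conj_iff)
    then obtain n where n: "dist (g (real n)) l < e/2" "n \<ge> M" by (auto simp: eventually_sequentially)
    show "\<forall>\<^sub>F s in at_top. dist (g s) l < e"
      using eventually_ge_at_top[of s0]
    proof eventually_elim
      case (elim s)
      have "real n \<ge> s0" using M n(2) by linarith
      then have "dist (g s) (g (real n)) \<le> e/2" using s0 elim by (simp add: dist_norm)
      then show ?case using n(1) dist_triangle[of "g s" l "g (real n)"] by linarith
    qed
  qed
  then show ?thesis by blast
qed

text \<open>Averaging over two cubes at once: by Fubini the two iterated means agree, and each is close to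
  a single mean because the means of the translates are uniformly close.\<close>

lemma ap_fun_mean_exists:
  fixes u :: "real^'p \<Rightarrow> 'a::euclidean_space"
  assumes u: "ap_fun u"
  shows "\<exists>m. (cube_mean u \<longlongrightarrow> m) at_top"
proof (rule Cauchy_at_top_limit)
  fix e :: real assume e: "e > 0"
  obtain s0 where s0: "\<forall>s\<ge>s0. \<forall>t. norm (cube_mean (\<lambda>x. u (x + t)) s - cube_mean u s) \<le> e/2"
    using ap_fun_shift_uniform[OF u, of "e/2"] e by auto
  note c = ap_fun_continuous[OF u]
  have double: "norm (cube_mean (\<lambda>t. cube_mean (\<lambda>x. u (x + t)) s) s' - cube_mean u s) \<le> e/2"
    if "s \<ge> s0" "s' > 0" for s s'
  proof -
    have "norm (cube_mean (\<lambda>t. cube_mean (\<lambda>x. u (x + t)) s - cube_mean u s) s') \<le> e/2"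
      using s0 that by (intro norm_cube_mean_le continuous_intros continuous_cube_mean_shift c) auto
    then show ?thesis
      by (simp add: cube_mean_diff continuous_cube_mean_shift c cube_mean_const that(2))
  qed
  show "\<exists>s0. \<forall>s\<ge>s0. \<forall>s'\<ge>s0. norm (cube_mean u s - cube_mean u s') \<le> e"
  proof (intro exI[of _ "max s0 1"] allI impI)
    fix s s' assume s: "s \<ge> max s0 1" "s' \<ge> max s0 1"
    have "norm (cube_mean (\<lambda>t. cube_mean (\<lambda>x. u (x + t)) s) s' - cube_mean u s) \<le> e/2"
      "norm (cube_mean (\<lambda>t. cube_mean (\<lambda>x. u (x + t)) s') s - cube_mean u s') \<le> e/2"
      using double s by auto
    moreover have "cube_mean (\<lambda>t. cube_mean (\<lambda>x. u (x + t)) s') s = cube_mean (\<lambda>t. cube_mean (\<lambda>x. u (x + t)) s) s'"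
      by (subst cube_mean_swap[OF c]) (simp add: add.commute)
    ultimately show "norm (cube_mean u s - cube_mean u s') \<le> e"
      using norm_diff_triangle_le[of "cube_mean u s" "cube_mean (\<lambda>t. cube_mean (\<lambda>x. u (x + t)) s) s'" "e/2" "cube_mean u s'" "e/2"]
      by (simp add: norm_minus_commute)
  qed
qed

text \<open>By Fubini, averaging first over segments in direction \<open>l\<close> and then over
  cubes again gives the mean \<open>m\<close>. Estimates on segments that are uniform in the base
  point thus carry over to means; this is how the bounds of \<open>rectangle_integral_bound\<close>
  are used.\<close>

lemma cube_mean_line_average:
  fixes u :: "real^'p \<Rightarrow> 'a::euclidean_space"
  assumes c: "continuous_on UNIV u" and B: "\<And>x. norm (u x) \<le> B" and T: "T > 0" and m: "(cube_mean u \<longlongrightarrow> m) at_top"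
    and av: "\<And>x. norm (integral {-T..T} (\<lambda>t. u (x + t *\<^sub>R l)) - (2 * T) *\<^sub>R a) \<le> 2 * T * \<eta>"
  shows "norm (m - a) \<le> \<eta>"
proof -
  define w where "w x = integral {-T..T} (\<lambda>t. u (x + t *\<^sub>R l))" for x
  have cw: "continuous_on UNIV w" unfolding w_def cbox_interval[symmetric]
    by (rule integral_continuous_on_param)
       (auto simp: split_def intro!: continuous_on_compose2[OF c] continuous_intros)
  have cl: "continuous_on UNIV (\<lambda>x. u (x + t *\<^sub>R l))" for t by (rule continuous_shift[OF c])
  have sw: "cube_mean w s = integral {-T..T} (\<lambda>t. cube_mean (\<lambda>x. u (x + t *\<^sub>R l)) s)" for s
  proof -
    have cc: "continuous_on (cbox (p, q) (p', q')) (\<lambda>(x, t). u (x + t *\<^sub>R l))" for p q p' q'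
      unfolding split_def by (intro continuous_on_compose2[OF c] continuous_intros) auto
    have "integral (cube s) w = integral (cbox (-T) T) (\<lambda>t. integral (cube s) (\<lambda>x. u (x + t *\<^sub>R l)))"
      unfolding w_def cbox_interval[symmetric] by (rule integral_swap_continuous[OF cc])
    then show ?thesis by (simp add: cube_mean_cbox cbox_interval)
  qed
  have "((\<lambda>s. cube_mean w s) \<longlongrightarrow> integral {-T..T} (\<lambda>t. m)) at_top"
  proof (rule tendsto_at_topI_sequentially)
    fix S :: "nat \<Rightarrow> real" assume S: "filterlim S at_top sequentially"
    \<comment> \<open>Cutting off at 1 keeps the side of the cube positive, so that the constant
      \<open>B\<close> dominates every term of the sequence.\<close>
    define S' where "S' n = max 1 (S n)" for n
    have ev: "\<forall>\<^sub>F n in sequentially. S' n = S n"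
      using S[unfolded filterlim_at_top, rule_format, of 1] by eventually_elim (simp add: S'_def)
    have S': "filterlim S' at_top sequentially"
      using filterlim_cong[OF refl refl ev] S by blast
    have "(\<lambda>n. integral {-T..T} (\<lambda>t. cube_mean (\<lambda>x. u (x + t *\<^sub>R l)) (S' n))) \<longlonglongrightarrow> integral {-T..T} (\<lambda>t. m)"
    proof (rule dominated_convergence(2)[where h = "\<lambda>_. B"])
      show "(\<lambda>t. cube_mean (\<lambda>x. u (x + t *\<^sub>R l)) (S' n)) integrable_on {-T..T}" for n
        by (rule integrable_continuous_real,
            rule continuous_on_compose2[OF continuous_cube_mean_shift[OF c], of _ "\<lambda>t. t *\<^sub>R l"])
           (auto intro!: continuous_intros)
      show "(\<lambda>t. B) integrable_on {-T..T}" by auto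
      show "norm (cube_mean (\<lambda>x. u (x + t *\<^sub>R l)) (S' n)) \<le> B" for n t
        by (rule norm_cube_mean_le[OF cl]) (auto simp: B S'_def)
      fix t
      have "((\<lambda>s. cube_mean u s + (cube_mean (\<lambda>x. u (x + t *\<^sub>R l)) s - cube_mean u s)) \<longlongrightarrow> m + 0) at_top"
        by (intro tendsto_add m cube_mean_shift[OF c B])
      then have "((\<lambda>s. cube_mean (\<lambda>x. u (x + t *\<^sub>R l)) s) \<longlongrightarrow> m) at_top" by simp
      then show "(\<lambda>n. cube_mean (\<lambda>x. u (x + t *\<^sub>R l)) (S' n)) \<longlonglongrightarrow> m" using filterlim_compose S' by blast
    qed
    then have "(\<lambda>n. cube_mean w (S' n)) \<longlonglongrightarrow> integral {-T..T} (\<lambda>t. m)" unfolding sw .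
    moreover have "\<forall>\<^sub>F n in sequentially. cube_mean w (S' n) = cube_mean w (S n)"
      using ev by eventually_elim simp
    ultimately show "(\<lambda>n. cube_mean w (S n)) \<longlonglongrightarrow> integral {-T..T} (\<lambda>t. m)" by (simp add: tendsto_cong)
  qed
  then have lim: "((\<lambda>s. cube_mean w s) \<longlongrightarrow> (2 * T) *\<^sub>R m) at_top" using T by simp
  have "\<forall>\<^sub>F s in at_top. norm (cube_mean w s - (2 * T) *\<^sub>R a) \<le> 2 * T * \<eta>"
    using eventually_gt_at_top[of 0]
  proof eventually_elim
    case (elim s)
    have "norm (cube_mean (\<lambda>x. w x - (2 * T) *\<^sub>R a) s) \<le> 2 * T * \<eta>"
      using av by (intro norm_cube_mean_le continuous_intros cw) (auto simp: w_def elim)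
    then show ?case by (simp add: cube_mean_diff cw cube_mean_const elim)
  qed
  then have "norm ((2 * T) *\<^sub>R m - (2 * T) *\<^sub>R a) \<le> 2 * T * \<eta>"
    by (intro tendsto_upperbound[OF tendsto_norm[OF tendsto_diff[OF lim tendsto_const]]]) auto
  then show ?thesis using T by (simp add: scaleR_right_diff_distrib[symmetric])
qed

lemma ap_fun_mult:
  fixes u v :: "real^'p \<Rightarrow> complex"
  assumes "ap_fun u" "ap_fun v" shows "ap_fun (\<lambda>x. u x * v x)"
  unfolding ap_fun_def
proof (intro conjI allI)
  show "continuous_on UNIV (\<lambda>x. u x * v x)" using assms by (intro continuous_intros) (auto simp: ap_fun_def)
  fix t :: "nat \<Rightarrow> real^'p"
  obtain r :: "nat \<Rightarrow> nat" where r: "strict_mono r"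
    "\<And>e. e > 0 \<Longrightarrow> \<exists>N. \<forall>m\<ge>N. \<forall>n\<ge>N. \<forall>x. norm (u (x + t (r m)) - u (x + t (r n))) \<le> e"
    using ap_fun_subseq[OF assms(1), of "t"] by blast
  obtain q :: "nat \<Rightarrow> nat" where q: "strict_mono q"
    "\<And>e. e > 0 \<Longrightarrow> \<exists>N. \<forall>m\<ge>N. \<forall>n\<ge>N. \<forall>x. norm (v (x + (t \<circ> r) (q m)) - v (x + (t \<circ> r) (q n))) \<le> e"
    using ap_fun_subseq[OF assms(2), of "t \<circ> r"] by blast
  obtain B where B: "\<And>x. norm (u x) \<le> B" using ap_fun_bounded[OF assms(1)] by blast
  obtain C where C: "\<And>x. norm (v x) \<le> C" using ap_fun_bounded[OF assms(2)] by blast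
  have B0: "B \<ge> 0" "C \<ge> 0" using B[of 0] C[of 0] norm_ge_zero order_trans by blast+
  show "\<exists>r::nat \<Rightarrow> nat. strict_mono r \<and> (\<forall>e>0. \<exists>N. \<forall>m\<ge>N. \<forall>n\<ge>N. \<forall>x.
      norm (u (x + t (r m)) * v (x + t (r m)) - u (x + t (r n)) * v (x + t (r n))) \<le> e)"
  proof (intro exI[of _ "r \<circ> q"] conjI allI impI)
    show "strict_mono (r \<circ> q)" using r(1) q(1) by (rule strict_mono_o)
    fix e :: real assume e: "e > 0"
    define d where "d = e / (B + C + 1)"
    have d: "d > 0" using e B0 by (auto simp: d_def)
    obtain N1 where N1: "\<forall>m\<ge>N1. \<forall>n\<ge>N1. \<forall>x. norm (u (x + t (r m)) - u (x + t (r n))) \<le> d" using r(2)[OF d] by auto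
    obtain N2 where N2: "\<forall>m\<ge>N2. \<forall>n\<ge>N2. \<forall>x. norm (v (x + t (r (q m))) - v (x + t (r (q n)))) \<le> d" using q(2)[OF d] by auto
    show "\<exists>N. \<forall>m\<ge>N. \<forall>n\<ge>N. \<forall>x. norm (u (x + t ((r \<circ> q) m)) * v (x + t ((r \<circ> q) m)) -
        u (x + t ((r \<circ> q) n)) * v (x + t ((r \<circ> q) n))) \<le> e"
    proof (intro exI[of _ "max N1 N2"] allI impI)
      fix m n x assume mn: "m \<ge> max N1 N2" "n \<ge> max N1 N2"
      have "q m \<ge> N1" "q n \<ge> N1" using seq_suble[OF q(1)] mn by (meson le_trans max.boundedE)+
      then have a: "norm (u (x + t (r (q m))) - u (x + t (r (q n)))) \<le> d" using N1 by blast
      have b: "norm (v (x + t (r (q m))) - v (x + t (r (q n)))) \<le> d" using N2 mn by auto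
      have "u (x + t (r (q m))) * v (x + t (r (q m))) - u (x + t (r (q n))) * v (x + t (r (q n))) =
         u (x + t (r (q m))) * (v (x + t (r (q m))) - v (x + t (r (q n)))) +
         (u (x + t (r (q m))) - u (x + t (r (q n)))) * v (x + t (r (q n)))" by (simp add: algebra_simps)
      also have "norm \<dots> \<le> B * d + d * C"
        by (intro order_trans[OF norm_triangle_ineq] add_mono) (auto simp: norm_mult intro!: mult_mono B C a b B0 less_imp_le[OF d])
      also have "\<dots> \<le> d * (B + C + 1)" using d by (simp add: algebra_simps)
      also have "\<dots> = e" using B0 by (simp add: d_def)
      finally show "norm (u (x + t ((r \<circ> q) m)) * v (x + t ((r \<circ> q) m)) -
        u (x + t ((r \<circ> q) n)) * v (x + t ((r \<circ> q) n))) \<le> e" by simp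
    qed
  qed
qed

section \<open>Characters and their means\<close>

definition chr :: "real^'p \<Rightarrow> real^'p \<Rightarrow> complex" where
  "chr l t = cis (l \<bullet> t)"

lemma chr_simps: "norm (chr l t) = 1" "chr l (s + t) = chr l s * chr l t" "chr 0 t = 1" "chr l 0 = 1"
  "chr (- l) t = inverse (chr l t)" "chr l t \<noteq> 0" "chr (l + m) t = chr l t * chr m t"
  by (auto simp: chr_def inner_add_right inner_add_left cis_mult)

lemma continuous_chr [continuous_intros]:
  "continuous_on S g \<Longrightarrow> continuous_on S (\<lambda>x. chr l (g x))"
  unfolding chr_def cis_conv_exp by (intro continuous_intros)

lemma ap_fun_chr: "ap_fun (chr (l :: real^'p))"
  unfolding ap_fun_def
proof (intro conjI allI)
  show "continuous_on UNIV (chr l)" using continuous_chr[OF continuous_on_id] by simp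
  fix t :: "nat \<Rightarrow> real^'p"
  have "\<forall>n. chr l (t n) \<in> cball 0 1" by (simp add: chr_simps)
  then obtain a r where r: "strict_mono r" "((\<lambda>n. chr l (t n)) \<circ> r) \<longlonglongrightarrow> a"
    using compact_cball[of "0::complex" 1] unfolding compact_def by metis
  then have C: "Cauchy ((\<lambda>n. chr l (t n)) \<circ> r)" using LIMSEQ_imp_Cauchy by blast
  show "\<exists>r::nat \<Rightarrow> nat. strict_mono r \<and> (\<forall>e>0. \<exists>N. \<forall>m\<ge>N. \<forall>n\<ge>N. \<forall>x. norm (chr l (x + t (r m)) - chr l (x + t (r n))) \<le> e)"
  proof (intro exI[of _ r] conjI allI impI r(1))
    fix e :: real assume "e > 0"
    then obtain N where N: "\<forall>m\<ge>N. \<forall>n\<ge>N. dist (chr l (t (r m))) (chr l (t (r n))) < e"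
      using metric_CauchyD[OF C, of e] by auto
    have "norm (chr l (x + t (r m)) - chr l (x + t (r n))) \<le> e" if "m \<ge> N" "n \<ge> N" for m n x
    proof -
      have "norm (chr l (x + t (r m)) - chr l (x + t (r n))) = norm (chr l x * (chr l (t (r m)) - chr l (t (r n))))"
        by (simp add: chr_simps algebra_simps)
      also have "\<dots> \<le> e" using N that by (simp add: norm_mult chr_simps dist_norm less_imp_le)
      finally show ?thesis .
    qed
    then show "\<exists>N. \<forall>m\<ge>N. \<forall>n\<ge>N. \<forall>x. norm (chr l (x + t (r m)) - chr l (x + t (r n))) \<le> e" by blast
  qed
qed

lemma chr_nontrivial:
  fixes l :: "real^'p" assumes "l \<noteq> 0" shows "\<exists>v. chr l v \<noteq> 1"
proof
  show "chr l ((pi / (l \<bullet> l)) *\<^sub>R l) \<noteq> 1" using assms by (simp add: chr_def cis_pi)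
qed

text \<open>A nontrivial character is multiplied by a constant different from 1 under a suitable
  translation, whereas its mean is invariant.\<close>

lemma cube_mean_chr: "(cube_mean (chr (l :: real^'p)) \<longlongrightarrow> (if l = 0 then 1 else 0)) at_top"
proof (cases "l = 0")
  case True
  have "\<forall>\<^sub>F s in at_top. 1 = cube_mean (chr l) s"
    using eventually_gt_at_top[of 0] by eventually_elim (simp add: True chr_simps(3)[abs_def] cube_mean_const)
  then show ?thesis by (simp add: True tendsto_eventually eventually_mono)
next
  case False
  obtain v where v: "chr l v \<noteq> 1" using chr_nontrivial[OF False] by blast
  have c: "continuous_on UNIV (chr l)" using ap_fun_chr ap_fun_continuous by blast
  have "((\<lambda>s. cube_mean (\<lambda>x. chr l (x + v)) s - cube_mean (chr l) s) \<longlongrightarrow> 0) at_top"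
    by (rule cube_mean_shift[OF c, of 1]) (simp add: chr_simps)
  moreover have "cube_mean (\<lambda>x. chr l (x + v)) s - cube_mean (chr l) s = (chr l v - 1) * cube_mean (chr l) s" for s
    using cube_mean_cmult[OF c, of "chr l v"] by (simp add: chr_simps mult.commute algebra_simps)
  ultimately have "((\<lambda>s. (chr l v - 1) * cube_mean (chr l) s) \<longlongrightarrow> 0) at_top" by simp
  then have "((\<lambda>s. inverse (chr l v - 1) * ((chr l v - 1) * cube_mean (chr l) s)) \<longlongrightarrow> inverse (chr l v - 1) * 0) at_top"
    by (intro tendsto_mult tendsto_const)
  moreover have "inverse (chr l v - 1) * ((chr l v - 1) * cube_mean (chr l) s) = cube_mean (chr l) s" for s
    using v by (simp add: mult.assoc[symmetric])
  ultimately show ?thesis using False by simp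
qed

subsection \<open>Kernels concentrated on the almost periods\<close>

definition rt :: "int \<Rightarrow> int \<Rightarrow> complex" where
  "rt N i = cis (2 * pi * of_int i / of_int N)"

lemma rt_simps: "norm (rt N i) = 1" "rt N 0 = 1" "rt N (i + j) = rt N i * rt N j" "cnj (rt N i) = rt N (- i)"
  "rt N (i * int n) = rt N i ^ n"
proof -
  show "rt N (i * int n) = rt N i ^ n"
    unfolding rt_def Complex.DeMoivre by (simp add: algebra_simps)
qed (auto simp: rt_def cis_mult cis_cnj distrib_left add_divide_distrib intro!: arg_cong[of _ _ cis])

lemma rt_sum: "rt N (sum f A) = (\<Prod>j\<in>A. rt N (f j))"
  by (induction A rule: infinite_finite_induct) (auto simp: rt_simps)

lemma rt_eq_1_iff: assumes "N > 0" shows "rt N i = 1 \<longleftrightarrow> N dvd i"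
proof
  assume "rt N i = 1"
  then have "cos (2 * pi * of_int i / of_int N) = 1" by (simp add: rt_def complex_eq_iff)
  then obtain n :: int where "2 * pi * of_int i / of_int N = of_int n * 2 * pi"
    unfolding cos_one_2pi_int by auto
  then have "real_of_int i = of_int (N * n)" using assms by (simp add: field_simps)
  then have "i = N * n" by (simp only: of_int_eq_iff)
  then show "N dvd i" by simp
next
  assume "N dvd i"
  then obtain n where "i = N * n" by blast
  then have "2 * pi * of_int i / of_int N = 2 * pi * of_int n" using assms by simp
  then show "rt N i = 1" by (simp add: rt_def cis_multiple_2pi)
qed

lemma sum_rt:
  assumes "N > 0" shows "(\<Sum>k\<in>{0..<N}. rt N (k * m)) = (if N dvd m then of_int N else 0)"
proof -
  have "(\<Sum>k\<in>{0..<N}. rt N (k * m)) = (\<Sum>k<nat N. rt N m ^ k)"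
    by (rule sum.reindex_bij_witness[of _ int nat]) (auto simp: rt_simps(5)[symmetric] mult.commute)
  also have "\<dots> = (if N dvd m then of_int N else 0)"
  proof (cases "N dvd m")
    case True
    then show ?thesis using assms by (simp add: rt_eq_1_iff[OF assms, THEN iffD2])
  next
    case False
    then have ne: "rt N m \<noteq> 1" using rt_eq_1_iff[OF assms] by simp
    have "rt N m ^ nat N = rt N (m * int (nat N))" by (simp only: rt_simps(5))
    also have "\<dots> = 1" using assms by (simp add: rt_eq_1_iff)
    finally show ?thesis using ne False by (simp add: geometric_sum)
  qed
  finally show ?thesis .
qed

section \<open>Discrete Fourier analysis on a box of lattice points\<close>

definition dotp :: "('p::finite \<Rightarrow> int) \<Rightarrow> ('p \<Rightarrow> int) \<Rightarrow> int" where
  "dotp k m = (\<Sum>j\<in>UNIV. k j * m j)"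

lemma dotp_simps: "dotp k (\<lambda>j. a j + b j) = dotp k a + dotp k b" "dotp k (\<lambda>j. a j - b j) = dotp k a - dotp k b"
   "dotp (\<lambda>j. 0) a = 0"
  by (auto simp: dotp_def sum.distrib sum_subtractf algebra_simps)

definition Qb :: "int \<Rightarrow> ('p::finite \<Rightarrow> int) set" where
  "Qb T = PiE UNIV (\<lambda>_. {0..<T})"

lemma finite_Qb [simp]: "finite (Qb T)" by (auto simp: Qb_def intro!: finite_PiE)
lemma mem_Qb: "n \<in> Qb T \<longleftrightarrow> (\<forall>j. 0 \<le> n j \<and> n j < T)" by (auto simp: Qb_def PiE_def Pi_def)
lemma card_Qb: "T > 0 \<Longrightarrow> real (card (Qb T :: ('p::finite \<Rightarrow> int) set)) = of_int T ^ CARD('p)"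
  by (simp add: Qb_def card_PiE)

lemma sum_rt_dotp:
  fixes m :: "'p::finite \<Rightarrow> int"
  assumes "N > 0"
  shows "(\<Sum>k\<in>Qb N. rt N (dotp k m)) = (if \<forall>j. N dvd m j then of_int N ^ CARD('p) else 0)"
proof -
  have p: "rt N (dotp k m) = (\<Prod>j\<in>UNIV. rt N (k j * m j))" for k
    unfolding dotp_def by (rule rt_sum)
  have "(\<Sum>k\<in>Qb N. rt N (dotp k m)) = (\<Prod>j\<in>UNIV. \<Sum>k\<in>{0..<N}. rt N (k * m j))"
    unfolding p Qb_def by (subst prod_sum_PiE) auto
  also have "\<dots> = (\<Prod>j\<in>UNIV. if N dvd m j then of_int N else 0)" by (simp add: sum_rt[OF assms])
  also have "\<dots> = (if \<forall>j. N dvd m j then of_int N ^ CARD('p) else 0)" by auto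
  finally show ?thesis .
qed

context
  fixes T N :: int and \<phi> :: "('p::finite \<Rightarrow> int) \<Rightarrow> real"
  assumes T: "T > 0" and N: "N = 4 * T" and \<phi>01: "\<And>n. 0 \<le> \<phi> n" "\<And>n. \<phi> n \<le> 1"
begin

text \<open>Discrete Fourier transform modulo \<open>N\<close> of \<open>\<phi>\<close> cut off to
  the box \<open>Qb T\<close>, normalized by the number of points of the box. Since
  \<open>\<phi>\<close> is not periodic, the cut-off causes the boundary terms in
  \<open>dft_modulus\<close>.\<close>

definition dft :: "('p \<Rightarrow> int) \<Rightarrow> complex" where
  "dft k = (\<Sum>n\<in>Qb T. of_real (\<phi> n) * rt N (- dotp k n)) / of_int T ^ CARD('p)"

definition pw :: "('p \<Rightarrow> int) \<Rightarrow> real" where "pw k = (norm (dft k))\<^sup>2"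

definition gg :: "('p \<Rightarrow> int) \<times> ('p \<Rightarrow> int) \<Rightarrow> real" where "gg p = \<phi> (fst p) * \<phi> (snd p)"
definition dd :: "('p \<Rightarrow> int) \<times> ('p \<Rightarrow> int) \<Rightarrow> 'p \<Rightarrow> int" where "dd p j = snd p j - fst p j"

lemma N0: "N > 0" using T N by simp

lemma pw_expand: "of_real (pw k) = (\<Sum>p\<in>Qb T \<times> Qb T. of_real (gg p) * rt N (dotp k (dd p))) / of_int T ^ (2 * CARD('p))"
proof -
  have "of_real (pw k) = dft k * cnj (dft k)" by (simp add: pw_def complex_norm_square[symmetric])
  also have "\<dots> = (\<Sum>n\<in>Qb T. of_real (\<phi> n) * rt N (- dotp k n)) * (\<Sum>n\<in>Qb T. of_real (\<phi> n) * rt N (dotp k n)) / of_int T ^ (2 * CARD('p))"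
    by (simp add: dft_def rt_simps power_add mult_2)
  also have "(\<Sum>n\<in>Qb T. of_real (\<phi> n) * rt N (- dotp k n)) * (\<Sum>n\<in>Qb T. of_real (\<phi> n) * rt N (dotp k n)) =
     (\<Sum>p\<in>Qb T \<times> Qb T. of_real (gg p) * rt N (dotp k (dd p)))"
    unfolding sum_product sum.cartesian_product
  proof (rule sum.cong[OF refl], clarify)
    fix a b :: "'p \<Rightarrow> int"
    have "rt N (dotp k (dd (a, b))) = rt N (- dotp k a) * rt N (dotp k b)"
      unfolding rt_simps(3)[symmetric] by (simp add: dd_def[abs_def] dotp_simps)
    then show "complex_of_real (\<phi> a) * rt N (- dotp k a) * (complex_of_real (\<phi> b) * rt N (dotp k b)) =
       complex_of_real (gg (a, b)) * rt N (dotp k (dd (a, b)))" by (simp add: gg_def)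
  qed
  finally show ?thesis .
qed

lemma pw_nonneg: "pw k \<ge> 0" by (simp add: pw_def)

text \<open>Parseval: two points of the box that are congruent modulo \<open>N\<close> coincide, so
  only the diagonal survives the sum over \<open>k\<close>. The bound is (N/T)^p and hence
  independent of \<open>T\<close>, which later bounds the number of large frequencies.\<close>

lemma sum_pw_le: "(\<Sum>k\<in>Qb N. pw k) \<le> 4 ^ CARD('p)"
proof -
  let ?P = "Qb T \<times> Qb T"
  have z: "(\<Sum>k\<in>Qb N. rt N (dotp k (dd p))) = (if fst p = snd p then of_int N ^ CARD('p) else 0)" if "p \<in> ?P" for p
  proof -
    have "(\<forall>j. N dvd dd p j) \<longleftrightarrow> fst p = snd p"
    proof
      assume a: "\<forall>j. N dvd dd p j"
      have "dd p j = 0" for j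
      proof (rule ccontr)
        assume "dd p j \<noteq> 0"
        then have "\<bar>N\<bar> \<le> \<bar>dd p j\<bar>" using a dvd_imp_le_int by blast
        moreover have "0 \<le> fst p j" "fst p j < T" "0 \<le> snd p j" "snd p j < T" using that by (auto simp: mem_Qb)
        ultimately show False using N by (auto simp: dd_def)
      qed
      then show "fst p = snd p" by (auto simp: dd_def fun_eq_iff)
    qed (simp add: dd_def)
    then show ?thesis by (simp add: sum_rt_dotp[OF N0])
  qed
  have "of_real (\<Sum>k\<in>Qb N. pw k) = (\<Sum>p\<in>?P. of_real (gg p) * (\<Sum>k\<in>Qb N. rt N (dotp k (dd p)))) / of_int T ^ (2 * CARD('p))"
    unfolding of_real_sum pw_expand sum_divide_distrib[symmetric] sum_distrib_left
    by (subst sum.swap) simp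
  also have "\<dots> = (\<Sum>p\<in>?P. of_real (if fst p = snd p then gg p else 0)) * of_int N ^ CARD('p) / of_int T ^ (2 * CARD('p))"
    unfolding sum_distrib_right by (intro arg_cong2[of _ _ _ _ "(/)"] sum.cong refl) (auto simp: z)
  also have "\<dots> = of_real ((\<Sum>p\<in>?P. if fst p = snd p then gg p else 0) * of_int N ^ CARD('p) / of_int T ^ (2 * CARD('p)))"
    by simp
  finally have "(\<Sum>k\<in>Qb N. pw k) = (\<Sum>p\<in>?P. if fst p = snd p then gg p else 0) * of_int N ^ CARD('p) / of_int T ^ (2 * CARD('p))"
    unfolding of_real_eq_iff .
  also have "(\<Sum>p\<in>?P. if fst p = snd p then gg p else 0) = (\<Sum>n\<in>Qb T. \<Sum>n'\<in>Qb T. if n = n' then gg (n, n') else 0)"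
    unfolding sum.cartesian_product by (rule sum.cong) auto
  also have "\<dots> = (\<Sum>n\<in>Qb T. gg (n, n))" by (simp add: sum.delta)
  also have "\<dots> * of_int N ^ CARD('p) / of_int T ^ (2 * CARD('p)) \<le> of_int T ^ CARD('p) * of_int N ^ CARD('p) / of_int T ^ (2 * CARD('p))"
  proof (intro divide_right_mono mult_right_mono)
    have "(\<Sum>n\<in>Qb T. gg (n, n)) \<le> (\<Sum>n\<in>(Qb T :: ('p \<Rightarrow> int) set). 1)"
      using \<phi>01 by (intro sum_mono) (simp add: gg_def mult_le_one)
    then show "(\<Sum>n\<in>Qb T. gg (n, n)) \<le> real_of_int T ^ CARD('p)" using card_Qb[OF T, where 'p='p] by simp
  qed (use N0 T in auto)
  also have "\<dots> = (of_int N / of_int T) ^ CARD('p)"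
    using T by (simp add: power_divide mult_2 power_add)
  also have "\<dots> = 4 ^ CARD('p)" using T N by simp
  finally show ?thesis .
qed

text \<open>\<open>pw\<close> is the Fourier transform of the autocorrelation of \<open>\<phi>\<close>, hence nonnegative. Squaring it
  convolves the autocorrelation with itself, so that \<open>psi\<close> has nonnegative values as well. The period
  \<open>N = 4 T\<close> leaves room for both convolutions without wrapping around.\<close>

definition psi :: "('p \<Rightarrow> int) \<Rightarrow> complex" where
  "psi x = (\<Sum>k\<in>Qb N. of_real ((pw k)\<^sup>2) * rt N (dotp k x))"

lemma psi_expand:
  "psi x = of_real ((\<Sum>p\<in>Qb T \<times> Qb T. \<Sum>q\<in>Qb T \<times> Qb T. gg p * gg q *
     (if \<forall>j. N dvd dd p j + dd q j + x j then of_int N ^ CARD('p) else 0)) / of_int T ^ (4 * CARD('p)))"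
proof -
  let ?P = "Qb T \<times> Qb T"
  have "of_real ((pw k)\<^sup>2) * rt N (dotp k x) =
      (\<Sum>p\<in>?P. \<Sum>q\<in>?P. of_real (gg p * gg q) * rt N (dotp k (\<lambda>j. dd p j + dd q j + x j))) / of_int T ^ (4 * CARD('p))" for k
  proof -
    have "of_real ((pw k)\<^sup>2) = (of_real (pw k))\<^sup>2" by simp
    also have "\<dots> = (\<Sum>p\<in>?P. \<Sum>q\<in>?P. (of_real (gg p) * rt N (dotp k (dd p))) * (of_real (gg q) * rt N (dotp k (dd q)))) / of_int T ^ (4 * CARD('p))"
      unfolding pw_expand power_divide unfolding power2_eq_square sum_product
      by (simp only: power_add[symmetric] mult_2[symmetric]) simp
    finally have A: "of_real ((pw k)\<^sup>2) = (\<Sum>p\<in>?P. \<Sum>q\<in>?P. (of_real (gg p) * rt N (dotp k (dd p))) * (of_real (gg q) * rt N (dotp k (dd q)))) / of_int T ^ (4 * CARD('p))" .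
    show ?thesis
      unfolding A times_divide_eq_left sum_distrib_right
      by (intro arg_cong2[of _ _ _ _ "(/)"] sum.cong refl) (simp add: dotp_simps rt_simps)
  qed
  then have "psi x = (\<Sum>k\<in>Qb N. \<Sum>p\<in>?P. \<Sum>q\<in>?P. of_real (gg p * gg q) * rt N (dotp k (\<lambda>j. dd p j + dd q j + x j))) / of_int T ^ (4 * CARD('p))"
    by (simp add: psi_def sum_divide_distrib)
  also have "(\<Sum>k\<in>Qb N. \<Sum>p\<in>?P. \<Sum>q\<in>?P. of_real (gg p * gg q) * rt N (dotp k (\<lambda>j. dd p j + dd q j + x j))) =
     (\<Sum>p\<in>?P. \<Sum>q\<in>?P. \<Sum>k\<in>Qb N. of_real (gg p * gg q) * rt N (dotp k (\<lambda>j. dd p j + dd q j + x j)))"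
    by (subst sum.swap, rule sum.cong[OF refl], subst sum.swap) simp
  also have "\<dots> = (\<Sum>p\<in>?P. \<Sum>q\<in>?P. of_real (gg p * gg q) *
     (if \<forall>j. N dvd dd p j + dd q j + x j then of_int N ^ CARD('p) else 0))"
    unfolding sum_distrib_left[symmetric] sum_rt_dotp[OF N0] by simp
  also have "\<dots> = of_real (\<Sum>p\<in>?P. \<Sum>q\<in>?P. gg p * gg q *
     (if \<forall>j. N dvd dd p j + dd q j + x j then of_int N ^ CARD('p) else 0))"
    unfolding of_real_sum by (intro sum.cong refl) auto
  finally show ?thesis by simp
qed

lemma gg_nonneg: "gg p \<ge> 0" using \<phi>01 by (simp add: gg_def)

lemma psi_nonneg: "\<exists>r\<ge>0. psi x = of_real r"
proof -
  have "(\<Sum>p\<in>Qb T \<times> Qb T. \<Sum>q\<in>Qb T \<times> Qb T. gg p * gg q *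
     (if \<forall>j. N dvd dd p j + dd q j + x j then of_int N ^ CARD('p) else 0)) / of_int T ^ (4 * CARD('p)) \<ge> (0::real)"
    using N0 T by (intro divide_nonneg_nonneg sum_nonneg mult_nonneg_nonneg gg_nonneg) auto
  then show ?thesis using psi_expand by blast
qed

text \<open>When \<open>\<phi>\<close> is a bump around a centre \<open>w\<close>, this writes
  \<open>x\<close> as a sum of two differences of points near \<open>w\<close>, so that
  \<open>x\<close> is an almost period. Both differences and \<open>x\<close> are below
  \<open>T\<close> in every coordinate, so their sum is below 3T and is divisible by N = 4T only if
  it is zero.\<close>

lemma psi_support:
  assumes "psi x \<noteq> 0" "\<And>j. \<bar>x j\<bar> < T"
  obtains a b a' b' where "\<phi> a \<noteq> 0" "\<phi> b \<noteq> 0" "\<phi> a' \<noteq> 0" "\<phi> b' \<noteq> 0" "\<And>j. x j = (a j - b j) + (a' j - b' j)"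
proof -
  let ?P = "Qb T \<times> Qb T"
  have "\<exists>p\<in>?P. \<exists>q\<in>?P. gg p * gg q * (if \<forall>j. N dvd dd p j + dd q j + x j then of_int N ^ CARD('p) else 0) \<noteq> 0"
  proof (rule ccontr)
    assume "\<not> ?thesis"
    then have "psi x = 0" unfolding psi_expand by (simp add: sum.neutral)
    then show False using assms by simp
  qed
  then obtain p q where pq: "p \<in> ?P" "q \<in> ?P" "gg p \<noteq> 0" "gg q \<noteq> 0" "\<forall>j. N dvd dd p j + dd q j + x j"
    by (auto split: if_splits)
  have "x j = (fst p j - snd p j) + (fst q j - snd q j)" for j
  proof (rule ccontr)
    assume "\<not> ?thesis"
    then have "dd p j + dd q j + x j \<noteq> 0" by (auto simp: dd_def)
    then have "\<bar>N\<bar> \<le> \<bar>dd p j + dd q j + x j\<bar>" using pq(5) dvd_imp_le_int by blast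
    moreover have "0 \<le> fst p j" "fst p j < T" "0 \<le> snd p j" "snd p j < T" 
       "0 \<le> fst q j" "fst q j < T" "0 \<le> snd q j" "snd q j < T" using pq(1,2) by (auto simp: mem_Qb)
    ultimately show False using N assms(2)[of j] T by (auto simp: dd_def abs_if split: if_splits)
  qed
  then show thesis using pq(3,4) that[of "fst p" "snd p" "fst q" "snd q"] by (auto simp: gg_def)
qed

lemma card_edge:
  assumes "v \<ge> 0"
  shows "real (card (PiE UNIV (\<lambda>i::'p. if i = j then {a..<a + v} else {0..<T}))) \<le> of_int v * of_int T ^ (CARD('p) - 1)"
proof -
  have "card (PiE UNIV (\<lambda>i::'p. if i = j then {a..<a + v} else {0..<T})) = (\<Prod>i\<in>UNIV. if i = j then nat v else nat T)"
    by (subst card_PiE) (auto intro!: prod.cong)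
  also have "\<dots> = nat v * (\<Prod>i\<in>UNIV - {j}. if i = j then nat v else nat T)" by (subst prod.remove[of _ j]) auto
  also have "(\<Prod>i\<in>UNIV - {j}. if i = j then nat v else nat T) = (\<Prod>i\<in>UNIV - {j}. nat T)" by (rule prod.cong) auto
  also have "\<dots> = nat T ^ (CARD('p) - 1)" by (simp add: card_Diff_singleton)
  finally show ?thesis using assms T by simp
qed

text \<open>Shifting by \<open>v\<close> in coordinate \<open>j\<close> multiplies the transform by
  a root of unity, up to two boundary slabs of at most v T^(p-1) points each and the oscillation
  \<open>\<omega>\<close> of \<open>\<phi>\<close>. If the transform is large, this root of unity
  must be near 1.\<close>

lemma dft_modulus:
  assumes v: "v \<ge> 0" and w: "\<And>n. \<bar>\<phi> (n(j := n j + v)) - \<phi> n\<bar> \<le> \<omega>"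
  shows "norm (dft k) * norm (1 - rt N (- (k j * v))) \<le> 2 * of_int v / of_int T + \<omega>"
proof -
  define \<psi> where "\<psi> n = of_real (\<phi> n) * rt N (- dotp k n)" for n
  define sh where "sh n = n(j := n j + v)" for n :: "'p \<Rightarrow> int"
  let ?Q = "Qb T :: ('p \<Rightarrow> int) set"
  define Q2 where "Q2 = {n \<in> ?Q. n j + v \<ge> T}"
  define Q3 where "Q3 = {n \<in> ?Q. n j < v}"
  have f: "finite Q2" "finite Q3" by (auto simp: Q2_def Q3_def)
  have n1: "norm (\<psi> n) \<le> 1" for n using \<phi>01[of n] by (simp add: \<psi>_def norm_mult rt_simps)
  have bij: "(\<Sum>n\<in>?Q - Q2. \<psi> (sh n)) = (\<Sum>n\<in>?Q - Q3. \<psi> n)"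
  proof -
    have "?Q - Q2 = {n \<in> ?Q. n j + v < T}" "?Q - Q3 = {n \<in> ?Q. v \<le> n j}" by (auto simp: Q2_def Q3_def)
    moreover have "n j - v < T" if "\<forall>i. 0 \<le> n i \<and> n i < T" for n
      using v that by (smt (verit))
    ultimately show ?thesis
      by (intro sum.reindex_bij_witness[of _ "\<lambda>n. n(j := n j - v)" sh])
         (use v in \<open>auto simp: mem_Qb sh_def add_nonneg_nonneg\<close>)
  qed
  have s1: "(\<Sum>n\<in>?Q. \<psi> (sh n)) = (\<Sum>n\<in>?Q - Q2. \<psi> (sh n)) + (\<Sum>n\<in>Q2. \<psi> (sh n))"
    by (rule sum.subset_diff) (auto simp: Q2_def)
  have s2: "(\<Sum>n\<in>?Q. \<psi> n) = (\<Sum>n\<in>?Q - Q3. \<psi> n) + (\<Sum>n\<in>Q3. \<psi> n)"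
    by (rule sum.subset_diff) (auto simp: Q3_def)
  have fin: "finite (PiE UNIV (\<lambda>i::'p. if i = j then {a..<a + v} else {0..<T}))" for a
    by (rule finite_PiE) auto
  have c2: "real (card Q2) \<le> of_int v * of_int T ^ (CARD('p) - 1)"
  proof -
    have "Q2 \<subseteq> PiE UNIV (\<lambda>i::'p. if i = j then {T - v..<(T - v) + v} else {0..<T})"
      by (auto simp: Q2_def mem_Qb PiE_def Pi_def)
    then show ?thesis using card_mono[OF fin] card_edge[OF v, of j "T - v"] by (meson of_nat_mono order_trans)
  qed
  have c3: "real (card Q3) \<le> of_int v * of_int T ^ (CARD('p) - 1)"
  proof -
    have "Q3 \<subseteq> PiE UNIV (\<lambda>i::'p. if i = j then {0..<0 + v} else {0..<T})"
      by (auto simp: Q3_def mem_Qb PiE_def Pi_def)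
    then show ?thesis using card_mono[OF fin] card_edge[OF v, of j 0] by (meson of_nat_mono order_trans)
  qed
  have shift: "\<psi> (sh n) = rt N (- (k j * v)) * (of_real (\<phi> (sh n)) * rt N (- dotp k n))" for n
  proof -
    have "dotp k (sh n) = (\<Sum>i\<in>UNIV. k i * n i + (if i = j then k j * v else 0))"
      unfolding dotp_def sh_def by (rule sum.cong) (auto simp: algebra_simps)
    also have "\<dots> = dotp k n + k j * v" by (simp add: dotp_def sum.distrib)
    finally have "rt N (- dotp k (sh n)) = rt N (- dotp k n) * rt N (- (k j * v))"
      unfolding rt_simps(3)[symmetric] by simp
    then show ?thesis by (simp add: \<psi>_def)
  qed
  let ?r = "rt N (- (k j * v))"
  have "(\<Sum>n\<in>?Q. \<psi> n) * (1 - ?r) = ((\<Sum>n\<in>Q3. \<psi> n) - (\<Sum>n\<in>Q2. \<psi> (sh n))) + 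
      (\<Sum>n\<in>?Q. ?r * (of_real (\<phi> (sh n) - \<phi> n) * rt N (- dotp k n)))"
  proof -
    have "(\<Sum>n\<in>?Q. ?r * (of_real (\<phi> (sh n) - \<phi> n) * rt N (- dotp k n))) = (\<Sum>n\<in>?Q. \<psi> (sh n) - ?r * \<psi> n)"
      by (rule sum.cong[OF refl], subst shift, simp add: \<psi>_def algebra_simps)
    also have "\<dots> = (\<Sum>n\<in>?Q. \<psi> (sh n)) - ?r * (\<Sum>n\<in>?Q. \<psi> n)" by (simp add: sum_subtractf sum_distrib_left)
    finally show ?thesis using s1 s2 bij by (simp add: algebra_simps)
  qed
  also have "norm \<dots> \<le> (real (card Q3) + real (card Q2)) + real (card ?Q) * \<omega>"
  proof (intro order_trans[OF norm_triangle_ineq] add_mono order_trans[OF norm_triangle_ineq4])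
    show "norm (\<Sum>n\<in>Q3. \<psi> n) \<le> real (card Q3)" using sum_norm_le[of Q3 \<psi> "\<lambda>_. 1"] n1 by simp
    show "norm (\<Sum>n\<in>Q2. \<psi> (sh n)) \<le> real (card Q2)" using sum_norm_le[of Q2 "\<lambda>n. \<psi> (sh n)" "\<lambda>_. 1"] n1 by simp
    show "norm (\<Sum>n\<in>?Q. ?r * (of_real (\<phi> (sh n) - \<phi> n) * rt N (- dotp k n))) \<le> real (card ?Q) * \<omega>"
      using sum_norm_le[of ?Q "\<lambda>n. ?r * (of_real (\<phi> (sh n) - \<phi> n) * rt N (- dotp k n))" "\<lambda>_. \<omega>"] w
      by (simp add: norm_mult rt_simps sh_def flip: of_real_diff)
  qed
  also have "\<dots> \<le> 2 * of_int v * of_int T ^ (CARD('p) - 1) + of_int T ^ CARD('p) * \<omega>"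
    using c2 c3 card_Qb[OF T, where 'p='p] by simp
  finally have "norm (\<Sum>n\<in>?Q. \<psi> n) * norm (1 - ?r) \<le> 2 * of_int v * of_int T ^ (CARD('p) - 1) + of_int T ^ CARD('p) * \<omega>"
    by (simp add: norm_mult)
  moreover have "norm (dft k) = norm (\<Sum>n\<in>?Q. \<psi> n) / of_int T ^ CARD('p)"
    using T by (simp add: dft_def \<psi>_def norm_divide norm_power)
  ultimately have "norm (dft k) * norm (1 - ?r) \<le> (2 * of_int v * of_int T ^ (CARD('p) - 1) + of_int T ^ CARD('p) * \<omega>) / of_int T ^ CARD('p)"
    using T by (simp add: divide_right_mono)
  also have "\<dots> = 2 * of_int v / of_int T + \<omega>"
  proof -
    have "(of_int T :: real) ^ CARD('p) = of_int T ^ (CARD('p) - 1) * of_int T"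
      by (simp only: power_minus_mult[OF zero_less_card_finite])
    then show ?thesis using T by (simp add: add_divide_distrib)
  qed
  finally show ?thesis .
qed

lemma dft_0: "norm (dft (\<lambda>_. 0)) = (\<Sum>n\<in>Qb T. \<phi> n) / of_int T ^ CARD('p)"
proof -
  have "dft (\<lambda>_. 0) = of_real ((\<Sum>n\<in>Qb T. \<phi> n) / of_int T ^ CARD('p))" by (simp add: dft_def dotp_simps rt_simps)
  then show ?thesis using T \<phi>01 by (simp add: sum_nonneg del: of_real_divide of_real_sum)
qed

end

section \<open>Passage from the lattice to Euclidean space\<close>

definition lv :: "real \<Rightarrow> ('p::finite \<Rightarrow> int) \<Rightarrow> real^'p" where
  "lv \<delta> m = (\<chi> j. \<delta> * of_int (m j))"

definition cen :: "int \<Rightarrow> int \<Rightarrow> int" where "cen N i = (if 2 * i \<le> N then i else i - N)"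

text \<open>A real frequency whose character agrees with \<open>x \<mapsto> rt N (dotp k x)\<close>
  on the lattice of mesh \<open>\<delta>\<close>. Frequencies with this property differ by multiples
  of 2 pi / \<open>\<delta>\<close>; the representative given by \<open>cen\<close>, in (-N/2, N/2],
  is the one that can stay bounded as the mesh shrinks and the box grows.\<close>

definition freq :: "real \<Rightarrow> int \<Rightarrow> ('p::finite \<Rightarrow> int) \<Rightarrow> real^'p" where
  "freq \<delta> N k = (\<chi> j. 2 * pi * of_int (cen N (k j)) / (of_int N * \<delta>))"

lemma rt_cen: assumes "N > 0" shows "rt N (k * x) = rt N (cen N k * x)"
proof (cases "2 * k \<le> N")
  case False
  have "rt N (k * x) = rt N (cen N k * x) * rt N (N * x)"
    unfolding rt_simps(3)[symmetric] using False by (simp add: cen_def algebra_simps)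
  then show ?thesis using rt_eq_1_iff[OF assms, of "N * x"] by simp
qed (simp add: cen_def)

lemma chr_freq:
  assumes "N > 0" "\<delta> > 0"
  shows "chr (freq \<delta> N k) (lv \<delta> x) = rt N (dotp k x)"
proof -
  have "freq \<delta> N k \<bullet> lv \<delta> x = (\<Sum>j\<in>UNIV. 2 * pi * of_int (cen N (k j) * x j) / of_int N)"
    unfolding inner_vec_def using assms by (intro sum.cong) (auto simp: freq_def lv_def)
  also have "\<dots> = 2 * pi * of_int (dotp (\<lambda>j. cen N (k j)) x) / of_int N"
    by (simp add: dotp_def sum_distrib_left sum_divide_distrib)
  finally have "chr (freq \<delta> N k) (lv \<delta> x) = rt N (dotp (\<lambda>j. cen N (k j)) x)" by (simp add: chr_def rt_def)
  also have "\<dots> = rt N (dotp k x)" unfolding dotp_def rt_sum by (intro prod.cong refl rt_cen[OF assms(1), symmetric])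
  finally show ?thesis .
qed

lemma norm_cis_diff_le: "norm (cis a - cis b) \<le> \<bar>a - b\<bar>"
proof -
  have "norm (cis a - cis b) \<le> 1 * norm (a - b)"
  proof (rule differentiable_bound[of UNIV cis "\<lambda>x h. h *\<^sub>R (\<i> * cis x)"])
    show "(cis has_derivative (\<lambda>h. h *\<^sub>R (\<i> * cis x))) (at x within UNIV)" for x
    proof -
      have "((\<lambda>b. exp (\<i> * complex_of_real b)) has_vector_derivative (\<i> * 1 * exp (\<i> * complex_of_real x))) (at x)"
        by (rule field_vector_diff_chain_at[unfolded o_def, where f = "\<lambda>b. \<i> * complex_of_real b" and g = exp])
           (auto intro!: derivative_eq_intros DERIV_exp)
      then show ?thesis unfolding cis_conv_exp by (simp add: has_vector_derivative_def)
    qed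
    show "onorm (\<lambda>h. h *\<^sub>R (\<i> * cis x)) \<le> 1" for x by (rule onorm_bound) (auto simp: norm_mult)
  qed auto
  then show ?thesis by simp
qed

lemma norm_chr_diff_le: "norm (chr l s - chr l t) \<le> norm l * norm (s - t)"
proof -
  have "norm (chr l s - chr l t) \<le> \<bar>l \<bullet> s - l \<bullet> t\<bar>" unfolding chr_def by (rule norm_cis_diff_le)
  also have "\<dots> \<le> norm l * norm (s - t)" unfolding inner_diff_right[symmetric] by (rule Cauchy_Schwarz_ineq2)
  finally show ?thesis .
qed

lemma finite_convergent_subsequence:
  fixes X :: "nat \<Rightarrow> nat \<Rightarrow> 'a::euclidean_space"
  assumes "\<And>m i. i < n \<Longrightarrow> norm (X m i) \<le> C"
  shows "\<exists>r l. strict_mono (r :: nat \<Rightarrow> nat) \<and> (\<forall>i<n. (\<lambda>m. X (r m) i) \<longlonglongrightarrow> l i)"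
  using assms
proof (induction n)
  case 0 then show ?case by (intro exI[of _ id]) (auto simp: strict_mono_def)
next
  case (Suc n)
  then obtain r l where r: "strict_mono (r :: nat \<Rightarrow> nat)" "\<forall>i<n. (\<lambda>m. X (r m) i) \<longlonglongrightarrow> l i" by (metis less_SucI)
  have "\<forall>m. X (r m) n \<in> cball 0 C" using Suc.prems by simp
  then obtain a q where q: "strict_mono (q :: nat \<Rightarrow> nat)" "((\<lambda>m. X (r m) n) \<circ> q) \<longlonglongrightarrow> a"
    using compact_cball[of "0::'a" C] unfolding compact_def by metis
  have "(\<lambda>m. X ((r \<circ> q) m) i) \<longlonglongrightarrow> (l(n := a)) i" if "i < Suc n" for i
  proof (cases "i = n")
    case True then show ?thesis using q(2) by (simp add: o_def)
  next
    case False
    then have "((\<lambda>m. X (r m) i) \<circ> q) \<longlonglongrightarrow> l i" using r(2) that by (intro LIMSEQ_subseq_LIMSEQ q) auto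
    then show ?thesis using False by (simp add: o_def)
  qed
  then show ?case using strict_mono_o[OF r(1) q(1)] by blast
qed

text \<open>Abstracts the seminorm t -> sup |f(z + t) - f(z)| over a tube, realized by
  \<open>dn E\<close>. Here \<open>d_cont\<close> is uniform continuity of f, and
  \<open>d_net\<close> says that finitely many translates approximate all of them.\<close>

locale ap_norm =
  fixes d :: "real^'p \<Rightarrow> real"
  assumes d_zero: "d 0 = 0" and d_tri: "\<And>s t. d (s + t) \<le> d s + d t" and d_minus: "\<And>t. d (- t) = d t"
    and d_cont: "\<And>e. e > 0 \<Longrightarrow> \<exists>r>0. \<forall>t. norm t \<le> r \<longrightarrow> d t \<le> e"
    and d_net: "\<And>e. e > 0 \<Longrightarrow> \<exists>S. finite S \<and> (\<forall>t. \<exists>s\<in>S. d (t - s) \<le> e)"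
begin

lemma d_nonneg: "d t \<ge> 0"
  using d_tri[of t "- t"] d_zero d_minus[of t] by simp

definition bump :: "real \<Rightarrow> real^'p \<Rightarrow> real" where "bump \<epsilon> t = max 0 (1 - d t / \<epsilon>)"

lemma bump_props:
  assumes "\<epsilon> > 0"
  shows "0 \<le> bump \<epsilon> t" "bump \<epsilon> t \<le> 1" "bump \<epsilon> t \<noteq> 0 \<Longrightarrow> d t < \<epsilon>" "\<bar>bump \<epsilon> s - bump \<epsilon> t\<bar> \<le> d (s - t) / \<epsilon>"
proof -
  show "0 \<le> bump \<epsilon> t" "bump \<epsilon> t \<le> 1" using assms d_nonneg[of t] by (auto simp: bump_def)
  show "bump \<epsilon> t \<noteq> 0 \<Longrightarrow> d t < \<epsilon>" using assms by (auto simp: bump_def max_def field_simps split: if_splits)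
  have "d s \<le> d t + d (s - t)" "d t \<le> d s + d (s - t)"
    using d_tri[of t "s - t"] d_tri[of s "t - s"] d_minus[of "s - t"] by auto
  then have "\<bar>d s / \<epsilon> - d t / \<epsilon>\<bar> \<le> d (s - t) / \<epsilon>" using assms by (simp add: field_simps abs_le_iff)
  then show "\<bar>bump \<epsilon> s - bump \<epsilon> t\<bar> \<le> d (s - t) / \<epsilon>" by (auto simp: bump_def max_def abs_le_iff)
qed

text \<open>If a coordinate of the frequency exceeded pi/\<open>\<rho>\<close>, a shift of length at
  most \<open>\<rho>\<close> would turn the character by an angle between pi/2 and pi while changing
  the bump by at most \<open>r0 / 4\<close>; then \<open>dft_modulus\<close> would bound the
  coefficient by \<open>r0 / 2\<close>.\<close>

lemma freq_bound:
  assumes \<epsilon>: "\<epsilon> > 0" and T: "T > 0" and N: "N = 4 * T" and \<delta>: "\<delta> > 0" and \<rho>: "\<rho> > 0" and r0: "r0 > 0"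
    and c: "\<And>t. norm t \<le> \<rho> \<Longrightarrow> d t \<le> \<epsilon> * r0 / 4" and big: "of_int T \<ge> 8 * \<rho> / (\<delta> * r0)"
    and k: "k \<in> Qb N" and dk: "norm (dft T N (\<lambda>n. bump \<epsilon> (lv \<delta> n - w)) k) \<ge> r0"
  shows "\<bar>freq \<delta> N k $ j\<bar> \<le> pi / \<rho>"
proof (rule ccontr)
  assume "\<not> ?thesis"
  then have bigl: "\<bar>freq \<delta> N k $ j\<bar> > pi / \<rho>" by simp
  \<comment> \<open>The angle by which the character turns along one lattice step; centring the
    frequency makes it at most pi.\<close>
  define x where "x = \<bar>freq \<delta> N k $ j\<bar> * \<delta>"
  have N0: "N > 0" using T N by simp
  have xeq: "x = 2 * pi * \<bar>of_int (cen N (k j))\<bar> / of_int N"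
    using N0 \<delta> by (simp add: x_def freq_def abs_mult)
  have x0: "x > 0" using bigl \<rho> \<delta> pi_gt_zero by (smt (verit) x_def divide_pos_pos mult_pos_pos)
  have "\<bar>2 * cen N (k j)\<bar> \<le> N" using k by (auto simp: cen_def mem_Qb abs_le_iff elim!: allE[of _ j])
  then have "2 * \<bar>real_of_int (cen N (k j))\<bar> \<le> of_int N" by linarith
  then have "pi * (2 * \<bar>real_of_int (cen N (k j))\<bar>) \<le> pi * of_int N" by (intro mult_left_mono) auto
  then have xpi: "x \<le> pi" using N0 by (simp add: xeq divide_le_eq mult_ac)
  \<comment> \<open>The largest number of steps that turn the character by at most pi. Since
    \<open>v\<close> is at least 1, 2v is at least v + 1, and v steps already turn it by more than
    pi/2.\<close>
  define v where "v = \<lfloor>pi / x\<rfloor>"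
  have v1: "v \<ge> 1" using x0 xpi by (simp add: v_def le_floor_iff field_simps)
  have vx: "of_int v * x \<le> pi" using of_int_floor_le[of "pi / x"] x0 unfolding v_def[symmetric] by (simp add: pos_le_divide_eq)
  have "(of_int v + 1) * x > pi" using floor_correct[of "pi / x"] x0 unfolding v_def[symmetric] by (simp add: pos_divide_less_eq)
  moreover have "(of_int v + 1) * x \<le> (2 * of_int v) * x" using v1 x0 by (intro mult_right_mono) auto
  ultimately have vx2: "of_int v * x > pi / 2" by simp
  have v\<delta>: "\<delta> * of_int v \<le> \<rho>"
  proof -
    have "x > pi / \<rho> * \<delta>" unfolding x_def using bigl \<delta> by (rule mult_strict_right_mono)
    then have "of_int v * (pi / \<rho> * \<delta>) \<le> of_int v * x" using v1 by (intro mult_left_mono) auto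
    then have "of_int v * (pi / \<rho> * \<delta>) \<le> pi" using vx by linarith
    then have "pi * (\<delta> * of_int v) \<le> pi * \<rho>" using \<rho> by (simp add: field_simps)
    then show ?thesis by simp
  qed
  have cosle: "cos (of_int v * x) \<le> 0"
    using vx vx2 cos_ge_zero[of "pi - of_int v * x"] by simp
  define \<theta> where "\<theta> = 2 * pi * of_int (cen N (k j)) * of_int v / of_int N"
  have "\<bar>\<theta>\<bar> = of_int v * x" using v1 N0 by (simp add: \<theta>_def xeq abs_mult)
  then have cos\<theta>: "cos \<theta> \<le> 0" using cosle by (metis cos_abs_real)
  have "rt N (- (k j * v)) = cnj (rt N (cen N (k j) * v))" using rt_cen[OF N0, of "k j" "- v"] by (simp add: rt_simps)
  then have "rt N (- (k j * v)) = cis (- \<theta>)" by (simp add: rt_def \<theta>_def cis_cnj mult.assoc)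
  then have "1 \<le> Re (1 - rt N (- (k j * v)))" using cos\<theta> by simp
  then have n1: "1 \<le> norm (1 - rt N (- (k j * v)))" using complex_Re_le_cmod order_trans by blast
  have lvs: "norm (lv \<delta> (n(j := n j + v)) - w - (lv \<delta> n - w)) \<le> \<rho>" for n :: "'p \<Rightarrow> int"
  proof -
    have "lv \<delta> (n(j := n j + v)) - w - (lv \<delta> n - w) = axis j (\<delta> * of_int v)"
      by (auto simp: lv_def vec_eq_iff axis_def algebra_simps)
    then show ?thesis using v\<delta> \<delta> v1 by (simp add: norm_eq_sqrt_inner inner_axis_axis)
  qed
  have w: "\<bar>bump \<epsilon> (lv \<delta> (n(j := n j + v)) - w) - bump \<epsilon> (lv \<delta> n - w)\<bar> \<le> r0 / 4" for n :: "'p \<Rightarrow> int"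
  proof (rule order_trans[OF bump_props(4)[OF \<epsilon>]])
    show "d (lv \<delta> (n(j := n j + v)) - w - (lv \<delta> n - w)) / \<epsilon> \<le> r0 / 4"
      using c[OF lvs[of n]] \<epsilon> by (simp add: pos_divide_le_eq mult_ac)
  qed
  have "norm (dft T N (\<lambda>n. bump \<epsilon> (lv \<delta> n - w)) k) * norm (1 - rt N (- (k j * v))) \<le> 2 * of_int v / of_int T + r0 / 4"
    by (rule dft_modulus[OF T N]) (use bump_props[OF \<epsilon>] v1 w in auto)
  moreover have "r0 * 1 \<le> norm (dft T N (\<lambda>n. bump \<epsilon> (lv \<delta> n - w)) k) * norm (1 - rt N (- (k j * v)))"
    using dk n1 r0 by (intro mult_mono) auto
  moreover have "2 * of_int v / of_int T \<le> r0 / 4"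
  proof -
    have "8 * (\<delta> * of_int v) \<le> 8 * \<rho>" using v\<delta> by simp
    also have "8 * \<rho> \<le> of_int T * (\<delta> * r0)" using big \<delta> r0 by (simp add: divide_le_eq)
    finally have "\<delta> * (8 * of_int v) \<le> \<delta> * (of_int T * r0)" by (simp add: mult_ac)
    then have "8 * of_int v \<le> of_int T * r0" using \<delta> by (simp only: mult_le_cancel_left_pos)
    then show ?thesis using T by (simp add: field_simps)
  qed
  ultimately show False using r0 by linarith
qed

text \<open>Pigeonhole: at every lattice point some bump with centre in \<open>S\<close> is at least
  1/2, so the average over the box is at least 1/(2 card S) for one of the centres, whatever the box
  and the mesh.\<close>

lemma mean_bump:
  assumes \<epsilon>: "\<epsilon> > 0" and T: "T > 0" and S: "finite S" "\<And>t. \<exists>s\<in>S. d (t - s) \<le> \<epsilon> / 2"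
  shows "\<exists>w\<in>S. (\<Sum>n\<in>Qb T. bump \<epsilon> (lv \<delta> n - w)) / of_int T ^ CARD('p) \<ge> 1 / (2 * real (card S))"
proof (rule ccontr)
  let ?Q = "Qb T :: ('p \<Rightarrow> int) set"
  have S0: "S \<noteq> {}" using S(2)[of 0] by auto
  then have cS: "card S > 0" using S(1) by (simp add: card_gt_0_iff)
  have Tp: "of_int T ^ CARD('p) > (0::real)" using T by simp
  assume "\<not> ?thesis"
  then have "\<And>w. w \<in> S \<Longrightarrow> (\<Sum>n\<in>?Q. bump \<epsilon> (lv \<delta> n - w)) < of_int T ^ CARD('p) * (1 / (2 * real (card S)))"
    using Tp by (auto simp: not_le divide_less_eq mult_ac)
  then have "(\<Sum>w\<in>S. \<Sum>n\<in>?Q. bump \<epsilon> (lv \<delta> n - w)) < (\<Sum>w\<in>S. of_int T ^ CARD('p) * (1 / (2 * real (card S))))"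
    by (rule sum_strict_mono[OF S(1) S0])
  also have "\<dots> = of_int T ^ CARD('p) / 2" using cS by simp
  finally have lt: "(\<Sum>w\<in>S. \<Sum>n\<in>?Q. bump \<epsilon> (lv \<delta> n - w)) < of_int T ^ CARD('p) / 2" .
  have "of_int T ^ CARD('p) / 2 = (\<Sum>n\<in>?Q. 1/2 :: real)" using card_Qb[OF T, where 'p='p] by simp
  also have "\<dots> \<le> (\<Sum>n\<in>?Q. \<Sum>w\<in>S. bump \<epsilon> (lv \<delta> n - w))"
  proof (rule sum_mono)
    fix n :: "'p \<Rightarrow> int"
    obtain s where s: "s \<in> S" "d (lv \<delta> n - s) \<le> \<epsilon> / 2" using S(2) by blast
    have "1/2 \<le> bump \<epsilon> (lv \<delta> n - s)" using s(2) \<epsilon> by (simp add: bump_def field_simps le_max_iff_disj)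
    also have "\<dots> \<le> (\<Sum>w\<in>S. bump \<epsilon> (lv \<delta> n - w))"
      by (rule member_le_sum) (use s S bump_props[OF \<epsilon>] in auto)
    finally show "1/2 \<le> (\<Sum>w\<in>S. bump \<epsilon> (lv \<delta> n - w))" .
  qed
  also have "\<dots> = (\<Sum>w\<in>S. \<Sum>n\<in>?Q. bump \<epsilon> (lv \<delta> n - w))" by (rule sum.swap)
  finally show False using lt by simp
qed

text \<open>Taking \<open>\<phi>\<close> to be a bump that vanishes unless \<open>d (t - w) < \<epsilon>\<close> makes \<open>psi\<close> vanish unless \<open>d t\<close> is small.
  Only the frequencies with \<open>pw\<close> at least a fixed threshold are kept: their number and size are
  bounded independently of \<open>B\<close>, so that a limit \<open>B \<rightarrow> \<infinity>\<close> is possible.\<close>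

lemma kernel_finite:
  assumes \<epsilon>: "\<epsilon> > 0" and S: "finite S" "\<And>t. \<exists>s\<in>S. d (t - s) \<le> \<epsilon> / 2" and \<eta>: "\<eta> > 0"
  shows "\<exists>C R. \<exists>n::nat. 0 < n \<and> (\<forall>B. \<exists>c L. (\<forall>i<n. 0 \<le> c i \<and> c i \<le> C \<and> norm (L i) \<le> R) \<and> L 0 = 0 \<and>
     c 0 \<ge> (1 / (2 * real (card S))) ^ 4 \<and>
     (\<forall>t. norm t \<le> B \<longrightarrow> norm (\<Sum>i<n. of_real (c i) * chr (L i) t) \<le> Re (\<Sum>i<n. of_real (c i) * chr (L i) t) + 2 * \<eta> \<and>
       (d t \<ge> 5 * \<epsilon> \<longrightarrow> norm (\<Sum>i<n. of_real (c i) * chr (L i) t) \<le> \<eta>)))"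
proof -
  define p where "p = CARD('p)"
  have p1: "real p \<ge> 1" by (simp add: p_def Suc_le_eq)
  have S0: "S \<noteq> {}" using S(2)[of 0] by auto
  define q where "q = real (card S)"
  have q0: "q > 0" using S S0 by (simp add: q_def card_gt_0_iff)
  \<comment> \<open>Dropping the frequencies with power below \<open>th\<close> costs at most
    \<open>th * 4 ^ p\<close>, half of the permitted \<open>\<eta>\<close>; the second entry ensures
    that the zero frequency is kept.\<close>
  define th where "th = min (\<eta> / (2 * 4 ^ p)) ((1 / (2 * q))\<^sup>2)"
  have th0: "th > 0" using \<eta> q0 by (simp add: th_def)
  define r0 where "r0 = sqrt th"
  have r0: "r0 > 0" "r0\<^sup>2 = th" using th0 by (auto simp: r0_def)
  obtain \<rho> where \<rho>: "\<rho> > 0" "\<And>t. norm t \<le> \<rho> \<Longrightarrow> d t \<le> \<epsilon> * r0 / 4"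
    using d_cont[of "\<epsilon> * r0 / 4"] \<epsilon> r0 by auto
  obtain \<rho>2 where \<rho>2: "\<rho>2 > 0" "\<And>t. norm t \<le> \<rho>2 \<Longrightarrow> d t \<le> \<epsilon>" using d_cont[OF \<epsilon>] by auto
  define R where "R = p * (pi / \<rho>)"
  have R0: "R > 0" using \<rho> p1 by (simp add: R_def)
  \<comment> \<open>The first bound makes rounding to the lattice change \<open>d\<close> by at most
    \<open>\<epsilon>\<close>, the second makes it change the trigonometric sum by at most
    \<open>\<eta> / 2\<close>.\<close>
  define \<delta> where "\<delta> = min (\<rho>2 / p) (\<eta> / (2 * 4 ^ p * 4 ^ p * R * p))"
  have \<delta>: "\<delta> > 0" using \<rho>2 \<eta> R0 p1 by (simp add: \<delta>_def)
  have \<delta>1: "p * \<delta> \<le> \<rho>2" "4 ^ p * 4 ^ p * R * (p * \<delta>) \<le> \<eta> / 2"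
  proof -
    have "\<delta> \<le> \<rho>2 / p" "\<delta> \<le> \<eta> / (2 * 4 ^ p * 4 ^ p * R * p)" by (auto simp: \<delta>_def)
    then show "p * \<delta> \<le> \<rho>2" "4 ^ p * 4 ^ p * R * (p * \<delta>) \<le> \<eta> / 2"
      using p1 R0 by (auto simp: le_divide_eq mult_ac)
  qed
  \<comment> \<open>The powers add up to at most \<open>4 ^ p\<close>, so at most
    \<open>4 ^ p / th\<close> frequencies reach the threshold. The count is fixed before
    \<open>B\<close> is.\<close>
  define n where "n = Suc (nat \<lceil>4 ^ p / th\<rceil>)"
  have key: "\<exists>c L. (\<forall>i<n. 0 \<le> c i \<and> c i \<le> 4 ^ p * 4 ^ p \<and> norm (L i) \<le> R) \<and> L 0 = (0::real^'p) \<and>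
        (1 / (2 * real (card S))) ^ 4 \<le> c 0 \<and>
        (\<forall>t. norm t \<le> B \<longrightarrow> norm (\<Sum>i<n. of_real (c i) * chr (L i) t) \<le> Re (\<Sum>i<n. of_real (c i) * chr (L i) t) + 2 * \<eta> \<and>
         (5 * \<epsilon> \<le> d t \<longrightarrow> norm (\<Sum>i<n. of_real (c i) * chr (L i) t) \<le> \<eta>))" for B :: real
  proof -
    \<comment> \<open>Large enough for the boundary terms in \<open>freq_bound\<close> and for the
      lattice points near the ball of radius \<open>B\<close> to satisfy the coordinate bound of
      \<open>psi_support\<close>.\<close>
    define T where "T = max 1 (max \<lceil>8 * \<rho> / (\<delta> * r0)\<rceil> (\<lceil>\<bar>B\<bar> / \<delta>\<rceil> + 2))"
    have T: "T > 0" by (simp add: T_def)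
    have "\<lceil>8 * \<rho> / (\<delta> * r0)\<rceil> \<le> T" by (simp add: T_def)
    then have T2: "of_int T \<ge> 8 * \<rho> / (\<delta> * r0)" by (simp add: ceiling_le_iff)
    have "\<lceil>\<bar>B\<bar> / \<delta>\<rceil> \<le> T - 2" by (simp add: T_def)
    then have T3: "\<bar>B\<bar> / \<delta> \<le> of_int T - 2" by (simp add: ceiling_le_iff)
    define N where "N = 4 * T"
    have N0: "N > 0" using T by (simp add: N_def)
    obtain w where w: "w \<in> S" "(\<Sum>n\<in>Qb T. bump \<epsilon> (lv \<delta> n - w)) / of_int T ^ CARD('p) \<ge> 1 / (2 * q)"
      using mean_bump[OF \<epsilon> T S] unfolding q_def by blast
    define \<phi> where "\<phi> n = bump \<epsilon> (lv \<delta> n - w)" for n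
    have \<phi>01: "\<And>n. 0 \<le> \<phi> n" "\<And>n. \<phi> n \<le> 1" using bump_props[OF \<epsilon>] by (auto simp: \<phi>_def)
    note A = T N_def \<phi>01
    define P where "P = pw T N \<phi>"
    have P0: "P k \<ge> 0" for k using pw_nonneg[where \<phi> = \<phi>, OF A] by (simp add: P_def)
    have sP: "(\<Sum>k\<in>Qb N. P k) \<le> 4 ^ p" using sum_pw_le[where \<phi> = \<phi>, OF A] by (simp add: P_def p_def)
    define z where "z = (\<lambda>_::'p. 0::int)"
    have zQ: "z \<in> Qb N" using N0 by (simp add: z_def mem_Qb)
    have nz: "norm (dft T N \<phi> z) \<ge> 1 / (2 * q)" using dft_0[where \<phi> = \<phi>, OF A] w(2) by (simp add: z_def \<phi>_def)
    have Pz: "P z \<ge> (1 / (2 * q))\<^sup>2" unfolding P_def pw_def[where \<phi> = \<phi>, OF A] using nz q0 by (intro power_mono) auto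
    define K where "K = {k \<in> Qb N. th \<le> P k}"
    have finK: "finite K" by (simp add: K_def)
    have zK: "z \<in> K" using zQ Pz by (simp add: K_def th_def)
    have Ple: "P k \<le> 4 ^ p" if "k \<in> Qb N" for k using member_le_sum[of k "Qb N" P] P0 sP that by force
    have cK: "real (card K) \<le> 4 ^ p / th"
    proof -
      have "real (card K) * th = (\<Sum>k\<in>K. th)" by simp
      also have "\<dots> \<le> (\<Sum>k\<in>K. P k)" by (rule sum_mono) (simp add: K_def)
      also have "\<dots> \<le> (\<Sum>k\<in>Qb N. P k)" by (rule sum_mono2) (auto simp: K_def P0)
      finally show ?thesis using sP th0 by (simp add: le_divide_eq)
    qed
    have frK: "norm (freq \<delta> N k) \<le> R" if "k \<in> K" for k
    proof -
      have "r0\<^sup>2 \<le> (norm (dft T N \<phi> k))\<^sup>2" using that r0(2) pw_def[where \<phi> = \<phi>, OF A] by (simp add: K_def P_def)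
      then have "r0 \<le> norm (dft T N \<phi> k)" using power2_le_imp_le norm_ge_zero by blast
      then have "\<bar>freq \<delta> N k $ j\<bar> \<le> pi / \<rho>" for j
        using freq_bound[OF \<epsilon> T N_def \<delta> \<rho>(1) r0(1) \<rho>(2) T2, of k w j] that unfolding \<phi>_def by (auto simp: K_def)
      then have "(\<Sum>j\<in>UNIV. \<bar>freq \<delta> N k $ j\<bar>) \<le> (\<Sum>j\<in>(UNIV::'p set). pi / \<rho>)" by (intro sum_mono) auto
      then show ?thesis using norm_le_l1_cart[of "freq \<delta> N k"] by (simp add: R_def p_def)
    qed
    have fr0: "freq \<delta> N z = 0" using N0 by (simp add: freq_def z_def cen_def vec_eq_iff)
    define G where "G k t = of_real ((P k)\<^sup>2) * chr (freq \<delta> N k) t" for k t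
    obtain h where h: "bij_betw h {0..<card (K - {z})} (K - {z})" using ex_bij_betw_nat_finite[of "K - {z}"] finK by auto
    \<comment> \<open>The zero frequency is listed first, and the list is later padded with zero
      coefficients to the length \<open>n\<close>, so that the sums for different \<open>B\<close>
      can be compared term by term.\<close>
    define e where "e i = (if i = 0 then z else h (i - 1))" for i
    define c where "c i = (if i < Suc (card (K - {z})) then (P (e i))\<^sup>2 else 0)" for i
    define L where "L i = (if i < Suc (card (K - {z})) then freq \<delta> N (e i) else 0)" for i
    have cKz: "card (K - {z}) \<le> nat \<lceil>4 ^ p / th\<rceil>"
    proof -
      have "real (card (K - {z})) \<le> real (card K)" by (simp add: card_mono finK)
      then show ?thesis using cK by linarith
    qed
    have eK: "e i \<in> K" if "i < Suc (card (K - {z}))" for i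
    proof (cases i)
      case (Suc i')
      then have "h i' \<in> K - {z}" using that bij_betwE[OF h] by auto
      then show ?thesis using Suc by (simp add: e_def)
    qed (simp add: e_def zK)
    have sumK: "(\<Sum>i<n. of_real (c i) * chr (L i) t) = (\<Sum>k\<in>K. G k t)" for t
    proof -
      have "(\<Sum>i<n. of_real (c i) * chr (L i) t) = (\<Sum>i<Suc (card (K - {z})). of_real (c i) * chr (L i) t)"
        using cKz by (intro sum.mono_neutral_right) (auto simp: n_def c_def)
      also have "\<dots> = (\<Sum>i<Suc (card (K - {z})). G (e i) t)" by (rule sum.cong) (auto simp: c_def L_def G_def)
      also have "\<dots> = G z t + (\<Sum>i<card (K - {z}). G (h i) t)" by (subst sum.lessThan_Suc_shift) (simp add: e_def)
      also have "(\<Sum>i<card (K - {z}). G (h i) t) = (\<Sum>k\<in>K - {z}. G k t)"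
        using sum.reindex_bij_betw[OF h, of "\<lambda>k. G k t"] by (simp add: atLeast0LessThan)
      also have "G z t + \<dots> = (\<Sum>k\<in>K. G k t)" by (rule sum.remove[OF finK zK, symmetric])
      finally show ?thesis .
    qed
    \<comment> \<open>The sum lies within \<open>\<eta>\<close> of a nonnegative number: rounding t
      to the lattice (\<open>lip\<close>) and dropping the small frequencies (\<open>tail\<close>)
      cost \<open>\<eta> / 2\<close> each.\<close>
    have main: "\<exists>r\<ge>0. norm ((\<Sum>k\<in>K. G k t) - of_real r) \<le> \<eta> \<and> (d t \<ge> 5 * \<epsilon> \<longrightarrow> r = 0)" if tB: "norm t \<le> B" for t
    proof -
      define x where "x j = \<lfloor>t $ j / \<delta>\<rfloor>" for j
      have xt: "\<bar>t $ j - \<delta> * of_int (x j)\<bar> \<le> \<delta>" for j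
      proof -
        have "of_int (x j) \<le> t $ j / \<delta>" "t $ j / \<delta> < of_int (x j) + 1" unfolding x_def by linarith+
        then have "\<delta> * of_int (x j) \<le> t $ j" "t $ j < \<delta> * of_int (x j) + \<delta>" using \<delta> by (auto simp: field_simps)
        then show ?thesis by linarith
      qed
      have "norm (t - lv \<delta> x) \<le> (\<Sum>j\<in>UNIV. \<bar>(t - lv \<delta> x) $ j\<bar>)" by (rule norm_le_l1_cart)
      also have "\<dots> \<le> (\<Sum>j\<in>(UNIV::'p set). \<delta>)" using xt by (intro sum_mono) (simp add: lv_def)
      finally have tx: "norm (t - lv \<delta> x) \<le> p * \<delta>" by (simp add: p_def)
      have xT: "\<bar>x j\<bar> < T" for j
      proof -
        have "\<bar>t $ j\<bar> \<le> \<bar>B\<bar>" using component_le_norm_cart[of t j] tB by linarith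
        then have "\<bar>t $ j / \<delta>\<bar> \<le> \<bar>B\<bar> / \<delta>" using \<delta> by (simp add: divide_right_mono)
        then have "\<bar>t $ j / \<delta>\<bar> \<le> of_int T - 2" using T3 by linarith
        then have "real_of_int (x j) \<le> of_int T - 2" "real_of_int (x j) > - (of_int T - 2) - 1"
          unfolding x_def by linarith+
        then show ?thesis by linarith
      qed
      have lip: "norm ((\<Sum>k\<in>K. G k t) - (\<Sum>k\<in>K. G k (lv \<delta> x))) \<le> \<eta> / 2"
      proof -
        have "norm (\<Sum>k\<in>K. G k t - G k (lv \<delta> x)) \<le> (\<Sum>k\<in>K. P k * (4 ^ p * (R * (p * \<delta>))))"
        proof (rule sum_norm_le)
          fix k assume k: "k \<in> K"
          have "norm (G k t - G k (lv \<delta> x)) = (P k)\<^sup>2 * norm (chr (freq \<delta> N k) t - chr (freq \<delta> N k) (lv \<delta> x))"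
            by (simp add: G_def right_diff_distrib[symmetric] norm_mult norm_power P0)
          also have "\<dots> \<le> (P k * 4 ^ p) * (R * (p * \<delta>))"
          proof (intro mult_mono)
            show "(P k)\<^sup>2 \<le> P k * 4 ^ p" unfolding power2_eq_square using k Ple P0 by (intro mult_left_mono) (auto simp: K_def)
            show "norm (chr (freq \<delta> N k) t - chr (freq \<delta> N k) (lv \<delta> x)) \<le> R * (p * \<delta>)"
              by (rule order_trans[OF norm_chr_diff_le]) (use frK[OF k] tx R0 in \<open>auto intro!: mult_mono\<close>)
          qed (use P0 in auto)
          finally show "norm (G k t - G k (lv \<delta> x)) \<le> P k * (4 ^ p * (R * (p * \<delta>)))" by (simp add: mult_ac)
        qed
        also have "\<dots> = (\<Sum>k\<in>K. P k) * (4 ^ p * (R * (p * \<delta>)))" by (simp add: sum_distrib_right)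
        also have "\<dots> \<le> 4 ^ p * (4 ^ p * (R * (p * \<delta>)))"
        proof (rule mult_right_mono)
          have "(\<Sum>k\<in>K. P k) \<le> (\<Sum>k\<in>Qb N. P k)" by (rule sum_mono2) (auto simp: K_def P0)
          then show "(\<Sum>k\<in>K. P k) \<le> 4 ^ p" using sP by simp
        qed (use R0 \<delta> in auto)
        also have "\<dots> \<le> \<eta> / 2" using \<delta>1(2) by (simp add: mult_ac)
        finally show ?thesis by (simp add: sum_subtractf)
      qed
      have tail: "norm ((\<Sum>k\<in>K. G k (lv \<delta> x)) - psi T N \<phi> x) \<le> \<eta> / 2"
      proof -
        have "psi T N \<phi> x = (\<Sum>k\<in>Qb N. G k (lv \<delta> x))"
          unfolding psi_def[where \<phi> = \<phi>, OF A] by (simp add: G_def P_def chr_freq[OF N0 \<delta>])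
        also have "\<dots> = (\<Sum>k\<in>Qb N - K. G k (lv \<delta> x)) + (\<Sum>k\<in>K. G k (lv \<delta> x))"
          by (rule sum.subset_diff) (auto simp: K_def)
        finally have "norm ((\<Sum>k\<in>K. G k (lv \<delta> x)) - psi T N \<phi> x) = norm (\<Sum>k\<in>Qb N - K. G k (lv \<delta> x))" by simp
        also have "\<dots> \<le> (\<Sum>k\<in>Qb N - K. th * P k)"
        proof (rule sum_norm_le)
          fix k assume k: "k \<in> Qb N - K"
          have "norm (G k (lv \<delta> x)) = P k * P k" by (simp add: G_def norm_mult norm_power P0 chr_simps power2_eq_square)
          also have "\<dots> \<le> th * P k" using k P0 by (intro mult_right_mono) (auto simp: K_def)
          finally show "norm (G k (lv \<delta> x)) \<le> th * P k" .
        qed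
        also have "\<dots> = th * (\<Sum>k\<in>Qb N - K. P k)" by (simp add: sum_distrib_left)
        also have "\<dots> \<le> th * 4 ^ p"
        proof (rule mult_left_mono)
          have "(\<Sum>k\<in>Qb N - K. P k) \<le> (\<Sum>k\<in>Qb N. P k)" by (rule sum_mono2) (auto simp: P0)
          then show "(\<Sum>k\<in>Qb N - K. P k) \<le> 4 ^ p" using sP by simp
        qed (use th0 in auto)
        also have "\<dots> \<le> \<eta> / (2 * 4 ^ p) * 4 ^ p" by (intro mult_right_mono) (auto simp: th_def)
        finally show ?thesis by simp
      qed
      obtain r where r: "r \<ge> 0" "psi T N \<phi> x = of_real r" using psi_nonneg[where \<phi> = \<phi>, OF A] by blast
      have "r = 0" if "d t \<ge> 5 * \<epsilon>"
      proof (rule ccontr)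
        assume "r \<noteq> 0"
        then have "psi T N \<phi> x \<noteq> 0" using r by simp
        then obtain a b a' b' where ab: "\<phi> a \<noteq> 0" "\<phi> b \<noteq> 0" "\<phi> a' \<noteq> 0" "\<phi> b' \<noteq> 0" "\<And>j. x j = (a j - b j) + (a' j - b' j)"
          using psi_support[where \<phi> = \<phi> and x = x, OF A _ xT] by blast
        \<comment> \<open>The centre \<open>w\<close> cancels, so four points in the support of the
          bump leave d < 4 \<open>\<epsilon>\<close> at the lattice point; rounding adds one more
          \<open>\<epsilon>\<close>, whence the factor 5.\<close>
        have "lv \<delta> x = ((lv \<delta> a - w) + - (lv \<delta> b - w)) + ((lv \<delta> a' - w) + - (lv \<delta> b' - w))"
          by (simp add: lv_def vec_eq_iff ab(5) algebra_simps)
        then have "d (lv \<delta> x) = d (((lv \<delta> a - w) + - (lv \<delta> b - w)) + ((lv \<delta> a' - w) + - (lv \<delta> b' - w)))"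
          by (rule arg_cong)
        then have "d (lv \<delta> x) \<le> (d (lv \<delta> a - w) + d (lv \<delta> b - w)) + (d (lv \<delta> a' - w) + d (lv \<delta> b' - w))"
          using d_tri[of "lv \<delta> a - w" "- (lv \<delta> b - w)"] d_tri[of "lv \<delta> a' - w" "- (lv \<delta> b' - w)"]
            d_tri[of "(lv \<delta> a - w) + - (lv \<delta> b - w)" "(lv \<delta> a' - w) + - (lv \<delta> b' - w)"]
            d_minus[of "lv \<delta> b - w"] d_minus[of "lv \<delta> b' - w"] by linarith
        also have "\<dots> < 4 * \<epsilon>" using ab(1-4) bump_props(3)[OF \<epsilon>] unfolding \<phi>_def by (smt (verit, best))
        finally have "d (lv \<delta> x) < 4 * \<epsilon>" .
        moreover have "d (t - lv \<delta> x) \<le> \<epsilon>" using \<rho>2(2) tx \<delta>1(1) by simp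
        moreover have "d t \<le> d (lv \<delta> x) + d (t - lv \<delta> x)" using d_tri[of "lv \<delta> x" "t - lv \<delta> x"] by simp
        ultimately show False using that by linarith
      qed
      moreover have "norm ((\<Sum>k\<in>K. G k t) - of_real r) \<le> \<eta>"
        using norm_diff_triangle_le[OF lip tail] r by simp
      ultimately show ?thesis using r(1) by blast
    qed
    show ?thesis
    proof (intro exI[of _ c] exI[of _ L] conjI allI impI)
      fix i
      show "0 \<le> c i" by (simp add: c_def)
      show "c i \<le> 4 ^ p * 4 ^ p"
        using eK[of i] Ple[of "e i"] P0 by (auto simp: c_def K_def power2_eq_square intro!: mult_mono)
      show "norm (L i) \<le> R" using frK[OF eK[of i]] R0 by (auto simp: L_def)
    next
      show "L 0 = 0" by (simp add: L_def e_def fr0)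
      have "((1 / (2 * q))\<^sup>2)\<^sup>2 \<le> (P z)\<^sup>2" using Pz q0 by (intro power_mono) auto
      then show "(1 / (2 * real (card S))) ^ 4 \<le> c 0" by (simp add: c_def e_def q_def flip: power_mult)
    next
      fix t :: "real^'p" assume "norm t \<le> B"
      then obtain r where r: "r \<ge> 0" "norm ((\<Sum>k\<in>K. G k t) - of_real r) \<le> \<eta>" "d t \<ge> 5 * \<epsilon> \<longrightarrow> r = 0" using main by blast
      have "\<bar>Re ((\<Sum>k\<in>K. G k t) - of_real r)\<bar> \<le> \<eta>" using r(2) abs_Re_le_cmod order_trans by blast
      moreover have "norm (\<Sum>k\<in>K. G k t) \<le> r + \<eta>" using r(1,2) norm_triangle_sub[of "\<Sum>k\<in>K. G k t" "of_real r"] by simp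
      ultimately show "norm (\<Sum>i<n. of_real (c i) * chr (L i) t) \<le> Re (\<Sum>i<n. of_real (c i) * chr (L i) t) + 2 * \<eta>"
        unfolding sumK by (simp add: abs_le_iff)
      show "norm (\<Sum>i<n. of_real (c i) * chr (L i) t) \<le> \<eta>" if "5 * \<epsilon> \<le> d t" using r that unfolding sumK by simp
    qed
  qed
  have n0: "0 < n" by (simp add: n_def)
  show ?thesis
    by (rule exI, rule exI, rule exI, rule conjI, rule n0, rule allI, rule key)
qed

text \<open>Compactness in the finitely many coefficients and frequencies, whose number and bounds
  do not depend on \<open>B\<close>, removes the restriction to bounded t. The quantifiers matter:
  \<open>m\<close> is fixed before \<open>\<eta>\<close>, so that \<open>\<eta>\<close> can later be
  chosen small relative to the mean of the kernel.\<close>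

theorem kernel_exists:
  assumes \<epsilon>: "\<epsilon> > 0"
  shows "\<exists>m>0. \<forall>\<eta>>0. \<exists>(n::nat) c L. (\<forall>i<n. 0 \<le> c i) \<and> 0 < n \<and> L 0 = 0 \<and> c 0 \<ge> m \<and>
     (\<forall>t. norm (\<Sum>i<n. of_real (c i) * chr (L i) t) \<le> Re (\<Sum>i<n. of_real (c i) * chr (L i) t) + 2 * \<eta> \<and>
       (d t > 5 * \<epsilon> \<longrightarrow> norm (\<Sum>i<n. of_real (c i) * chr (L i) t) \<le> \<eta>))"
proof -
  obtain S where S: "finite S" "\<And>t. \<exists>s\<in>S. d (t - s) \<le> \<epsilon> / 2" using d_net[of "\<epsilon>/2"] \<epsilon> by auto
  have "S \<noteq> {}" using S(2)[of 0] by auto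
  then have cS: "card S > 0" using S(1) by (simp add: card_gt_0_iff)
  \<comment> \<open>Fourth power because the coefficient at the zero frequency is
    \<open>(pw z)\<^sup>2\<close>, and \<open>pw\<close> is itself the square of the average bounded
    in \<open>mean_bump\<close>.\<close>
  define m where "m = (1 / (2 * real (card S))) ^ 4"
  show ?thesis
  proof (intro exI[of _ m] conjI allI impI)
    show "m > 0" using cS by (simp add: m_def)
    fix \<eta> :: real assume \<eta>: "\<eta> > 0"
    define Kf where "Kf n c L t = (\<Sum>i<n. complex_of_real (c i) * chr (L i) t)" for n :: nat and c and L :: "nat \<Rightarrow> real^'p" and t
    define good where "good n C R B c L \<longleftrightarrow> (\<forall>i<n. 0 \<le> c i \<and> c i \<le> C \<and> norm (L i) \<le> R) \<and> L 0 = 0 \<and> c 0 \<ge> m \<and>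
     (\<forall>t. norm t \<le> B \<longrightarrow> norm (Kf n c L t) \<le> Re (Kf n c L t) + 2 * \<eta> \<and> (d t \<ge> 5 * \<epsilon> \<longrightarrow> norm (Kf n c L t) \<le> \<eta>))"
      for n C R B c and L :: "nat \<Rightarrow> real^'p"
    have "\<exists>C R. \<exists>n::nat. 0 < n \<and> (\<forall>B. \<exists>c L. good n C R B c L)"
      using kernel_finite[OF \<epsilon> S \<eta>] unfolding good_def Kf_def m_def .
    then obtain C R n where CRn: "0 < n" "\<forall>B. \<exists>c L. good n C R B c L" by blast
    obtain c L where good: "\<And>B. good n C R B (c B) (L B)" using CRn(2) by metis
    have cL: "\<And>B i. i < n \<Longrightarrow> 0 \<le> c B i \<and> c B i \<le> C \<and> norm (L B i) \<le> R" "\<And>B. L B 0 = 0" "\<And>B. c B 0 \<ge> m"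
     "\<And>B t. norm t \<le> B \<Longrightarrow> norm (Kf n (c B) (L B) t) \<le> Re (Kf n (c B) (L B) t) + 2 * \<eta>"
     "\<And>B t. norm t \<le> B \<Longrightarrow> d t \<ge> 5 * \<epsilon> \<Longrightarrow> norm (Kf n (c B) (L B) t) \<le> \<eta>"
      using good unfolding good_def by blast+
    have "\<exists>r l. strict_mono (r :: nat \<Rightarrow> nat) \<and> (\<forall>i<n. (\<lambda>k. (c (real (r k)) i, L (real (r k)) i)) \<longlonglongrightarrow> l i)"
    proof (rule finite_convergent_subsequence[where C = "C + R"])
      fix k i assume "i < n"
      then have "norm (c (real k) i) + norm (L (real k) i) \<le> C + R" using cL(1)[of i "real k"] by simp
      then show "norm (c (real k) i, L (real k) i) \<le> C + R"
        using norm_Pair_le[of "c (real k) i" "L (real k) i"] by (rule order_trans[rotated])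
    qed
    then obtain r l where r: "strict_mono (r :: nat \<Rightarrow> nat)"
       "\<And>i. i < n \<Longrightarrow> (\<lambda>k. (c (real (r k)) i, L (real (r k)) i)) \<longlonglongrightarrow> l i" by blast
    define c' where "c' i = fst (l i)" for i
    define L' where "L' i = snd (l i)" for i
    have c': "(\<lambda>k. c (real (r k)) i) \<longlonglongrightarrow> c' i" and L': "(\<lambda>k. L (real (r k)) i) \<longlonglongrightarrow> L' i" if "i < n" for i
      using tendsto_fst[OF r(2)[OF that]] tendsto_snd[OF r(2)[OF that]] unfolding c'_def L'_def fst_conv snd_conv .
    have K': "(\<lambda>k. Kf n (c (real (r k))) (L (real (r k))) t) \<longlonglongrightarrow> Kf n c' L' t" for t
      unfolding Kf_def chr_def cis_conv_exp
    proof (rule tendsto_sum)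
      fix i assume "i \<in> {..<n}"
      then have i: "i < n" by simp
      show "(\<lambda>k. complex_of_real (c (real (r k)) i) * exp (\<i> * complex_of_real (L (real (r k)) i \<bullet> t)))
          \<longlonglongrightarrow> complex_of_real (c' i) * exp (\<i> * complex_of_real (L' i \<bullet> t))"
        by (intro tendsto_mult tendsto_of_real tendsto_exp tendsto_inner tendsto_const c'[OF i] L'[OF i])
    qed
    have ev: "\<forall>\<^sub>F k in sequentially. norm t \<le> real (r k)" for t :: "real^'p"
    proof -
      obtain M :: nat where "norm t \<le> real M" using real_arch_simple by blast
      then have "norm t \<le> real (r k)" if "k \<ge> M" for k using seq_suble[OF r(1), of k] that by linarith
      then show ?thesis by (auto simp: eventually_sequentially)
    qed
    have "(\<forall>i<n. 0 \<le> c' i) \<and> 0 < n \<and> L' 0 = 0 \<and> c' 0 \<ge> m \<and>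
      (\<forall>t. norm (Kf n c' L' t) \<le> Re (Kf n c' L' t) + 2 * \<eta> \<and> (d t > 5 * \<epsilon> \<longrightarrow> norm (Kf n c' L' t) \<le> \<eta>))"
    proof (intro conjI allI impI CRn(1))
      show "0 \<le> c' i" if "i < n" for i
        by (rule LIMSEQ_le_const[OF c'[OF that]]) (use cL(1)[OF that] in blast)
      show "L' 0 = 0" using LIMSEQ_unique[OF L'[OF CRn(1)], of 0] cL(2) by simp
      show "c' 0 \<ge> m" by (rule LIMSEQ_le_const[OF c'[OF CRn(1)]]) (use cL(3) in blast)
      fix t
      show "norm (Kf n c' L' t) \<le> Re (Kf n c' L' t) + 2 * \<eta>"
      proof (rule tendsto_le[OF trivial_limit_sequentially tendsto_add[OF tendsto_Re[OF K'] tendsto_const] tendsto_norm[OF K']])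
        show "\<forall>\<^sub>F k in sequentially. norm (Kf n (c (real (r k))) (L (real (r k))) t) \<le> Re (Kf n (c (real (r k))) (L (real (r k))) t) + 2 * \<eta>"
          using ev[of t] by (rule eventually_mono) (rule cL(4))
      qed
      show "norm (Kf n c' L' t) \<le> \<eta>" if "d t > 5 * \<epsilon>"
      proof (rule tendsto_upperbound[OF tendsto_norm[OF K'] _ trivial_limit_sequentially])
        show "\<forall>\<^sub>F k in sequentially. norm (Kf n (c (real (r k))) (L (real (r k))) t) \<le> \<eta>"
          using ev[of t] by (rule eventually_mono) (rule cL(5), assumption, use that in simp)
      qed
    qed
    then show "\<exists>(n::nat) c L. (\<forall>i<n. 0 \<le> c i) \<and> 0 < n \<and> L 0 = 0 \<and> c 0 \<ge> m \<and>
     (\<forall>t. norm (\<Sum>i<n. of_real (c i) * chr (L i) t) \<le> Re (\<Sum>i<n. of_real (c i) * chr (L i) t) + 2 * \<eta> \<and>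
       (d t > 5 * \<epsilon> \<longrightarrow> norm (\<Sum>i<n. of_real (c i) * chr (L i) t) \<le> \<eta>))"
      unfolding Kf_def by blast
  qed
qed

end

subsection \<open>Approximation by exponential polynomials\<close>

text \<open>Otherwise points that are pairwise far apart could be chosen one after another.
  \<open>D\<close> is arbitrary because \<open>finite_net\<close> applies the lemma to a relation
  coded by the values 0 and 1.\<close>

lemma sequential_totally_bounded:
  fixes D :: "'a \<Rightarrow> 'a \<Rightarrow> real"
  assumes "\<And>t :: nat \<Rightarrow> 'a. \<exists>r :: nat \<Rightarrow> nat. strict_mono r \<and> (\<exists>N. \<forall>m\<ge>N. \<forall>n\<ge>N. D (t (r m)) (t (r n)) \<le> e)"
  shows "\<exists>S. finite S \<and> (\<forall>t. \<exists>s\<in>S. D t s \<le> e)"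
proof (rule ccontr)
  assume "\<not> ?thesis"
  then have ex: "\<exists>t. \<forall>s\<in>S. D t s > e" if "finite S" for S using that by (meson not_le)
  have "\<exists>t :: nat \<Rightarrow> 'a. \<forall>n. \<forall>s\<in>t ` {..<n}. D (t n) s > e"
  proof (rule dependent_wellorder_choice)
    fix r and f g :: "nat \<Rightarrow> 'a" and n :: nat assume "\<And>m. m < n \<Longrightarrow> f m = g m"
    then have "f ` {..<n} = g ` {..<n}" by auto
    then show "(\<forall>s\<in>f ` {..<n}. e < D r s) = (\<forall>s\<in>g ` {..<n}. e < D r s)" by simp
  next
    fix n :: nat and f :: "nat \<Rightarrow> 'a"
    show "\<exists>r. \<forall>s\<in>f ` {..<n}. e < D r s" by (rule ex) auto
  qed
  then obtain t :: "nat \<Rightarrow> 'a" where t': "\<forall>n. \<forall>s\<in>t ` {..<n}. D (t n) s > e" by (rule exE)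
  have t: "D (t n) (t m) > e" if "m < n" for n m using t'[rule_format, of "t m" n] that by blast
  obtain r :: "nat \<Rightarrow> nat" and N where r: "strict_mono r" "\<forall>m\<ge>N. \<forall>n\<ge>N. D (t (r m)) (t (r n)) \<le> e" using assms by blast
  have "D (t (r (Suc N))) (t (r N)) > e" by (rule t) (rule strict_monoD[OF r(1)], simp)
  moreover have "D (t (r (Suc N))) (t (r N)) \<le> e" using r(2) by simp
  ultimately show False by simp
qed

text \<open>Cauchy's theorem on the rectangle of width 2T and height \<open>\<kappa>\<close>, by way
  of a primitive: the vertical sides contribute a bound independent of T. The term with
  \<open>\<mu>\<close> allows linear growth of G, as for a logarithm whose phase has mean slope
  \<open>\<mu>\<close>; with \<open>\<mu>\<close> = 0 the lemma serves Fourier coefficients.\<close>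

lemma rectangle_integral_bound:
  fixes G :: "complex \<Rightarrow> complex"
  assumes holo: "G holomorphic_on {w. Im w \<in> V}" and V: "open V" "convex V" "{0..\<kappa>} \<subseteq> V" and \<kappa>: "\<kappa> \<ge> 0" and T: "T > 0"
    and C: "\<And>v. v \<in> {0..\<kappa>} \<Longrightarrow> norm (G (Complex T v) - G (Complex (- T) v) - 2 * \<i> * of_real (T * \<mu>)) \<le> C"
  shows "norm (integral {-T..T} (\<lambda>u. G (Complex u \<kappa>) - G (Complex u 0)) + of_real (2 * T * \<kappa> * \<mu>)) \<le> C * \<kappa>"
proof -
  let ?S = "{w. Im w \<in> V}"
  have oS: "open ?S" using open_vimage[OF V(1) continuous_on_Im[OF continuous_on_id]] by (simp add: vimage_def)
  have cS: "convex ?S"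
    using V(2) unfolding convex_def by (auto simp: scaleR_conv_of_real)
  obtain \<Phi> where \<Phi>: "\<And>w. w \<in> ?S \<Longrightarrow> (\<Phi> has_field_derivative G w) (at w within ?S)"
    using holomorphic_convex_primitive'[OF cS oS holo] by blast
  have \<Phi>': "(\<Phi> has_field_derivative G w) (at w)" if "w \<in> ?S" for w using \<Phi>[OF that] at_within_open[OF that oS] by simp
  have hor: "((\<lambda>u. \<Phi> (Complex u v)) has_vector_derivative G (Complex u v)) (at u within X)" if "v \<in> V" for u v X
  proof -
    have "((\<lambda>u. Complex u v) has_vector_derivative 1) (at u within X)"
      unfolding Complex_eq by (auto intro!: derivative_eq_intros)
    then show ?thesis using field_vector_diff_chain_within[of "\<lambda>u. Complex u v" 1 u X \<Phi> "G (Complex u v)"]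
      \<Phi>'[of "Complex u v"] that by (simp add: o_def has_field_derivative_at_within)
  qed
  have ver: "((\<lambda>v. \<Phi> (Complex u v)) has_vector_derivative \<i> * G (Complex u v)) (at v within X)" if "v \<in> V" for u v X
  proof -
    have "((\<lambda>v. Complex u v) has_vector_derivative \<i>) (at v within X)"
      unfolding Complex_eq by (auto intro!: derivative_eq_intros)
    then show ?thesis using field_vector_diff_chain_within[of "\<lambda>v. Complex u v" \<i> v X \<Phi> "G (Complex u v)"]
      \<Phi>'[of "Complex u v"] that by (simp add: o_def has_field_derivative_at_within)
  qed
  have int: "((\<lambda>u. G (Complex u v)) has_integral \<Phi> (Complex T v) - \<Phi> (Complex (- T) v)) {-T..T}" if "v \<in> V" for v
    by (rule fundamental_theorem_of_calculus) (use T hor[OF that] in auto)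
  define Dv where "Dv v = \<Phi> (Complex T v) - \<Phi> (Complex (- T) v) + of_real (2 * T * v * \<mu>)" for v
  have "norm (Dv \<kappa> - Dv 0) \<le> C * norm (\<kappa> - 0)"
  proof (rule differentiable_bound[of "{0..\<kappa>}" Dv "\<lambda>v h. h *\<^sub>R (\<i> * (G (Complex T v) - G (Complex (- T) v) - 2 * \<i> * of_real (T * \<mu>)))"])
    fix v assume v: "v \<in> {0..\<kappa>}"
    then have vV: "v \<in> V" using V by auto
    have "(Dv has_vector_derivative (\<i> * G (Complex T v) - \<i> * G (Complex (- T) v) + of_real (2 * T * \<mu>))) (at v within {0..\<kappa>})"
      unfolding Dv_def by (auto intro!: derivative_eq_intros ver[OF vV])
    then show "(Dv has_derivative (\<lambda>h. h *\<^sub>R (\<i> * (G (Complex T v) - G (Complex (- T) v) - 2 * \<i> * of_real (T * \<mu>))))) (at v within {0..\<kappa>})"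
      by (simp add: has_vector_derivative_def algebra_simps)
    have C0: "C \<ge> 0" using C[OF v] norm_ge_zero order_trans by blast
    show "onorm (\<lambda>h. h *\<^sub>R (\<i> * (G (Complex T v) - G (Complex (- T) v) - 2 * \<i> * of_real (T * \<mu>)))) \<le> C"
      using C[OF v] C0 by (intro onorm_bound) (auto simp: norm_mult mult.commute[of C] intro!: mult_left_mono)
  qed (use \<kappa> in auto)
  moreover have "Dv \<kappa> - Dv 0 = integral {-T..T} (\<lambda>u. G (Complex u \<kappa>) - G (Complex u 0)) + of_real (2 * T * \<kappa> * \<mu>)"
  proof -
    have "0 \<in> V" "\<kappa> \<in> V" using V(3) \<kappa> by auto
    then have "((\<lambda>u. G (Complex u \<kappa>) - G (Complex u 0)) has_integral 
      (\<Phi> (Complex T \<kappa>) - \<Phi> (Complex (- T) \<kappa>)) - (\<Phi> (Complex T 0) - \<Phi> (Complex (- T) 0))) {-T..T}"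
      by (intro has_integral_diff int)
    then show ?thesis by (simp add: integral_unique Dv_def)
  qed
  ultimately show ?thesis using \<kappa> by simp
qed

lemma cvec_rvec: "cvec x y + rvec t = cvec (x + t) y"
  by (simp add: cvec_def rvec_def vec_eq_iff complex_eq_iff)

lemma cvec_in_tube: "cvec x y \<in> tube \<Omega> \<longleftrightarrow> y \<in> \<Omega>"
  by (auto simp: tube_def cvec_def vec_eq_iff)
     (metis (no_types) vec_eq_iff)

lemma tube_cases: assumes "z \<in> tube \<Omega>" obtains x y where "z = cvec x y" "y \<in> \<Omega>"
  using assms by (auto simp: tube_def)

lemma continuous_on_cvec [continuous_intros]:
  assumes "continuous_on S g" "continuous_on S h" shows "continuous_on S (\<lambda>x. cvec (g x) (h x))"
  unfolding cvec_def Complex_eq by (intro continuous_intros assms)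

lemma cinner_cvec: "cinner (cvec x y) l = Complex (x \<bullet> l) (y \<bullet> l)"
  by (simp add: cinner_def cvec_def inner_vec_def complex_eq_iff)

lemma exp_cinner: "exp (- \<i> * cinner (cvec x y) l) = chr (- l) x * of_real (exp (l \<bullet> y))"
  by (simp add: cinner_cvec chr_def Complex_eq cis_conv_exp exp_of_real[symmetric] exp_add[symmetric] inner_commute algebra_simps)

section \<open>Almost periodic holomorphic functions on a tube and their Fourier
  coefficients\<close>

locale ap_tube =
  fixes \<Omega> :: "(real^'p) set" and f :: "complex^'p \<Rightarrow> complex"
  assumes dom: "domain \<Omega>" and ap: "f \<in> AP \<Omega>"
begin

lemma openO: "open \<Omega>" and connO: "connected \<Omega>" and neO: "\<Omega> \<noteq> {}" using dom by (auto simp: domain_def)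

lemma f_continuous: "continuous_on (tube \<Omega>) f"
proof -
  have "\<exists>L. (f has_derivative L) (at z)" if "z \<in> tube \<Omega>" for z using ap that by (auto simp: AP_def holo_on_def)
  then have "isCont f z" if "z \<in> tube \<Omega>" for z using that has_derivative_continuous by blast
  then show ?thesis by (simp add: continuous_at_imp_continuous_on)
qed

lemma continuous_f [continuous_intros]:
  assumes "continuous_on S g" "continuous_on S h" "\<And>s. s \<in> S \<Longrightarrow> h s \<in> \<Omega>"
  shows "continuous_on S (\<lambda>s. f (cvec (g s) (h s)))"
  by (rule continuous_on_compose2[OF f_continuous continuous_on_cvec[OF assms(1,2)]]) (auto simp: cvec_in_tube assms)

lemma translates_subseq:
  fixes t :: "nat \<Rightarrow> real^'p"
  obtains r :: "nat \<Rightarrow> nat" where "strict_mono r"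
    "\<And>E e. compactly_in E \<Omega> \<Longrightarrow> e > 0 \<Longrightarrow> \<exists>N. \<forall>m\<ge>N. \<forall>n\<ge>N. \<forall>x. \<forall>y\<in>E.
       norm (f (cvec (x + t (r m)) y) - f (cvec (x + t (r n)) y)) \<le> e"
proof -
  obtain r :: "nat \<Rightarrow> nat" and g where r: "strict_mono r"
    "\<And>E. compactly_in E \<Omega> \<Longrightarrow> uniform_limit (tube E) (\<lambda>n z. f (z + rvec (t (r n)))) g sequentially"
    using ap unfolding AP_def mem_Collect_eq by metis
  show thesis
  proof (rule that[OF r(1)])
    fix E and e :: real assume E: "compactly_in E \<Omega>" and e: "e > 0"
    have "\<forall>\<^sub>F n in sequentially. \<forall>z\<in>tube E. dist (f (z + rvec (t (r n)))) (g z) < e/2"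
      using uniform_limitD[OF r(2)[OF E], of "e/2"] e by simp
    then obtain N where N: "\<And>n z. n \<ge> N \<Longrightarrow> z \<in> tube E \<Longrightarrow> dist (f (z + rvec (t (r n)))) (g z) < e/2"
      by (auto simp: eventually_sequentially)
    have "norm (f (cvec (x + t (r m)) y) - f (cvec (x + t (r n)) y)) \<le> e" if "m \<ge> N" "n \<ge> N" "y \<in> E" for m n x y
    proof -
      have z: "cvec x y \<in> tube E" using that by (simp add: cvec_in_tube)
      show ?thesis using dist_triangle_half_l[OF N[OF that(1) z] N[OF that(2) z]] by (simp add: cvec_rvec dist_norm)
    qed
    then show "\<exists>N. \<forall>m\<ge>N. \<forall>n\<ge>N. \<forall>x. \<forall>y\<in>E. norm (f (cvec (x + t (r m)) y) - f (cvec (x + t (r n)) y)) \<le> e" by blast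
  qed
qed

text \<open>If |f| exceeded n over points \<open>x n\<close>, one fixed translate, bounded over the
  compact closure of \<open>E\<close>, would be within 1 of all later translates in a
  subsequence.\<close>

lemma bounded_on_tube:
  assumes E: "compactly_in E \<Omega>"
  shows "\<exists>B>0. \<forall>x. \<forall>y\<in>E. norm (f (cvec x y)) \<le> B"
proof (rule ccontr)
  assume n: "\<not> ?thesis"
  have "\<forall>n::nat. \<exists>x y. y \<in> E \<and> norm (f (cvec x y)) > real n + 1"
  proof
    fix n :: nat
    have "real n + 1 > 0" by simp
    then show "\<exists>x y. y \<in> E \<and> norm (f (cvec x y)) > real n + 1" using n by (meson not_le)
  qed
  then obtain x y where xy: "\<And>n. y n \<in> E" "\<And>n. norm (f (cvec (x n) (y n))) > real n + 1" by metis
  obtain r :: "nat \<Rightarrow> nat" where r: "strict_mono r" "\<And>E e. compactly_in E \<Omega> \<Longrightarrow> e > 0 \<Longrightarrow> \<exists>N. \<forall>m\<ge>N. \<forall>n\<ge>N. \<forall>u. \<forall>y\<in>E.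
       norm (f (cvec (u + x (r m)) y) - f (cvec (u + x (r n)) y)) \<le> e" using translates_subseq[of x] by blast
  obtain N where N: "\<And>m u y. m \<ge> N \<Longrightarrow> y \<in> E \<Longrightarrow> norm (f (cvec (u + x (r m)) y) - f (cvec (u + x (r N)) y)) \<le> 1"
    using r(2)[OF E, of 1] by fastforce
  have cE: "compact (closure E)" "closure E \<subseteq> \<Omega>" using E by (auto simp: compactly_in_def)
  have "compact ((\<lambda>y. f (cvec (x (r N)) y)) ` closure E)"
    by (intro compact_continuous_image continuous_intros cE) (use cE in auto)
  from compact_imp_bounded[OF this] obtain B where "\<forall>z\<in>(\<lambda>y. f (cvec (x (r N)) y)) ` closure E. norm z \<le> B"
    unfolding bounded_iff by (rule exE)
  then have B: "norm (f (cvec (x (r N)) y)) \<le> B" if "y \<in> closure E" for y using that by blast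
  obtain M :: nat where M: "real M > B + 1" using reals_Archimedean2 by blast
  define m where "m = max M N"
  have mN: "m \<ge> N" by (simp add: m_def)
  have "norm (f (cvec (0 + x (r m)) (y (r m))) - f (cvec (0 + x (r N)) (y (r m)))) \<le> 1" by (rule N[OF mN xy(1)])
  moreover have "norm (f (cvec (x (r N)) (y (r m)))) \<le> B" using B xy closure_subset by blast
  moreover have "real (r m) \<ge> real M" using seq_suble[OF r(1), of m] by (simp add: m_def)
  moreover have "norm (f (cvec (x (r m)) (y (r m)))) > real (r m) + 1" by (rule xy)
  ultimately show False
    using M norm_triangle_ineq2[of "f (cvec (x (r m)) (y (r m)))" "f (cvec (x (r N)) (y (r m)))"] by simp
qed

text \<open>A suitable translation moves each violating pair close to the origin, where a single
  translate of f is uniformly continuous on a compact set; relative compactness makes one translate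
  serve for infinitely many pairs.\<close>

lemma uniformly_continuous_on_tube:
  assumes E: "compactly_in E \<Omega>" and e: "e > 0"
  shows "\<exists>d>0. \<forall>x x' y y'. y \<in> E \<longrightarrow> y' \<in> E \<longrightarrow> norm (x - x') \<le> d \<longrightarrow> norm (y - y') \<le> d \<longrightarrow> norm (f (cvec x y) - f (cvec x' y')) \<le> e"
proof (rule ccontr)
  assume n: "\<not> ?thesis"
  have "\<forall>n::nat. \<exists>x x' y y'. y \<in> E \<and> y' \<in> E \<and> norm (x - x') \<le> 1 / (real n + 1) \<and> norm (y - y') \<le> 1 / (real n + 1) \<and>
     norm (f (cvec x y) - f (cvec x' y')) > e"
  proof
    fix n :: nat
    have "1 / (real n + 1) > 0" by simp
    then show "\<exists>x x' y y'. y \<in> E \<and> y' \<in> E \<and> norm (x - x') \<le> 1 / (real n + 1) \<and> norm (y - y') \<le> 1 / (real n + 1) \<and>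
     norm (f (cvec x y) - f (cvec x' y')) > e" using n by (meson not_le)
  qed
  then obtain x x' y y' where xy: "\<And>n. y n \<in> E" "\<And>n. y' n \<in> E" "\<And>n. norm (x n - x' n) \<le> 1 / (real n + 1)"
    "\<And>n. norm (y n - y' n) \<le> 1 / (real n + 1)" "\<And>n. norm (f (cvec (x n) (y n)) - f (cvec (x' n) (y' n))) > e" by metis
  obtain r :: "nat \<Rightarrow> nat" where r: "strict_mono r" "\<And>E e. compactly_in E \<Omega> \<Longrightarrow> e > 0 \<Longrightarrow> \<exists>N. \<forall>m\<ge>N. \<forall>n\<ge>N. \<forall>u. \<forall>y\<in>E.
       norm (f (cvec (u + x (r m)) y) - f (cvec (u + x (r n)) y)) \<le> e" using translates_subseq[of x] by blast
  obtain N where N: "\<And>m u y. m \<ge> N \<Longrightarrow> y \<in> E \<Longrightarrow> norm (f (cvec (u + x (r m)) y) - f (cvec (u + x (r N)) y)) \<le> e/3"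
    using r(2)[OF E, of "e/3"] e by fastforce
  have cE: "compact (closure E)" "closure E \<subseteq> \<Omega>" using E by (auto simp: compactly_in_def)
  let ?C = "cball (0::real^'p) 1 \<times> closure E"
  have "uniformly_continuous_on ?C (\<lambda>p. f (cvec (fst p + x (r N)) (snd p)))"
    by (intro compact_uniformly_continuous continuous_intros compact_Times cE) (use cE in auto)
  then obtain d where d: "d > 0" "\<And>p q. p \<in> ?C \<Longrightarrow> q \<in> ?C \<Longrightarrow> dist q p < d \<Longrightarrow>
      dist (f (cvec (fst q + x (r N)) (snd q))) (f (cvec (fst p + x (r N)) (snd p))) < e/3"
    unfolding uniformly_continuous_on_def using e by (metis divide_pos_pos zero_less_numeral)
  obtain M :: nat where M: "real M > 2 / d" using reals_Archimedean2 by blast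
  define m where "m = r (max M N)"
  have mM: "m \<ge> M" "m = r (max M N)" "max M N \<ge> N" using seq_suble[OF r(1), of "max M N"] by (auto simp: m_def)
  have sm: "1 / (real m + 1) < d / 2" "1 / (real m + 1) \<le> 1"
  proof -
    have "real m + 1 > 2 / d" using M mM(1) by linarith
    then show "1 / (real m + 1) < d / 2" using d(1) by (simp add: field_simps)
  qed simp
  have p: "(0, y m) \<in> ?C" "(x' m - x m, y' m) \<in> ?C"
    using xy(1,2)[of m] order_trans[OF xy(3)[of m] sm(2)] closure_subset[of E] by (auto simp: norm_minus_commute)
  have "dist (x' m - x m, y' m) (0, y m) \<le> norm (x' m - x m) + norm (y' m - y m)"
    by (simp add: dist_norm norm_Pair_le)
  also have "\<dots> < d" using xy(3,4)[of m] sm(1) by (simp add: norm_minus_commute)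
  finally have a: "dist (f (cvec (x' m - x m + x (r N)) (y' m))) (f (cvec (0 + x (r N)) (y m))) < e/3"
    using d(2)[OF p] by simp
  have b: "norm (f (cvec (0 + x m) (y m)) - f (cvec (0 + x (r N)) (y m))) \<le> e/3"
    using N[OF mM(3) xy(1)[of m], of 0] by (simp add: mM(2)[symmetric])
  have c: "norm (f (cvec ((x' m - x m) + x m) (y' m)) - f (cvec ((x' m - x m) + x (r N)) (y' m))) \<le> e/3"
    using N[OF mM(3) xy(2)[of m], of "x' m - x m"] by (simp add: mM(2)[symmetric])
  have "norm (f (cvec (x m) (y m)) - f (cvec (x' m) (y' m))) \<le> e/3 + e/3 + e/3"
  proof -
    have "f (cvec (x m) (y m)) - f (cvec (x' m) (y' m)) =
      (f (cvec (0 + x m) (y m)) - f (cvec (0 + x (r N)) (y m))) -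
      (f (cvec (x' m - x m + x (r N)) (y' m)) - f (cvec (0 + x (r N)) (y m))) -
      (f (cvec ((x' m - x m) + x m) (y' m)) - f (cvec ((x' m - x m) + x (r N)) (y' m)))" by simp
    also have "norm \<dots> \<le> e/3 + e/3 + e/3"
      by (intro order_trans[OF norm_triangle_ineq4] add_mono a[unfolded dist_norm, THEN less_imp_le] b c)
    finally show ?thesis .
  qed
  then show False using xy(5)[of m] by simp
qed

lemma finite_net:
  assumes E: "compactly_in E \<Omega>" and e: "e > 0"
  shows "\<exists>S. finite S \<and> (\<forall>t. \<exists>s\<in>S. \<forall>x. \<forall>y\<in>E. norm (f (cvec (x + t) y) - f (cvec (x + s) y)) \<le> e)"
proof -
  define D where "D t s = (if \<forall>x. \<forall>y\<in>E. norm (f (cvec (x + t) y) - f (cvec (x + s) y)) \<le> e then 0 else 1::real)" for t s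
  have "\<exists>S. finite S \<and> (\<forall>t. \<exists>s\<in>S. D t s \<le> 0)"
  proof (rule sequential_totally_bounded)
    fix t :: "nat \<Rightarrow> real^'p"
    obtain r :: "nat \<Rightarrow> nat" where r: "strict_mono r"
      "\<And>E e. compactly_in E \<Omega> \<Longrightarrow> e > 0 \<Longrightarrow> \<exists>N. \<forall>m\<ge>N. \<forall>n\<ge>N. \<forall>x. \<forall>y\<in>E.
       norm (f (cvec (x + t (r m)) y) - f (cvec (x + t (r n)) y)) \<le> e" using translates_subseq[of t] by blast
    show "\<exists>r::nat \<Rightarrow> nat. strict_mono r \<and> (\<exists>N. \<forall>m\<ge>N. \<forall>n\<ge>N. D (t (r m)) (t (r n)) \<le> 0)"
    proof (intro exI[of _ r] conjI r(1))
      obtain N where N: "\<forall>m\<ge>N. \<forall>n\<ge>N. \<forall>x. \<forall>y\<in>E. norm (f (cvec (x + t (r m)) y) - f (cvec (x + t (r n)) y)) \<le> e"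
        using r(2)[OF E e] by blast
      have "D (t (r m)) (t (r n)) \<le> 0" if "m \<ge> N" "n \<ge> N" for m n using N that by (simp add: D_def)
      then show "\<exists>N. \<forall>m\<ge>N. \<forall>n\<ge>N. D (t (r m)) (t (r n)) \<le> 0" by blast
    qed
  qed
  then show ?thesis by (auto simp: D_def split: if_splits)
qed

definition dn :: "(real^'p) set \<Rightarrow> real^'p \<Rightarrow> real" where
  "dn E t = (SUP p\<in>UNIV \<times> E. norm (f (cvec (fst p + t) (snd p)) - f (cvec (fst p) (snd p))))"

context
  fixes E assumes E: "compactly_in E \<Omega>" "E \<noteq> {}"
begin

lemma dn_upper: assumes "y \<in> E" shows "norm (f (cvec (x + t) y) - f (cvec x y)) \<le> dn E t"
proof -
  obtain B where B: "\<And>x y. y \<in> E \<Longrightarrow> norm (f (cvec x y)) \<le> B" using bounded_on_tube[OF E(1)] by blast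
  have "bdd_above ((\<lambda>p. norm (f (cvec (fst p + t) (snd p)) - f (cvec (fst p) (snd p)))) ` (UNIV \<times> E))"
    by (rule bdd_aboveI2[where M = "B + B"]) (rule order_trans[OF norm_triangle_ineq4 add_mono[OF B B]]; simp add: mem_Times_iff)
  from cSUP_upper[OF _ this, of "(x, y)"] show ?thesis using assms by (simp add: dn_def)
qed

lemma dn_least: assumes "\<And>x y. y \<in> E \<Longrightarrow> norm (f (cvec (x + t) y) - f (cvec x y)) \<le> e" shows "dn E t \<le> e"
  unfolding dn_def using E(2) assms by (intro cSUP_least) auto

lemma ap_norm_dn: "ap_norm (dn E)"
proof
  obtain y0 where y0: "y0 \<in> E" using E(2) by blast
  have nn: "dn E t \<ge> 0" for t using dn_upper[OF y0, of 0 t] norm_ge_zero order_trans by blast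
  have le0: "dn E 0 \<le> 0" by (rule dn_least) simp
  show "dn E 0 = 0" using le0 nn[of 0] by simp
  show "dn E (s + t) \<le> dn E s + dn E t" for s t
  proof (rule dn_least)
    fix x y assume y: "y \<in> E"
    have "norm ((f (cvec (x + s + t) y) - f (cvec (x + s) y)) + (f (cvec (x + s) y) - f (cvec x y))) \<le> dn E t + dn E s"
      by (intro order_trans[OF norm_triangle_ineq] add_mono dn_upper y)
    then show "norm (f (cvec (x + (s + t)) y) - f (cvec x y)) \<le> dn E s + dn E t" by (simp add: add_ac)
  qed
  have m: "dn E (- t) \<le> dn E t" for t
  proof (rule dn_least)
    fix x y assume "y \<in> E"
    then show "norm (f (cvec (x + - t) y) - f (cvec x y)) \<le> dn E t"
      using dn_upper[of y "x - t" t] by (simp add: norm_minus_commute)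
  qed
  show "dn E (- t) = dn E t" for t using m[of t] m[of "- t"] by simp
  show "\<exists>r>0. \<forall>t. norm t \<le> r \<longrightarrow> dn E t \<le> e" if "e > 0" for e
  proof -
    obtain d where d: "d > 0" "\<And>x x' y y'. y \<in> E \<Longrightarrow> y' \<in> E \<Longrightarrow> norm (x - x') \<le> d \<Longrightarrow> norm (y - y') \<le> d \<Longrightarrow>
       norm (f (cvec x y) - f (cvec x' y')) \<le> e" using uniformly_continuous_on_tube[OF E(1) \<open>e > 0\<close>] by blast
    have "dn E t \<le> e" if "norm t \<le> d" for t by (rule dn_least) (use d(1) that in \<open>auto intro!: d(2)\<close>)
    then show ?thesis using d(1) by blast
  qed
  show "\<exists>S. finite S \<and> (\<forall>t. \<exists>s\<in>S. dn E (t - s) \<le> e)" if "e > 0" for e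
  proof -
    obtain S where S: "finite S" "\<And>t. \<exists>s\<in>S. \<forall>x. \<forall>y\<in>E. norm (f (cvec (x + t) y) - f (cvec (x + s) y)) \<le> e"
      using finite_net[OF E(1) \<open>e > 0\<close>] by blast
    have "\<exists>s\<in>S. dn E (t - s) \<le> e" for t
    proof -
      obtain s where s: "s \<in> S" "\<And>x y. y \<in> E \<Longrightarrow> norm (f (cvec (x + t) y) - f (cvec (x + s) y)) \<le> e" using S(2) by blast
      have "dn E (t - s) \<le> e"
      proof (rule dn_least)
        fix x y assume "y \<in> E"
        then show "norm (f (cvec (x + (t - s)) y) - f (cvec x y)) \<le> e" using s(2)[of y "x - s"] by (simp add: algebra_simps)
      qed
      then show ?thesis using s(1) by blast
    qed
    then show ?thesis using S(1) by blast
  qed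
qed

end

lemma compactly_in_singleton: "y \<in> \<Omega> \<Longrightarrow> compactly_in {y} \<Omega>" by (simp add: compactly_in_def)

lemma ap_fun_slice: assumes "y \<in> \<Omega>" shows "ap_fun (\<lambda>x. f (cvec x y))"
  unfolding ap_fun_def
proof (intro conjI allI)
  show "continuous_on UNIV (\<lambda>x. f (cvec x y))" by (intro continuous_intros assms)
  fix t :: "nat \<Rightarrow> real^'p"
  obtain r :: "nat \<Rightarrow> nat" where r: "strict_mono r"
      "\<And>E e. compactly_in E \<Omega> \<Longrightarrow> e > 0 \<Longrightarrow> \<exists>N. \<forall>m\<ge>N. \<forall>n\<ge>N. \<forall>x. \<forall>y\<in>E.
       norm (f (cvec (x + t (r m)) y) - f (cvec (x + t (r n)) y)) \<le> e" using translates_subseq[of t] by blast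
  show "\<exists>r::nat \<Rightarrow> nat. strict_mono r \<and> (\<forall>e>0. \<exists>N. \<forall>m\<ge>N. \<forall>n\<ge>N. \<forall>x. norm (f (cvec (x + t (r m)) y) - f (cvec (x + t (r n)) y)) \<le> e)"
    using r(1) r(2)[OF compactly_in_singleton[OF assms]] by (intro exI[of _ r]) auto
qed

text \<open>This is exp(-i <z,l>) f(z) at z = x + iy, and \<open>coef l y\<close> is its mean in x:
  the Fourier coefficient of f at the frequency \<open>l\<close>.\<close>

definition tw :: "real^'p \<Rightarrow> real^'p \<Rightarrow> real^'p \<Rightarrow> complex" where
  "tw l x y = chr (- l) x * of_real (exp (l \<bullet> y)) * f (cvec x y)"

definition coef :: "real^'p \<Rightarrow> real^'p \<Rightarrow> complex" where
  "coef l y = Lim at_top (cube_mean (\<lambda>x. tw l x y))"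

lemma ap_fun_tw: assumes "y \<in> \<Omega>" shows "ap_fun (\<lambda>x. tw l x y)"
proof -
  have "ap_fun (\<lambda>x. chr (- l) x * of_real (exp (l \<bullet> y)))"
    using ap_fun_chr[of "- l"] unfolding ap_fun_def
  proof (elim conjE, intro conjI allI)
    assume c: "continuous_on UNIV (chr (- l))"
    then show "continuous_on UNIV (\<lambda>x. chr (- l) x * complex_of_real (exp (l \<bullet> y)))" by (intro continuous_intros)
    fix t :: "nat \<Rightarrow> real^'p"
    assume "\<forall>t. \<exists>r::nat \<Rightarrow> nat. strict_mono r \<and> (\<forall>e>0. \<exists>N. \<forall>m\<ge>N. \<forall>n\<ge>N. \<forall>x. norm (chr (- l) (x + t (r m)) - chr (- l) (x + t (r n))) \<le> e)"
    then obtain r :: "nat \<Rightarrow> nat" where r: "strict_mono r"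
      "\<And>e. e > 0 \<Longrightarrow> \<exists>N. \<forall>m\<ge>N. \<forall>n\<ge>N. \<forall>x. norm (chr (- l) (x + t (r m)) - chr (- l) (x + t (r n))) \<le> e" by meson
    show "\<exists>r::nat \<Rightarrow> nat. strict_mono r \<and> (\<forall>e>0. \<exists>N. \<forall>m\<ge>N. \<forall>n\<ge>N. \<forall>x.
       norm (chr (- l) (x + t (r m)) * complex_of_real (exp (l \<bullet> y)) - chr (- l) (x + t (r n)) * complex_of_real (exp (l \<bullet> y))) \<le> e)"
    proof (intro exI[of _ r] conjI r(1) allI impI)
      fix e :: real assume "e > 0"
      then have "e / exp (l \<bullet> y) > 0" by simp
      from r(2)[OF this] show "\<exists>N. \<forall>m\<ge>N. \<forall>n\<ge>N. \<forall>x.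
       norm (chr (- l) (x + t (r m)) * complex_of_real (exp (l \<bullet> y)) - chr (- l) (x + t (r n)) * complex_of_real (exp (l \<bullet> y))) \<le> e"
        by (simp add: left_diff_distrib[symmetric] norm_mult le_divide_eq)
    qed
  qed
  from ap_fun_mult[OF this ap_fun_slice[OF assms]] show ?thesis by (simp add: tw_def)
qed

lemma coef_lim: assumes "y \<in> \<Omega>" shows "(cube_mean (\<lambda>x. tw l x y) \<longlongrightarrow> coef l y) at_top"
proof -
  obtain m where "(cube_mean (\<lambda>x. tw l x y) \<longlongrightarrow> m) at_top" using ap_fun_mean_exists[OF ap_fun_tw[OF assms]] by blast
  then show ?thesis unfolding coef_def by (simp add: tendsto_Lim[OF trivial_limit_at_top_linorder])
qed

lemma line_holomorphic:
  "(\<lambda>w. f (cvec (x + Re w *\<^sub>R l) (y + Im w *\<^sub>R l))) holomorphic_on {w. y + Im w *\<^sub>R l \<in> \<Omega>}"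
proof -
  have "\<exists>f'. ((\<lambda>w. f (cvec (x + Re w *\<^sub>R l) (y + Im w *\<^sub>R l))) has_field_derivative f') (at w)"
    if w: "y + Im w *\<^sub>R l \<in> \<Omega>" for w
  proof -
    let ?g = "\<lambda>w. cvec (x + Re w *\<^sub>R l) (y + Im w *\<^sub>R l)"
    have g: "?g = (\<lambda>w. cvec x y + w *s rvec l)"
      by (auto simp: fun_eq_iff cvec_def rvec_def vec_eq_iff complex_eq_iff)
    have "?g w \<in> tube \<Omega>" using w by (simp add: cvec_in_tube)
    then obtain L where L: "(f has_derivative L) (at (?g w))" "\<And>h. L (\<i> *s h) = \<i> * L h"
      using ap by (auto simp: AP_def holo_on_def)
    have lin: "linear (\<lambda>w::complex. w *s rvec l)" by (rule linearI) (auto simp: vec_eq_iff algebra_simps)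
    have "(?g has_derivative (\<lambda>h. h *s rvec l)) (at w)"
      unfolding g by (auto intro!: derivative_eq_intros bounded_linear_imp_has_derivative linear_conv_bounded_linear[THEN iffD1] lin)
    then have "((\<lambda>w. f (?g w)) has_derivative (\<lambda>h. L (h *s rvec l))) (at w)"
      using has_derivative_compose L(1) by blast
    moreover have "L (h *s rvec l) = L (rvec l) * h" for h
    proof -
      interpret bl: bounded_linear L by (rule has_derivative_bounded_linear[OF L(1)])
      have "h *s rvec l = Re h *\<^sub>R rvec l + Im h *\<^sub>R (\<i> *s rvec l)"
        by (auto simp: vec_eq_iff complex_eq_iff rvec_def)
      then have "L (h *s rvec l) = Re h *\<^sub>R L (rvec l) + Im h *\<^sub>R (\<i> * L (rvec l))"
        by (simp add: bl.add bl.scaleR L(2))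
      also have "\<dots> = L (rvec l) * h" by (simp add: complex_eq_iff algebra_simps)
      finally show ?thesis .
    qed
    ultimately show ?thesis by (auto simp: has_field_derivative_def)
  qed
  then show ?thesis unfolding holomorphic_on_def field_differentiable_def
    using has_field_derivative_at_within by blast
qed

text \<open>Along a complex line joining the two heights the twisted function is holomorphic and
  bounded by some C. By \<open>rectangle_integral_bound\<close> its averages over segments of length
  2T at the two heights differ by at most C/T.\<close>

lemma coef_local:
  assumes "ball y0 r \<subseteq> \<Omega>" "compactly_in (ball y0 r) \<Omega>" "y \<in> ball y0 r" "y' \<in> ball y0 r"
  shows "coef l y = coef l y'"
proof -
  define h where "h = y' - y"
  define V where "V = {v. y + v *\<^sub>R h \<in> ball y0 r}"
  have yO: "y \<in> \<Omega>" "y' \<in> \<Omega>" using assms by auto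
  have oV: "open V"
  proof -
    have "continuous_on UNIV (\<lambda>v. y + v *\<^sub>R h)" by (intro continuous_intros)
    from open_vimage[OF open_ball this] show ?thesis by (simp only: V_def vimage_def)
  qed
  have cV: "convex V"
  proof (rule convexI)
    fix u v a b :: real assume *: "u \<in> V" "v \<in> V" "0 \<le> a" "0 \<le> b" "a + b = 1"
    have "a *\<^sub>R (y + u *\<^sub>R h) + b *\<^sub>R (y + v *\<^sub>R h) \<in> ball y0 r"
      using * by (intro convexD[OF convex_ball]) (auto simp only: V_def mem_Collect_eq)
    moreover have "a *\<^sub>R (y + u *\<^sub>R h) + b *\<^sub>R (y + v *\<^sub>R h) = y + (a *\<^sub>R u + b *\<^sub>R v) *\<^sub>R h"
    proof -
      have "a *\<^sub>R y + b *\<^sub>R y = y" using *(5) by (simp flip: scaleR_add_left)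
      then show ?thesis by (simp add: algebra_simps)
    qed
    ultimately show "a *\<^sub>R u + b *\<^sub>R v \<in> V" by (simp only: V_def mem_Collect_eq)
  qed
  have V01: "{0..1} \<subseteq> V"
  proof
    fix v :: real assume v: "v \<in> {0..1}"
    have "(1 - v) *\<^sub>R y + v *\<^sub>R y' \<in> ball y0 r" using convexD_alt[OF convex_ball assms(3,4), of v] v by auto
    then show "v \<in> V" by (simp add: V_def h_def algebra_simps)
  qed
  obtain B where B: "B > 0" "\<And>x y. y \<in> ball y0 r \<Longrightarrow> norm (f (cvec x y)) \<le> B" using bounded_on_tube[OF assms(2)] by blast
  define C where "C = exp (norm l * (norm y0 + r)) * B"
  have C: "norm (tw l x z) \<le> C" if "z \<in> ball y0 r" for x z
  proof -
    have "norm z \<le> norm y0 + r" using that norm_triangle_sub[of z y0] by (simp add: dist_norm norm_minus_commute)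
    then have "l \<bullet> z \<le> norm l * (norm y0 + r)"
      using norm_cauchy_schwarz[of l z] by (meson mult_left_mono norm_ge_zero order_trans)
    then show ?thesis unfolding tw_def C_def using B that by (auto simp: norm_mult chr_simps(1) intro!: mult_mono)
  qed
  have C0: "C \<ge> 0" using C[OF assms(3), of 0] norm_ge_zero order_trans by blast
  define u where "u x = tw l x y' - tw l x y" for x
  have lim: "(cube_mean u \<longlongrightarrow> coef l y' - coef l y) at_top"
  proof -
    have "cube_mean u = (\<lambda>s. cube_mean (\<lambda>x. tw l x y') s - cube_mean (\<lambda>x. tw l x y) s)"
      unfolding u_def by (rule ext) (intro cube_mean_diff ap_fun_continuous ap_fun_tw yO)
    then show ?thesis using tendsto_diff[OF coef_lim[OF yO(2)] coef_lim[OF yO(1)]] by simp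
  qed
  have cu: "continuous_on UNIV u" unfolding u_def by (intro continuous_intros ap_fun_continuous ap_fun_tw yO)
  have nu: "norm (u x) \<le> C + C" for x
    unfolding u_def by (intro order_trans[OF norm_triangle_ineq4] add_mono C assms)
  have est: "norm (coef l y' - coef l y) \<le> C / T" if T: "T > 0" for T
  proof -
    have "norm (integral {-T..T} (\<lambda>t. u (x + t *\<^sub>R h)) - (2 * T) *\<^sub>R 0) \<le> 2 * T * (C / T)" for x
    proof -
      \<comment> \<open>Written with \<open>cinner\<close>, the twist is an exponential of an affine
        function of w, which shows that \<open>G\<close> is holomorphic.\<close>
      define G where "G w = tw l (x + Re w *\<^sub>R h) (y + Im w *\<^sub>R h)" for w
      have G: "G w = exp (- \<i> * (cinner (cvec x y) l + w * of_real (h \<bullet> l))) * f (cvec (x + Re w *\<^sub>R h) (y + Im w *\<^sub>R h))" for w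
      proof -
        have "cinner (cvec (x + Re w *\<^sub>R h) (y + Im w *\<^sub>R h)) l = cinner (cvec x y) l + w * of_real (h \<bullet> l)"
          by (simp add: cinner_cvec inner_add_left complex_eq_iff)
        then show ?thesis unfolding G_def tw_def exp_cinner[symmetric] by simp
      qed
      have "G holomorphic_on {w. Im w \<in> V}"
        unfolding G by (intro holomorphic_intros holomorphic_on_subset[OF line_holomorphic]) (use assms(1) in \<open>auto simp: V_def\<close>)
      then have "norm (integral {-T..T} (\<lambda>u. G (Complex u 1) - G (Complex u 0)) + of_real (2 * T * 1 * 0)) \<le> (C + C) * 1"
      proof (rule rectangle_integral_bound[OF _ oV cV])
        fix v :: real assume "v \<in> {0..1}"
        then have "y + v *\<^sub>R h \<in> ball y0 r" using V01 by (auto simp: V_def)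
        then have "norm (G (Complex T v)) \<le> C" "norm (G (Complex (- T) v)) \<le> C" unfolding G_def by (auto intro: C)
        then show "norm (G (Complex T v) - G (Complex (- T) v) - 2 * \<i> * complex_of_real (T * 0)) \<le> C + C"
          using norm_triangle_ineq4[of "G (Complex T v)" "G (Complex (- T) v)"] by simp
      qed (use V01 T in auto)
      then show ?thesis using T by (simp add: G_def u_def h_def)
    qed
    from cube_mean_line_average[OF cu nu T lim this] show ?thesis by simp
  qed
  have "norm (coef l y' - coef l y) \<le> 0"
  proof (rule field_le_epsilon)
    fix e :: real assume e: "e > 0"
    have "C / ((C + 1) / e) \<le> e" using C0 e by (simp add: field_simps)
    then show "norm (coef l y' - coef l y) \<le> 0 + e" using est[of "(C + 1) / e"] C0 e by (simp add: add_nonneg_pos)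
  qed
  then show ?thesis by simp
qed

lemma compactly_in_ball: assumes "y \<in> \<Omega>" shows "\<exists>r>0. ball y r \<subseteq> \<Omega> \<and> compactly_in (ball y r) \<Omega>"
proof -
  obtain r where r: "r > 0" "cball y r \<subseteq> \<Omega>" using openO assms open_contains_cball by blast
  then have "ball y r \<subseteq> \<Omega>" "compactly_in (ball y r) \<Omega>" by (auto simp: compactly_in_def)
  then show ?thesis using r by blast
qed

lemma coef_const: assumes "y \<in> \<Omega>" "y' \<in> \<Omega>" shows "coef l y = coef l y'"
proof (rule connected_local_const[OF connO assms])
  show "\<forall>a\<in>\<Omega>. \<forall>\<^sub>F b in at a within \<Omega>. coef l a = coef l b"
  proof
    fix a assume "a \<in> \<Omega>"
    then obtain r where r: "r > 0" "ball a r \<subseteq> \<Omega>" "compactly_in (ball a r) \<Omega>" using compactly_in_ball by blast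
    have "\<forall>\<^sub>F b in at a within \<Omega>. b \<in> ball a r" using r(1) by (auto simp: eventually_at dist_commute intro!: exI[of _ r])
    then show "\<forall>\<^sub>F b in at a within \<Omega>. coef l a = coef l b"
      by (rule eventually_mono) (use r coef_local[OF r(2,3), of a] in auto)
  qed
qed

text \<open>The spectrum asks for a nonzero limit at some height; by \<open>coef_const\<close> every
  height gives the same answer, so one height can be fixed once and for all.\<close>

lemma spec_iff: assumes "y \<in> \<Omega>" shows "l \<in> spec \<Omega> f \<longleftrightarrow> coef l y \<noteq> 0"
proof -
  have eq: "(\<lambda>s. cube_mean (\<lambda>x. exp (- \<i> * cinner (cvec x y) l) * f (cvec x y)) s) = cube_mean (\<lambda>x. tw l x y)" for y
    by (simp only: exp_cinner tw_def[abs_def])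
  show ?thesis
  proof
    assume "l \<in> spec \<Omega> f"
    then have "\<exists>y\<in>\<Omega>. \<exists>a. a \<noteq> 0 \<and> (cube_mean (\<lambda>x. tw l x y) \<longlongrightarrow> a) at_top"
      unfolding spec_def eq mem_Collect_eq .
    then obtain y' a where *: "y' \<in> \<Omega>" "a \<noteq> 0" "(cube_mean (\<lambda>x. tw l x y') \<longlongrightarrow> a) at_top"
      by (elim bexE exE conjE)
    then have "coef l y' = a" using tendsto_unique[OF trivial_limit_at_top_linorder coef_lim[OF *(1)] *(3)] by simp
    then show "coef l y \<noteq> 0" using coef_const[OF assms \<open>y' \<in> \<Omega>\<close>] \<open>a \<noteq> 0\<close> by simp
  next
    assume "coef l y \<noteq> 0"
    then have "coef l y \<noteq> 0 \<and> (cube_mean (\<lambda>x. tw l x y) \<longlongrightarrow> coef l y) at_top" using coef_lim[OF assms] by simp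
    then have "\<exists>y\<in>\<Omega>. \<exists>a. a \<noteq> 0 \<and> (cube_mean (\<lambda>x. tw l x y) \<longlongrightarrow> a) at_top"
      using assms by (intro bexI[of _ y] exI[of _ "coef l y"])
    then show "l \<in> spec \<Omega> f" unfolding spec_def eq mem_Collect_eq .
  qed
qed

end

lemma generic_direction:
  fixes N :: "(real^'p) set"
  assumes "countable N" "0 \<notin> N"
  shows "\<exists>l. norm l = 1 \<and> (\<forall>\<nu>\<in>N. \<nu> \<bullet> l \<noteq> 0)"
proof -
  obtain b :: "real^'p" where b: "b \<in> Basis" using nonempty_Basis by blast
  \<comment> \<open>Adding a basis vector ensures that the point found is nonzero and can be
    normalized, even if \<open>N\<close> is empty.\<close>
  let ?N = "insert b N"
  have "negligible (\<Union>\<nu>\<in>?N. {x. \<nu> \<bullet> x = 0})"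
    by (rule negligible_countable_Union)
       (use assms b in \<open>auto intro!: negligible_hyperplane simp: nonzero_Basis\<close>)
  then have "(\<Union>\<nu>\<in>?N. {x. \<nu> \<bullet> x = 0}) \<noteq> UNIV" using non_negligible_UNIV by metis
  then obtain x where x: "\<And>\<nu>. \<nu> \<in> ?N \<Longrightarrow> \<nu> \<bullet> x \<noteq> 0" by blast
  then have x0: "x \<noteq> 0" by force
  show ?thesis by (rule exI[of _ "x /\<^sub>R norm x"]) (use x x0 in auto)
qed

lemma norm_integral_cis_le:
  assumes "\<theta> \<noteq> 0" "R > 0"
  shows "norm (integral {-R..R} (\<lambda>u. cis (\<theta> * u))) \<le> 2 / \<bar>\<theta>\<bar>"
proof -
  have "((\<lambda>u. cis (\<theta> * u)) has_integral cis (\<theta> * R) / (\<i> * of_real \<theta>) - cis (\<theta> * (- R)) / (\<i> * of_real \<theta>)) {-R..R}"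
  proof (rule fundamental_theorem_of_calculus)
    fix u
    have "((\<lambda>w. exp (\<i> * of_real \<theta> * w) / (\<i> * of_real \<theta>)) has_field_derivative exp (\<i> * of_real \<theta> * of_real u)) (at (of_real u))"
      using assms by (auto intro!: derivative_eq_intros)
    then have "((\<lambda>u. exp (\<i> * of_real \<theta> * of_real u) / (\<i> * of_real \<theta>)) has_vector_derivative exp (\<i> * of_real \<theta> * of_real u)) (at u within {-R..R})"
      using has_vector_derivative_real_field has_vector_derivative_at_within by blast
    then show "((\<lambda>u. cis (\<theta> * u) / (\<i> * of_real \<theta>)) has_vector_derivative cis (\<theta> * u)) (at u within {-R..R})"
      by (simp add: cis_conv_exp mult.assoc)
  qed (use assms in auto)
  then have "integral {-R..R} (\<lambda>u. cis (\<theta> * u)) = (cis (\<theta> * R) - cis (\<theta> * (- R))) / (\<i> * of_real \<theta>)"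
    by (simp add: integral_unique diff_divide_distrib)
  moreover have "norm (cis (\<theta> * R) - cis (\<theta> * (- R))) \<le> 2"
    using norm_triangle_ineq4[of "cis (\<theta> * R)" "cis (\<theta> * (- R))"] by simp
  ultimately show ?thesis by (simp add: norm_divide norm_mult divide_right_mono)
qed

lemma compactly_in_neighbourhood:
  fixes D :: "(real^'p) set"
  assumes "compactly_in D \<Omega>" "open \<Omega>"
  shows "\<exists>\<sigma>>0. compactly_in {y. \<exists>d\<in>D. dist d y < \<sigma>} \<Omega>"
proof -
  have cD: "compact (closure D)" "closure D \<subseteq> \<Omega>" using assms by (auto simp: compactly_in_def)
  obtain e where e: "e > 0" "(\<Union>x\<in>closure D. ball x e) \<subseteq> \<Omega>"
    using compact_subset_open_imp_ball_epsilon_subset[OF cD(1) assms(2) cD(2)] by blast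
  let ?U = "{y. \<exists>d\<in>D. dist d y < e/2}"
  obtain B where B: "\<And>d. d \<in> D \<Longrightarrow> norm d \<le> B" using assms(1) unfolding compactly_in_def bounded_iff by blast
  have "bounded ?U" unfolding bounded_iff
  proof (intro exI[of _ "B + e/2"] ballI)
    fix y assume "y \<in> ?U"
    then obtain d where d: "d \<in> D" "dist d y < e/2" by blast
    then show "norm y \<le> B + e/2" using B[OF d(1)] norm_triangle_sub[of y d] by (simp add: dist_norm norm_minus_commute)
  qed
  moreover have "closure ?U \<subseteq> \<Omega>"
  proof
    fix y assume "y \<in> closure ?U"
    then have "\<forall>e>0. \<exists>u\<in>?U. dist u y < e" by (simp only: closure_approachable)
    then obtain u where u: "u \<in> ?U" "dist u y < e/2" using half_gt_zero[OF e(1)] by blast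
    then obtain d where d: "d \<in> D" "dist d u < e/2" by blast
    have "dist d y < e" using dist_triangle[of d y u] u(2) d(2) by linarith
    then show "y \<in> \<Omega>" using e(2) d(1) closure_subset[of D] by (meson UN_I mem_ball subsetD)
  qed
  ultimately show ?thesis using e(1) by (intro exI[of _ "e/2"]) (simp add: compactly_in_def)
qed

context ap_tube begin

text \<open>The exponential exp(i <z,l>) at z = x + iy.\<close>

definition em :: "real^'p \<Rightarrow> real^'p \<Rightarrow> real^'p \<Rightarrow> complex" where
  "em l x y = chr l x * of_real (exp (- (l \<bullet> y)))"

text \<open>Averaging the translates of f against a character isolates one term of the Fourier
  series, exponential included. Applied to each term of the kernel, it turns the convolution into an
  exponential polynomial.\<close>

lemma mean_against_chr:
  assumes "y \<in> \<Omega>"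
  shows "(cube_mean (\<lambda>t. f (cvec (x + t) y) * chr (- l) t) \<longlongrightarrow> em l x y * coef l y) at_top"
proof -
  have eq: "f (cvec (x + t) y) * chr (- l) t = em l x y * tw l (t + x) y" for t
  proof -
    have "exp (- (l \<bullet> y)) * exp (l \<bullet> y) = 1" by (simp flip: exp_add)
    then have "complex_of_real (exp (- (l \<bullet> y))) * complex_of_real (exp (l \<bullet> y)) = 1" by (simp only: of_real_mult[symmetric] of_real_1)
    moreover have "chr l x * chr (- l) x = 1" by (simp add: chr_simps)
    moreover have "em l x y * tw l (t + x) y = (chr l x * chr (- l) x) * (complex_of_real (exp (- (l \<bullet> y))) * complex_of_real (exp (l \<bullet> y))) * (f (cvec (x + t) y) * chr (- l) t)"
      by (simp add: em_def tw_def chr_simps(2) add.commute)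
    ultimately show ?thesis by simp
  qed
  note c = ap_fun_continuous[OF ap_fun_tw[OF assms, of l]]
  obtain B where B: "\<And>t. norm (tw l t y) \<le> B" using ap_fun_bounded[OF ap_fun_tw[OF assms]] by blast
  have "((\<lambda>s. cube_mean (\<lambda>t. tw l t y) s + (cube_mean (\<lambda>t. tw l (t + x) y) s - cube_mean (\<lambda>t. tw l t y) s)) \<longlongrightarrow> coef l y + 0) at_top"
    by (intro tendsto_add coef_lim[OF assms] cube_mean_shift[OF c B])
  then have "((\<lambda>s. em l x y * cube_mean (\<lambda>t. tw l (t + x) y) s) \<longlongrightarrow> em l x y * coef l y) at_top"
    by (intro tendsto_mult tendsto_const) simp
  moreover have "cube_mean (\<lambda>t. em l x y * tw l (t + x) y) = (\<lambda>s. em l x y * cube_mean (\<lambda>t. tw l (t + x) y) s)"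
    by (rule ext) (rule cube_mean_cmult[OF continuous_shift[OF c]])
  ultimately show ?thesis unfolding eq by (simp only:)
qed

text \<open>Convolving \<open>f\<close> with the normalized kernel moves it little, since the kernel lives on almost periods,
  and replaces it by a finite combination of those exponentials that have nonzero coefficients.\<close>

theorem exponential_polynomial_approximation:
  assumes E: "compactly_in E \<Omega>" and e: "e > 0"
  shows "\<exists>\<Lambda> b. finite \<Lambda> \<and> \<Lambda> \<subseteq> spec \<Omega> f \<and> (\<forall>x. \<forall>y\<in>E. norm (f (cvec x y) - (\<Sum>l\<in>\<Lambda>. b l * em l x y)) \<le> e)"
proof (cases "E = {}")
  case True then show ?thesis by (intro exI[of _ "{}"]) auto
next
  case ne: False
  then obtain y0 where y0: "y0 \<in> E" by blast
  have EO: "y \<in> \<Omega>" if "y \<in> E" for y using E closure_subset[of E] that by (auto simp: compactly_in_def)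
  interpret d: ap_norm "dn E" by (rule ap_norm_dn[OF E ne])
  obtain B where B: "B > 0" "\<And>x y. y \<in> E \<Longrightarrow> norm (f (cvec x y)) \<le> B" using bounded_on_tube[OF E] by blast
  \<comment> \<open>The kernel is negligible where \<open>dn E t > 5 * \<epsilon>\<close>; all other
    shifts change f by at most 5 \<open>\<epsilon>\<close> = e/2.\<close>
  define \<epsilon> where "\<epsilon> = e / 10"
  have \<epsilon>: "\<epsilon> > 0" using e by (simp add: \<epsilon>_def)
  obtain m where m: "m > 0" "\<And>\<eta>. \<eta> > 0 \<Longrightarrow> \<exists>(n::nat) c L. (\<forall>i<n. 0 \<le> c i) \<and> 0 < n \<and> L 0 = 0 \<and> c 0 \<ge> m \<and>
     (\<forall>t. norm (\<Sum>i<n. of_real (c i) * chr (L i) t) \<le> Re (\<Sum>i<n. of_real (c i) * chr (L i) t) + 2 * \<eta> \<and>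
       (dn E t > 5 * \<epsilon> \<longrightarrow> norm (\<Sum>i<n. of_real (c i) * chr (L i) t) \<le> \<eta>))"
    using d.kernel_exists[OF \<epsilon>] by blast
  \<comment> \<open>Chosen after \<open>m\<close>, so that all error terms containing
    \<open>\<eta>\<close> add up to m e/2, at most half of e times the mean of the kernel.\<close>
  define \<eta> where "\<eta> = m * e / (2 * (10 * \<epsilon> + 2 * B))"
  have \<eta>: "\<eta> > 0" using m e \<epsilon> B by (simp add: \<eta>_def add_pos_pos)
  obtain n :: nat and c L where K: "\<And>i. i < n \<Longrightarrow> 0 \<le> c i" "0 < n" "L 0 = 0" "c 0 \<ge> m"
     "\<And>t. norm (\<Sum>i<n. of_real (c i) * chr (L i) t) \<le> Re (\<Sum>i<n. of_real (c i) * chr (L i) t) + 2 * \<eta>"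
     "\<And>t. dn E t > 5 * \<epsilon> \<Longrightarrow> norm (\<Sum>i<n. of_real (c i) * chr (L i) t) \<le> \<eta>"
    using m(2)[OF \<eta>] by (elim exE conjE) blast
  \<comment> \<open>The conjugate kernel: against f(x + t) its terms pick out the frequencies
    \<open>L i\<close> themselves rather than their negatives.\<close>
  define Kb where "Kb t = (\<Sum>i<n. of_real (c i) * chr (- L i) t)" for t
  have Kc: "Kb t = cnj (\<Sum>i<n. of_real (c i) * chr (L i) t)" for t
    by (simp add: Kb_def chr_def cis_cnj)
  have K5: "norm (Kb t) \<le> Re (Kb t) + 2 * \<eta>" for t using K(5)[of t] by (simp only: Kc complex_mod_cnj complex_cnj)  simp
  have K6: "dn E t > 5 * \<epsilon> \<Longrightarrow> norm (Kb t) \<le> \<eta>" for t using K(6)[of t] by (simp only: Kc complex_mod_cnj)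
  \<comment> \<open>The mean of the kernel. Several \<open>L i\<close> may vanish, so all of them
    are collected; the index 0 alone already contributes at least \<open>m\<close>.\<close>
  define \<kappa> where "\<kappa> = (\<Sum>i<n. if L i = 0 then c i else 0)"
  have \<kappa>m: "\<kappa> \<ge> m"
  proof -
    have "(\<Sum>i\<in>{0}. if L i = 0 then c i else 0) \<le> \<kappa>" unfolding \<kappa>_def by (rule sum_mono2) (use K in auto)
    then show ?thesis using K by simp
  qed
  then have \<kappa>0: "\<kappa> > 0" using m by simp
  have cchr: "continuous_on UNIV (chr l)" for l :: "real^'p" using ap_fun_chr ap_fun_continuous by blast
  have cK: "continuous_on UNIV Kb" unfolding Kb_def by (intro continuous_intros)
  have Klim: "(cube_mean Kb \<longlongrightarrow> of_real \<kappa>) at_top"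
  proof -
    have "cube_mean Kb = (\<lambda>s. \<Sum>i<n. of_real (c i) * cube_mean (chr (- L i)) s)"
      unfolding Kb_def[abs_def]
      by (rule ext, subst cube_mean_sum) (auto intro!: continuous_intros cchr simp: cube_mean_cmult[OF cchr])
    moreover have "((\<lambda>s. \<Sum>i<n. of_real (c i) * cube_mean (chr (- L i)) s) \<longlongrightarrow> (\<Sum>i<n. of_real (c i) * (if - L i = 0 then 1 else 0))) at_top"
      by (intro tendsto_sum tendsto_mult tendsto_const cube_mean_chr)
    moreover have "(\<Sum>i<n. of_real (c i) * (if - L i = 0 then 1 else 0)) = complex_of_real \<kappa>"
      unfolding \<kappa>_def of_real_sum by (rule sum.cong) auto
    ultimately show ?thesis by (simp only:)
  qed
  define a where "a l = coef l y0" for l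
  have a: "coef l y = a l" if "y \<in> E" for l y unfolding a_def using that y0 EO coef_const by blast
  have main: "norm (f (cvec x y) - (\<Sum>i<n. of_real (c i) / of_real \<kappa> * a (L i) * em (L i) x y)) \<le> e" if y: "y \<in> E" for x y
  proof -
    define u where "u t = (f (cvec x y) - f (cvec (x + t) y)) * Kb t" for t
    \<comment> \<open>A continuous majorant of |u| whose mean is computable. Its first part covers
      the almost periods, its second the region where the kernel is below \<open>\<eta>\<close>; as
      both parts are nonnegative, the sum works without splitting the domain.\<close>
    define v where "v t = 5 * \<epsilon> * (Re (Kb t) + 2 * \<eta>) + 2 * B * \<eta>" for t
    have cf: "continuous_on UNIV (\<lambda>t. f (cvec (x + t) y))" by (intro continuous_intros) (use y EO in auto)
    have cu: "continuous_on UNIV u" unfolding u_def by (intro continuous_intros cf cK)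
    have cv: "continuous_on UNIV v" unfolding v_def by (intro continuous_intros cK)
    have uv: "norm (u t) \<le> v t" for t
    proof -
      have nn: "0 \<le> 5 * \<epsilon> * (Re (Kb t) + 2 * \<eta>)" using K5[of t] norm_ge_zero[of "Kb t"] \<epsilon> by (intro mult_nonneg_nonneg) linarith+
      show ?thesis
      proof (cases "dn E t > 5 * \<epsilon>")
        case True
        have "norm (f (cvec x y) - f (cvec (x + t) y)) \<le> B + B"
          by (intro order_trans[OF norm_triangle_ineq4] add_mono B y)
        then have "norm (u t) \<le> (2 * B) * \<eta>"
          unfolding u_def norm_mult using K6[OF True] B by (intro mult_mono) auto
        then show ?thesis using nn by (simp add: v_def)
      next
        case False
        have "norm (f (cvec x y) - f (cvec (x + t) y)) \<le> 5 * \<epsilon>"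
          using dn_upper[OF E ne y, of x t] False by (simp add: norm_minus_commute)
        then have "norm (u t) \<le> (5 * \<epsilon>) * (Re (Kb t) + 2 * \<eta>)"
          unfolding u_def norm_mult using K5[of t] \<epsilon> by (intro mult_mono) auto
        moreover have "0 \<le> 2 * B * \<eta>" using B \<eta> by simp
        ultimately show ?thesis unfolding v_def by linarith
      qed
    qed
    have ulim: "(cube_mean u \<longlongrightarrow> f (cvec x y) * of_real \<kappa> - (\<Sum>i<n. of_real (c i) * (em (L i) x y * coef (L i) y))) at_top"
    proof -
      have "cube_mean u = (\<lambda>s. f (cvec x y) * cube_mean Kb s - (\<Sum>i<n. of_real (c i) * cube_mean (\<lambda>t. f (cvec (x + t) y) * chr (- L i) t) s))"
      proof (rule ext)
        fix s
        have "u = (\<lambda>t. f (cvec x y) * Kb t - (\<Sum>i<n. of_real (c i) * (f (cvec (x + t) y) * chr (- L i) t)))"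
          by (rule ext) (simp add: u_def Kb_def sum_distrib_left flip: sum_subtractf, rule sum.cong[OF refl], simp add: algebra_simps)
        then have "cube_mean u s = cube_mean (\<lambda>t. f (cvec x y) * Kb t) s - cube_mean (\<lambda>t. \<Sum>i<n. of_real (c i) * (f (cvec (x + t) y) * chr (- L i) t)) s"
          by (simp only:) (intro cube_mean_diff continuous_intros cK cf)
        also have "cube_mean (\<lambda>t. \<Sum>i<n. of_real (c i) * (f (cvec (x + t) y) * chr (- L i) t)) s = (\<Sum>i<n. cube_mean (\<lambda>t. of_real (c i) * (f (cvec (x + t) y) * chr (- L i) t)) s)"
          by (intro cube_mean_sum) (auto intro!: continuous_intros cf)
        also have "\<dots> = (\<Sum>i<n. of_real (c i) * cube_mean (\<lambda>t. f (cvec (x + t) y) * chr (- L i) t) s)"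
          by (intro sum.cong refl cube_mean_cmult continuous_intros cf)
        finally show "cube_mean u s = f (cvec x y) * cube_mean Kb s - (\<Sum>i<n. of_real (c i) * cube_mean (\<lambda>t. f (cvec (x + t) y) * chr (- L i) t) s)"
          by (simp add: cube_mean_cmult[OF cK])
      qed
      moreover have "((\<lambda>s. f (cvec x y) * cube_mean Kb s - (\<Sum>i<n. of_real (c i) * cube_mean (\<lambda>t. f (cvec (x + t) y) * chr (- L i) t) s)) \<longlongrightarrow>
          f (cvec x y) * of_real \<kappa> - (\<Sum>i<n. of_real (c i) * (em (L i) x y * coef (L i) y))) at_top"
        by (intro tendsto_diff tendsto_sum tendsto_mult tendsto_const Klim mean_against_chr EO y)
      ultimately show ?thesis by (simp only:)
    qed
    have vlim: "(cube_mean v \<longlongrightarrow> 5 * \<epsilon> * (\<kappa> + 2 * \<eta>) + 2 * B * \<eta>) at_top"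
    proof -
      have ev: "\<forall>\<^sub>F s in at_top. 5 * \<epsilon> * (Re (cube_mean Kb s) + 2 * \<eta>) + 2 * B * \<eta> = cube_mean v s"
        using eventually_gt_at_top[of 0]
      proof eventually_elim
        case (elim s)
        have cr: "continuous_on UNIV (\<lambda>t. (5 * \<epsilon>) * Re (Kb t))" by (intro continuous_intros cK)
        have "cube_mean v s = cube_mean (\<lambda>t. (5 * \<epsilon>) * Re (Kb t) + (5 * \<epsilon> * (2 * \<eta>) + 2 * B * \<eta>)) s"
          by (rule arg_cong[of _ _ "\<lambda>w. cube_mean w s"]) (simp add: v_def[abs_def] algebra_simps)
        also have "\<dots> = cube_mean (\<lambda>t. (5 * \<epsilon>) * Re (Kb t)) s + (5 * \<epsilon> * (2 * \<eta>) + 2 * B * \<eta>)"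
          using elim by (simp add: cube_mean_add[OF cr continuous_on_const] cube_mean_const)
        also have "cube_mean (\<lambda>t. (5 * \<epsilon>) * Re (Kb t)) s = (5 * \<epsilon>) * Re (cube_mean Kb s)"
          by (rule cube_mean_linear[OF cK]) (intro bounded_linear_const_mult bounded_linear_Re)
        finally show ?case by (simp add: algebra_simps)
      qed
      have "((\<lambda>s. 5 * \<epsilon> * (Re (cube_mean Kb s) + 2 * \<eta>) + 2 * B * \<eta>) \<longlongrightarrow> 5 * \<epsilon> * (Re (of_real \<kappa>) + 2 * \<eta>) + 2 * B * \<eta>) at_top"
        by (intro tendsto_add tendsto_mult tendsto_const tendsto_Re Klim)
      then show ?thesis using tendsto_cong[OF ev] by simp
    qed
    have "\<forall>\<^sub>F s in at_top. norm (cube_mean u s) \<le> cube_mean v s"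
      using eventually_gt_at_top[of 0] by eventually_elim (intro cube_mean_mono_norm cu cv uv)
    then have "norm (f (cvec x y) * of_real \<kappa> - (\<Sum>i<n. of_real (c i) * (em (L i) x y * coef (L i) y))) \<le> 5 * \<epsilon> * (\<kappa> + 2 * \<eta>) + 2 * B * \<eta>"
      by (rule tendsto_le[OF trivial_limit_at_top_linorder vlim tendsto_norm[OF ulim]])
    moreover have "f (cvec x y) * of_real \<kappa> - (\<Sum>i<n. of_real (c i) * (em (L i) x y * coef (L i) y)) =
       of_real \<kappa> * (f (cvec x y) - (\<Sum>i<n. of_real (c i) / of_real \<kappa> * a (L i) * em (L i) x y))"
      using \<kappa>0 by (simp add: a[OF y] right_diff_distrib sum_distrib_left mult_ac)
    ultimately have le: "\<kappa> * norm (f (cvec x y) - (\<Sum>i<n. of_real (c i) / of_real \<kappa> * a (L i) * em (L i) x y)) \<le> 5 * \<epsilon> * (\<kappa> + 2 * \<eta>) + 2 * B * \<eta>"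
      using \<kappa>0 by (simp add: norm_mult)
    have "5 * \<epsilon> * (\<kappa> + 2 * \<eta>) + 2 * B * \<eta> = 5 * \<epsilon> * \<kappa> + \<eta> * (10 * \<epsilon> + 2 * B)" by (simp add: algebra_simps)
    also have "\<eta> * (10 * \<epsilon> + 2 * B) = m * e / 2" using \<epsilon> B by (simp add: \<eta>_def field_simps add_pos_pos)
    also have "5 * \<epsilon> * \<kappa> + m * e / 2 \<le> \<kappa> * e"
    proof -
      have "m * e \<le> \<kappa> * e" using \<kappa>m e by (intro mult_right_mono) auto
      moreover have "5 * \<epsilon> * \<kappa> = \<kappa> * e / 2" by (simp add: \<epsilon>_def)
      ultimately show ?thesis by linarith
    qed
    finally have "\<kappa> * norm (f (cvec x y) - (\<Sum>i<n. of_real (c i) / of_real \<kappa> * a (L i) * em (L i) x y)) \<le> \<kappa> * e" using le by linarith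
    then show ?thesis using \<kappa>0 by simp
  qed
  \<comment> \<open>Frequencies with coefficient zero drop out here, which puts the rest inside the
    spectrum. Coinciding \<open>L i\<close> are merged in \<open>b\<close>.\<close>
  define \<Lambda> where "\<Lambda> = L ` {..<n} \<inter> spec \<Omega> f"
  define b where "b l = (\<Sum>i\<in>{i \<in> {..<n}. L i = l}. of_real (c i) / of_real \<kappa>) * a l" for l
  have "(\<Sum>i<n. of_real (c i) / of_real \<kappa> * a (L i) * em (L i) x y) = (\<Sum>l\<in>\<Lambda>. b l * em l x y)" for x y
  proof -
    have "(\<Sum>i<n. of_real (c i) / of_real \<kappa> * a (L i) * em (L i) x y) =
       (\<Sum>l\<in>L ` {..<n}. \<Sum>i\<in>{i \<in> {..<n}. L i = l}. of_real (c i) / of_real \<kappa> * a (L i) * em (L i) x y)"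
      by (rule sum.image_gen) simp
    also have "\<dots> = (\<Sum>l\<in>L ` {..<n}. b l * em l x y)"
      by (rule sum.cong[OF refl]) (auto simp: b_def sum_distrib_right intro!: sum.cong)
    also have "\<dots> = (\<Sum>l\<in>\<Lambda>. b l * em l x y)"
      by (rule sum.mono_neutral_right) (use spec_iff[OF EO[OF y0]] in \<open>auto simp: \<Lambda>_def b_def a_def\<close>)
    finally show ?thesis .
  qed
  then have "\<forall>x. \<forall>y\<in>E. norm (f (cvec x y) - (\<Sum>l\<in>\<Lambda>. b l * em l x y)) \<le> e" using main by simp
  moreover have "finite \<Lambda>" "\<Lambda> \<subseteq> spec \<Omega> f" by (auto simp: \<Lambda>_def)
  ultimately show ?thesis by blast
qed

end

subsection \<open>Lower bounds on lines and columns\<close>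

lemma Montel_bounded:
  fixes \<phi> :: "nat \<Rightarrow> complex \<Rightarrow> complex"
  assumes "open S" "\<And>n. \<phi> n holomorphic_on S" "\<forall>n. \<forall>w\<in>S. norm (\<phi> n w) \<le> B"
  shows "\<exists>g q. g holomorphic_on S \<and> strict_mono (q :: nat \<Rightarrow> nat) \<and> (\<forall>w\<in>S. (\<lambda>n. \<phi> (q n) w) \<longlonglongrightarrow> g w) \<and>
    (\<forall>K. compact K \<longrightarrow> K \<subseteq> S \<longrightarrow> uniform_limit K (\<phi> \<circ> q) g sequentially)"
proof (rule Montel[OF assms(1), of "range \<phi>" \<phi>])
  show "\<And>h. h \<in> range \<phi> \<Longrightarrow> h holomorphic_on S" using assms(2) by auto
  show "\<exists>B. \<forall>h\<in>range \<phi>. \<forall>z\<in>K. norm (h z) \<le> B" if "compact K" "K \<subseteq> S" for K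
    using assms(3) that(2) by (intro exI[of _ B]) auto
  show "range \<phi> \<subseteq> range \<phi>" by simp
  fix g and q :: "nat \<Rightarrow> nat"
  assume "g holomorphic_on S" "strict_mono q" "\<And>x. x \<in> S \<Longrightarrow> (\<lambda>n. \<phi> (q n) x) \<longlonglongrightarrow> g x"
    "\<And>K. compact K \<Longrightarrow> K \<subseteq> S \<Longrightarrow> uniform_limit K (\<phi> \<circ> q) g sequentially"
  then show ?thesis by (intro exI[of _ g] exI[of _ q] conjI ballI allI impI)
qed

context ap_tube begin

text \<open>After division by one exponential of \<open>sp f\<close> the approximating polynomial has a nonzero constant term and
  finitely many further frequencies \<open>\<nu> \<in> N\<close>; their averages over \<open>[-R, R]\<close> in direction \<open>h\<close> are
  small as soon as all \<open>\<bar>\<nu> \<bullet> h\<bar>\<close> are bounded below.\<close>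

lemma window_lower_bound:
  assumes E: "compactly_in E \<Omega>" and nz: "\<exists>z\<in>tube \<Omega>. f z \<noteq> 0"
  shows "\<exists>N k. finite N \<and> 0 \<notin> N \<and> k > 0 \<and> (\<forall>\<kappa>>0. \<exists>R>0. \<forall>h x. \<forall>y\<in>E. (\<forall>\<nu>\<in>N. \<kappa> \<le> \<bar>\<nu> \<bullet> h\<bar>) \<longrightarrow>
     (\<exists>u\<in>{-R..R}. k \<le> norm (f (cvec (x + u *\<^sub>R h) y))))"
proof (cases "E = {}")
  case True
  then show ?thesis by (intro exI[of _ "{}"] exI[of _ 1]) (auto intro!: exI[of _ 1])
next
  case ne: False
  then obtain yE where yE: "yE \<in> E" by blast
  have EO: "y \<in> \<Omega>" if "y \<in> E" for y using E closure_subset[of E] that by (auto simp: compactly_in_def)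
  obtain x0 y0 where xy0: "y0 \<in> \<Omega>" "f (cvec x0 y0) \<noteq> 0" using nz by (metis tube_cases)
  \<comment> \<open>An approximation at one point to within half of the value there cannot be the
    empty sum, so the spectrum is nonempty.\<close>
  have e0: "norm (f (cvec x0 y0)) / 2 > 0" using xy0 by simp
  obtain \<Lambda>0 b' where L0: "\<Lambda>0 \<subseteq> spec \<Omega> f" "norm (f (cvec x0 y0) - (\<Sum>l\<in>\<Lambda>0. b' l * em l x0 y0)) \<le> norm (f (cvec x0 y0)) / 2"
    using exponential_polynomial_approximation[OF compactly_in_singleton[OF xy0(1)] e0] by (metis singletonI)
  have "\<Lambda>0 \<noteq> {}" using L0(2) e0 by auto
  then obtain \<mu>0 where l0: "\<mu>0 \<in> spec \<Omega> f" using L0 by blast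
  define a0 where "a0 = coef \<mu>0 yE"
  have a0: "a0 \<noteq> 0" using l0 spec_iff[OF EO[OF yE]] by (simp add: a0_def)
  obtain Y where Y: "\<And>y. y \<in> E \<Longrightarrow> norm y \<le> Y" using E unfolding compactly_in_def bounded_iff by blast
  have ex: "exp (l \<bullet> y) \<le> exp (norm l * Y)" if "y \<in> E" for l y
    using norm_cauchy_schwarz[of l y] mult_left_mono[OF Y[OF that] norm_ge_zero[of l]] by simp
  define C1 where "C1 = exp (norm \<mu>0 * Y)"
  have C1: "C1 > 0" by (simp add: C1_def)
  \<comment> \<open>Multiplication by the exponential removing the frequency \<open>\<mu>0\<close>
    enlarges norms by at most \<open>C1\<close>; an error or value of size \<open>k\<close> then
    becomes at most \<open>norm a0 / 8\<close>.\<close>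
  define k where "k = norm a0 / (8 * C1)"
  have k: "k > 0" using a0 C1 by (simp add: k_def)
  obtain \<Lambda> b where L: "finite \<Lambda>" "\<And>x y. y \<in> E \<Longrightarrow> norm (f (cvec x y) - (\<Sum>l\<in>\<Lambda>. b l * em l x y)) \<le> k"
    using exponential_polynomial_approximation[OF E k] by blast
  \<comment> \<open>The constant term after division. It might be 0 by this definition, but
    \<open>ab\<close> shows by comparing means at the height \<open>yE\<close> that it is within
    |a0|/8 of the nonzero coefficient \<open>a0\<close>.\<close>
  define b0 where "b0 = (if \<mu>0 \<in> \<Lambda> then b \<mu>0 else 0)"
  define \<Lambda>' where "\<Lambda>' = \<Lambda> - {\<mu>0}"
  have fin': "finite \<Lambda>'" using L(1) by (simp add: \<Lambda>'_def)
  define g where "g l y = b l * of_real (exp ((\<mu>0 - l) \<bullet> y))" for l y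
  define q where "q x y = b0 + (\<Sum>l\<in>\<Lambda>'. g l y * chr (l - \<mu>0) x)" for x y
  have q: "chr (- \<mu>0) x * of_real (exp (\<mu>0 \<bullet> y)) * (\<Sum>l\<in>\<Lambda>. b l * em l x y) = q x y" for x y
  proof -
    have t: "chr (- \<mu>0) x * of_real (exp (\<mu>0 \<bullet> y)) * (b l * em l x y) = g l y * chr (l - \<mu>0) x" for l
    proof -
      have "chr (l - \<mu>0) x = chr l x * chr (- \<mu>0) x" using chr_simps(7)[of l "- \<mu>0" x] by simp
      moreover have "exp ((\<mu>0 - l) \<bullet> y) = exp (\<mu>0 \<bullet> y) * exp (- (l \<bullet> y))" by (simp add: inner_diff_left flip: exp_add)
      ultimately show ?thesis by (simp add: g_def em_def)
    qed
    have "chr (- \<mu>0) x * of_real (exp (\<mu>0 \<bullet> y)) * (\<Sum>l\<in>\<Lambda>. b l * em l x y) = (\<Sum>l\<in>\<Lambda>. g l y * chr (l - \<mu>0) x)"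
      unfolding sum_distrib_left by (rule sum.cong[OF refl t])
    also have "\<dots> = q x y"
    proof (cases "\<mu>0 \<in> \<Lambda>")
      case True
      then show ?thesis unfolding q_def \<Lambda>'_def
        by (subst sum.remove[OF L(1) True]) (simp add: b0_def g_def chr_simps(3))
    qed (simp add: q_def \<Lambda>'_def b0_def)
    finally show ?thesis .
  qed
  have twq: "norm (tw \<mu>0 x y - q x y) \<le> C1 * k" if "y \<in> E" for x y
  proof -
    have "tw \<mu>0 x y - q x y = chr (- \<mu>0) x * of_real (exp (\<mu>0 \<bullet> y)) * (f (cvec x y) - (\<Sum>l\<in>\<Lambda>. b l * em l x y))"
      unfolding q[symmetric] tw_def by (simp add: algebra_simps)
    also have "norm \<dots> \<le> C1 * k"
      unfolding norm_mult using ex[OF that, of \<mu>0] L(2)[OF that, of x] C1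
      by (intro mult_mono) (auto simp: chr_simps(1) C1_def)
    finally show ?thesis .
  qed
  have C1k: "C1 * k = norm a0 / 8" using C1 by (simp add: k_def)
  have cq: "continuous_on UNIV (\<lambda>x. q x y)" for y unfolding q_def by (intro continuous_intros)
  have cchr: "continuous_on UNIV (chr l)" for l :: "real^'p" using ap_fun_chr ap_fun_continuous by blast
  have ab: "norm (a0 - b0) \<le> norm a0 / 8"
  proof -
    note ct = ap_fun_continuous[OF ap_fun_tw[OF EO[OF yE], of \<mu>0]]
    have "((\<lambda>s. b0 + (\<Sum>l\<in>\<Lambda>'. g l yE * cube_mean (chr (l - \<mu>0)) s)) \<longlongrightarrow> b0 + (\<Sum>l\<in>\<Lambda>'. g l yE * (if l - \<mu>0 = 0 then 1 else 0))) at_top"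
      by (intro tendsto_add tendsto_const tendsto_sum tendsto_mult cube_mean_chr)
    moreover have "(\<Sum>l\<in>\<Lambda>'. g l yE * (if l - \<mu>0 = 0 then 1 else 0)) = 0" by (rule sum.neutral) (auto simp: \<Lambda>'_def)
    ultimately have l1: "((\<lambda>s. b0 + (\<Sum>l\<in>\<Lambda>'. g l yE * cube_mean (chr (l - \<mu>0)) s)) \<longlongrightarrow> b0) at_top" by simp
    have "\<forall>\<^sub>F s in at_top. norm (cube_mean (\<lambda>x. tw \<mu>0 x yE) s - (b0 + (\<Sum>l\<in>\<Lambda>'. g l yE * cube_mean (chr (l - \<mu>0)) s))) \<le> C1 * k"
      using eventually_gt_at_top[of 0]
    proof eventually_elim
      case (elim s)
      have "cube_mean (\<lambda>x. q x yE) s = cube_mean (\<lambda>x::real^'p. b0) s + cube_mean (\<lambda>x. \<Sum>l\<in>\<Lambda>'. g l yE * chr (l - \<mu>0) x) s"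
        unfolding q_def by (rule cube_mean_add) (intro continuous_intros)+
      also have "cube_mean (\<lambda>x. \<Sum>l\<in>\<Lambda>'. g l yE * chr (l - \<mu>0) x) s = (\<Sum>l\<in>\<Lambda>'. cube_mean (\<lambda>x. g l yE * chr (l - \<mu>0) x) s)"
        by (rule cube_mean_sum[OF fin']) (intro continuous_intros)
      also have "\<dots> = (\<Sum>l\<in>\<Lambda>'. g l yE * cube_mean (chr (l - \<mu>0)) s)"
        by (intro sum.cong refl cube_mean_cmult cchr)
      finally have e: "cube_mean (\<lambda>x. q x yE) s = b0 + (\<Sum>l\<in>\<Lambda>'. g l yE * cube_mean (chr (l - \<mu>0)) s)"
        using elim by (simp add: cube_mean_const)
      have "norm (cube_mean (\<lambda>x. tw \<mu>0 x yE - q x yE) s) \<le> C1 * k"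
        by (intro norm_cube_mean_le continuous_intros ct cq twq yE elim)
      then show ?case unfolding e[symmetric] by (simp add: cube_mean_diff[OF ct cq])
    qed
    then have "norm (a0 - b0) \<le> C1 * k"
      unfolding a0_def
      by (rule tendsto_upperbound[OF tendsto_norm[OF tendsto_diff[OF coef_lim[OF EO[OF yE]] l1]] _ trivial_limit_at_top_linorder])
    then show ?thesis by (simp add: C1k)
  qed
  define M where "M = (\<Sum>l\<in>\<Lambda>'. norm (b l) * exp (norm (\<mu>0 - l) * Y))"
  have M0: "M \<ge> 0" unfolding M_def by (intro sum_nonneg mult_nonneg_nonneg) auto
  show ?thesis
  proof (rule exI[of _ "(\<lambda>l. l - \<mu>0) ` \<Lambda>'"], rule exI[of _ k], intro conjI allI impI k)
    show "finite ((\<lambda>l. l - \<mu>0) ` \<Lambda>')" using fin' by simp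
    show "0 \<notin> (\<lambda>l. l - \<mu>0) ` \<Lambda>'" by (auto simp: \<Lambda>'_def)
    fix \<kappa> :: real assume \<kappa>: "\<kappa> > 0"
    \<comment> \<open>Makes the oscillating terms contribute less than |a0|/8 to the average over
      [-R, R], given the bound 2/\<open>\<kappa>\<close> for each integral.\<close>
    define R where "R = 8 * M / (\<kappa> * norm a0) + 1"
    have R: "R > 0" using M0 \<kappa> by (simp add: R_def add_nonneg_pos)
    show "\<exists>R>0. \<forall>h x. \<forall>y\<in>E. (\<forall>\<nu>\<in>(\<lambda>l. l - \<mu>0) ` \<Lambda>'. \<kappa> \<le> \<bar>\<nu> \<bullet> h\<bar>) \<longrightarrow> (\<exists>u\<in>{-R..R}. k \<le> norm (f (cvec (x + u *\<^sub>R h) y)))"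
    proof (intro exI[of _ R] conjI R allI ballI impI, rule ccontr)
      fix h x y assume y: "y \<in> E" and good: "\<forall>\<nu>\<in>(\<lambda>l. l - \<mu>0) ` \<Lambda>'. \<kappa> \<le> \<bar>\<nu> \<bullet> h\<bar>"
        and "\<not> (\<exists>u\<in>{-R..R}. k \<le> norm (f (cvec (x + u *\<^sub>R h) y)))"
      then have small: "norm (f (cvec (x + u *\<^sub>R h) y)) \<le> k" if "u \<in> {-R..R}" for u using that by force
      have qs: "norm (q (x + u *\<^sub>R h) y) \<le> 2 * (norm a0 / 8)" if "u \<in> {-R..R}" for u
      proof -
        have "norm (tw \<mu>0 (x + u *\<^sub>R h) y) \<le> C1 * k"
          unfolding tw_def norm_mult using ex[OF y, of \<mu>0] small[OF that] C1
          by (intro mult_mono) (auto simp: chr_simps(1) C1_def)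
        then show ?thesis using twq[OF y, of "x + u *\<^sub>R h"] norm_triangle_sub[of "q (x + u *\<^sub>R h) y" "tw \<mu>0 (x + u *\<^sub>R h) y"] C1k
          by (simp add: norm_minus_commute)
      qed
      have qe: "q (x + u *\<^sub>R h) y = b0 + (\<Sum>l\<in>\<Lambda>'. (g l y * chr (l - \<mu>0) x) * cis (((l - \<mu>0) \<bullet> h) * u))" for u
        unfolding q_def chr_simps(2) by (simp add: chr_def mult_ac)
      have I: "integral {-R..R} (\<lambda>u. q (x + u *\<^sub>R h) y) = 2 * R * b0 +
          (\<Sum>l\<in>\<Lambda>'. (g l y * chr (l - \<mu>0) x) * integral {-R..R} (\<lambda>u. cis (((l - \<mu>0) \<bullet> h) * u)))"
      proof -
        have ii: "(\<lambda>u. cis (\<theta> * u)) integrable_on {-R..R}" for \<theta>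
          by (intro integrable_continuous_real) (auto simp: cis_conv_exp intro!: continuous_intros)
        have "((\<lambda>u. b0 + (\<Sum>l\<in>\<Lambda>'. (g l y * chr (l - \<mu>0) x) * cis (((l - \<mu>0) \<bullet> h) * u))) has_integral
           Henstock_Kurzweil_Integration.content {-R..R} *\<^sub>R b0 + (\<Sum>l\<in>\<Lambda>'. (g l y * chr (l - \<mu>0) x) * integral {-R..R} (\<lambda>u. cis (((l - \<mu>0) \<bullet> h) * u)))) {-R..R}"
          by (intro has_integral_add has_integral_const_real has_integral_sum fin' has_integral_mult_right integrable_integral ii)
        then show ?thesis unfolding qe using R by (simp add: integral_unique scaleR_conv_of_real)
      qed
      have "norm (\<Sum>l\<in>\<Lambda>'. (g l y * chr (l - \<mu>0) x) * integral {-R..R} (\<lambda>u. cis (((l - \<mu>0) \<bullet> h) * u))) \<le>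
         (\<Sum>l\<in>\<Lambda>'. (norm (b l) * exp (norm (\<mu>0 - l) * Y)) * (2 / \<kappa>))"
      proof (rule sum_norm_le)
        fix l assume l: "l \<in> \<Lambda>'"
        then have kl: "\<kappa> \<le> \<bar>(l - \<mu>0) \<bullet> h\<bar>" using good by auto
        have "norm (integral {-R..R} (\<lambda>u. cis (((l - \<mu>0) \<bullet> h) * u))) \<le> 2 / \<bar>(l - \<mu>0) \<bullet> h\<bar>"
          by (rule norm_integral_cis_le) (use kl \<kappa> R in auto)
        also have "\<dots> \<le> 2 / \<kappa>" using kl \<kappa> by (intro divide_left_mono) auto
        finally have "norm (integral {-R..R} (\<lambda>u. cis (((l - \<mu>0) \<bullet> h) * u))) \<le> 2 / \<kappa>" .
        show "norm (g l y * chr (l - \<mu>0) x * integral {-R..R} (\<lambda>u. cis (((l - \<mu>0) \<bullet> h) * u))) \<le>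
          (norm (b l) * exp (norm (\<mu>0 - l) * Y)) * (2 / \<kappa>)"
        proof -
          have "norm (g l y * chr (l - \<mu>0) x) = norm (b l) * exp ((\<mu>0 - l) \<bullet> y)" by (simp add: g_def norm_mult chr_simps(1))
          also have "\<dots> \<le> norm (b l) * exp (norm (\<mu>0 - l) * Y)" by (intro mult_left_mono ex[OF y]) auto
          finally have "norm (g l y * chr (l - \<mu>0) x) \<le> norm (b l) * exp (norm (\<mu>0 - l) * Y)" .
          then show ?thesis unfolding norm_mult[of "g l y * chr (l - \<mu>0) x"]
            by (rule mult_mono) (use \<open>norm (integral {-R..R} (\<lambda>u. cis (((l - \<mu>0) \<bullet> h) * u))) \<le> 2 / \<kappa>\<close> in auto)
        qed
      qed
      also have "\<dots> = M * (2 / \<kappa>)" unfolding M_def by (rule sum_distrib_right[symmetric])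
      finally have s: "norm (\<Sum>l\<in>\<Lambda>'. (g l y * chr (l - \<mu>0) x) * integral {-R..R} (\<lambda>u. cis (((l - \<mu>0) \<bullet> h) * u))) \<le> M * (2 / \<kappa>)" .
      \<comment> \<open>If |f| stays below \<open>k\<close> on the window, then |q| is at most
        |a0|/4 there. The constant term would be below |a0|/4 + |a0|/8, although it is at least
        7|a0|/8.\<close>
      have "norm (integral {-R..R} (\<lambda>u. q (x + u *\<^sub>R h) y)) \<le> (2 * (norm a0 / 8)) * (R - (- R))"
        by (rule integral_bound)
           (use R qs in \<open>auto intro!: continuous_on_compose2[OF cq] continuous_intros\<close>)
      then have "norm (2 * R * b0) \<le> (2 * (norm a0 / 8)) * (2 * R) + M * (2 / \<kappa>)"
      proof -
        let ?a = "complex_of_real (2 * R) * b0"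
          and ?s = "\<Sum>l\<in>\<Lambda>'. (g l y * chr (l - \<mu>0) x) * integral {-R..R} (\<lambda>u. cis (((l - \<mu>0) \<bullet> h) * u))"
        assume a: "norm (integral {-R..R} (\<lambda>u. q (x + u *\<^sub>R h) y)) \<le> (2 * (norm a0 / 8)) * (R - (- R))"
        have "norm ?a \<le> norm (?a + ?s) + norm ?s" using norm_triangle_ineq4[of "?a + ?s" ?s] by simp
        then show ?thesis using a s unfolding I by simp
      qed
      then have "2 * R * norm b0 \<le> (2 * (norm a0 / 8)) * (2 * R) + M * (2 / \<kappa>)" using R by (simp add: norm_mult)
      moreover have "M * (2 / \<kappa>) < (norm a0 / 8) * (2 * R)"
      proof -
        have "(norm a0 / 8) * (2 * R) = M * (2 / \<kappa>) + norm a0 / 4" using a0 \<kappa> by (simp add: R_def field_simps)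
        then show ?thesis using a0 by simp
      qed
      moreover have "norm b0 \<ge> 7 * (norm a0 / 8)" using ab norm_triangle_ineq2[of a0 b0] by linarith
      then have "2 * R * norm b0 \<ge> 2 * R * (7 * (norm a0 / 8))" using R by (intro mult_left_mono) auto
      ultimately have "2 * R * (7 * (norm a0 / 8)) < (2 * (norm a0 / 8)) * (2 * R) + (norm a0 / 8) * (2 * R)" by linarith
      also have "\<dots> = 2 * R * (3 * (norm a0 / 8))" by (simp add: algebra_simps)
      finally have "2 * R * (7 * (norm a0 / 8)) < 2 * R * (3 * (norm a0 / 8))" .
      then have "7 * (norm a0 / 8) < 3 * (norm a0 / 8)" using R by (simp only: mult_less_cancel_left_pos mult_pos_pos zero_less_numeral)
      then show False using a0 by simp
    qed
  qed
qed

text \<open>If |f| came arbitrarily close to 0 over the fibre, restrictions to complex lines through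
  such points would be a normal family of zero-free functions, with a limit that vanishes at 0. By
  Hurwitz the limit is identically 0, against \<open>window_lower_bound\<close> in a generic
  direction.\<close>

lemma zero_free_lower_bound:
  assumes nz: "\<exists>z\<in>tube \<Omega>. f z \<noteq> 0" and \<rho>: "\<rho> > 0" "ball y \<rho> \<subseteq> \<Omega>" and zf: "\<And>x y'. y' \<in> ball y \<rho> \<Longrightarrow> f (cvec x y') \<noteq> 0"
  shows "\<exists>\<delta>>0. \<forall>x. \<delta> \<le> norm (f (cvec x y))"
proof (rule ccontr)
  assume no: "\<not> ?thesis"
  have yO: "y \<in> \<Omega>" using \<rho> by auto
  obtain N k where Nk: "finite N" "0 \<notin> N" "k > 0" "\<And>\<kappa>. \<kappa> > 0 \<Longrightarrow> \<exists>R>0. \<forall>h x. \<forall>y'\<in>{y}. (\<forall>\<nu>\<in>N. \<kappa> \<le> \<bar>\<nu> \<bullet> h\<bar>) \<longrightarrow>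
     (\<exists>u\<in>{-R..R}. k \<le> norm (f (cvec (x + u *\<^sub>R h) y')))"
    using window_lower_bound[OF compactly_in_singleton[OF yO] nz] by blast
  obtain h where h: "norm h = 1" "\<forall>\<nu>\<in>N. \<nu> \<bullet> h \<noteq> 0" using generic_direction[OF countable_finite[OF Nk(1)] Nk(2)] by blast
  define \<kappa> where "\<kappa> = Min (insert 1 ((\<lambda>\<nu>. \<bar>\<nu> \<bullet> h\<bar>) ` N))"
  have \<kappa>: "\<kappa> > 0" "\<And>\<nu>. \<nu> \<in> N \<Longrightarrow> \<kappa> \<le> \<bar>\<nu> \<bullet> h\<bar>" using Nk(1) h(2) by (auto simp: \<kappa>_def)
  obtain R where R: "R > 0" "\<And>x. \<exists>u\<in>{-R..R}. k \<le> norm (f (cvec (x + u *\<^sub>R h) y))"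
    using Nk(4)[OF \<kappa>(1)] \<kappa>(2) by blast
  have "\<forall>n::nat. \<exists>x. norm (f (cvec x y)) < 1 / (real n + 1)"
  proof
    fix n :: nat
    have "1 / (real n + 1) > 0" by simp
    then show "\<exists>x. norm (f (cvec x y)) < 1 / (real n + 1)" using no by (meson not_le)
  qed
  then obtain x where x: "\<And>n. norm (f (cvec (x n) y)) < 1 / (real n + 1)" by metis
  obtain r0 where r0: "r0 > 0" "ball y r0 \<subseteq> \<Omega>" "compactly_in (ball y r0) \<Omega>" using compactly_in_ball[OF yO] by blast
  define r where "r = min r0 \<rho>"
  have r: "r > 0" using r0 \<rho> by (simp add: r_def)
  obtain B where B: "\<And>x y'. y' \<in> ball y r0 \<Longrightarrow> norm (f (cvec x y')) \<le> B" using bounded_on_tube[OF r0(3)] by blast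
  let ?S = "{w. \<bar>Im w\<bar> < r}"
  have Seq: "?S = {w. Im w \<in> {-r<..<r}}" by auto
  have oS: "open ?S" unfolding Seq using open_vimage[OF open_greaterThanLessThan continuous_on_Im[OF continuous_on_id]] by (simp add: vimage_def)
  have "convex ?S" unfolding Seq using convex_linear_vimage[of Im "{-r<..<r}"] by (simp add: vimage_def linear_iff)
  then have cS: "connected ?S" by (rule convex_connected)
  have inb: "y + Im w *\<^sub>R h \<in> ball y r" if "w \<in> ?S" for w using that h(1) by (simp add: dist_norm)
  define \<phi> where "\<phi> n w = f (cvec (x n + Re w *\<^sub>R h) (y + Im w *\<^sub>R h))" for n w
  have hol: "\<phi> n holomorphic_on ?S" for n
    unfolding \<phi>_def by (rule holomorphic_on_subset[OF line_holomorphic]) (use inb r0(2) in \<open>force simp: r_def\<close>)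
  have \<phi>B: "norm (\<phi> n w) \<le> B" if "w \<in> ?S" for n w unfolding \<phi>_def using inb[OF that] by (intro B) (auto simp: r_def)
  have \<phi>nz: "\<phi> n w \<noteq> 0" if "w \<in> ?S" for n w unfolding \<phi>_def using inb[OF that] by (intro zf) (auto simp: r_def)
  have \<phi>B': "\<forall>n. \<forall>w\<in>?S. norm (\<phi> n w) \<le> B" by (intro allI ballI \<phi>B)
  from Montel_bounded[where \<phi> = \<phi>, OF oS hol \<phi>B']
  obtain g q where g': "g holomorphic_on ?S" "strict_mono (q :: nat \<Rightarrow> nat)" "\<forall>w\<in>?S. (\<lambda>n. \<phi> (q n) w) \<longlonglongrightarrow> g w"
    "\<forall>K. compact K \<longrightarrow> K \<subseteq> ?S \<longrightarrow> uniform_limit K (\<phi> \<circ> q) g sequentially"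
    by (elim exE conjE)
  note g = g'(1,2) bspec[OF g'(3)] g'(4)[rule_format]
  have g0: "g 0 = 0"
  proof -
    have "(\<lambda>n. \<phi> (q n) 0) \<longlonglongrightarrow> 0"
    proof (rule Lim_null_comparison)
      show "\<forall>\<^sub>F n in sequentially. norm (\<phi> (q n) 0) \<le> 1 / (real n + 1)"
      proof (intro always_eventually allI)
        fix n
        have "norm (\<phi> (q n) 0) \<le> 1 / (real (q n) + 1)" using x[of "q n"] by (simp add: \<phi>_def less_imp_le)
        also have "\<dots> \<le> 1 / (real n + 1)" using seq_suble[OF g(2), of n] by (intro divide_left_mono) auto
        finally show "norm (\<phi> (q n) 0) \<le> 1 / (real n + 1)" .
      qed
      show "(\<lambda>n. 1 / (real n + 1)) \<longlonglongrightarrow> 0" using LIMSEQ_inverse_real_of_nat by (simp add: inverse_eq_divide add.commute)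
    qed
    then show ?thesis using LIMSEQ_unique[OF g(3)[of 0]] r by simp
  qed
  show False
  proof (cases "g constant_on ?S")
    case True
    then have gz: "g w = 0" if "w \<in> ?S" for w using g0 that r by (auto simp: constant_on_def)
    let ?K = "complex_of_real ` {-R..R}"
    have "compact ?K" by (intro compact_continuous_image continuous_intros) auto
    moreover have KS: "?K \<subseteq> ?S" using r by auto
    ultimately have "uniform_limit ?K (\<phi> \<circ> q) g sequentially" by (rule g(4))
    from uniform_limitD[OF this Nk(3)] obtain n where n: "\<forall>w\<in>?K. dist ((\<phi> \<circ> q) n w) (g w) < k"
      by (auto simp: eventually_sequentially)
    obtain u where u: "u \<in> {-R..R}" "k \<le> norm (f (cvec (x (q n) + u *\<^sub>R h) y))" using R(2) by blast
    have "dist ((\<phi> \<circ> q) n (of_real u)) (g (of_real u)) < k" using n u(1) by blast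
    moreover have "g (of_real u) = 0" by (rule gz) (use KS u(1) in blast)
    ultimately show False using u(2) by (simp add: \<phi>_def)
  next
    case False
    have "g 0 \<noteq> 0"
      by (rule Hurwitz_no_zeros[OF oS cS, of "\<phi> \<circ> q"]) (use hol g(1,4) False \<phi>nz r in auto)
    then show False using g0 by simp
  qed
qed

text \<open>A limit of counterexamples under Montel's theorem is not identically 0 because of the
  windows. It has finitely many zeros in a compact rectangle, so some column avoids them all, and on
  it the approximating functions are bounded below. Direction, base point and length vary along the
  sequence, so the bound is uniform in all of them.\<close>

lemma column_lower_bound:
  assumes D: "compactly_in D \<Omega>" "convex D" and k: "k > 0" and R: "R > 0"
    and win: "\<And>h x y. G h \<Longrightarrow> y \<in> D \<Longrightarrow> \<exists>u\<in>{-R..R}. k \<le> norm (f (cvec (x + u *\<^sub>R h) y))"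
  shows "\<exists>\<epsilon>>0. \<forall>h x y L. G h \<longrightarrow> norm h = 1 \<longrightarrow> y \<in> D \<longrightarrow> L \<ge> 0 \<longrightarrow> y + L *\<^sub>R h \<in> D \<longrightarrow>
     (\<exists>u\<in>{-R..R}. \<forall>v\<in>{0..L}. \<epsilon> \<le> norm (f (cvec (x + u *\<^sub>R h) (y + v *\<^sub>R h))))"
proof (rule ccontr)
  assume no: "\<not> ?thesis"
  have "\<forall>n::nat. \<exists>h x y L. G h \<and> norm h = 1 \<and> y \<in> D \<and> L \<ge> 0 \<and> y + L *\<^sub>R h \<in> D \<and>
     (\<forall>u\<in>{-R..R}. \<exists>v\<in>{0..L}. norm (f (cvec (x + u *\<^sub>R h) (y + v *\<^sub>R h))) < 1 / (real n + 1))"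
  proof
    fix n :: nat
    have "1 / (real n + 1) > 0" by simp
    then show "\<exists>h x y L. G h \<and> norm h = 1 \<and> y \<in> D \<and> L \<ge> 0 \<and> y + L *\<^sub>R h \<in> D \<and>
     (\<forall>u\<in>{-R..R}. \<exists>v\<in>{0..L}. norm (f (cvec (x + u *\<^sub>R h) (y + v *\<^sub>R h))) < 1 / (real n + 1))"
      using no by (meson not_le)
  qed
  then obtain h x y L where s: "\<And>n. G (h n)" "\<And>n. norm (h n) = 1" "\<And>n. y n \<in> D" "\<And>n. L n \<ge> 0" "\<And>n. y n + L n *\<^sub>R h n \<in> D"
    "\<And>n u. u \<in> {-R..R} \<Longrightarrow> \<exists>v\<in>{0..L n}. norm (f (cvec (x n + u *\<^sub>R h n) (y n + v *\<^sub>R h n))) < 1 / (real n + 1)"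
    by metis
  obtain \<sigma> where \<sigma>: "\<sigma> > 0" "compactly_in {y. \<exists>d\<in>D. dist d y < \<sigma>} \<Omega>" using compactly_in_neighbourhood[OF D(1) openO] by blast
  let ?D = "{y. \<exists>d\<in>D. dist d y < \<sigma>}"
  have DO: "?D \<subseteq> \<Omega>" using \<sigma>(2) closure_subset[of ?D] unfolding compactly_in_def by blast
  obtain B where B: "\<And>x y. y \<in> ?D \<Longrightarrow> norm (f (cvec x y)) \<le> B" using bounded_on_tube[OF \<sigma>(2)] by blast
  obtain M where M: "\<And>y. y \<in> D \<Longrightarrow> norm y \<le> M" using D(1) unfolding compactly_in_def bounded_iff by blast
  have Lb: "L n \<in> {0..2 * M}" for n
  proof -
    have "L n = norm ((y n + L n *\<^sub>R h n) - y n)" using s(2,4)[of n] by simp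
    also have "\<dots> \<le> M + M" by (intro order_trans[OF norm_triangle_ineq4] add_mono M s)
    finally show ?thesis using s(4)[of n] by simp
  qed
  obtain Li q where q: "strict_mono (q :: nat \<Rightarrow> nat)" "(L \<circ> q) \<longlonglongrightarrow> Li" "Li \<in> {0..2 * M}"
    using compact_Icc[of 0 "2 * M"] Lb unfolding compact_def by metis
  have "\<forall>\<^sub>F n in sequentially. dist ((L \<circ> q) n) Li < \<sigma> / 4" using tendstoD[OF q(2), of "\<sigma> / 4"] \<sigma>(1) by simp
  then obtain n0 where n0: "\<And>n. n \<ge> n0 \<Longrightarrow> \<bar>L (q n) - Li\<bar> < \<sigma> / 4" by (auto simp: eventually_sequentially dist_real_def)
  \<comment> \<open>After this reindexing every length is within \<open>\<sigma>/4\<close> of the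
    limit \<open>Li\<close>, so that all functions live on one common strip.\<close>
  define p where "p n = q (n + n0)" for n
  have pn: "p n \<ge> n" for n using seq_suble[OF q(1), of "n + n0"] by (simp add: p_def)
  have Lp: "\<bar>L (p n) - Li\<bar> < \<sigma> / 4" for n using n0[of "n + n0"] by (simp add: p_def)
  let ?S = "{w. Im w \<in> {-\<sigma><..<Li + \<sigma> / 2}}"
  have oS: "open ?S" using open_vimage[OF open_greaterThanLessThan continuous_on_Im[OF continuous_on_id]] by (simp add: vimage_def)
  have "convex ?S" using convex_linear_vimage[of Im "{-\<sigma><..<Li + \<sigma> / 2}"] by (simp add: vimage_def linear_iff)
  then have cS: "connected ?S" by (rule convex_connected)
  have inD: "y (p n) + v *\<^sub>R h (p n) \<in> ?D" if v: "v \<in> {-\<sigma><..<Li + \<sigma> / 2}" for n v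
  proof -
    consider "v < 0" | "0 \<le> v" "v \<le> L (p n)" | "v > L (p n)" by linarith
    then show ?thesis
    proof cases
      case 1
      have "dist (y (p n)) (y (p n) + v *\<^sub>R h (p n)) < \<sigma>" using 1 v s(2)[of "p n"] by (simp add: dist_norm)
      then show ?thesis using s(3) by blast
    next
      case 2
      have "y (p n) + v *\<^sub>R h (p n) \<in> D"
      proof (cases "L (p n) = 0")
        case True then show ?thesis using 2 s(3) by simp
      next
        case False
        then have Lpos: "L (p n) > 0" using s(4)[of "p n"] by simp
        have "(1 - v / L (p n)) *\<^sub>R y (p n) + (v / L (p n)) *\<^sub>R (y (p n) + L (p n) *\<^sub>R h (p n)) \<in> D"
          by (rule convexD_alt[OF D(2) s(3) s(5)]) (use 2 Lpos in auto)
        then show ?thesis using Lpos by (simp add: algebra_simps)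
      qed
      then show ?thesis using \<sigma>(1) by (metis (mono_tags, lifting) dist_self mem_Collect_eq)
    next
      case 3
      have "v - L (p n) < \<sigma>" using v Lp[of n] \<sigma>(1) unfolding abs_less_iff greaterThanLessThan_iff by linarith
      moreover have "dist (y (p n) + L (p n) *\<^sub>R h (p n)) (y (p n) + v *\<^sub>R h (p n)) = v - L (p n)"
        using 3 s(2)[of "p n"] by (simp add: dist_norm scaleR_diff_left[symmetric])
      ultimately show ?thesis using s(5) by (metis (mono_tags, lifting) mem_Collect_eq)
    qed
  qed
  define \<phi> where "\<phi> n w = f (cvec (x (p n) + Re w *\<^sub>R h (p n)) (y (p n) + Im w *\<^sub>R h (p n)))" for n w
  have hol: "\<phi> n holomorphic_on ?S" for n
    unfolding \<phi>_def by (rule holomorphic_on_subset[OF line_holomorphic]) (use inD DO in blast)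
  have \<phi>B: "norm (\<phi> n w) \<le> B" if "w \<in> ?S" for n w unfolding \<phi>_def by (rule B, rule inD) (use that in simp)
  have \<phi>B': "\<forall>n. \<forall>w\<in>?S. norm (\<phi> n w) \<le> B" by (intro allI ballI \<phi>B)
  from Montel_bounded[where \<phi> = \<phi>, OF oS hol \<phi>B']
  obtain g r where g': "g holomorphic_on ?S" "strict_mono (r :: nat \<Rightarrow> nat)" "\<forall>w\<in>?S. (\<lambda>n. \<phi> (r n) w) \<longlonglongrightarrow> g w"
    "\<forall>K. compact K \<longrightarrow> K \<subseteq> ?S \<longrightarrow> uniform_limit K (\<phi> \<circ> r) g sequentially"
    by (elim exE conjE)
  note g = g'(1,2) bspec[OF g'(3)] g'(4)[rule_format]
  let ?K = "cbox (Complex (-R) 0) (Complex R (Li + \<sigma> / 4))"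
  have Kmem: "w \<in> ?K \<longleftrightarrow> Re w \<in> {-R..R} \<and> Im w \<in> {0..Li + \<sigma> / 4}" for w by (auto simp: in_cbox_complex_iff)
  have KS: "?K \<subseteq> ?S" using \<sigma>(1) by (auto simp: in_cbox_complex_iff)
  have ul: "uniform_limit ?K (\<phi> \<circ> r) g sequentially" by (rule g(4)[OF compact_cbox KS])
  have Li0: "Li \<ge> 0" using q(3) by simp
  \<comment> \<open>A constant limit has to be treated separately: the window at the bottom of the
    columns excludes the constant 0.\<close>
  have fin: "finite {w\<in>?K. g w = 0}"
  proof (cases "g constant_on ?S")
    case True
    then obtain c where c: "\<And>w. w \<in> ?S \<Longrightarrow> g w = c" by (auto simp: constant_on_def)
    have "c \<noteq> 0"
    proof
      assume "c = 0"
      from uniform_limitD[OF ul k] obtain n where n: "\<forall>w\<in>?K. dist ((\<phi> \<circ> r) n w) (g w) < k"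
        by (auto simp: eventually_sequentially)
      obtain u where u: "u \<in> {-R..R}" "k \<le> norm (f (cvec (x (p (r n)) + u *\<^sub>R h (p (r n))) (y (p (r n)))))"
        using win[OF s(1) s(3)] by blast
      have uK: "of_real u \<in> ?K" using u(1) Li0 \<sigma>(1) by (simp add: Kmem)
      then have "dist ((\<phi> \<circ> r) n (of_real u)) (g (of_real u)) < k" using n by blast
      moreover have "g (of_real u) = 0" using c \<open>c = 0\<close> uK KS by blast
      ultimately show False using u(2) by (simp add: \<phi>_def)
    qed
    then have "g w \<noteq> 0" if "w \<in> ?K" for w using c[OF subsetD[OF KS that]] by simp
    then have "{w\<in>?K. g w = 0} = {}" by blast
    then show ?thesis by (simp only: finite.emptyI)
  next
    case False
    then show ?thesis by (intro holomorphic_compact_finite_zeros[OF g(1) oS cS compact_cbox KS])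
  qed
  have "infinite {-R..R}" using R by (simp add: infinite_Icc)
  then obtain u where u: "u \<in> {-R..R}" "u \<notin> Re ` {w\<in>?K. g w = 0}"
    using finite_subset[OF _ finite_imageI[OF fin, of Re]] by blast
  let ?C = "(\<lambda>v. Complex u v) ` {0..Li + \<sigma> / 4}"
  have CK: "?C \<subseteq> ?K" using u(1) by (auto simp: Kmem)
  have cC: "compact ?C" by (intro compact_continuous_image) (auto simp: Complex_eq intro!: continuous_intros)
  have neC: "?C \<noteq> {}" using Li0 \<sigma>(1) by simp
  have gC: "g w \<noteq> 0" if "w \<in> ?C" for w
  proof
    assume "g w = 0"
    then have "w \<in> {w\<in>?K. g w = 0}" using that CK by blast
    then have "Re w \<in> Re ` {w\<in>?K. g w = 0}" by (rule imageI)
    moreover have "Re w = u" using that by auto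
    ultimately show False using u(2) by simp
  qed
  have "continuous_on ?C (\<lambda>w. norm (g w))"
    using holomorphic_on_imp_continuous_on[OF g(1)] CK KS by (intro continuous_on_norm) (meson continuous_on_subset subset_trans)
  from continuous_attains_inf[OF cC neC this] obtain w0 where w0: "w0 \<in> ?C" "\<And>w. w \<in> ?C \<Longrightarrow> norm (g w0) \<le> norm (g w)" by blast
  define \<tau> where "\<tau> = norm (g w0) / 2"
  have \<tau>: "\<tau> > 0" using gC[OF w0(1)] by (simp add: \<tau>_def)
  obtain n1 where n1: "\<And>n w. n \<ge> n1 \<Longrightarrow> w \<in> ?K \<Longrightarrow> dist ((\<phi> \<circ> r) n w) (g w) < \<tau>"
    using uniform_limitD[OF ul \<tau>] by (auto simp: eventually_sequentially)
  obtain n2 :: nat where n2: "real n2 > 1 / \<tau>" using reals_Archimedean2 by blast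
  define n where "n = max n1 n2"
  have "real (p (r n)) \<ge> real n2" using pn[of "r n"] seq_suble[OF g(2), of n] by (simp add: n_def)
  then have "1 / \<tau> < real (p (r n)) + 1" using n2 by linarith
  then have pr: "1 / (real (p (r n)) + 1) < \<tau>" using \<tau> by (simp add: field_simps)
  obtain v where v: "v \<in> {0..L (p (r n))}"
    "norm (f (cvec (x (p (r n)) + u *\<^sub>R h (p (r n))) (y (p (r n)) + v *\<^sub>R h (p (r n))))) < 1 / (real (p (r n)) + 1)"
    using s(6)[OF u(1)] by blast
  have vC: "Complex u v \<in> ?C" 
  proof (rule imageI)
    have "L (p (r n)) - Li < \<sigma> / 4" using Lp[of "r n"] unfolding abs_less_iff by simp
    then show "v \<in> {0..Li + \<sigma> / 4}" using v(1) by simp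
  qed
  have "dist ((\<phi> \<circ> r) n (Complex u v)) (g (Complex u v)) < \<tau>" using n1 vC CK by (simp add: n_def subset_iff)
  then have "norm (g (Complex u v)) < norm (\<phi> (r n) (Complex u v)) + \<tau>"
    using norm_triangle_sub[of "g (Complex u v)" "\<phi> (r n) (Complex u v)"] by (simp add: dist_norm norm_minus_commute)
  moreover have "norm (\<phi> (r n) (Complex u v)) < \<tau>" using v(2) pr by (simp add: \<phi>_def)
  moreover have "2 * \<tau> \<le> norm (g (Complex u v))" using w0(2)[OF vC] by (simp add: \<tau>_def)
  ultimately show False by linarith
qed

end

subsection \<open>Logarithms and mean motions\<close>

lemma norm_Ln_ratio_le:
  assumes "norm (w - 1) < 1/2" shows "norm (Ln w) \<le> 2 * norm (w - 1)"
  using norm_Ln_le[of "w - 1"] assms by simp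

text \<open>Near 1 the principal logarithm is continuous, so \<open>k\<close> minus the principal
  logarithm of \<open>exp k\<close> is continuous with values in 2 pi i Z, hence constant on a
  connected set.\<close>

lemma log_branch:
  fixes k :: "'a::topological_space \<Rightarrow> complex"
  assumes X: "connected X" and c: "continuous_on X k" and near: "\<And>x. x \<in> X \<Longrightarrow> norm (exp (k x) - 1) < 1/2"
  shows "\<exists>n::int. \<forall>x\<in>X. k x = Ln (exp (k x)) + 2 * pi * of_int n * \<i>"
proof (cases "X = {}")
  case True then show ?thesis by simp
next
  case False
  then obtain x0 where x0: "x0 \<in> X" by blast
  have "\<exists>n::int. k x - Ln (exp (k x)) = 2 * pi * of_int n * \<i>" for x
  proof -
    have "exp (k x) = exp (Ln (exp (k x)))" by simp
    then obtain n :: int where "k x = Ln (exp (k x)) + (of_int (2 * n) * pi) * \<i>" unfolding exp_eq by blast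
    then have "k x - Ln (exp (k x)) = (of_int (2 * n) * pi) * \<i>" by (metis add_diff_cancel_left')
    also have "\<dots> = 2 * pi * of_int n * \<i>" by simp
    finally show ?thesis by blast
  qed
  then obtain N :: "'a \<Rightarrow> int" where N: "\<And>x. k x - Ln (exp (k x)) = 2 * pi * of_int (N x) * \<i>" by metis
  have "(\<lambda>x. k x - Ln (exp (k x))) constant_on X"
  proof (rule continuous_discrete_range_constant[OF X])
    have "exp (k x) \<notin> \<real>\<^sub>\<le>\<^sub>0" if "x \<in> X" for x
    proof -
      have "\<bar>Re (exp (k x) - 1)\<bar> < 1/2" using near[OF that] abs_Re_le_cmod le_less_trans by blast
      then have "- (1/2) < Re (exp (k x) - 1)" unfolding abs_less_iff by linarith
      then have "Re (exp (k x)) > 0" by simp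
      then show ?thesis by (auto simp: complex_nonpos_Reals_iff)
    qed
    then show "continuous_on X (\<lambda>x. k x - Ln (exp (k x)))" by (intro continuous_intros c)
    fix x assume "x \<in> X"
    show "\<exists>e>0. \<forall>y. y \<in> X \<and> k y - Ln (exp (k y)) \<noteq> k x - Ln (exp (k x)) \<longrightarrow>
        e \<le> norm (k y - Ln (exp (k y)) - (k x - Ln (exp (k x))))"
    proof (intro exI[of _ "2 * pi"] conjI allI impI)
      fix y assume "y \<in> X \<and> k y - Ln (exp (k y)) \<noteq> k x - Ln (exp (k x))"
      then have ne: "N y \<noteq> N x" unfolding N by auto
      define m where "m = N y - N x"
      have "k y - Ln (exp (k y)) - (k x - Ln (exp (k x))) = 2 * pi * of_int m * \<i>"
        unfolding N m_def by (simp add: algebra_simps)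
      moreover have "norm (2 * pi * of_int m * \<i>) = 2 * pi * \<bar>of_int m\<bar>" by (simp add: norm_mult)
      ultimately have "norm (k y - Ln (exp (k y)) - (k x - Ln (exp (k x)))) = 2 * pi * \<bar>of_int m\<bar>" by (simp only:)
      moreover have "(1::real) \<le> \<bar>of_int m\<bar>" using ne unfolding m_def by linarith
      ultimately show "2 * pi \<le> norm (k y - Ln (exp (k y)) - (k x - Ln (exp (k x))))" by simp
    qed simp
  qed
  then obtain z where z: "\<And>x. x \<in> X \<Longrightarrow> k x - Ln (exp (k x)) = z" by (auto simp: constant_on_def)
  have "k x = Ln (exp (k x)) + 2 * pi * of_int (N x0) * \<i>" if "x \<in> X" for x
    using z[OF that] z[OF x0] N[of x0] by (metis diff_eq_eq add.commute)
  then show ?thesis by blast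
qed

lemma log_diff:
  fixes k :: "'a::topological_space \<Rightarrow> complex"
  assumes X: "connected X" "continuous_on X k" "\<And>x. x \<in> X \<Longrightarrow> norm (exp (k x) - 1) < 1/2" and xy: "x \<in> X" "y \<in> X"
  shows "k x - k y = Ln (exp (k x)) - Ln (exp (k y))"
  using log_branch[OF X] xy by (metis add_diff_cancel_right)

lemma log_diff_le_2:
  fixes k :: "'a::topological_space \<Rightarrow> complex"
  assumes X: "connected X" "continuous_on X k" "\<And>x. x \<in> X \<Longrightarrow> norm (exp (k x) - 1) < 1/2" and xy: "x \<in> X" "y \<in> X"
  shows "norm (k x - k y) \<le> 2"
proof -
  have "norm (Ln (exp (k z))) \<le> 1" if "z \<in> X" for z using norm_Ln_ratio_le[OF X(3)[OF that]] X(3)[OF that] by linarith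
  then have "norm (Ln (exp (k x))) \<le> 1" "norm (Ln (exp (k y))) \<le> 1" using xy by blast+
  moreover have "k x - k y = Ln (exp (k x)) - Ln (exp (k y))" by (rule log_diff[OF X xy])
  ultimately show ?thesis using norm_triangle_ineq4[of "Ln (exp (k x))" "Ln (exp (k y))"] by simp
qed

text \<open>Each step of length \<open>d\<close> changes the phase by at most 2. Crude, but it gives
  a bound that depends only on the modulus of continuity and a lower bound of |f|.\<close>

lemma log_increment:
  fixes k :: "real \<Rightarrow> complex"
  assumes c: "continuous_on {0..L} k" and d: "d > 0" and L: "L \<ge> 0"
    and small: "\<And>v v'. v \<in> {0..L} \<Longrightarrow> v' \<in> {0..L} \<Longrightarrow> \<bar>v - v'\<bar> \<le> d \<Longrightarrow> norm (exp (k v') - exp (k v)) < norm (exp (k v)) / 2"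
  shows "\<bar>Im (k L - k 0)\<bar> \<le> 2 * (L / d + 1)"
proof -
  have step: "norm (k v' - k v) \<le> 2" if v: "v \<in> {0..L}" "v' \<in> {0..L}" "v \<le> v'" "v' \<le> v + d" for v v'
  proof -
    have "norm ((k v' - k v) - (k v - k v)) \<le> 2"
    proof (rule log_diff_le_2[where k = "\<lambda>w. k w - k v" and X = "{v..v'}"])
      show "continuous_on {v..v'} (\<lambda>w. k w - k v)" using v by (intro continuous_intros continuous_on_subset[OF c]) auto
      fix w assume w: "w \<in> {v..v'}"
      have "norm (exp (k w) - exp (k v)) < norm (exp (k v)) / 2" by (rule small) (use w v in auto)
      moreover have "exp (k w - k v) - 1 = (exp (k w) - exp (k v)) / exp (k v)" by (simp add: exp_diff diff_divide_distrib)
      ultimately show "norm (exp (k w - k v) - 1) < 1/2" by (simp add: norm_divide divide_less_eq)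
    qed (use v in auto)
    then show ?thesis by simp
  qed
  have ind: "\<bar>Im (k v - k 0)\<bar> \<le> 2 * real n" if "v \<in> {0..L}" "v \<le> real n * d" for n v
    using that
  proof (induction n arbitrary: v)
    case 0
    then have "v = 0" by simp
    then show ?case by simp
  next
    case (Suc n)
    define w where "w = max 0 (v - d)"
    have w: "w \<in> {0..L}" "w \<le> real n * d" "w \<le> v" "v \<le> w + d" using Suc.prems d by (auto simp: w_def algebra_simps)
    have "\<bar>Im (k w - k 0)\<bar> \<le> 2 * real n" by (rule Suc.IH[OF w(1,2)])
    moreover have "\<bar>Im (k v - k w)\<bar> \<le> 2" using step[OF w(1) Suc.prems(1) w(3,4)] abs_Im_le_cmod order_trans by blast
    ultimately show ?case by (simp add: abs_le_iff)
  qed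
  define n where "n = nat \<lceil>L / d\<rceil>"
  have "L / d \<le> real n" by (simp add: n_def of_nat_ceiling)
  then have "L \<le> real n * d" using d by (simp add: divide_le_eq)
  then have "\<bar>Im (k L - k 0)\<bar> \<le> 2 * real n" using ind L by simp
  also have "real n \<le> L / d + 1" using L d by (simp add: n_def)
  finally show ?thesis by simp
qed

text \<open>Let m r be an integer plus \<open>\<theta>\<close>. Additivity gives m (A(r x) - r A(x))
  = A(\<open>\<theta>\<close> x) - \<open>\<theta>\<close> A(x), which is bounded; let m tend to
  infinity.\<close>

lemma additive_bounded_linear:
  fixes A :: "real^'p \<Rightarrow> real"
  assumes add: "\<And>x y. A (x + y) = A x + A y" and bd: "\<And>r. \<exists>M. \<forall>x. norm x \<le> r \<longrightarrow> \<bar>A x\<bar> \<le> M"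
  shows "\<exists>c. \<forall>x. A x = c \<bullet> x"
proof -
  have A0: "A 0 = 0" using add[of 0 0] by simp
  have An: "A (of_nat n *\<^sub>R x) = of_nat n * A x" for n x by (induction n) (auto simp: A0 add algebra_simps)
  have Am: "A (- x) = - A x" for x using add[of x "- x"] A0 by simp
  have Ai: "A (of_int n *\<^sub>R x) = of_int n * A x" for n x
    by (cases n rule: int_cases2) (auto simp: An Am)
  have scale: "A (r *\<^sub>R x) = r * A x" for r x
  proof -
    obtain M where M: "\<And>z. norm z \<le> norm x \<Longrightarrow> \<bar>A z\<bar> \<le> M" using bd[of "norm x"] by blast
    have le: "\<bar>A (r *\<^sub>R x) - r * A x\<bar> \<le> (M + \<bar>A x\<bar>) / (real n + 1)" for n :: nat
    proof -
      define m where "m = real n + 1"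
      have m: "m > 0" by (simp add: m_def)
      define \<theta> where "\<theta> = m * r - of_int \<lfloor>m * r\<rfloor>"
      have \<theta>: "0 \<le> \<theta>" "\<theta> \<le> 1" unfolding \<theta>_def by linarith+
      have "m * A (r *\<^sub>R x) = A (of_nat (Suc n) *\<^sub>R (r *\<^sub>R x))" by (simp only: An) (simp add: m_def)
      also have "of_nat (Suc n) *\<^sub>R (r *\<^sub>R x) = of_int \<lfloor>m * r\<rfloor> *\<^sub>R x + \<theta> *\<^sub>R x"
      proof -
        have "of_int \<lfloor>m * r\<rfloor> *\<^sub>R x + \<theta> *\<^sub>R x = (m * r) *\<^sub>R x" unfolding scaleR_add_left[symmetric] \<theta>_def by simp
        moreover have "of_nat (Suc n) *\<^sub>R (r *\<^sub>R x) = (m * r) *\<^sub>R x" by (simp add: m_def add.commute)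
        ultimately show ?thesis by (simp only:)
      qed
      finally have "m * A (r *\<^sub>R x) = of_int \<lfloor>m * r\<rfloor> * A x + A (\<theta> *\<^sub>R x)" by (simp only: add Ai)
      then have "m * (A (r *\<^sub>R x) - r * A x) = A (\<theta> *\<^sub>R x) - \<theta> * A x" by (simp add: \<theta>_def algebra_simps)
      moreover have "\<bar>A (\<theta> *\<^sub>R x)\<bar> \<le> M" by (rule M) (use \<theta> in \<open>simp add: mult_left_le_one_le\<close>)
      moreover have "\<bar>\<theta> * A x\<bar> \<le> \<bar>A x\<bar>" using \<theta> by (simp add: abs_mult mult_left_le_one_le)
      ultimately have "\<bar>m * (A (r *\<^sub>R x) - r * A x)\<bar> \<le> M + \<bar>A x\<bar>" by linarith
      then show ?thesis using m by (simp add: abs_mult m_def[symmetric] le_divide_eq mult.commute)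
    qed
    have "M + \<bar>A x\<bar> \<ge> 0" using M[of 0] by (simp add: A0)
    have lim: "(\<lambda>n. (M + \<bar>A x\<bar>) / (real n + 1)) \<longlonglongrightarrow> 0"
      using tendsto_mult[OF tendsto_const[of "M + \<bar>A x\<bar>"] LIMSEQ_inverse_real_of_nat] by (simp add: divide_inverse add.commute)
    have "\<bar>A (r *\<^sub>R x) - r * A x\<bar> \<le> 0" by (rule LIMSEQ_le_const[OF lim]) (use le in auto)
    then show ?thesis by simp
  qed
  have "linear A" by (rule linearI) (auto simp: add scale)
  then have "A x = (\<chi> i. A (axis i 1)) \<bullet> x" for x
  proof -
    have "A x = A (\<Sum>i\<in>UNIV. x $ i *\<^sub>R axis i 1)" by (subst basis_expansion[symmetric]) (simp add: scalar_mult_eq_scaleR)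
    also have "\<dots> = (\<Sum>i\<in>UNIV. x $ i * A (axis i 1))" using \<open>linear A\<close> by (simp add: linear_sum linear_scale)
    finally show ?thesis by (simp add: inner_vec_def mult.commute)
  qed
  then show ?thesis by blast
qed

text \<open>The argument of Hyers: the dyadic limits of \<open>\<phi>(2^n x) / 2^n\<close> exist,
  are additive and remain at bounded distance from \<open>\<phi>\<close>; continuity of
  \<open>\<phi>\<close> bounds them on balls.\<close>

lemma quasi_additive_linear:
  fixes \<phi> :: "real^'p \<Rightarrow> real"
  assumes q: "\<And>x t. \<bar>\<phi> (x + t) - \<phi> x - \<phi> t\<bar> \<le> C" and c: "continuous_on UNIV \<phi>"
  shows "\<exists>c. \<forall>x. \<bar>\<phi> x - c \<bullet> x\<bar> \<le> 2 * C"
proof -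
  have C: "C \<ge> 0" using q[of 0 0] by linarith
  define s where "s x n = \<phi> (2 ^ n *\<^sub>R x) / 2 ^ n" for x and n :: nat
  have step: "\<bar>s x (Suc n) - s x n\<bar> \<le> C / 2 ^ Suc n" for x n
  proof -
    have "\<bar>\<phi> (2 ^ n *\<^sub>R x + 2 ^ n *\<^sub>R x) - \<phi> (2 ^ n *\<^sub>R x) - \<phi> (2 ^ n *\<^sub>R x)\<bar> \<le> C" by (rule q)
    moreover have "2 ^ n *\<^sub>R x + 2 ^ n *\<^sub>R x = 2 ^ Suc n *\<^sub>R x" by (simp flip: scaleR_add_left)
    moreover have "s x (Suc n) - s x n = (\<phi> (2 ^ Suc n *\<^sub>R x) - \<phi> (2 ^ n *\<^sub>R x) - \<phi> (2 ^ n *\<^sub>R x)) / 2 ^ Suc n"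
      by (simp add: s_def field_simps)
    ultimately show ?thesis by (simp add: divide_right_mono)
  qed
  have tel: "\<bar>s x (n + k) - s x n\<bar> \<le> 2 * C / 2 ^ n - 2 * C / 2 ^ (n + k)" for x n k
  proof (induction k)
    case (Suc k)
    have "2 * C / 2 ^ (n + k) - 2 * C / 2 ^ (n + Suc k) = 2 * C / 2 ^ Suc (n + k)" by (simp add: field_simps)
    moreover have "C / 2 ^ Suc (n + k) \<le> 2 * C / 2 ^ Suc (n + k)" using C by (intro divide_right_mono) auto
    ultimately show ?case using Suc step[of x "n + k"] by (simp add: abs_le_iff) 
  qed simp
  have tel': "\<bar>s x m - s x n\<bar> \<le> 2 * C / 2 ^ n" if "m \<ge> n" for x m n
  proof -
    have "\<bar>s x (n + (m - n)) - s x n\<bar> \<le> 2 * C / 2 ^ n - 2 * C / 2 ^ (n + (m - n))" by (rule tel)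
    moreover have "2 * C / 2 ^ (n + (m - n)) \<ge> 0" using C by simp
    ultimately show ?thesis using that by simp
  qed
  have "convergent (s x)" for x
  proof -
    have "Cauchy (s x)"
    proof (rule metric_CauchyI)
      fix e :: real assume e: "e > 0"
      have "(\<lambda>n. 2 * (2 * C) * (1/2) ^ n) \<longlonglongrightarrow> 2 * (2 * C) * 0" by (intro tendsto_intros LIMSEQ_power_zero) auto
      then have "\<forall>\<^sub>F n in sequentially. 2 * (2 * C) * (1/2) ^ n < e" using e by (intro order_tendstoD(2)) auto
      then obtain M where M: "2 * (2 * C) * (1/2) ^ M < e" by (auto simp: eventually_sequentially)
      have "dist (s x m) (s x n) < e" if "m \<ge> M" "n \<ge> M" for m n
      proof -
        have "\<bar>s x m - s x n\<bar> \<le> 2 * C / 2 ^ M + 2 * C / 2 ^ M" using tel'[OF that(1), of x] tel'[OF that(2), of x] by linarith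
        also have "\<dots> = 2 * (2 * C) * (1/2) ^ M" by (simp add: power_divide)
        finally show ?thesis using M by (simp add: dist_real_def)
      qed
      then show "\<exists>M. \<forall>m\<ge>M. \<forall>n\<ge>M. dist (s x m) (s x n) < e" by blast
    qed
    then show ?thesis by (simp add: Cauchy_convergent_iff)
  qed
  then obtain A where A: "\<And>x. s x \<longlonglongrightarrow> A x" unfolding convergent_def by metis
  have close: "\<bar>\<phi> x - A x\<bar> \<le> 2 * C" for x
  proof -
    have "(\<lambda>n. \<bar>s x n - s x 0\<bar>) \<longlonglongrightarrow> \<bar>A x - s x 0\<bar>" by (intro tendsto_intros A)
    then have "\<bar>A x - s x 0\<bar> \<le> 2 * C" by (rule LIMSEQ_le_const2) (use tel'[of 0 _ x] in auto)
    then show ?thesis by (simp add: s_def abs_minus_commute)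
  qed
  have add: "A (x + y) = A x + A y" for x y
  proof -
    have le: "\<bar>s (x + y) n - s x n - s y n\<bar> \<le> C * (1/2) ^ n" for n
    proof -
      have "s (x + y) n - s x n - s y n = (\<phi> (2 ^ n *\<^sub>R x + 2 ^ n *\<^sub>R y) - \<phi> (2 ^ n *\<^sub>R x) - \<phi> (2 ^ n *\<^sub>R y)) / 2 ^ n"
        by (simp add: s_def diff_divide_distrib scaleR_add_right)
      then show ?thesis using q[of "2 ^ n *\<^sub>R x" "2 ^ n *\<^sub>R y"] by (simp add: power_divide divide_right_mono)
    qed
    have "(\<lambda>n. \<bar>s (x + y) n - s x n - s y n\<bar>) \<longlonglongrightarrow> \<bar>A (x + y) - A x - A y\<bar>" by (intro tendsto_intros A)
    moreover have "(\<lambda>n. C * (1/2) ^ n) \<longlonglongrightarrow> C * 0" by (intro tendsto_intros LIMSEQ_power_zero) auto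
    ultimately have "\<bar>A (x + y) - A x - A y\<bar> \<le> C * 0" by (rule LIMSEQ_le) (use le in auto)
    then show ?thesis by simp
  qed
  have bd: "\<exists>M. \<forall>x. norm x \<le> r \<longrightarrow> \<bar>A x\<bar> \<le> M" for r
  proof -
    have "compact (\<phi> ` cball 0 r)" by (intro compact_continuous_image continuous_on_subset[OF c]) auto
    from compact_imp_bounded[OF this] obtain M where M: "\<forall>z\<in>\<phi> ` cball 0 r. norm z \<le> M" unfolding bounded_iff by (rule exE)
    have "\<bar>A x\<bar> \<le> M + 2 * C" if "norm x \<le> r" for x
    proof -
      have "norm (\<phi> x) \<le> M" using M that by auto
      then show ?thesis using close[of x] by (simp add: abs_le_iff)
    qed
    then show ?thesis by blast
  qed
  obtain c where "\<And>x. A x = c \<bullet> x" using additive_bounded_linear[of A, OF add bd] by blast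
  then show ?thesis using close by metis
qed

context ap_tube begin

text \<open>The phase is quasi-additive. A translate by any \<open>t\<close> is close to one by some
  \<open>s\<close> in a finite net, so h(x + t) - h(x + s) varies by at most 2 in x, and each of the
  finitely many shifts by \<open>s\<close> changes the phase by a bounded amount.\<close>

theorem mean_motion_exists:
  assumes y: "y \<in> \<Omega>" and \<delta>: "\<delta> > 0" "\<And>x. \<delta> \<le> norm (f (cvec x y))"
    and h: "continuous_on UNIV h" "\<And>x. f (cvec x y) = exp (h x)"
  shows "\<exists>c C. \<forall>x. \<bar>Im (h x) - c \<bullet> x\<bar> \<le> C"
proof -
  note E = compactly_in_singleton[OF y]
  have d4: "\<delta> / 4 > 0" using \<delta> by simp
  obtain S where S: "finite S" "\<And>t. \<exists>s\<in>S. \<forall>x. norm (f (cvec (x + t) y) - f (cvec (x + s) y)) \<le> \<delta> / 4"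
    using finite_net[OF E d4] by auto
  obtain d where d: "d > 0" "\<And>x x'. norm (x - x') \<le> d \<Longrightarrow> norm (f (cvec x y) - f (cvec x' y)) \<le> \<delta> / 4"
    using uniformly_continuous_on_tube[OF E d4] by auto
  have inc: "\<bar>Im (h (x + s) - h x)\<bar> \<le> 2 * (1 / (d / (norm s + 1)) + 1)" for x s
  proof -
    have "\<bar>Im (h (x + 1 *\<^sub>R s) - h (x + 0 *\<^sub>R s))\<bar> \<le> 2 * (1 / (d / (norm s + 1)) + 1)"
    proof (rule log_increment[where k = "\<lambda>v. h (x + v *\<^sub>R s)" and L = 1])
      show "continuous_on {0..1} (\<lambda>v. h (x + v *\<^sub>R s))" by (intro continuous_on_compose2[OF h(1)] continuous_intros) auto
      show "d / (norm s + 1) > 0" using d(1) by (simp add: add_nonneg_pos)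
      fix v v' :: real assume vv: "\<bar>v - v'\<bar> \<le> d / (norm s + 1)"
      have "norm ((x + v' *\<^sub>R s) - (x + v *\<^sub>R s)) = \<bar>v - v'\<bar> * norm s"
        by (simp add: scaleR_diff_left[symmetric] abs_minus_commute)
      also have "\<dots> \<le> d / (norm s + 1) * (norm s + 1)" by (intro mult_mono vv) (use d in auto)
      also have "\<dots> = d" by (simp add: add_nonneg_eq_0_iff) 
      finally have "norm (f (cvec (x + v' *\<^sub>R s) y) - f (cvec (x + v *\<^sub>R s) y)) \<le> \<delta> / 4" by (rule d(2))
      also have "\<dots> < norm (f (cvec (x + v *\<^sub>R s) y)) / 2" using \<delta>(2)[of "x + v *\<^sub>R s"] \<delta>(1) by linarith
      finally show "norm (exp (h (x + v' *\<^sub>R s)) - exp (h (x + v *\<^sub>R s))) < norm (exp (h (x + v *\<^sub>R s))) / 2" unfolding h(2) .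
    qed simp
    then show ?thesis by simp
  qed
  define C1 where "C1 = Max (insert 0 ((\<lambda>s. 2 * (1 / (d / (norm s + 1)) + 1)) ` S))"
  have C1: "\<bar>Im (h (x + s) - h x)\<bar> \<le> C1" if "s \<in> S" for x s
    unfolding C1_def by (rule order_trans[OF inc Max_ge]) (use S(1) that in auto)
  define \<phi> where "\<phi> x = Im (h x - h 0)" for x
  have "\<bar>\<phi> (x + t) - \<phi> x - \<phi> t\<bar> \<le> 2 + 2 * C1" for x t
  proof -
    obtain s where s: "s \<in> S" "\<And>x. norm (f (cvec (x + t) y) - f (cvec (x + s) y)) \<le> \<delta> / 4" using S(2) by blast
    have "norm ((h (x + t) - h (x + s)) - (h (0 + t) - h (0 + s))) \<le> 2"
    proof (rule log_diff_le_2[where k = "\<lambda>x. h (x + t) - h (x + s)" and X = UNIV])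
      show "continuous_on UNIV (\<lambda>x. h (x + t) - h (x + s))" by (intro continuous_intros continuous_shift h(1))
      fix z
      have "exp (h (z + t) - h (z + s)) - 1 = (f (cvec (z + t) y) - f (cvec (z + s) y)) / f (cvec (z + s) y)"
        by (simp add: exp_diff h(2) diff_divide_distrib)
      moreover have "norm (f (cvec (z + t) y) - f (cvec (z + s) y)) < norm (f (cvec (z + s) y)) / 2"
        using s(2)[of z] \<delta>(2)[of "z + s"] \<delta>(1) by linarith
      ultimately show "norm (exp (h (z + t) - h (z + s)) - 1) < 1/2" using \<delta>(2)[of "z + s"] \<delta>(1)
        by (simp add: norm_divide divide_less_eq)
    qed auto
    then have "\<bar>Im ((h (x + t) - h (x + s)) - (h (0 + t) - h (0 + s)))\<bar> \<le> 2" using abs_Im_le_cmod order_trans by blast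
    moreover have "\<bar>Im (h (x + s) - h x)\<bar> \<le> C1" "\<bar>Im (h (0 + s) - h 0)\<bar> \<le> C1" using C1[OF s(1)] by blast+
    ultimately show ?thesis by (simp add: \<phi>_def abs_le_iff)
  qed
  moreover have "continuous_on UNIV \<phi>" unfolding \<phi>_def by (intro continuous_intros h(1))
  ultimately obtain c where c: "\<And>x. \<bar>\<phi> x - c \<bullet> x\<bar> \<le> 2 * (2 + 2 * C1)" using quasi_additive_linear[of \<phi>] by metis
  have "\<bar>Im (h x) - c \<bullet> x\<bar> \<le> 2 * (2 + 2 * C1) + \<bar>Im (h 0)\<bar>" for x
  proof -
    have "\<phi> x = Im (h x) - Im (h 0)" by (simp add: \<phi>_def)
    then show ?thesis using c[of x] by linarith
  qed
  then show ?thesis by blast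
qed

lemma log_exists:
  assumes "y \<in> \<Omega>" "\<And>x. f (cvec x y) \<noteq> 0"
  obtains h where "continuous_on UNIV h" "\<And>x. f (cvec x y) = exp (h x)"
proof -
  have "continuous_on UNIV (\<lambda>x. f (cvec x y))" by (intro continuous_intros assms)
  then show thesis
    using continuous_logarithm_on_contractible[OF _ convex_imp_contractible[OF convex_UNIV], of "\<lambda>x. f (cvec x y)"] assms(2) that
    by (metis UNIV_I)
qed

lemma ap_fun_ln:
  assumes y: "y \<in> \<Omega>" and \<delta>: "\<delta> > 0" "\<And>x. \<delta> \<le> norm (f (cvec x y))"
  shows "ap_fun (\<lambda>x. ln (norm (f (cvec x y))))"
  unfolding ap_fun_def
proof (intro conjI allI)
  have nz: "f (cvec x y) \<noteq> 0" for x using \<delta>(1) \<delta>(2)[of x] by auto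
  show "continuous_on UNIV (\<lambda>x. ln (norm (f (cvec x y))))" using nz by (intro continuous_intros y) auto
  fix t :: "nat \<Rightarrow> real^'p"
  obtain r :: "nat \<Rightarrow> nat" where r: "strict_mono r"
    "\<And>e. e > 0 \<Longrightarrow> \<exists>N. \<forall>m\<ge>N. \<forall>n\<ge>N. \<forall>x. norm (f (cvec (x + t (r m)) y) - f (cvec (x + t (r n)) y)) \<le> e"
    using ap_fun_subseq[OF ap_fun_slice[OF y], of t] by blast
  have lip: "\<bar>ln (norm a) - ln (norm b)\<bar> \<le> norm (a - b) / \<delta>" if "\<delta> \<le> norm a" "\<delta> \<le> norm b" for a b :: complex
  proof -
    have 1: "ln p - ln q \<le> \<bar>p - q\<bar> / \<delta>" if "\<delta> \<le> p" "\<delta> \<le> q" for p q :: real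
    proof -
      have pq: "p > 0" "q > 0" using that \<delta> by auto
      have "ln p - ln q \<le> (p - q) / q" using ln_diff_le[OF pq] .
      also have "\<dots> \<le> \<bar>p - q\<bar> / q" using pq by (intro divide_right_mono) auto
      also have "\<dots> \<le> \<bar>p - q\<bar> / \<delta>" using that \<delta> by (intro divide_left_mono) auto
      finally show ?thesis .
    qed
    have "\<bar>ln (norm a) - ln (norm b)\<bar> \<le> \<bar>norm a - norm b\<bar> / \<delta>"
      using 1[OF that] 1[OF that(2,1)] by (simp add: abs_le_iff abs_minus_commute)
    also have "\<dots> \<le> norm (a - b) / \<delta>" using \<delta> norm_triangle_ineq3[of a b] by (intro divide_right_mono) auto
    finally show ?thesis .
  qed
  show "\<exists>r::nat \<Rightarrow> nat. strict_mono r \<and> (\<forall>e>0. \<exists>N. \<forall>m\<ge>N. \<forall>n\<ge>N. \<forall>x. norm (ln (norm (f (cvec (x + t (r m)) y))) - ln (norm (f (cvec (x + t (r n)) y)))) \<le> e)"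
  proof (intro exI[of _ r] conjI r(1) allI impI)
    fix e :: real assume e: "e > 0"
    then obtain N where N: "\<forall>m\<ge>N. \<forall>n\<ge>N. \<forall>x. norm (f (cvec (x + t (r m)) y) - f (cvec (x + t (r n)) y)) \<le> e * \<delta>"
      using r(2)[of "e * \<delta>"] \<delta> by auto
    have "norm (ln (norm (f (cvec (x + t (r m)) y))) - ln (norm (f (cvec (x + t (r n)) y)))) \<le> e" if "m \<ge> N" "n \<ge> N" for m n x
    proof -
      have "norm (ln (norm (f (cvec (x + t (r m)) y))) - ln (norm (f (cvec (x + t (r n)) y)))) \<le>
         norm (f (cvec (x + t (r m)) y) - f (cvec (x + t (r n)) y)) / \<delta>" using lip[OF \<delta>(2) \<delta>(2)] by simp
      also have "\<dots> \<le> e" using N that \<delta>(1) by (simp add: divide_le_eq)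
      finally show ?thesis .
    qed
    then show "\<exists>N. \<forall>m\<ge>N. \<forall>n\<ge>N. \<forall>x. norm (ln (norm (f (cvec (x + t (r m)) y))) - ln (norm (f (cvec (x + t (r n)) y)))) \<le> e" by blast
  qed
qed

lemma jessen_lim:
  assumes "y \<in> \<Omega>" "\<delta> > 0" "\<And>x. \<delta> \<le> norm (f (cvec x y))"
  shows "(cube_mean (\<lambda>x. ln (norm (f (cvec x y)))) \<longlongrightarrow> jessen f y) at_top"
proof -
  obtain m where "(cube_mean (\<lambda>x. ln (norm (f (cvec x y)))) \<longlongrightarrow> m) at_top" using ap_fun_mean_exists[OF ap_fun_ln[OF assms]] by blast
  moreover from this have "jessen f y = m" unfolding jessen_def by (intro tendsto_Lim) auto
  ultimately show ?thesis by simp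
qed

end

section \<open>The gradient of the Jessen function\<close>

context ap_tube begin

text \<open>Over a segment near \<open>y\<close> a holomorphic logarithm exists on a strip, and its
  increment over [-T, T] is 2 i T (c . e) up to a bounded error, by comparison with
  \<open>h\<close>. The real part of \<open>rectangle_integral_bound\<close> then says that the mean
  of log |f| changes by exactly -(c . e) along the segment.\<close>

lemma jessen_local:
  assumes y: "y \<in> \<Omega>" and \<delta>: "\<delta> > 0" "\<And>x. \<delta> \<le> norm (f (cvec x y))"
    and h: "continuous_on UNIV h" "\<And>x. f (cvec x y) = exp (h x)" and hc: "\<And>x. \<bar>Im (h x) - c \<bullet> x\<bar> \<le> C"
  shows "\<exists>r>0. ball y r \<subseteq> \<Omega> \<and> (\<forall>a\<in>ball y r. (jessen f has_derivative (\<lambda>v. - (c \<bullet> v))) (at a))"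
proof -
  obtain r0 where r0: "r0 > 0" "ball y r0 \<subseteq> \<Omega>" "compactly_in (ball y r0) \<Omega>" using compactly_in_ball[OF y] by blast
  have d4: "\<delta> / 4 > 0" using \<delta> by simp
  obtain d where d: "d > 0" "\<And>x x' y1 y2. y1 \<in> ball y r0 \<Longrightarrow> y2 \<in> ball y r0 \<Longrightarrow> norm (x - x') \<le> d \<Longrightarrow> norm (y1 - y2) \<le> d \<Longrightarrow>
      norm (f (cvec x y1) - f (cvec x' y2)) \<le> \<delta> / 4"
    using uniformly_continuous_on_tube[OF r0(3) d4] by blast
  obtain B where B: "B > 0" "\<And>x y'. y' \<in> ball y r0 \<Longrightarrow> norm (f (cvec x y')) \<le> B" using bounded_on_tube[OF r0(3)] by blast
  define r where "r = min r0 d"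
  have r: "r > 0" using r0 d by (simp add: r_def)
  have rO: "a \<in> \<Omega>" if "a \<in> ball y r" for a using that r0(2) by (auto simp: r_def)
  have near: "norm (f (cvec x a) - f (cvec x y)) \<le> \<delta> / 4" if "a \<in> ball y r" for x a
    using that r0(1) d(1) by (intro d(2)) (auto simp: r_def dist_norm norm_minus_commute)
  have low: "\<delta> / 2 \<le> norm (f (cvec x a))" if "a \<in> ball y r" for x a
    using near[OF that, of x] \<delta>(2)[of x] \<delta>(1) norm_triangle_ineq2[of "f (cvec x y)" "f (cvec x a)"]
    by (simp add: norm_minus_commute)
  have d2: "\<delta> / 2 > 0" using \<delta> by simp
  have key: "jessen f b - jessen f a = - (c \<bullet> (b - a))" if a: "a \<in> ball y r" and b: "b \<in> ball y r" for a b
  proof -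
    define e where "e = b - a"
    define V where "V = {v. a + v *\<^sub>R e \<in> ball y r}"
    have oV: "open V"
    proof -
      have "continuous_on UNIV (\<lambda>v. a + v *\<^sub>R e)" by (intro continuous_intros)
      from open_vimage[OF open_ball this] show ?thesis by (simp only: V_def vimage_def)
    qed
    have cV: "convex V"
    proof (rule convexI)
      fix u v p q :: real assume *: "u \<in> V" "v \<in> V" "0 \<le> p" "0 \<le> q" "p + q = 1"
      have "p *\<^sub>R (a + u *\<^sub>R e) + q *\<^sub>R (a + v *\<^sub>R e) \<in> ball y r"
        using * by (intro convexD[OF convex_ball]) (auto simp only: V_def mem_Collect_eq)
      moreover have "p *\<^sub>R (a + u *\<^sub>R e) + q *\<^sub>R (a + v *\<^sub>R e) = a + (p *\<^sub>R u + q *\<^sub>R v) *\<^sub>R e"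
      proof -
        have "p *\<^sub>R a + q *\<^sub>R a = a" using *(5) by (simp flip: scaleR_add_left)
        then show ?thesis by (simp add: algebra_simps)
      qed
      ultimately show "p *\<^sub>R u + q *\<^sub>R v \<in> V" by (simp only: V_def mem_Collect_eq)
    qed
    have V01: "{0..1} \<subseteq> V"
    proof
      fix v :: real assume v: "v \<in> {0..1}"
      have "(1 - v) *\<^sub>R a + v *\<^sub>R b \<in> ball y r" using convexD_alt[OF convex_ball a b, of v] v by auto
      then show "v \<in> V" by (simp add: V_def e_def algebra_simps)
    qed
    \<comment> \<open>2 for the comparison of two logarithms, 2C for the phase of \<open>h\<close>
      at both ends, and the remaining terms for its real part, which lies between ln
      \<open>\<delta>\<close> and ln B.\<close>
    define C2 where "C2 = 1 + (2 * C + 2 * \<bar>ln B\<bar> + 2 * \<bar>ln \<delta>\<bar>) + 1"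
    define u where "u x = ln (norm (f (cvec x b))) - ln (norm (f (cvec x a)))" for x
    have la: "ap_fun (\<lambda>x. ln (norm (f (cvec x a))))" by (rule ap_fun_ln[OF rO[OF a] d2 low[OF a]])
    have lb: "ap_fun (\<lambda>x. ln (norm (f (cvec x b))))" by (rule ap_fun_ln[OF rO[OF b] d2 low[OF b]])
    have cu: "continuous_on UNIV u" unfolding u_def by (intro continuous_intros ap_fun_continuous la lb)
    obtain Ma Mb where M: "\<And>x. norm (ln (norm (f (cvec x a)))) \<le> Ma" "\<And>x. norm (ln (norm (f (cvec x b)))) \<le> Mb"
      using ap_fun_bounded[OF la] ap_fun_bounded[OF lb] by metis
    have bu: "norm (u x) \<le> Mb + Ma" for x unfolding u_def by (intro order_trans[OF norm_triangle_ineq4] add_mono M)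
    have lim: "(cube_mean u \<longlongrightarrow> jessen f b - jessen f a) at_top"
    proof -
      have "cube_mean u = (\<lambda>s. cube_mean (\<lambda>x. ln (norm (f (cvec x b)))) s - cube_mean (\<lambda>x. ln (norm (f (cvec x a)))) s)"
        unfolding u_def by (rule ext) (intro cube_mean_diff ap_fun_continuous la lb)
      then show ?thesis using tendsto_diff[OF jessen_lim[OF rO[OF b] d2 low[OF b]] jessen_lim[OF rO[OF a] d2 low[OF a]]] by simp
    qed
    have est: "norm ((jessen f b - jessen f a) - (- (c \<bullet> e))) \<le> C2 / (2 * T)" if T: "T > 0" for T
    proof -
      have av: "norm (integral {-T..T} (\<lambda>t. u (x + t *\<^sub>R e)) - (2 * T) *\<^sub>R (- (c \<bullet> e))) \<le> 2 * T * (C2 / (2 * T))" for x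
      proof -
        let ?S = "{w. Im w \<in> V}"
        define \<phi> where "\<phi> w = f (cvec (x + Re w *\<^sub>R e) (a + Im w *\<^sub>R e))" for w
        have hol: "\<phi> holomorphic_on ?S" unfolding \<phi>_def
          by (rule holomorphic_on_subset[OF line_holomorphic]) (use rO in \<open>auto simp: V_def\<close>)
        have nz: "\<phi> w \<noteq> 0" if "w \<in> ?S" for w
          using low[of "a + Im w *\<^sub>R e" "x + Re w *\<^sub>R e"] that \<delta>(1) by (auto simp: \<phi>_def V_def)
        have "convex ?S" using cV unfolding convex_def by (auto simp: scaleR_conv_of_real)
        then obtain G where G: "G holomorphic_on ?S" "\<And>w. w \<in> ?S \<Longrightarrow> \<phi> w = exp (G w)"
          using contractible_imp_holomorphic_log[OF hol convex_imp_contractible nz] by metis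
        have bound: "norm (G (Complex T v) - G (Complex (- T) v) - 2 * \<i> * of_real (T * (c \<bullet> e))) \<le> C2" if v: "v \<in> {0..1}" for v
        proof -
          have vV: "v \<in> V" using v V01 by blast
          then have vb: "a + v *\<^sub>R e \<in> ball y r" by (simp add: V_def)
          \<comment> \<open>The two functions being logarithmized differ by at most
            \<open>\<delta>/4\<close> along the line, so their quotient stays near 1 and the
            difference of the logarithms varies by at most 2.\<close>
          have "norm ((G (Complex T v) - h (x + T *\<^sub>R e)) - (G (Complex (- T) v) - h (x + (- T) *\<^sub>R e))) \<le> 2"
          proof (rule log_diff_le_2[where k = "\<lambda>s. G (Complex s v) - h (x + s *\<^sub>R e)" and X = UNIV])
            show "continuous_on UNIV (\<lambda>s. G (Complex s v) - h (x + s *\<^sub>R e))"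
            proof (intro continuous_intros)
              show "continuous_on UNIV (\<lambda>s. G (Complex s v))"
                by (rule continuous_on_compose2[OF holomorphic_on_imp_continuous_on[OF G(1)]])
                   (use vV in \<open>auto simp: Complex_eq intro!: continuous_intros\<close>)
              show "continuous_on UNIV (\<lambda>s. h (x + s *\<^sub>R e))"
                by (rule continuous_on_compose2[OF h(1)]) (auto intro!: continuous_intros)
            qed
            fix s
            have S: "Complex s v \<in> ?S" using vV by simp
            have "exp (G (Complex s v) - h (x + s *\<^sub>R e)) - 1 =
               (f (cvec (x + s *\<^sub>R e) (a + v *\<^sub>R e)) - f (cvec (x + s *\<^sub>R e) y)) / f (cvec (x + s *\<^sub>R e) y)"
              using \<delta>(1) \<delta>(2)[of "x + s *\<^sub>R e"] unfolding exp_diff G(2)[OF S, symmetric] h(2)[symmetric]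
              by (auto simp: \<phi>_def diff_divide_distrib)
            moreover have "norm (f (cvec (x + s *\<^sub>R e) (a + v *\<^sub>R e)) - f (cvec (x + s *\<^sub>R e) y)) < norm (f (cvec (x + s *\<^sub>R e) y)) / 2"
              using near[OF vb, of "x + s *\<^sub>R e"] \<delta>(1) \<delta>(2)[of "x + s *\<^sub>R e"] by linarith
            ultimately show "norm (exp (G (Complex s v) - h (x + s *\<^sub>R e)) - 1) < 1/2"
              using \<delta>(1) \<delta>(2)[of "x + s *\<^sub>R e"] by (simp add: norm_divide divide_less_eq)
          qed auto
          moreover have "norm (h (x + T *\<^sub>R e) - h (x + (- T) *\<^sub>R e) - 2 * \<i> * of_real (T * (c \<bullet> e))) \<le> 2 * C + 2 * \<bar>ln B\<bar> + 2 * \<bar>ln \<delta>\<bar>"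
          proof -
            define z where "z = h (x + T *\<^sub>R e) - h (x + (- T) *\<^sub>R e) - 2 * \<i> * of_real (T * (c \<bullet> e))"
            have re: "\<bar>Re (h w)\<bar> \<le> \<bar>ln B\<bar> + \<bar>ln \<delta>\<bar>" for w
            proof -
              have "norm (f (cvec w y)) = exp (Re (h w))" by (simp add: h(2))
              then have "Re (h w) = ln (norm (f (cvec w y)))" by simp
              moreover have "ln \<delta> \<le> ln (norm (f (cvec w y)))"
              proof -
                have "0 < norm (f (cvec w y))" using \<delta>(1) \<delta>(2)[of w] by linarith
                then show ?thesis using \<delta>(1) \<delta>(2)[of w] by (simp only: ln_le_cancel_iff)
              qed
              moreover have "ln (norm (f (cvec w y))) \<le> ln B"
              proof -
                have "0 < norm (f (cvec w y))" using \<delta>(1) \<delta>(2)[of w] by linarith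
                moreover have "norm (f (cvec w y)) \<le> B" using B(2)[of y w] r0(1) by simp
                ultimately show ?thesis using B(1) by (simp only: ln_le_cancel_iff)
              qed
              ultimately show ?thesis by linarith
            qed
            have "\<bar>Re z\<bar> \<le> 2 * \<bar>ln B\<bar> + 2 * \<bar>ln \<delta>\<bar>" using re[of "x + T *\<^sub>R e"] re[of "x + (- T) *\<^sub>R e"] unfolding z_def by simp
            moreover have "\<bar>Im z\<bar> \<le> 2 * C"
            proof -
              have "Im z = (Im (h (x + T *\<^sub>R e)) - c \<bullet> (x + T *\<^sub>R e)) - (Im (h (x + (- T) *\<^sub>R e)) - c \<bullet> (x + (- T) *\<^sub>R e))"
                by (simp add: z_def inner_add_right inner_diff_right)
              then show ?thesis using hc[of "x + T *\<^sub>R e"] hc[of "x + (- T) *\<^sub>R e"] by linarith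
            qed
            ultimately show ?thesis using cmod_le[of z] unfolding z_def by linarith
          qed
          moreover have "G (Complex T v) - G (Complex (- T) v) - 2 * \<i> * of_real (T * (c \<bullet> e)) =
            ((G (Complex T v) - h (x + T *\<^sub>R e)) - (G (Complex (- T) v) - h (x + (- T) *\<^sub>R e))) +
            (h (x + T *\<^sub>R e) - h (x + (- T) *\<^sub>R e) - 2 * \<i> * of_real (T * (c \<bullet> e)))" by simp
          ultimately show ?thesis unfolding C2_def by (smt (verit) norm_triangle_ineq)
        qed
        have R: "norm (integral {-T..T} (\<lambda>u. G (Complex u 1) - G (Complex u 0)) + of_real (2 * T * 1 * (c \<bullet> e))) \<le> C2 * 1"
          by (rule rectangle_integral_bound[OF G(1) oV cV V01 _ T bound]) auto
        have cG: "continuous_on {-T..T} (\<lambda>s. G (Complex s v))" if "v \<in> V" for v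
          by (rule continuous_on_compose2[OF holomorphic_on_imp_continuous_on[OF G(1)]])
             (use that in \<open>auto simp: Complex_eq intro!: continuous_intros\<close>)
        have V2: "0 \<in> V" "1 \<in> V" using V01 by auto
        have ReG: "Re (G (Complex s v)) = ln (norm (f (cvec (x + s *\<^sub>R e) (a + v *\<^sub>R e))))" if "v \<in> V" for s v
        proof -
          have "exp (G (Complex s v)) = f (cvec (x + s *\<^sub>R e) (a + v *\<^sub>R e))" using G(2)[of "Complex s v"] that by (simp add: \<phi>_def)
          then have "norm (f (cvec (x + s *\<^sub>R e) (a + v *\<^sub>R e))) = exp (Re (G (Complex s v)))" by (metis norm_exp_eq_Re)
          then show ?thesis by simp
        qed
        have "integral {-T..T} (\<lambda>s. u (x + s *\<^sub>R e)) = integral {-T..T} (\<lambda>s. Re (G (Complex s 1) - G (Complex s 0)))"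
          using ReG[OF V2(1)] ReG[OF V2(2)] by (simp add: u_def e_def)
        also have "\<dots> = Re (integral {-T..T} (\<lambda>s. G (Complex s 1) - G (Complex s 0)))"
          by (rule integral_linear[OF _ bounded_linear_Re, unfolded o_def])
             (intro integrable_continuous_real continuous_intros cG V2)
        finally have "integral {-T..T} (\<lambda>t. u (x + t *\<^sub>R e)) - (2 * T) *\<^sub>R (- (c \<bullet> e)) =
           Re (integral {-T..T} (\<lambda>u. G (Complex u 1) - G (Complex u 0)) + of_real (2 * T * 1 * (c \<bullet> e)))" by simp
        then have "norm (integral {-T..T} (\<lambda>t. u (x + t *\<^sub>R e)) - (2 * T) *\<^sub>R (- (c \<bullet> e))) \<le> C2"
          using R abs_Re_le_cmod[of "integral {-T..T} (\<lambda>u. G (Complex u 1) - G (Complex u 0)) + of_real (2 * T * 1 * (c \<bullet> e))"]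
          by (simp only: real_norm_def mult_1_right)
        then show ?thesis using T by simp
      qed
      show ?thesis using cube_mean_line_average[OF cu bu T lim av] by simp
    qed
    have "norm ((jessen f b - jessen f a) - (- (c \<bullet> e))) \<le> 0"
    proof (rule field_le_epsilon)
      fix \<epsilon> :: real assume \<epsilon>: "\<epsilon> > 0"
      define T where "T = (\<bar>C2\<bar> + 1) / \<epsilon>"
      have T: "T > 0" using \<epsilon> by (simp add: T_def add_nonneg_pos)
      have "C2 \<le> \<epsilon> * (2 * T)" using \<epsilon> by (simp add: T_def)
      then have "C2 / (2 * T) \<le> \<epsilon>" using T by (simp add: divide_le_eq)
      then show "norm ((jessen f b - jessen f a) - (- (c \<bullet> e))) \<le> 0 + \<epsilon>" using est[OF T] by linarith
    qed
    then show ?thesis by (simp add: e_def)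
  qed
  have "(jessen f has_derivative (\<lambda>v. - (c \<bullet> v))) (at a)" if a: "a \<in> ball y r" for a
  proof (rule has_derivative_transform_within_open[OF _ open_ball a])
    show "((\<lambda>b. jessen f a - c \<bullet> (b - a)) has_derivative (\<lambda>v. - (c \<bullet> v))) (at a)"
      by (auto intro!: derivative_eq_intros)
    show "jessen f a - c \<bullet> (b - a) = jessen f b" if "b \<in> ball y r" for b using key[OF a that] by simp
  qed
  moreover have "ball y r \<subseteq> \<Omega>" using rO by blast
  ultimately show ?thesis using r by blast
qed

lemma inner_derivative_unique:
  fixes c c' :: "real^'p"
  assumes "(J has_derivative (\<lambda>v. - (c \<bullet> v))) (at a)" "(J has_derivative (\<lambda>v. - (c' \<bullet> v))) (at a)"
  shows "c = c'"
proof -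
  have "(\<lambda>v. - (c \<bullet> v)) = (\<lambda>v. - (c' \<bullet> v))" by (rule has_derivative_unique[OF assms])
  then have "- (c \<bullet> (c - c')) = - (c' \<bullet> (c - c'))" by meson
  then have "(c - c') \<bullet> (c - c') = 0" by (simp add: inner_diff_left)
  then show ?thesis by simp
qed

text \<open>The gradient of the Jessen function is locally constant on a connected set, so the phase
  over a single fibre determines the value selected by the definite description in
  \<open>mean_motion\<close>.\<close>

lemma mean_motion_eq:
  assumes U: "connected U" "U \<subseteq> \<Omega>" "y0 \<in> U" and low: "\<And>y. y \<in> U \<Longrightarrow> \<exists>\<delta>>0. \<forall>x. \<delta> \<le> norm (f (cvec x y))"
    and h: "continuous_on UNIV h" "\<And>x. f (cvec x y0) = exp (h x)" and hc: "\<And>x. \<bar>Im (h x) - c \<bullet> x\<bar> \<le> C"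
  shows "mean_motion f U = c"
proof -
  have "\<exists>c. \<exists>r>0. \<forall>a\<in>ball y r. (jessen f has_derivative (\<lambda>v. - (c \<bullet> v))) (at a)" if y: "y \<in> U" for y
  proof -
    obtain \<delta> where \<delta>: "\<delta> > 0" "\<And>x. \<delta> \<le> norm (f (cvec x y))" using low[OF y] by blast
    have yO: "y \<in> \<Omega>" using y U by blast
    have nz: "f (cvec x y) \<noteq> 0" for x using \<delta>(1) \<delta>(2)[of x] by auto
    obtain h' where h': "continuous_on UNIV h'" "\<And>x. f (cvec x y) = exp (h' x)" using log_exists[OF yO nz] by blast
    obtain c' C' where "\<forall>x. \<bar>Im (h' x) - c' \<bullet> x\<bar> \<le> C'" using mean_motion_exists[OF yO \<delta> h'] by blast
    then show ?thesis using jessen_local[OF yO \<delta> h', of c' C'] by blast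
  qed
  then obtain cf r where cf: "\<And>y. y \<in> U \<Longrightarrow> r y > 0" "\<And>y a. y \<in> U \<Longrightarrow> a \<in> ball y (r y) \<Longrightarrow> (jessen f has_derivative (\<lambda>v. - (cf y \<bullet> v))) (at a)"
    by metis
  have at: "(jessen f has_derivative (\<lambda>v. - (cf y \<bullet> v))) (at y)" if "y \<in> U" for y using cf(2)[OF that] cf(1)[OF that] by simp
  have const: "cf y = cf y'" if "y \<in> U" "y' \<in> U" for y y'
  proof (rule connected_local_const[OF U(1) that], intro ballI)
    fix a assume a: "a \<in> U"
    have "cf a = cf b" if "b \<in> U" "dist b a < r a" for b
      using cf(2)[OF a, of b] at[OF that(1)] that(2) by (intro inner_derivative_unique) (auto simp: dist_commute)
    then show "\<forall>\<^sub>F b in at a within U. cf a = cf b"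
      using cf(1)[OF a] by (auto simp: eventually_at)
  qed
  obtain \<delta> where \<delta>: "\<delta> > 0" "\<And>x. \<delta> \<le> norm (f (cvec x y0))" using low[OF U(3)] by blast
  have yO: "y0 \<in> \<Omega>" using U by blast
  have "(jessen f has_derivative (\<lambda>v. - (c \<bullet> v))) (at y0)" using jessen_local[OF yO \<delta> h hc] by fastforce
  then have c0: "cf y0 = c" using at[OF U(3)] inner_derivative_unique by blast
  show ?thesis unfolding mean_motion_def
  proof (rule the_equality)
    show "\<forall>y\<in>U. (jessen f has_derivative (\<lambda>h. - (c \<bullet> h))) (at y)" using at const[OF _ U(3)] c0 by metis
    show "c' = c" if "\<forall>y\<in>U. (jessen f has_derivative (\<lambda>h. - (c' \<bullet> h))) (at y)" for c'
      using that at[OF U(3)] U(3) c0 inner_derivative_unique by blast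
  qed
qed

end

subsection \<open>Rational bases and Kronecker's theorem\<close>

text \<open>Viewed as spaces over the rationals, \<open>real^'p\<close> and the reals are linked by
  the additive maps, which can be prescribed freely on a rationally independent set.\<close>

interpretation QV: vector_space "\<lambda>(q::rat) (x::real^'p). of_rat q *\<^sub>R x"
  by unfold_locales (auto simp: of_rat_add of_rat_mult algebra_simps)

interpretation QR: vector_space "\<lambda>(q::rat) (x::real). of_rat q * x"
  by unfold_locales (auto simp: of_rat_add of_rat_mult algebra_simps)

interpretation QP: vector_space_pair "\<lambda>(q::rat) (x::real^'p). of_rat q *\<^sub>R x" "\<lambda>(q::rat) (x::real). of_rat q * x"
  by unfold_locales

text \<open>The last clause is the alternative used to detect membership in the rational span: an element outside
  it is separated from \<open>\<Lambda>\<close> by an additive (not necessarily continuous) functional.\<close>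

lemma rational_basis:
  fixes \<Lambda> :: "(real^'p) set"
  assumes "finite \<Lambda>"
  shows "\<exists>(k::nat) lam (\<psi> :: nat \<Rightarrow> real^'p \<Rightarrow> real). (\<forall>j<k. lam j \<in> \<Lambda>) \<and>
     (\<forall>n :: nat \<Rightarrow> int. (\<Sum>j<k. of_int (n j) *\<^sub>R lam j) = 0 \<longrightarrow> (\<forall>j<k. n j = 0)) \<and>
     (\<forall>j<k. (\<forall>x y. \<psi> j (x + y) = \<psi> j x + \<psi> j y) \<and> (\<forall>i<k. \<psi> j (lam i) = (if i = j then 1 else 0))) \<and>
     (\<forall>c. (\<exists>q :: nat \<Rightarrow> rat. c = (\<Sum>j<k. of_rat (q j) *\<^sub>R lam j)) \<or>
        (\<exists>\<xi> :: real^'p \<Rightarrow> real. (\<forall>x y. \<xi> (x + y) = \<xi> x + \<xi> y) \<and> \<xi> c = 1 \<and> (\<forall>l\<in>\<Lambda>. \<xi> l = 0)))"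
proof -
  obtain B where B: "B \<subseteq> \<Lambda>" "QV.independent B" "\<Lambda> \<subseteq> QV.span B" by (rule QV.maximal_independent_subset)
  have fB: "finite B" using B(1) assms finite_subset by blast
  obtain e where e: "bij_betw e {..<card B} B" using ex_bij_betw_nat_finite[OF fB] by (auto simp: atLeast0LessThan)
  define k where "k = card B"
  have eB: "e j \<in> B" if "j < k" for j using e that by (auto simp: bij_betw_def k_def)
  have inj: "inj_on e {..<k}" using e by (simp add: bij_betw_def k_def)
  have re: "(\<Sum>j<k. g (e j)) = (\<Sum>v\<in>B. g v)" for g :: "real^'p \<Rightarrow> real^'p"
    unfolding k_def by (rule sum.reindex_bij_betw[OF e])
  define iv where "iv = inv_into {..<k} e"
  have iv: "iv (e j) = j" if "j < k" for j using inv_into_f_f[OF inj, of j] that by (simp add: iv_def)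
  have "\<exists>g. Vector_Spaces.linear (\<lambda>(q::rat) (x::real^'p). of_rat q *\<^sub>R x) (\<lambda>(q::rat) (x::real). of_rat q * x) g \<and>
      (\<forall>x\<in>B. g x = (if iv x = j then 1 else 0))" for j
    by (rule QP.linear_independent_extend[OF B(2)])
  then obtain \<psi> where \<psi>: "\<And>j. Vector_Spaces.linear (\<lambda>(q::rat) (x::real^'p). of_rat q *\<^sub>R x) (\<lambda>(q::rat) (x::real). of_rat q * x) (\<psi> j)"
      "\<And>j x. x \<in> B \<Longrightarrow> \<psi> j x = (if iv x = j then 1 else 0)" by metis
  show ?thesis
  proof (rule exI[of _ k], rule exI[of _ e], rule exI[of _ \<psi>], intro conjI allI impI)
    show "e j \<in> \<Lambda>" if "j < k" for j using eB[OF that] B(1) by blast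
  next
    fix n :: "nat \<Rightarrow> int" and j assume 0: "(\<Sum>j<k. of_int (n j) *\<^sub>R e j) = 0" and j: "j < k"
    have "(\<Sum>v\<in>B. of_rat (of_int (n (iv v))) *\<^sub>R v) = (\<Sum>j<k. of_rat (of_int (n (iv (e j)))) *\<^sub>R e j)"
      by (rule re[symmetric])
    also have "\<dots> = (\<Sum>j<k. of_int (n j) *\<^sub>R e j)" by (rule sum.cong) (auto simp: iv)
    finally have "(\<Sum>v\<in>B. of_rat (of_int (n (iv v))) *\<^sub>R v) = 0" using 0 by simp
    from QV.independentD[OF B(2) fB order_refl this eB[OF j]] show "n j = 0" by (simp add: iv[OF j])
  next
    show "\<psi> j (x + y) = \<psi> j x + \<psi> j y" for j x y
    proof -
      interpret l: Vector_Spaces.linear "\<lambda>(q::rat) (x::real^'p). of_rat q *\<^sub>R x" "\<lambda>(q::rat) (x::real). of_rat q * x" "\<psi> j" by (rule \<psi>(1))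
      show ?thesis by (rule l.add)
    qed
  next
    show "\<psi> j (e i) = (if i = j then 1 else 0)" if "j < k" "i < k" for i j using \<psi>(2)[OF eB[OF that(2)]] iv[OF that(2)] by simp
  next
    fix c
    show "(\<exists>q :: nat \<Rightarrow> rat. c = (\<Sum>j<k. of_rat (q j) *\<^sub>R e j)) \<or>
        (\<exists>\<xi> :: real^'p \<Rightarrow> real. (\<forall>x y. \<xi> (x + y) = \<xi> x + \<xi> y) \<and> \<xi> c = 1 \<and> (\<forall>l\<in>\<Lambda>. \<xi> l = 0))"
    proof (cases "c \<in> QV.span B")
      case True
      then obtain u where "c = (\<Sum>v\<in>B. of_rat (u v) *\<^sub>R v)" unfolding QV.span_finite[OF fB] by blast
      then have "c = (\<Sum>j<k. of_rat (u (e j)) *\<^sub>R e j)" using re[of "\<lambda>v. of_rat (u v) *\<^sub>R v"] by simp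
      then show ?thesis by (intro disjI1 exI[of _ "\<lambda>j. u (e j)"])
    next
      case False
      then have "QV.independent (insert c B)" using B(2) QV.independent_insert by metis
      from QP.linear_independent_extend[OF this, of "\<lambda>x. if x = c then 1 else 0"]
      obtain g where g: "Vector_Spaces.linear (\<lambda>(q::rat) (x::real^'p). of_rat q *\<^sub>R x) (\<lambda>(q::rat) (x::real). of_rat q * x) g"
        "\<forall>x\<in>insert c B. g x = (if x = c then 1 else 0)" by (elim exE conjE)
      have cB: "c \<notin> B" using False QV.span_base by blast
      interpret g: Vector_Spaces.linear "\<lambda>(q::rat) (x::real^'p). of_rat q *\<^sub>R x" "\<lambda>(q::rat) (x::real). of_rat q * x" g by (rule g(1))
      have "g l = 0" if "l \<in> \<Lambda>" for l
      proof -
        have "l \<in> QV.span B" using B(3) that by blast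
        then show ?thesis by (rule QP.linear_eq_0_on_span[OF g(1), rotated]) (use g(2) cB in auto)
      qed
      then show ?thesis using g(2) g.add by (intro disjI2 exI[of _ g]) auto
    qed
  qed
qed

lemma additive_scale_int:
  fixes \<psi> :: "'a::real_vector \<Rightarrow> real"
  assumes add: "\<And>x y. \<psi> (x + y) = \<psi> x + \<psi> y"
  shows "\<psi> (of_int n *\<^sub>R x) = of_int n * \<psi> x" "\<psi> 0 = 0" "\<psi> (sum g A) = (\<Sum>a\<in>A. \<psi> (g a))"
proof -
  show z: "\<psi> 0 = 0" using add[of 0 0] by simp
  have m: "\<psi> (- x) = - \<psi> x" for x using add[of x "- x"] z by simp
  have n: "\<psi> (of_nat n *\<^sub>R x) = of_nat n * \<psi> x" for n by (induction n) (auto simp: z add algebra_simps)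
  show "\<psi> (of_int n *\<^sub>R x) = of_int n * \<psi> x" by (cases n rule: int_cases2) (auto simp: n m)
  show "\<psi> (sum g A) = (\<Sum>a\<in>A. \<psi> (g a))" by (induction A rule: infinite_finite_induct) (auto simp: z add)
qed

lemma additive_scale_rat:
  fixes \<psi> :: "'a::real_vector \<Rightarrow> real"
  assumes add: "\<And>x y. \<psi> (x + y) = \<psi> x + \<psi> y"
  shows "\<psi> (of_rat q *\<^sub>R x) = of_rat q * \<psi> x"
proof -
  obtain a b :: int where q: "q = of_int a / of_int b" "b \<noteq> 0" by (metis Fract_of_int_quotient Rat_cases less_irrefl)
  have "of_int b * \<psi> (of_rat q *\<^sub>R x) = \<psi> (of_int b *\<^sub>R of_rat q *\<^sub>R x)" by (rule additive_scale_int[OF add, symmetric])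
  also have "of_int b *\<^sub>R of_rat q *\<^sub>R x = of_int a *\<^sub>R x" using q by (simp add: of_rat_divide)
  also have "\<psi> \<dots> = of_int a * \<psi> x" by (rule additive_scale_int[OF add])
  finally have F: "of_int b * \<psi> (of_rat q *\<^sub>R x) = of_int a * \<psi> x" .
  have "\<psi> (of_rat q *\<^sub>R x) = (of_int b * \<psi> (of_rat q *\<^sub>R x)) / of_int b" using q(2) by simp
  also have "\<dots> = of_int a / of_int b * \<psi> x" unfolding F by simp
  also have "of_int a / of_int b = (of_rat q :: real)" unfolding q(1) by (simp add: of_rat_divide)
  finally show ?thesis .
qed

lemma common_denominator:
  fixes Q :: "rat set"
  assumes "finite Q" shows "\<exists>M::int. M > 0 \<and> (\<forall>q\<in>Q. \<exists>a. of_int M * q = of_int a)"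
  using assms
proof (induction Q rule: finite_induct)
  case empty then show ?case by (intro exI[of _ 1]) auto
next
  case (insert q Q)
  then obtain M where M: "M > 0" "\<forall>q\<in>Q. \<exists>a. of_int M * q = of_int a" by blast
  obtain a b where q: "q = Fract a b" "b > 0" by (cases q)
  have "\<exists>c. of_int (M * b) * p = of_int c" if "p \<in> insert q Q" for p
  proof (cases "p = q")
    case True
    have "of_int b * q = of_int a" using q by (simp add: Fract_of_int_quotient)
    then have "of_int (M * b) * p = of_int (M * a)" using True by (simp add: mult.assoc)
    then show ?thesis by blast
  next
    case False
    then have "p \<in> Q" using that by simp
    then obtain c where c: "of_int M * p = of_int c" using M(2) by (elim ballE exE) auto
    have "of_int (M * b) * p = of_int b * (of_int M * p)" by simp
    also have "\<dots> = of_int (b * c)" by (simp only: c of_int_mult)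
    finally show ?thesis by (rule exI)
  qed
  then show ?case using M(1) q(2) by (intro exI[of _ "M * b"]) auto
qed

text \<open>Prescribed phases on \<open>\<Lambda>\<close> can be obstructed only by rational
  relations, and an additive \<open>\<psi>\<close> respects all of these. It suffices to move along
  one generic line b = t h on which a rational basis of \<open>\<Lambda>\<close> stays independent;
  there the one-dimensional theorem applies.\<close>

theorem Kronecker_additive:
  fixes \<Lambda> :: "(real^'p) set" and \<psi> :: "real^'p \<Rightarrow> real"
  assumes fin: "finite \<Lambda>" and add: "\<And>x y. \<psi> (x + y) = \<psi> x + \<psi> y" and \<epsilon>: "\<epsilon> > 0"
  shows "\<exists>b. \<forall>l\<in>\<Lambda>. \<exists>n::int. \<bar>l \<bullet> b - \<psi> l - 2 * pi * of_int n\<bar> < \<epsilon>"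
proof -
  from rational_basis[OF fin] obtain k :: nat and lam and \<psi>' :: "nat \<Rightarrow> real^'p \<Rightarrow> real" where R:
     "\<forall>n :: nat \<Rightarrow> int. (\<Sum>j<k. of_int (n j) *\<^sub>R lam j) = 0 \<longrightarrow> (\<forall>j<k. n j = 0)"
     "\<forall>c. (\<exists>q :: nat \<Rightarrow> rat. c = (\<Sum>j<k. of_rat (q j) *\<^sub>R lam j)) \<or>
        (\<exists>\<xi> :: real^'p \<Rightarrow> real. (\<forall>x y. \<xi> (x + y) = \<xi> x + \<xi> y) \<and> \<xi> c = 1 \<and> (\<forall>l\<in>\<Lambda>. \<xi> l = 0))"
    by (elim exE conjE)
  note lam = R(1)[rule_format]
  have "\<exists>q :: nat \<Rightarrow> rat. l = (\<Sum>j<k. of_rat (q j) *\<^sub>R lam j)" if "l \<in> \<Lambda>" for l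
  proof (rule ccontr)
    assume "\<not> ?thesis"
    then obtain \<xi> :: "real^'p \<Rightarrow> real" where "\<xi> l = 1" "\<forall>l\<in>\<Lambda>. \<xi> l = 0" using R(2)[rule_format, of l] by blast
    then show False using that by simp
  qed
  then have "\<forall>l\<in>\<Lambda>. \<exists>q :: nat \<Rightarrow> rat. l = (\<Sum>j<k. of_rat (q j) *\<^sub>R lam j)" by blast
  from bchoice[OF this] obtain q :: "real^'p \<Rightarrow> nat \<Rightarrow> rat" where q': "\<forall>l\<in>\<Lambda>. l = (\<Sum>j<k. of_rat (q l j) *\<^sub>R lam j)" by (rule exE)
  note q = bspec[OF q']
  have "finite ((\<lambda>(l, j). q l j) ` (\<Lambda> \<times> {..<k}))" using fin by simp
  from common_denominator[OF this] obtain M :: int where M: "M > 0" "\<And>l j. l \<in> \<Lambda> \<Longrightarrow> j < k \<Longrightarrow> \<exists>a. of_int M * q l j = of_int a"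
    by auto
  define A where "A l j = (SOME a. of_int M * q l j = of_int a)" for l j
  have A: "of_int M * q l j = of_int (A l j)" if "l \<in> \<Lambda>" "j < k" for l j
    unfolding A_def by (rule someI_ex[OF M(2)[OF that]])
  have qA: "(of_rat (q l j) :: real) = of_int (A l j) / of_int M" if "l \<in> \<Lambda>" "j < k" for l j
  proof -
    have "of_rat (of_int M * q l j) = (of_rat (of_int (A l j)) :: real)" using A[OF that] by simp
    then have "of_int M * of_rat (q l j) = (of_int (A l j) :: real)" by (simp add: of_rat_mult)
    then show ?thesis using M(1) by (simp add: field_simps)
  qed
  define comb where "comb n = (\<Sum>j<k. of_int (n j) *\<^sub>R lam j)" for n :: "nat \<Rightarrow> int"
  \<comment> \<open>The nonzero integer combinations of the basis, a countable set; a direction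
    orthogonal to none of them keeps the numbers \<open>lam j \<bullet> h\<close> independent over
    the integers.\<close>
  define Z where "Z = comb ` (PiE {..<k} (\<lambda>_. UNIV)) - {0}"
  have combZ: "comb n \<in> Z \<or> comb n = 0" for n
  proof -
    have "comb n = comb (restrict n {..<k})" by (simp add: comb_def)
    then show ?thesis by (auto simp: Z_def)
  qed
  have cZ: "countable Z" unfolding Z_def by (intro countable_Diff countable_image countable_PiE) auto
  have Z0: "0 \<notin> Z" by (simp add: Z_def)
  from generic_direction[OF cZ Z0] obtain h where h': "\<forall>z\<in>Z. z \<bullet> h \<noteq> 0" by (elim exE conjE)
  note h = bspec[OF h']
  have indep: "\<forall>j<k. n j = 0" if "(\<Sum>j<k. of_int (n j) * (lam j \<bullet> h)) = 0" for n :: "nat \<Rightarrow> int"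
  proof -
    have "comb n \<bullet> h = 0" using that by (simp add: comb_def inner_sum_left)
    then have "comb n = 0" using combZ h by blast
    then show ?thesis using lam[of n] by (simp add: comb_def)
  qed
  \<comment> \<open>The factor \<open>M\<close> provides for the denominators: integer multiples of
    2 pi M at the basis vectors become integer multiples of 2 pi on all of
    \<open>\<Lambda>\<close>.\<close>
  define \<theta> where "\<theta> j = (lam j \<bullet> h) / (2 * pi * of_int M)" for j
  have \<theta>0: "(\<Sum>j<k. of_int (n j) * \<theta> j) = 0 \<Longrightarrow> \<forall>j<k. n j = 0" for n :: "nat \<Rightarrow> int"
  proof -
    assume "(\<Sum>j<k. of_int (n j) * \<theta> j) = 0"
    then have "(\<Sum>j<k. of_int (n j) * (lam j \<bullet> h)) / (2 * pi * of_int M) = 0" by (simp add: \<theta>_def sum_divide_distrib)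
    then have "(\<Sum>j<k. of_int (n j) * (lam j \<bullet> h)) = 0" using M(1) by simp
    then show "\<forall>j<k. n j = 0" by (rule indep)
  qed
  have inj: "inj_on \<theta> {..<k}"
  proof (rule inj_onI, rule ccontr)
    fix i j assume ij: "i \<in> {..<k}" "j \<in> {..<k}" "\<theta> i = \<theta> j" "i \<noteq> j"
    define n :: "nat \<Rightarrow> int" where "n m = (if m = i then 1 else 0) - (if m = j then 1 else 0)" for m
    have "(\<Sum>m<k. of_int (n m) * \<theta> m) = (\<Sum>m<k. (if m = i then \<theta> m else 0) - (if m = j then \<theta> m else 0))"
      by (rule sum.cong) (auto simp: n_def)
    also have "\<dots> = 0" using ij by (simp add: sum_subtractf)
    finally have "\<forall>m<k. n m = 0" by (rule \<theta>0)
    then show False using ij by (auto simp: n_def)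
  qed
  interpret ZM: Modules.module "\<lambda>r. (*) (real_of_int r)" by unfold_locales (auto simp: algebra_simps)
  have ind: "ZM.independent (\<theta> ` {..<k})"
    unfolding ZM.independent_explicit_module
  proof (intro allI impI)
    fix t u v assume t: "finite t" "t \<subseteq> \<theta> ` {..<k}" "(\<Sum>v\<in>t. real_of_int (u v) * v) = 0" "v \<in> t"
    define n where "n j = (if \<theta> j \<in> t then u (\<theta> j) else 0)" for j
    have "(\<Sum>j<k. of_int (n j) * \<theta> j) = (\<Sum>v\<in>\<theta> ` {..<k}. of_int (if v \<in> t then u v else 0) * v)"
      by (subst sum.reindex[OF inj]) (auto simp: n_def intro!: sum.cong)
    also have "\<dots> = (\<Sum>v\<in>t. real_of_int (u v) * v)"
      by (rule sum.mono_neutral_cong_right) (use t in auto)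
    finally have "\<forall>j<k. n j = 0" using \<theta>0 t(3) by simp
    moreover obtain j where "j < k" "v = \<theta> j" using t(2,4) by blast
    ultimately show "u v = 0" using t(4) by (auto simp: n_def)
  qed
  define W where "W = (\<Sum>l\<in>\<Lambda>. \<Sum>j<k. \<bar>real_of_int (A l j)\<bar>) + 1"
  have W: "W > 0" unfolding W_def by (intro add_nonneg_pos sum_nonneg) auto
  define \<epsilon>' where "\<epsilon>' = \<epsilon> / (2 * pi * W)"
  have \<epsilon>': "\<epsilon>' > 0" using \<epsilon> W by (simp add: \<epsilon>'_def)
  obtain t H where tH: "\<And>i. i < k \<Longrightarrow> \<bar>t * \<theta> i - of_int (H i) - \<psi> (lam i) / (2 * pi * of_int M)\<bar> < \<epsilon>'"
    using Kronecker_thm_1[OF ind inj \<epsilon>', of "\<lambda>i. \<psi> (lam i) / (2 * pi * of_int M)"] by blast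
  have "\<exists>n::int. \<bar>l \<bullet> (t *\<^sub>R h) - \<psi> l - 2 * pi * of_int n\<bar> < \<epsilon>" if l: "l \<in> \<Lambda>" for l
  proof
    have lq: "l = (\<Sum>j<k. of_rat (q l j) *\<^sub>R lam j)" by (rule q[OF l])
    have "\<psi> l = (\<Sum>j<k. \<psi> (of_rat (q l j) *\<^sub>R lam j))" by (subst lq) (rule additive_scale_int(3)[OF add])
    also have "\<dots> = (\<Sum>j<k. of_rat (q l j) * \<psi> (lam j))"
      by (simp only: additive_scale_rat[OF add])
    also have "\<dots> = (\<Sum>j<k. of_int (A l j) / of_int M * \<psi> (lam j))"
      by (rule sum.cong) (auto simp: qA[OF l])
    finally have pl: "\<psi> l = (\<Sum>j<k. of_int (A l j) / of_int M * \<psi> (lam j))" .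
    have "l \<bullet> (t *\<^sub>R h) = (\<Sum>j<k. of_rat (q l j) * (lam j \<bullet> (t *\<^sub>R h)))"
      by (subst lq) (simp only: inner_sum_left inner_scaleR_left)
    also have "\<dots> = (\<Sum>j<k. of_int (A l j) / of_int M * (lam j \<bullet> (t *\<^sub>R h)))" by (rule sum.cong) (auto simp: qA[OF l])
    finally have "l \<bullet> (t *\<^sub>R h) - \<psi> l - 2 * pi * of_int (\<Sum>j<k. A l j * H j) =
      (\<Sum>j<k. of_int (A l j) / of_int M * (lam j \<bullet> (t *\<^sub>R h)) - of_int (A l j) / of_int M * \<psi> (lam j) - 2 * pi * of_int (A l j * H j))"
      unfolding pl by (simp add: sum_subtractf sum_distrib_left)
    also have "\<dots> = (\<Sum>j<k. 2 * pi * of_int (A l j) * (t * \<theta> j - of_int (H j) - \<psi> (lam j) / (2 * pi * of_int M)))"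
    proof (rule sum.cong[OF refl])
      fix j
      have alg: "a / m * (t * x) - a / m * P - 2 * pi * (a * H) = 2 * pi * a * (t * (x / (2 * pi * m)) - H - P / (2 * pi * m))"
        if "m > 0" for a m x P H :: real
        using that by (simp add: field_simps)
      show "of_int (A l j) / of_int M * (lam j \<bullet> (t *\<^sub>R h)) - of_int (A l j) / of_int M * \<psi> (lam j) - 2 * pi * of_int (A l j * H j)
        = 2 * pi * of_int (A l j) * (t * \<theta> j - of_int (H j) - \<psi> (lam j) / (2 * pi * of_int M))"
        unfolding \<theta>_def inner_scaleR_right of_int_mult by (rule alg) (use M(1) in simp)
    qed
    also have "\<bar>\<dots>\<bar> \<le> (\<Sum>j<k. 2 * pi * \<bar>of_int (A l j)\<bar> * \<epsilon>')"
    proof (intro order_trans[OF sum_abs] sum_mono)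
      fix j assume "j \<in> {..<k}"
      then have "\<bar>t * \<theta> j - of_int (H j) - \<psi> (lam j) / (2 * pi * of_int M)\<bar> \<le> \<epsilon>'"
        by (intro tH[THEN less_imp_le]) simp
      then show "\<bar>2 * pi * of_int (A l j) * (t * \<theta> j - of_int (H j) - \<psi> (lam j) / (2 * pi * of_int M))\<bar>
        \<le> 2 * pi * \<bar>of_int (A l j)\<bar> * \<epsilon>'" by (simp only: abs_mult) (intro mult_mono, auto)
    qed
    also have "\<dots> = 2 * pi * \<epsilon>' * (\<Sum>j<k. \<bar>real_of_int (A l j)\<bar>)" by (simp add: sum_distrib_left mult_ac)
    also have "\<dots> < 2 * pi * \<epsilon>' * W"
    proof (rule mult_strict_left_mono)
      have "(\<Sum>j<k. \<bar>real_of_int (A l j)\<bar>) \<le> (\<Sum>l\<in>\<Lambda>. \<Sum>j<k. \<bar>real_of_int (A l j)\<bar>)"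
        by (rule member_le_sum[OF l]) (auto intro!: sum_nonneg fin)
      then show "(\<Sum>j<k. \<bar>real_of_int (A l j)\<bar>) < W" by (simp add: W_def)
    qed (use \<epsilon>' in simp)
    also have "\<dots> = \<epsilon>" using W by (simp add: \<epsilon>'_def)
    finally show "\<bar>l \<bullet> (t *\<^sub>R h) - \<psi> l - 2 * pi * of_int (\<Sum>j<k. A l j * H j)\<bar> < \<epsilon>" .
  qed
  then show ?thesis by blast
qed

subsection \<open>Almost periods with prescribed drift\<close>

lemma Ln_mult_near_one:
  assumes "norm (u - 1) \<le> 1/4" "norm (v - 1) \<le> 1/4"
  shows "Ln (u * v) = Ln u + Ln v"
proof -
  have "norm (Ln u) \<le> 1/2" "norm (Ln v) \<le> 1/2"
    using norm_Ln_ratio_le[of u] norm_Ln_ratio_le[of v] assms by linarith+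
  then have "\<bar>Im (Ln u)\<bar> \<le> 1/2" "\<bar>Im (Ln v)\<bar> \<le> 1/2"
    using abs_Im_le_cmod order_trans by blast+
  moreover have "u \<noteq> 0" "v \<noteq> 0" using assms by auto
  ultimately show ?thesis using pi_gt3 by (intro Ln_times_simple) auto
qed

lemma norm_divide_minus_one_le:
  assumes "norm (u - v) \<le> r * norm v" "v \<noteq> (0::complex)"
  shows "norm (u / v - 1) \<le> r"
proof -
  have "u / v - 1 = (u - v) / v" using assms(2) by (simp add: field_simps)
  then have "norm (u / v - 1) = norm (u - v) / norm v" by (simp add: norm_divide)
  then show ?thesis using assms by (simp add: divide_le_eq)
qed

context ap_tube begin

text \<open>\<open>wt l\<close> bounds the term of frequency \<open>l\<close> on the whole of
  \<open>D\<close>, so that the effect of a shift \<open>a\<close> is controlled by the numbers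
  \<open>chr l a - 1\<close> alone, uniformly in the height.\<close>

definition approximant :: "(real^'p) set \<Rightarrow> real \<Rightarrow> (real^'p) set \<Rightarrow> (real^'p \<Rightarrow> complex) \<Rightarrow> (real^'p \<Rightarrow> real) \<Rightarrow> bool" where
  "approximant D e \<Lambda> b wt \<longleftrightarrow> finite \<Lambda> \<and> (\<forall>x. \<forall>y\<in>D. norm (f (cvec x y) - (\<Sum>l\<in>\<Lambda>. b l * em l x y)) \<le> e) \<and>
     (\<forall>l. 0 \<le> wt l) \<and> (\<forall>l. \<forall>y\<in>D. norm (b l) * exp (- (l \<bullet> y)) \<le> wt l)"

lemma approximant_exists:
  assumes D: "compactly_in D \<Omega>" and e: "e > 0"
  shows "\<exists>\<Lambda> b wt. \<Lambda> \<subseteq> spec \<Omega> f \<and> approximant D e \<Lambda> b wt"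
proof -
  from exponential_polynomial_approximation[OF D e] obtain \<Lambda> b where A: "finite \<Lambda>" "\<Lambda> \<subseteq> spec \<Omega> f"
    "\<forall>x. \<forall>y\<in>D. norm (f (cvec x y) - (\<Sum>l\<in>\<Lambda>. b l * em l x y)) \<le> e" by (elim exE conjE)
  obtain B where B: "\<And>y. y \<in> D \<Longrightarrow> norm y \<le> B" using D unfolding compactly_in_def bounded_iff by blast
  have "approximant D e \<Lambda> b (\<lambda>l. norm (b l) * exp (norm l * B))" unfolding approximant_def
  proof (intro conjI A allI ballI)
    fix l y assume y: "y \<in> D"
    have "- (l \<bullet> y) \<le> norm l * norm y" using Cauchy_Schwarz_ineq2[of l y] by linarith
    also have "\<dots> \<le> norm l * B" by (intro mult_left_mono B[OF y]) simp
    finally show "norm (b l) * exp (- (l \<bullet> y)) \<le> norm (b l) * exp (norm l * B)" by (intro mult_left_mono) auto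
  qed auto
  with A(2) show ?thesis by blast
qed

lemma approximant_shift:
  assumes A: "approximant D e \<Lambda> b wt" and y: "y \<in> D" and r: "\<And>l. l \<in> \<Lambda> \<Longrightarrow> norm (chr l a - 1) \<le> r l"
  shows "norm (f (cvec (x + a) y) - f (cvec x y)) \<le> 2 * e + (\<Sum>l\<in>\<Lambda>. wt l * r l)"
proof -
  let ?P = "\<lambda>x. \<Sum>l\<in>\<Lambda>. b l * em l x y"
  have 1: "norm (f (cvec x y) - ?P x) \<le> e" for x using A y by (simp add: approximant_def)
  have "?P (x + a) - ?P x = (\<Sum>l\<in>\<Lambda>. b l * em l x y * (chr l a - 1))"
    unfolding sum_subtractf[symmetric] by (rule sum.cong) (auto simp: em_def chr_simps(2) algebra_simps)
  also have "norm \<dots> \<le> (\<Sum>l\<in>\<Lambda>. wt l * r l)"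
  proof (rule order_trans[OF norm_sum], rule sum_mono)
    fix l assume l: "l \<in> \<Lambda>"
    have "norm (b l * em l x y) = norm (b l) * exp (- (l \<bullet> y))" by (simp add: norm_mult em_def chr_simps)
    also have "\<dots> \<le> wt l" using A y by (simp add: approximant_def)
    finally show "norm (b l * em l x y * (chr l a - 1)) \<le> wt l * r l"
      using r[OF l] A by (subst norm_mult, intro mult_mono) (auto simp: approximant_def)
  qed
  finally have 2: "norm (?P (x + a) - ?P x) \<le> (\<Sum>l\<in>\<Lambda>. wt l * r l)" .
  have "norm (u - v) \<le> 2 * e + S" if "norm (u - p) \<le> e" "norm (v - q) \<le> e" "norm (p - q) \<le> S" for u v p q :: complex and S
    using that by norm
  from this[OF 1 1 2] show ?thesis .
qed

text \<open>The increment of \<open>h\<close> under the shift is a principal logarithm plus one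
  constant 2 pi i n. Iterating the shift N times and comparing with c . (N b) gives N |c . b - 2 pi
  n| at most N/4 + 2C; for large N only 1/4 remains, whatever \<open>C\<close> is.\<close>

lemma small_shift_log:
  assumes h: "continuous_on UNIV h" "\<And>x. f (cvec x y) = exp (h x)" and hc: "\<And>x. \<bar>Im (h x) - c \<bullet> x\<bar> \<le> C"
    and b: "\<And>x. norm (f (cvec (x + b) y) - f (cvec x y)) \<le> (1/8) * norm (f (cvec x y))"
  shows "\<exists>n::int. \<bar>c \<bullet> b - 2 * pi * of_int n\<bar> \<le> 1/4 \<and> (\<forall>x. h (x + b) - h x = Ln (f (cvec (x + b) y) / f (cvec x y)) + 2 * pi * of_int n * \<i>)"
proof -
  have ex: "exp (h (x + b) - h x) = f (cvec (x + b) y) / f (cvec x y)" for x by (simp add: exp_diff h(2))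
  have near: "norm (exp (h (x + b) - h x) - 1) \<le> 1/8" for x
    unfolding ex by (rule norm_divide_minus_one_le[OF b]) (simp add: h(2))
  have "continuous_on UNIV (\<lambda>x. h (x + b) - h x)"
    by (intro continuous_intros continuous_on_compose2[OF h(1)] h(1)) auto
  moreover have "norm (exp (h (x + b) - h x) - 1) < 1/2" for x using near[of x] by linarith
  ultimately have "\<exists>n::int. \<forall>x\<in>UNIV. h (x + b) - h x = Ln (exp (h (x + b) - h x)) + 2 * pi * of_int n * \<i>"
    by (intro log_branch[OF connected_UNIV])
  then obtain n :: int where n: "\<And>x. h (x + b) - h x = Ln (exp (h (x + b) - h x)) + 2 * pi * of_int n * \<i>" by blast
  have "\<bar>Im (h (x + b) - h x) - 2 * pi * of_int n\<bar> \<le> 1/4" for x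
  proof -
    have "norm (Ln (exp (h (x + b) - h x))) \<le> 1/4" using norm_Ln_ratio_le[of "exp (h (x + b) - h x)"] near[of x] by linarith
    then have "\<bar>Im (Ln (exp (h (x + b) - h x)))\<bar> \<le> 1/4" using abs_Im_le_cmod order_trans by blast
    moreover have "Im (h (x + b) - h x) = Im (Ln (exp (h (x + b) - h x))) + 2 * pi * of_int n" by (subst n) simp
    ultimately show ?thesis by linarith
  qed note st = this
  have it: "\<bar>Im (h (real N *\<^sub>R b) - h 0) - real N * (2 * pi * of_int n)\<bar> \<le> real N / 4" for N
  proof (induction N)
    case (Suc N)
    have "real (Suc N) *\<^sub>R b = real N *\<^sub>R b + b" by (simp add: algebra_simps)
    then have "Im (h (real (Suc N) *\<^sub>R b) - h 0) = Im (h (real N *\<^sub>R b + b) - h (real N *\<^sub>R b)) + Im (h (real N *\<^sub>R b) - h 0)" by simp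
    moreover have "real (Suc N) * (2 * pi * of_int n) = real N * (2 * pi * of_int n) + 2 * pi * of_int n" by (simp add: algebra_simps)
    moreover have "real (Suc N) / 4 = real N / 4 + 1 / 4" by simp
    ultimately show ?case using Suc st[of "real N *\<^sub>R b"] by linarith
  qed simp
  have bd: "real N * \<bar>c \<bullet> b - 2 * pi * of_int n\<bar> \<le> real N / 4 + 2 * C" for N
  proof -
    have "\<bar>Im (h (real N *\<^sub>R b)) - real N * (c \<bullet> b)\<bar> \<le> C" using hc[of "real N *\<^sub>R b"] by simp
    moreover have "\<bar>Im (h 0)\<bar> \<le> C" using hc[of 0] by simp
    ultimately have "\<bar>real N * (c \<bullet> b) - real N * (2 * pi * of_int n)\<bar> \<le> real N / 4 + 2 * C"
      using it[of N] unfolding minus_complex.simps by linarith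
    moreover have "real N * (c \<bullet> b) - real N * (2 * pi * of_int n) = real N * (c \<bullet> b - 2 * pi * of_int n)" by (simp add: algebra_simps)
    ultimately show ?thesis by (simp add: abs_mult)
  qed
  have "\<bar>c \<bullet> b - 2 * pi * of_int n\<bar> \<le> 1/4"
  proof (rule ccontr)
    assume "\<not> ?thesis"
    then have p: "\<bar>c \<bullet> b - 2 * pi * of_int n\<bar> - 1/4 > 0" by simp
    obtain N where "2 * C < real N * (\<bar>c \<bullet> b - 2 * pi * of_int n\<bar> - 1/4)" using ex_less_of_nat_mult[OF p] by blast
    then show False using bd[of N] by (simp add: algebra_simps)
  qed
  then show ?thesis using n unfolding ex by blast
qed

text \<open>One step \<open>s\<close> with drift \<open>\<psi>/m\<close> is small even relative to
  \<open>\<delta>\<close>, so \<open>small_shift_log\<close> follows the logarithm over each fibre;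
  the sum of \<open>m\<close> steps still moves f by at most \<open>\<epsilon>\<close>. Thus
  \<open>\<delta>\<close> and \<open>C\<close> influence only the choice of \<open>m\<close>, and
  the condition on \<open>\<psi>\<close> involves nothing but \<open>\<epsilon>\<close> and its
  approximant. The index set lets several fibres share one almost period.\<close>

lemma almost_period_with_drift:
  fixes c :: "'i \<Rightarrow> real^'p" and \<psi> :: "real^'p \<Rightarrow> real"
  assumes D: "compactly_in D \<Omega>" and I: "finite I" and yy: "\<And>i. i \<in> I \<Longrightarrow> yy i \<in> D"
    and \<delta>: "\<delta> > 0" "\<And>i x. i \<in> I \<Longrightarrow> \<delta> \<le> norm (f (cvec x (yy i)))"
    and h: "\<And>i. i \<in> I \<Longrightarrow> continuous_on UNIV (h i)" "\<And>i x. i \<in> I \<Longrightarrow> f (cvec x (yy i)) = exp (h i x)"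
    and hc: "\<And>i x. i \<in> I \<Longrightarrow> \<bar>Im (h i x) - c i \<bullet> x\<bar> \<le> C"
    and add: "\<And>a b. \<psi> (a + b) = \<psi> a + \<psi> b"
    and A: "approximant D (\<epsilon> / 4) \<Lambda> b wt" and sw: "(\<Sum>l\<in>\<Lambda>. wt l * \<bar>\<psi> l\<bar>) \<le> \<epsilon> / 4" and e: "\<epsilon> > 0" "\<eta> > 0"
  shows "\<exists>a (J :: 'i \<Rightarrow> int). (\<forall>x. \<forall>y\<in>D. norm (f (cvec (x + a) y) - f (cvec x y)) \<le> \<epsilon>) \<and>
     (\<forall>i\<in>I. \<bar>c i \<bullet> a - \<psi> (c i) - 2 * pi * of_int (J i)\<bar> \<le> \<eta>) \<and>
     (\<forall>i\<in>I. \<forall>x. 4 * \<epsilon> \<le> norm (f (cvec x (yy i))) \<longrightarrow>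
        h i (x + a) - h i x = Ln (f (cvec (x + a) (yy i)) / f (cvec x (yy i))) + 2 * pi * of_int (J i) * \<i>)"
proof -
  have "\<delta> / 32 > 0" using \<delta> by simp
  from approximant_exists[OF D this] obtain \<Lambda>2 b2 wt2 where A2: "approximant D (\<delta> / 32) \<Lambda>2 b2 wt2" by (elim exE conjE)
  have wt: "\<And>l. 0 \<le> wt l" "\<And>l. 0 \<le> wt2 l" "finite \<Lambda>" "finite \<Lambda>2" using A A2 by (auto simp: approximant_def)
  define W W2 S2 SI where "W = (\<Sum>l\<in>\<Lambda>. wt l)" and "W2 = (\<Sum>l\<in>\<Lambda>2. wt2 l)"
    and "S2 = (\<Sum>l\<in>\<Lambda>2. wt2 l * \<bar>\<psi> l\<bar>)" and "SI = (\<Sum>i\<in>I. \<bar>\<psi> (c i)\<bar>)"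
  have pos: "W \<ge> 0" "W2 \<ge> 0" "S2 \<ge> 0" "SI \<ge> 0" unfolding W_def W2_def S2_def SI_def using wt by (auto intro!: sum_nonneg)
  \<comment> \<open>Makes the drift per step negligible against \<open>\<delta>\<close> on the finer
    spectrum \<open>\<Lambda>2\<close> and at most 1/4 at each mean motion.\<close>
  obtain m :: nat where m: "real m > max 1 (max (32 * S2 / \<delta>) (4 * SI))" using reals_Archimedean2 by blast
  have m1: "real m > 0" "S2 / real m \<le> \<delta> / 32" "\<And>i. i \<in> I \<Longrightarrow> \<bar>\<psi> (c i)\<bar> / real m \<le> 1/4"
  proof -
    show m0: "real m > 0" using m by linarith
    have "32 * S2 < real m * \<delta>" using m \<delta> by (simp add: divide_less_eq)
    then show "S2 / real m \<le> \<delta> / 32" using m0 by (simp add: field_simps)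
    fix i assume i: "i \<in> I"
    have "\<bar>\<psi> (c i)\<bar> \<le> SI" unfolding SI_def by (rule member_le_sum[OF i]) (auto simp: I)
    then have "4 * \<bar>\<psi> (c i)\<bar> \<le> real m" using m by linarith
    then show "\<bar>\<psi> (c i)\<bar> / real m \<le> 1/4" using m0 by (simp add: field_simps)
  qed
  \<comment> \<open>In order: m steps accumulate an error of at most \<open>\<eta>\<close> in the
    drift, and an allowable error in the almost period; one step is small relative to
    \<open>\<delta>\<close>; and the integers produced by Kronecker's theorem can be identified
    below.\<close>
  define \<kappa> where "\<kappa> = Min {\<eta> / real m, \<epsilon> / (4 * (W + 1) * real m), \<delta> / (32 * (W2 + 1)), 1/4}"
  have \<kappa>0: "\<kappa> > 0" unfolding \<kappa>_def using e \<delta> m1 pos by simp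
  have \<kappa>4: "\<kappa> \<le> 1/4" unfolding \<kappa>_def by (rule Min_le) simp_all
  have "\<kappa> \<le> \<eta> / real m" "\<kappa> \<le> \<epsilon> / (4 * (W + 1) * real m)" "\<kappa> \<le> \<delta> / (32 * (W2 + 1))"
    unfolding \<kappa>_def by (rule Min_le; simp only: finite.intros insert_iff simp_thms)+
  then have \<kappa>: "real m * \<kappa> \<le> \<eta>" "W * (real m * \<kappa>) \<le> \<epsilon> / 4" "W2 * \<kappa> \<le> \<delta> / 32"
  proof -
    assume k: "\<kappa> \<le> \<eta> / real m" "\<kappa> \<le> \<epsilon> / (4 * (W + 1) * real m)" "\<kappa> \<le> \<delta> / (32 * (W2 + 1))"
    show "real m * \<kappa> \<le> \<eta>" using k(1) m1(1) by (simp add: field_simps)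
    have "real m * \<kappa> \<le> \<epsilon> / 4 / (W + 1)" using mult_left_mono[OF k(2), of "real m"] m1(1) by simp
    then have "real m * \<kappa> * (W + 1) \<le> \<epsilon> / 4" by (rule pos_le_divide_eq[THEN iffD1, rotated]) (use pos in simp)
    then have "(W + 1) * (real m * \<kappa>) \<le> \<epsilon> / 4" by (simp only: mult.commute)
    moreover have "W * (real m * \<kappa>) \<le> (W + 1) * (real m * \<kappa>)" using \<kappa>0 m1(1) by (intro mult_right_mono) auto
    ultimately show "W * (real m * \<kappa>) \<le> \<epsilon> / 4" by linarith
    have "\<kappa> \<le> \<delta> / 32 / (W2 + 1)" using k(3) by simp
    then have "\<kappa> * (W2 + 1) \<le> \<delta> / 32" by (rule pos_le_divide_eq[THEN iffD1, rotated]) (use pos in simp)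
    then have "(W2 + 1) * \<kappa> \<le> \<delta> / 32" by (simp only: mult.commute)
    moreover have "W2 * \<kappa> \<le> (W2 + 1) * \<kappa>" using \<kappa>0 by (intro mult_right_mono) auto
    ultimately show "W2 * \<kappa> \<le> \<delta> / 32" by linarith
  qed
  have "\<And>a b. \<psi> (a + b) / real m = \<psi> a / real m + \<psi> b / real m" by (simp add: add add_divide_distrib)
  from Kronecker_additive[OF _ this \<kappa>0, of "\<Lambda> \<union> \<Lambda>2 \<union> c ` I"] wt(3,4) I
  obtain s where s: "\<forall>l\<in>\<Lambda> \<union> \<Lambda>2 \<union> c ` I. \<exists>n::int. \<bar>l \<bullet> s - \<psi> l / real m - 2 * pi * of_int n\<bar> < \<kappa>" by auto
  have ch: "norm (chr l (real k *\<^sub>R s) - 1) \<le> real k * (\<bar>\<psi> l\<bar> / real m + \<kappa>)" if l: "l \<in> \<Lambda> \<union> \<Lambda>2" for l k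
  proof -
    obtain n :: int where n: "\<bar>l \<bullet> s - \<psi> l / real m - 2 * pi * of_int n\<bar> < \<kappa>" using s l by blast
    have n': "\<bar>l \<bullet> s - 2 * pi * of_int n\<bar> \<le> \<bar>\<psi> l\<bar> / real m + \<kappa>"
      using n m1(1) abs_triangle_ineq[of "l \<bullet> s - \<psi> l / real m - 2 * pi * of_int n" "\<psi> l / real m"] by simp
    have one: "cis (2 * pi * of_int (int k * n)) = 1" by (rule cis_multiple_2pi) simp
    have "norm (chr l (real k *\<^sub>R s) - 1) = norm (cis (l \<bullet> (real k *\<^sub>R s)) - cis (2 * pi * of_int (int k * n)))"
      unfolding one chr_def ..
    also have "\<dots> \<le> \<bar>l \<bullet> (real k *\<^sub>R s) - 2 * pi * of_int (int k * n)\<bar>" by (rule norm_cis_diff_le)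
    also have "\<dots> = \<bar>real k * (l \<bullet> s - 2 * pi * of_int n)\<bar>" by (simp add: algebra_simps)
    also have "\<dots> = real k * \<bar>l \<bullet> s - 2 * pi * of_int n\<bar>" by (simp add: abs_mult)
    also have "\<dots> \<le> real k * (\<bar>\<psi> l\<bar> / real m + \<kappa>)" by (intro mult_left_mono n') simp
    finally show ?thesis .
  qed
  \<comment> \<open>Needed for every k up to \<open>m\<close>, not only for the end point, since the
    logarithms are added along all intermediate points.\<close>
  have per: "norm (f (cvec (x + real k *\<^sub>R s) y) - f (cvec x y)) \<le> \<epsilon>" if k: "k \<le> m" and y: "y \<in> D" for k x y
  proof -
    have "norm (f (cvec (x + real k *\<^sub>R s) y) - f (cvec x y)) \<le> 2 * (\<epsilon> / 4) + (\<Sum>l\<in>\<Lambda>. wt l * (\<bar>\<psi> l\<bar> + real m * \<kappa>))"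
    proof (rule approximant_shift[OF A y])
      fix l assume "l \<in> \<Lambda>"
      then have "norm (chr l (real k *\<^sub>R s) - 1) \<le> real k * (\<bar>\<psi> l\<bar> / real m + \<kappa>)" by (intro ch) simp
      also have "\<dots> \<le> real m * (\<bar>\<psi> l\<bar> / real m + \<kappa>)" using k \<kappa>0 by (intro mult_right_mono) auto
      also have "\<dots> = \<bar>\<psi> l\<bar> + real m * \<kappa>" using m1(1) by (simp add: field_simps)
      finally show "norm (chr l (real k *\<^sub>R s) - 1) \<le> \<bar>\<psi> l\<bar> + real m * \<kappa>" .
    qed
    also have "(\<Sum>l\<in>\<Lambda>. wt l * (\<bar>\<psi> l\<bar> + real m * \<kappa>)) = (\<Sum>l\<in>\<Lambda>. wt l * \<bar>\<psi> l\<bar>) + W * (real m * \<kappa>)"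
      by (simp add: W_def distrib_left sum.distrib sum_distrib_right)
    finally show ?thesis using sw \<kappa>(2) by linarith
  qed
  have small: "norm (f (cvec (x + s) (yy i)) - f (cvec x (yy i))) \<le> (1/8) * norm (f (cvec x (yy i)))" if i: "i \<in> I" for i x
  proof -
    have "norm (f (cvec (x + s) (yy i)) - f (cvec x (yy i))) \<le> 2 * (\<delta> / 32) + (\<Sum>l\<in>\<Lambda>2. wt2 l * (\<bar>\<psi> l\<bar> / real m + \<kappa>))"
      using ch[of _ 1] by (intro approximant_shift[OF A2 yy[OF i]]) auto
    also have "(\<Sum>l\<in>\<Lambda>2. wt2 l * (\<bar>\<psi> l\<bar> / real m + \<kappa>)) = S2 / real m + W2 * \<kappa>"
      by (simp add: W2_def S2_def distrib_left sum.distrib sum_distrib_right sum_divide_distrib)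
    finally show ?thesis using m1(2) \<kappa>(3) \<delta>(2)[OF i, of x] by linarith
  qed
  have "\<forall>i\<in>I. \<exists>n::int. \<bar>c i \<bullet> s - 2 * pi * of_int n\<bar> \<le> 1/4 \<and>
     (\<forall>x. h i (x + s) - h i x = Ln (f (cvec (x + s) (yy i)) / f (cvec x (yy i))) + 2 * pi * of_int n * \<i>)"
    using small_shift_log[OF h hc small] by blast
  from bchoice[OF this] obtain n :: "'i \<Rightarrow> int" where n: "\<And>i. i \<in> I \<Longrightarrow> \<bar>c i \<bullet> s - 2 * pi * of_int (n i)\<bar> \<le> 1/4"
     "\<And>i x. i \<in> I \<Longrightarrow> h i (x + s) - h i x = Ln (f (cvec (x + s) (yy i)) / f (cvec x (yy i))) + 2 * pi * of_int (n i) * \<i>" by blast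
  define a where "a = real m *\<^sub>R s"
  show ?thesis
  proof (rule exI[of _ a], rule exI[of _ "\<lambda>i. int m * n i"], intro conjI allI ballI impI)
    show "norm (f (cvec (x + a) y) - f (cvec x y)) \<le> \<epsilon>" if "y \<in> D" for x y
      unfolding a_def by (rule per) (use that in auto)
    fix i assume i: "i \<in> I"
    obtain n' :: int where n': "\<bar>c i \<bullet> s - \<psi> (c i) / real m - 2 * pi * of_int n'\<bar> < \<kappa>" using s i by blast
    have "\<bar>2 * pi * of_int (n i) - 2 * pi * of_int n'\<bar> \<le> 3/4"
    proof -
      have "\<bar>\<psi> (c i) / real m\<bar> \<le> 1/4" using m1(3)[OF i] m1(1) by simp
      then show ?thesis using n' n(1)[OF i] \<kappa>4 by linarith
    qed
    moreover have "2 * pi * of_int (n i) - 2 * pi * of_int n' = 2 * pi * of_int (n i - n')" by (simp add: algebra_simps)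
    ultimately have "2 * pi * \<bar>of_int (n i - n')\<bar> \<le> 3/4" by (simp add: abs_mult)
    \<comment> \<open>The integer counting the winding of the logarithm and the one from Kronecker's
      theorem lie within 3/4 of each other after multiplication by 2 pi, so they agree. This ties
      the drift of the phase to \<open>\<psi> (c i)\<close>.\<close>
    have "n i = n'"
    proof (rule ccontr)
      assume "n i \<noteq> n'"
      then have "1 \<le> \<bar>real_of_int (n i - n')\<bar>" by linarith
      then have "2 * pi * 1 \<le> 2 * pi * \<bar>real_of_int (n i - n')\<bar>" by (intro mult_left_mono) auto
      then show False using \<open>2 * pi * \<bar>of_int (n i - n')\<bar> \<le> 3/4\<close> pi_gt3 by linarith
    qed
    have "\<bar>c i \<bullet> a - \<psi> (c i) - 2 * pi * of_int (int m * n i)\<bar> = \<bar>real m * (c i \<bullet> s - \<psi> (c i) / real m - 2 * pi * of_int (n i))\<bar>"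
      using m1(1) by (simp add: a_def right_diff_distrib mult_ac)
    also have "\<dots> = real m * \<bar>c i \<bullet> s - \<psi> (c i) / real m - 2 * pi * of_int (n i)\<bar>" by (simp add: abs_mult)
    also have "\<dots> \<le> real m * \<kappa>" using n' \<open>n i = n'\<close> by (intro mult_left_mono) auto
    finally show "\<bar>c i \<bullet> a - \<psi> (c i) - 2 * pi * of_int (int m * n i)\<bar> \<le> \<eta>" using \<kappa>(1) by linarith
    fix x assume big: "4 * \<epsilon> \<le> norm (f (cvec x (yy i)))"
    let ?F = "\<lambda>k. f (cvec (x + real k *\<^sub>R s) (yy i))"
    have nz: "f (cvec x' (yy i)) \<noteq> 0" for x' using h(2)[OF i] by simp
    \<comment> \<open>Where |f| is at least 4 \<open>\<epsilon>\<close>, every intermediate value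
      has ratio within 1/4 of 1 to the first, and so has each single step; hence the principal
      logarithms add without jumps.\<close>
    have "k \<le> m \<Longrightarrow> h i (x + real k *\<^sub>R s) - h i x = Ln (?F k / f (cvec x (yy i))) + 2 * pi * of_int (int k * n i) * \<i>" for k
    proof (induction k)
      case 0 then show ?case using nz by simp
    next
      case (Suc k)
      have eq: "x + real (Suc k) *\<^sub>R s = x + real k *\<^sub>R s + s" by (simp add: algebra_simps)
      have "norm (?F k / f (cvec x (yy i)) - 1) \<le> 1/4"
        by (rule norm_divide_minus_one_le) (use per[of k "yy i" x] Suc(2) yy[OF i] big nz in auto)
      moreover have "norm (f (cvec (x + real k *\<^sub>R s + s) (yy i)) / ?F k - 1) \<le> 1/4"
      proof (rule norm_divide_minus_one_le)
        show "norm (f (cvec (x + real k *\<^sub>R s + s) (yy i)) - ?F k) \<le> 1/4 * norm (?F k)"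
          using small[OF i, of "x + real k *\<^sub>R s"] norm_ge_zero[of "?F k"] by linarith
      qed (rule nz)
      ultimately have "Ln (?F k / f (cvec x (yy i)) * (f (cvec (x + real k *\<^sub>R s + s) (yy i)) / ?F k)) =
         Ln (?F k / f (cvec x (yy i))) + Ln (f (cvec (x + real k *\<^sub>R s + s) (yy i)) / ?F k)" by (rule Ln_mult_near_one)
      moreover have "?F k / f (cvec x (yy i)) * (f (cvec (x + real k *\<^sub>R s + s) (yy i)) / ?F k) = ?F (Suc k) / f (cvec x (yy i))"
        unfolding eq using nz by simp
      ultimately have L: "Ln (?F (Suc k) / f (cvec x (yy i))) = Ln (?F k / f (cvec x (yy i))) + Ln (f (cvec (x + real k *\<^sub>R s + s) (yy i)) / ?F k)" by simp
      have "h i (x + real (Suc k) *\<^sub>R s) - h i x = (h i (x + real k *\<^sub>R s + s) - h i (x + real k *\<^sub>R s)) + (h i (x + real k *\<^sub>R s) - h i x)"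
        unfolding eq by simp
      then show ?case unfolding L n(2)[OF i] using Suc by (simp add: algebra_simps)
    qed
    from this[of m] show "h i (x + a) - h i x = Ln (f (cvec (x + a) (yy i)) / f (cvec x (yy i))) + 2 * pi * of_int (int m * n i) * \<i>"
      by (simp add: a_def)
  qed
qed

text \<open>A functional vanishing on \<open>\<Lambda>\<close> satisfies the smallness condition for
  every multiple s. For large s the fibre would have to drift by s although its phase over an almost
  period is known up to 3/2 + 2C; that \<open>C\<close> depends on the fibre does no harm because s
  is free.\<close>

lemma mean_motion_in_span:
  fixes \<xi> :: "real^'p \<Rightarrow> real"
  assumes D: "compactly_in D \<Omega>" and y: "y \<in> D" and \<delta>: "\<delta> > 0" "\<And>x. \<delta> \<le> norm (f (cvec x y))"
    and h: "continuous_on UNIV h" "\<And>x. f (cvec x y) = exp (h x)" and hc: "\<And>x. \<bar>Im (h x) - c \<bullet> x\<bar> \<le> C"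
    and add: "\<And>a b. \<xi> (a + b) = \<xi> a + \<xi> b" and \<xi>: "\<xi> c = 1" "\<And>l. l \<in> \<Lambda> \<Longrightarrow> \<xi> l = 0"
    and A: "approximant D (\<epsilon> / 4) \<Lambda> b wt" and e: "\<epsilon> > 0" and big: "4 * \<epsilon> \<le> norm (f (cvec x y))"
  shows False
proof -
  have C: "0 \<le> C" using hc[of 0] by linarith
  \<comment> \<open>Just above 1 + 1/2 + 2C: the error in the drift, the principal logarithm, and
    the deviation of the phase from c . x at two points.\<close>
  define s where "s = 2 + 2 * C"
  have "\<And>a b. s * \<xi> (a + b) = s * \<xi> a + s * \<xi> b" by (simp add: add distrib_left)
  from almost_period_with_drift[OF D, of "{()}" "\<lambda>_. y" \<delta> "\<lambda>_. h" "\<lambda>_. c" C "\<lambda>v. s * \<xi> v", OF _ _ \<delta> h hc this A _ e zero_less_one]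
  obtain a J where aJ: "\<forall>x. \<forall>y\<in>D. norm (f (cvec (x + a) y) - f (cvec x y)) \<le> \<epsilon>"
     "\<forall>i\<in>{()}. \<bar>c \<bullet> a - s * \<xi> c - 2 * pi * of_int (J i)\<bar> \<le> 1"
     "\<forall>i\<in>{()}. \<forall>x. 4 * \<epsilon> \<le> norm (f (cvec x y)) \<longrightarrow>
        h (x + a) - h x = Ln (f (cvec (x + a) y) / f (cvec x y)) + 2 * pi * of_int (J i) * \<i>"
    using y e \<xi>(2) by auto
  have L: "h (x + a) - h x = Ln (f (cvec (x + a) y) / f (cvec x y)) + 2 * pi * of_int (J ()) * \<i>" using aJ(3) big by simp
  have "norm (f (cvec (x + a) y) - f (cvec x y)) \<le> \<epsilon>" using aJ(1) y by blast
  then have "norm (f (cvec (x + a) y) - f (cvec x y)) \<le> 1/4 * norm (f (cvec x y))" using big by linarith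
  then have "norm (f (cvec (x + a) y) / f (cvec x y) - 1) \<le> 1/4"
    by (rule norm_divide_minus_one_le) (simp add: h(2))
  then have "norm (Ln (f (cvec (x + a) y) / f (cvec x y))) \<le> 1/2"
    using norm_Ln_ratio_le[of "f (cvec (x + a) y) / f (cvec x y)"] by linarith
  then have "\<bar>Im (Ln (f (cvec (x + a) y) / f (cvec x y)))\<bar> \<le> 1/2" using abs_Im_le_cmod order_trans by blast
  moreover have "Im (h (x + a)) - Im (h x) = Im (Ln (f (cvec (x + a) y) / f (cvec x y))) + 2 * pi * of_int (J ())"
    using arg_cong[OF L, of Im] by simp
  moreover have "\<bar>Im (h (x + a)) - (c \<bullet> x + c \<bullet> a)\<bar> \<le> C" using hc[of "x + a"] by (simp add: inner_add_right)
  moreover have "\<bar>c \<bullet> a - s - 2 * pi * of_int (J ())\<bar> \<le> 1" using aJ(2) \<xi>(1) by simp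
  ultimately have "\<bar>s\<bar> \<le> 1 + 1/2 + 2 * C" using hc[of x] by linarith
  then show False using C by (simp add: s_def)
qed

end

subsection \<open>Monotonicity of the phase difference\<close>

text \<open>\<open>k\<close> is merely continuous, so it is not differentiated; the winding number
  of the image curve, which is that of \<open>exp \<circ> k\<close>, supplies the increment.\<close>

lemma contour_integral_log_derivative:
  assumes \<phi>: "\<phi> holomorphic_on T" "open T" and ab: "closed_segment a b \<subseteq> T"
    and k: "continuous_on {0..1} k" "\<And>t. t \<in> {0..1} \<Longrightarrow> \<phi> (linepath a b t) = exp (k t)"
  shows "contour_integral (linepath a b) (\<lambda>w. deriv \<phi> w / \<phi> w) = k 1 - k 0"
proof -
  have "contour_integral (linepath a b) (\<lambda>w. deriv \<phi> w / \<phi> w) = contour_integral (linepath a b) (\<lambda>w. deriv \<phi> w * (1 / (\<phi> w - 0)))" by simp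
  also have "\<dots> = contour_integral (\<phi> \<circ> linepath a b) (\<lambda>w. 1 / (w - 0))"
    by (rule contour_integral_comp_analyticW[symmetric, where s = T]) (use \<phi> ab in \<open>auto simp: analytic_on_open\<close>)
  also have "\<dots> = 2 * pi * \<i> * winding_number (\<phi> \<circ> linepath a b) 0"
  proof (subst winding_number_valid_path)
    show "valid_path (\<phi> \<circ> linepath a b)" by (rule valid_path_compose_holomorphic[OF _ \<phi>]) (use ab in auto)
    show "0 \<notin> path_image (\<phi> \<circ> linepath a b)"
    proof
      assume "0 \<in> path_image (\<phi> \<circ> linepath a b)"
      then obtain t where "t \<in> {0..1}" "\<phi> (linepath a b t) = 0" unfolding path_image_def by auto
      then show False using k(2) by simp
    qed
  qed simp
  also have "winding_number (\<phi> \<circ> linepath a b) 0 = winding_number (exp \<circ> k) 0"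
    by (rule winding_number_cong) (simp add: k(2))
  also have "\<dots> = (pathfinish k - pathstart k) / (2 * of_real pi * \<i>)"
    by (rule winding_number_compose_exp) (simp add: path_def k(1))
  finally show ?thesis by (simp add: pathfinish_def pathstart_def)
qed

lemma sum_in_Nats:
  fixes F :: "'a \<Rightarrow> 'b::semiring_1"
  shows "(\<And>p. p \<in> A \<Longrightarrow> F p \<in> \<nat>) \<Longrightarrow> sum F A \<in> \<nat>"
  by (induction A rule: infinite_finite_induct) auto

text \<open>By the argument principle the increments along the four sides, taken counterclockwise,
  add up to 2 pi i times the number of enclosed zeros. Only increments enter, so each side may carry
  its own branch.\<close>

lemma rectangle_log_increment:
  assumes hol: "\<phi> holomorphic_on {w. - \<sigma> < Im w \<and> Im w < L + \<sigma>}" and pos: "u > 0" "L > 0" "\<sigma> > 0"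
    and kb: "continuous_on {0..u} kb" "\<And>s. s \<in> {0..u} \<Longrightarrow> \<phi> (Complex s 0) = exp (kb s)"
    and kt: "continuous_on {0..u} kt" "\<And>s. s \<in> {0..u} \<Longrightarrow> \<phi> (Complex s L) = exp (kt s)"
    and kl: "continuous_on {0..L} kl" "\<And>v. v \<in> {0..L} \<Longrightarrow> \<phi> (Complex 0 v) = exp (kl v)"
    and kr: "continuous_on {0..L} kr" "\<And>v. v \<in> {0..L} \<Longrightarrow> \<phi> (Complex u v) = exp (kr v)"
  shows "0 \<le> Im ((kb u - kb 0) + (kr L - kr 0) - (kt u - kt 0) - (kl L - kl 0))"
proof -
  define T where "T = {w. - \<sigma> < Im w \<and> Im w < L + \<sigma>}"
  have T: "open T" "connected T"
  proof -
    have e: "T = {w. Im w > - \<sigma>} \<inter> {w. Im w < L + \<sigma>}" by (auto simp: T_def)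
    show "open T" unfolding e by (intro open_Int open_halfspace_Im_gt open_halfspace_Im_lt)
    show "connected T" unfolding e by (intro convex_connected convex_Int convex_halfspace_Im_gt convex_halfspace_Im_lt)
  qed
  note holT = hol[folded T_def]
  \<comment> \<open>A slightly larger rectangle inside the strip: the argument principle wants an
    open connected set around the contour, and compactness of its closure leaves finitely many
    zeros.\<close>
  define p1 p2 where "p1 = Complex (-1) (- \<sigma> / 2)" and "p2 = Complex (u + 1) (L + \<sigma> / 2)"
  define S where "S = box p1 p2"
  have ST: "cbox p1 p2 \<subseteq> T" "S \<subseteq> cbox p1 p2" using pos
    by (auto simp: S_def T_def p1_def p2_def in_cbox_complex_iff box_subset_cbox)
  let ?g = "rectpath 0 (Complex u L)"
  have nzb: "\<phi> w \<noteq> 0" if "w \<in> path_image ?g" for w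
  proof -
    have "(Re w = 0 \<or> Re w = u) \<and> Im w \<in> {0..L} \<or> (Im w = 0 \<or> Im w = L) \<and> Re w \<in> {0..u}"
      using that pos by (subst (asm) path_image_rectpath) auto
    moreover have w: "w = Complex (Re w) (Im w)" by simp
    ultimately show ?thesis using kb(2)[of "Re w"] kt(2)[of "Re w"] kl(2)[of "Im w"] kr(2)[of "Im w"] exp_not_eq_zero by metis
  qed
  have ci: "path_image ?g \<subseteq> cbox 0 (Complex u L)" using pos by (intro path_image_rectpath_subset_cbox) auto
  have cS: "cbox 0 (Complex u L) \<subseteq> S" using pos
    by (auto simp: S_def p1_def p2_def in_cbox_complex_iff in_box_complex_iff)
  have "finite {z \<in> cbox p1 p2. \<phi> z = 0}"
  proof (cases "\<phi> constant_on T")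
    case True
    then obtain c where c: "\<And>w. w \<in> T \<Longrightarrow> \<phi> w = c" unfolding constant_on_def by blast
    have "0 \<in> cbox 0 (Complex u L)" using pos by (simp add: in_cbox_complex_iff)
    then have "0 \<in> T" using cS ST by blast
    moreover have "\<phi> 0 \<noteq> 0" using kb(2)[of 0] pos by (simp add: Complex_eq_0 flip: zero_complex.code)
    ultimately have "c \<noteq> 0" using c by auto
    then have "{z \<in> cbox p1 p2. \<phi> z = 0} = {}" using c ST by auto
    then show ?thesis by (simp only: finite.emptyI)
  next
    case False
    show ?thesis by (rule holomorphic_compact_finite_zeros[OF holT T _ ST(1) False]) simp
  qed
  then have fin: "finite {w \<in> S. \<phi> w = 0}" by (rule rev_finite_subset) (use ST in auto)
  have arg: "contour_integral ?g (\<lambda>x. deriv \<phi> x * 1 / \<phi> x) = 2 * pi * \<i> * (\<Sum>p\<in>{w \<in> S. \<phi> w = 0 \<or> w \<in> {}}. winding_number ?g p * 1 * zorder \<phi> p)"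
  proof (rule argument_principle)
    show "open S" unfolding S_def by (rule open_box)
    show "connected S" unfolding S_def by (intro convex_connected convex_box)
    show "\<phi> holomorphic_on S - {}" using holT ST holomorphic_on_subset by auto
    show "path_image ?g \<subseteq> S - {w \<in> S. \<phi> w = 0 \<or> w \<in> {}}" using ci cS nzb by auto
    show "\<forall>z. z \<notin> S \<longrightarrow> winding_number ?g z = 0"
    proof (intro allI impI)
      fix z assume "z \<notin> S"
      then have "z \<notin> cbox 0 (Complex u L)" using cS by blast
      then show "winding_number ?g z = 0" using pos by (intro winding_number_rectpath_outside) auto
    qed
  qed (use fin in auto)
  have nn: "winding_number ?g p * 1 * zorder \<phi> p \<in> \<nat>" if p: "p \<in> {w \<in> S. \<phi> w = 0 \<or> w \<in> {}}" for p
  proof -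
    have "winding_number ?g p \<in> \<nat>"
    proof (cases "p \<in> cbox 0 (Complex u L)")
      case True
      have "p \<in> box 0 (Complex u L)" using True p nzb path_image_rectpath_cbox_minus_box[of 0 "Complex u L"] pos by auto
      then have "winding_number ?g p = 1" by (rule winding_number_rectpath)
      then show ?thesis by simp
    next
      case False
      then have "winding_number ?g p = 0" using pos by (intro winding_number_rectpath_outside) auto
      then show ?thesis by simp
    qed
    moreover have "zorder \<phi> p \<ge> 0"
    proof (rule zorder_ge_0)
      show "\<phi> analytic_on {p}" using holT T p ST by (auto simp: analytic_at intro!: exI[of _ T])
      have "open (S - ({w \<in> S. \<phi> w = 0} - {p}))" using fin by (intro open_Diff finite_imp_closed) (auto simp: S_def open_box)
      then have "eventually (\<lambda>w. w \<in> S - ({w \<in> S. \<phi> w = 0} - {p}) - {p}) (at p)"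
        using p by (intro eventually_at_in_open) auto
      then have "eventually (\<lambda>w. \<phi> w \<noteq> 0) (at p)" by (rule eventually_mono) auto
      then show "frequently (\<lambda>w. \<phi> w \<noteq> 0) (at p)" by (intro eventually_frequently) simp_all
    qed
    then have "of_int (zorder \<phi> p) \<in> (\<nat> :: complex set)" by (metis of_nat_in_Nats of_int_of_nat_eq zero_le_imp_eq_int)
    ultimately show ?thesis by simp
  qed
  have "(\<Sum>p\<in>{w \<in> S. \<phi> w = 0 \<or> w \<in> {}}. winding_number ?g p * 1 * zorder \<phi> p) \<in> \<nat>"
    by (rule sum_in_Nats[OF nn])
  then obtain n where "(\<Sum>p\<in>{w \<in> S. \<phi> w = 0 \<or> w \<in> {}}. winding_number ?g p * 1 * zorder \<phi> p) = of_nat n" by (rule Nats_cases)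
  with arg have ci_n: "contour_integral ?g (\<lambda>x. deriv \<phi> x / \<phi> x) = 2 * pi * \<i> * of_nat n" by simp
  have cont: "continuous_on (path_image ?g) (\<lambda>x. deriv \<phi> x / \<phi> x)"
  proof (intro continuous_on_divide)
    show "continuous_on (path_image ?g) (deriv \<phi>)"
      by (rule continuous_on_subset[OF holomorphic_on_imp_continuous_on[OF holomorphic_deriv[OF holT T(1)]]]) (use ci cS ST in blast)
    show "continuous_on (path_image ?g) \<phi>"
      by (rule continuous_on_subset[OF holomorphic_on_imp_continuous_on[OF holT]]) (use ci cS ST in blast)
  qed (use nzb in auto)
  have pim: "path_image ?g = closed_segment 0 (Complex u 0) \<union> (closed_segment (Complex u 0) (Complex u L) \<union>
     (closed_segment (Complex u L) (Complex 0 L) \<union> closed_segment (Complex 0 L) 0))"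
    by (simp add: rectpath_def Let_def path_image_join)
  have sub: "path_image ?g \<subseteq> T" using ci cS ST by blast
  have ig: "(\<lambda>x. deriv \<phi> x / \<phi> x) contour_integrable_on linepath 0 (Complex u 0)"
    "(\<lambda>x. deriv \<phi> x / \<phi> x) contour_integrable_on linepath (Complex u 0) (Complex u L)"
    "(\<lambda>x. deriv \<phi> x / \<phi> x) contour_integrable_on linepath (Complex u L) (Complex 0 L)"
    "(\<lambda>x. deriv \<phi> x / \<phi> x) contour_integrable_on linepath (Complex 0 L) 0"
    by (rule contour_integrable_continuous_linepath, rule continuous_on_subset[OF cont], simp add: pim; blast)+
  have "contour_integral ?g (\<lambda>x. deriv \<phi> x / \<phi> x) = contour_integral (linepath 0 (Complex u 0)) (\<lambda>x. deriv \<phi> x / \<phi> x)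
     + (contour_integral (linepath (Complex u 0) (Complex u L)) (\<lambda>x. deriv \<phi> x / \<phi> x)
     + (contour_integral (linepath (Complex u L) (Complex 0 L)) (\<lambda>x. deriv \<phi> x / \<phi> x)
     + contour_integral (linepath (Complex 0 L) 0) (\<lambda>x. deriv \<phi> x / \<phi> x)))"
    by (simp add: rectpath_def Let_def ig)
  also have "contour_integral (linepath 0 (Complex u 0)) (\<lambda>x. deriv \<phi> x / \<phi> x) = kb (u * 1) - kb (u * 0)"
  proof (rule contour_integral_log_derivative[OF holT T(1)])
    show "continuous_on {0..1} (\<lambda>t. kb (u * t))"
      by (rule continuous_on_compose2[OF kb(1)]) (use pos in \<open>auto intro!: continuous_intros simp: mult_left_le\<close>)
    show "\<phi> (linepath 0 (Complex u 0) t) = exp (kb (u * t))" if "t \<in> {0..1}" for t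
    proof -
      have "linepath 0 (Complex u 0) t = Complex (u * t) 0" by (simp add: linepath_def complex_eq_iff)
      then show ?thesis using kb(2)[of "u * t"] that pos by (simp add: mult_left_le)
    qed
  qed (use sub pim in auto)
  also have "contour_integral (linepath (Complex u 0) (Complex u L)) (\<lambda>x. deriv \<phi> x / \<phi> x) = kr (L * 1) - kr (L * 0)"
  proof (rule contour_integral_log_derivative[OF holT T(1)])
    show "continuous_on {0..1} (\<lambda>t. kr (L * t))"
      by (rule continuous_on_compose2[OF kr(1)]) (use pos in \<open>auto intro!: continuous_intros simp: mult_left_le\<close>)
    show "\<phi> (linepath (Complex u 0) (Complex u L) t) = exp (kr (L * t))" if "t \<in> {0..1}" for t
    proof -
      have "linepath (Complex u 0) (Complex u L) t = Complex u (L * t)" by (simp add: linepath_def complex_eq_iff algebra_simps)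
      then show ?thesis using kr(2)[of "L * t"] that pos by (simp add: mult_left_le)
    qed
  qed (use sub pim in auto)
  also have "contour_integral (linepath (Complex u L) (Complex 0 L)) (\<lambda>x. deriv \<phi> x / \<phi> x) = kt (u * (1 - 1)) - kt (u * (1 - 0))"
  proof (rule contour_integral_log_derivative[OF holT T(1)])
    show "continuous_on {0..1} (\<lambda>t. kt (u * (1 - t)))"
      by (rule continuous_on_compose2[OF kt(1)]) (use pos in \<open>auto intro!: continuous_intros simp: mult_left_le\<close>)
    show "\<phi> (linepath (Complex u L) (Complex 0 L) t) = exp (kt (u * (1 - t)))" if "t \<in> {0..1}" for t
    proof -
      have "linepath (Complex u L) (Complex 0 L) t = Complex (u * (1 - t)) L" by (simp add: linepath_def complex_eq_iff algebra_simps)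
      then show ?thesis using kt(2)[of "u * (1 - t)"] that pos by (simp add: mult_left_le)
    qed
  qed (use sub pim in auto)
  also have "contour_integral (linepath (Complex 0 L) 0) (\<lambda>x. deriv \<phi> x / \<phi> x) = kl (L * (1 - 1)) - kl (L * (1 - 0))"
  proof (rule contour_integral_log_derivative[OF holT T(1)])
    show "continuous_on {0..1} (\<lambda>t. kl (L * (1 - t)))"
      by (rule continuous_on_compose2[OF kl(1)]) (use pos in \<open>auto intro!: continuous_intros simp: mult_left_le\<close>)
    show "\<phi> (linepath (Complex 0 L) 0 t) = exp (kl (L * (1 - t)))" if "t \<in> {0..1}" for t
    proof -
      have "linepath (Complex 0 L) 0 t = Complex 0 (L * (1 - t))" by (simp add: linepath_def complex_eq_iff algebra_simps)
      then show ?thesis using kl(2)[of "L * (1 - t)"] that pos by (simp add: mult_left_le)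
    qed
  qed (use sub pim in auto)
  finally have "(kb u - kb 0) + (kr L - kr 0) - (kt u - kt 0) - (kl L - kl 0) = 2 * pi * \<i> * of_nat n"
    using ci_n by (simp add: algebra_simps)
  then have "Im ((kb u - kb 0) + (kr L - kr 0) - (kt u - kt 0) - (kl L - kl 0)) = 2 * pi * real n" by (simp only:) simp
  then show ?thesis by simp
qed

context ap_tube begin

text \<open>Let q = c1 - c0. The phase gap \<open>\<nu>\<close> of a column is -(q . x) up to a
  constant (\<open>N4\<close>), does not decrease in direction e (\<open>N2\<close>), and changes by
  exactly \<open>M\<close> under the almost period a (\<open>N3\<close>). Columns near n a + 3 R n e
  thus have \<open>\<nu>\<close> at least n M up to a constant, while q . a is about
  \<open>\<psi>\<close>(q) - M. The sum cancels M, and division by n removes the constants.\<close>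

lemma mean_motion_difference_upper:
  fixes \<psi> :: "real^'p \<Rightarrow> real" and e :: "real^'p"
  assumes D: "compactly_in D \<Omega>" "convex D" "open D" and y: "y0 \<in> D" "y0 + L *\<^sub>R e \<in> D" and L: "L > 0"
    and \<delta>: "\<delta> > 0" "\<And>x. \<delta> \<le> norm (f (cvec x y0))" "\<And>x. \<delta> \<le> norm (f (cvec x (y0 + L *\<^sub>R e)))"
    and h0: "continuous_on UNIV h0" "\<And>x. f (cvec x y0) = exp (h0 x)" "\<And>x. \<bar>Im (h0 x) - c0 \<bullet> x\<bar> \<le> C"
    and h1: "continuous_on UNIV h1" "\<And>x. f (cvec x (y0 + L *\<^sub>R e)) = exp (h1 x)" "\<And>x. \<bar>Im (h1 x) - c1 \<bullet> x\<bar> \<le> C"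
    and col: "\<And>x. \<exists>u\<in>{-R..R}. \<forall>v\<in>{0..L}. 4 * \<epsilon> \<le> norm (f (cvec (x + u *\<^sub>R e) (y0 + v *\<^sub>R e)))" and R: "R > 0"
    and add: "\<And>a b. \<psi> (a + b) = \<psi> a + \<psi> b"
    and A: "approximant D (\<epsilon> / 4) \<Lambda> b wt" and sw: "(\<Sum>l\<in>\<Lambda>. wt l * \<bar>\<psi> l\<bar>) \<le> \<epsilon> / 4" and e: "\<epsilon> > 0"
  shows "\<psi> (c1 - c0) \<le> 3 * R * \<bar>(c1 - c0) \<bullet> e\<bar>"
proof (rule field_le_epsilon)
  fix \<eta>' :: real assume \<eta>': "\<eta>' > 0"
  define \<eta> where "\<eta> = \<eta>' / 2"
  have \<eta>: "\<eta> > 0" using \<eta>' by (simp add: \<eta>_def)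
  define y1 where "y1 = y0 + L *\<^sub>R e"
  note y1D = y(2)[folded y1_def] and \<delta>1 = \<delta>(3)[folded y1_def] and h1' = h1(2)[folded y1_def]
  have seg: "y0 + v *\<^sub>R e \<in> D" if v: "v \<in> {0..L}" for v
  proof -
    have "y0 + v *\<^sub>R e = (1 - v / L) *\<^sub>R y0 + (v / L) *\<^sub>R y1" using L by (simp add: y1_def algebra_simps)
    moreover have "\<dots> \<in> D" using v L by (intro convexD_alt[OF D(2) y(1) y1D]) auto
    ultimately show ?thesis by simp
  qed
  have DO: "D \<subseteq> \<Omega>" using D(1) closure_subset by (auto simp: compactly_in_def)
  \<comment> \<open>D is open at both ends of the segment; the extra room gives a strip that
    contains the closed rectangles in its interior.\<close>
  obtain \<sigma> where \<sigma>: "\<sigma> > 0" "\<And>v. - \<sigma> < v \<Longrightarrow> v < L + \<sigma> \<Longrightarrow> y0 + v *\<^sub>R e \<in> D"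
  proof -
    obtain r0 where r0: "r0 > 0" "ball y0 r0 \<subseteq> D" using D(3) y(1) open_contains_ball by blast
    obtain r1 where r1: "r1 > 0" "ball y1 r1 \<subseteq> D" using D(3) y1D open_contains_ball by blast
    define \<sigma> where "\<sigma> = min r0 r1 / (norm e + 1)"
    have ne: "norm e + 1 > 0" by (simp add: add_nonneg_pos)
    have s0: "\<sigma> > 0" using r0 r1 ne by (simp add: \<sigma>_def)
    have "\<sigma> * norm e < \<sigma> * (norm e + 1)" using s0 by simp
    also have "\<sigma> * (norm e + 1) = min r0 r1" using ne by (simp add: \<sigma>_def)
    finally have se: "\<sigma> * norm e < r0" "\<sigma> * norm e < r1" by auto
    show thesis
    proof (rule that[OF s0])
      fix v assume v: "- \<sigma> < v" "v < L + \<sigma>"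
      consider "v \<in> {0..L}" | "v < 0" | "v > L" by fastforce
      then show "y0 + v *\<^sub>R e \<in> D"
      proof cases
        case 2
        have "\<bar>v\<bar> * norm e \<le> \<sigma> * norm e" using v 2 by (intro mult_right_mono) auto
        then have "y0 + v *\<^sub>R e \<in> ball y0 r0" using se by (simp add: dist_norm)
        then show ?thesis using r0 by blast
      next
        case 3
        have "\<bar>v - L\<bar> * norm e \<le> \<sigma> * norm e" using v 3 by (intro mult_right_mono) auto
        moreover have "y1 - (y0 + v *\<^sub>R e) = - ((v - L) *\<^sub>R e)" by (simp add: y1_def algebra_simps)
        ultimately have "y0 + v *\<^sub>R e \<in> ball y1 r1" using se by (simp add: dist_norm)
        then show ?thesis using r1 by blast
      qed (rule seg)
    qed
  qed
  define col_ok where "col_ok x \<longleftrightarrow> (\<forall>v\<in>{0..L}. 4 * \<epsilon> \<le> norm (f (cvec x (y0 + v *\<^sub>R e))))" for x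
  \<comment> \<open>\<open>NN x \<nu>\<close>: going up the column over \<open>x\<close>, the phase of \<open>f\<close> started at \<open>h0 x\<close> ends at \<open>\<nu>\<close> above that of \<open>h1 x\<close>.\<close>
  define NN where "NN x \<nu> \<longleftrightarrow> (\<exists>k. continuous_on {0..L} k \<and> (\<forall>v\<in>{0..L}. f (cvec x (y0 + v *\<^sub>R e)) = exp (k v)) \<and> k 0 = h0 x \<and> \<nu> = Im (k L - h1 x))" for x \<nu>
  have contF: "continuous_on {0..L} (\<lambda>v. f (cvec x (y0 + v *\<^sub>R e)))" for x
    by (intro continuous_intros) (use seg DO in auto)
  have N1: "\<exists>\<nu>. NN x \<nu>" if x: "col_ok x" for x
  proof -
    have "\<And>v. v \<in> {0..L} \<Longrightarrow> f (cvec x (y0 + v *\<^sub>R e)) \<noteq> 0" using x e unfolding col_ok_def by fastforce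
    with continuous_logarithm_on_contractible[OF contF convex_imp_contractible[OF convex_real_interval(5)]]
    obtain k where k: "continuous_on {0..L} k" "\<And>v. v \<in> {0..L} \<Longrightarrow> f (cvec x (y0 + v *\<^sub>R e)) = exp (k v)" by metis
    have "exp (k 0) = exp (h0 x)" using k(2)[of 0] L h0(2)[of x] by simp
    then have "exp (h0 x - k 0) = 1" by (simp add: exp_diff)
    then have "continuous_on {0..L} (\<lambda>v. k v + (h0 x - k 0)) \<and> (\<forall>v\<in>{0..L}. f (cvec x (y0 + v *\<^sub>R e)) = exp (k v + (h0 x - k 0)))"
      using k by (auto intro!: continuous_intros simp: exp_add)
    then show ?thesis unfolding NN_def by (intro exI[of _ "Im (k L + (h0 x - k 0) - h1 x)"] exI[of _ "\<lambda>v. k v + (h0 x - k 0)"]) simp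
  qed
  \<comment> \<open>The rectangle between the columns over x and x + u e, with \<open>h0\<close>
    below and \<open>h1\<close> above, has increment \<open>\<nu>' - \<nu>\<close>.\<close>
  have N2: "\<nu> \<le> \<nu>'" if NN: "NN x \<nu>" "NN (x + u *\<^sub>R e) \<nu>'" and u: "u > 0" for x u \<nu> \<nu>'
  proof -
    obtain k where k: "continuous_on {0..L} k" "\<forall>v\<in>{0..L}. f (cvec x (y0 + v *\<^sub>R e)) = exp (k v)" "k 0 = h0 x" "\<nu> = Im (k L - h1 x)"
      using NN(1) unfolding NN_def by (elim exE conjE)
    obtain k' where k': "continuous_on {0..L} k'" "\<forall>v\<in>{0..L}. f (cvec (x + u *\<^sub>R e) (y0 + v *\<^sub>R e)) = exp (k' v)" "k' 0 = h0 (x + u *\<^sub>R e)" "\<nu>' = Im (k' L - h1 (x + u *\<^sub>R e))"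
      using NN(2) unfolding NN_def by (elim exE conjE)
    let ?\<phi> = "\<lambda>w. f (cvec (x + Re w *\<^sub>R e) (y0 + Im w *\<^sub>R e))"
    have "0 \<le> Im ((h0 (x + u *\<^sub>R e) - h0 (x + 0 *\<^sub>R e)) + (k' L - k' 0) - (h1 (x + u *\<^sub>R e) - h1 (x + 0 *\<^sub>R e)) - (k L - k 0))"
    proof (rule rectangle_log_increment[where \<phi> = ?\<phi> and \<sigma> = \<sigma> and kb = "\<lambda>s. h0 (x + s *\<^sub>R e)" and kt = "\<lambda>s. h1 (x + s *\<^sub>R e)"])
      show "?\<phi> holomorphic_on {w. - \<sigma> < Im w \<and> Im w < L + \<sigma>}"
        by (rule holomorphic_on_subset[OF line_holomorphic]) (use \<sigma>(2) DO in auto)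
      show "continuous_on {0..u} (\<lambda>s. h0 (x + s *\<^sub>R e))"
        by (rule continuous_on_compose2[OF h0(1)]) (auto intro!: continuous_intros)
      show "continuous_on {0..u} (\<lambda>s. h1 (x + s *\<^sub>R e))"
        by (rule continuous_on_compose2[OF h1(1)]) (auto intro!: continuous_intros)
    qed (use u L \<sigma> k k' h0(2) h1' in \<open>auto simp: y1_def\<close>)
    then show ?thesis unfolding k(3,4) k'(3,4) by simp
  qed
  define q where "q = c1 - c0"
  \<comment> \<open>\<open>C'\<close> may depend on the two fibres and on \<open>C\<close>; it is
    divided by n in the end.\<close>
  obtain C' where N4: "\<And>x \<nu>. NN x \<nu> \<Longrightarrow> col_ok x \<Longrightarrow> \<bar>\<nu> + q \<bullet> x\<bar> \<le> C'"
  proof -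
    obtain d where d: "d > 0" "\<forall>x x' y y'. y \<in> D \<longrightarrow> y' \<in> D \<longrightarrow> norm (x - x') \<le> d \<longrightarrow> norm (y - y') \<le> d \<longrightarrow> norm (f (cvec x y) - f (cvec x' y')) \<le> \<epsilon>"
      using uniformly_continuous_on_tube[OF D(1) e] by blast
    define d' where "d' = d / (norm e + 1)"
    have ne: "norm e + 1 > 0" by (simp add: add_nonneg_pos)
    have d': "d' > 0" using d ne by (simp add: d'_def)
    have d'e: "r * norm e \<le> d" if r: "0 \<le> r" "r \<le> d'" for r
    proof -
      have "r * norm e \<le> d' * (norm e + 1)" using r by (intro mult_mono) auto
      also have "\<dots> = d" using ne by (simp add: d'_def)
      finally show ?thesis .
    qed
    show thesis
    proof (rule that[of "2 * (L / d' + 1) + 2 * C"])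
      fix x \<nu> assume NN: "NN x \<nu>" and ok: "col_ok x"
      obtain k where k: "continuous_on {0..L} k" "\<forall>v\<in>{0..L}. f (cvec x (y0 + v *\<^sub>R e)) = exp (k v)" "k 0 = h0 x" "\<nu> = Im (k L - h1 x)"
        using NN unfolding NN_def by (elim exE conjE)
      have "\<bar>Im (k L - k 0)\<bar> \<le> 2 * (L / d' + 1)"
      proof (rule log_increment[OF k(1) d'])
        fix v v' assume v: "v \<in> {0..L}" "v' \<in> {0..L}" "\<bar>v - v'\<bar> \<le> d'"
        have "norm ((y0 + v' *\<^sub>R e) - (y0 + v *\<^sub>R e)) = \<bar>v - v'\<bar> * norm e"
          by (simp add: scaleR_diff_left[symmetric] abs_minus_commute)
        also have "\<dots> \<le> d" using v by (intro d'e) auto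
        finally have "norm (f (cvec x (y0 + v' *\<^sub>R e)) - f (cvec x (y0 + v *\<^sub>R e))) \<le> \<epsilon>"
          using d v seg by simp
        moreover have "4 * \<epsilon> \<le> norm (f (cvec x (y0 + v *\<^sub>R e)))" using ok v unfolding col_ok_def by blast
        ultimately show "norm (exp (k v') - exp (k v)) < norm (exp (k v)) / 2" using k(2) v e by simp
      qed (use L in simp)
      moreover have "\<bar>Im (h0 x) - c0 \<bullet> x\<bar> \<le> C" "\<bar>Im (h1 x) - c1 \<bullet> x\<bar> \<le> C" by (rule h0 h1)+
      moreover have "q \<bullet> x = c1 \<bullet> x - c0 \<bullet> x" by (simp add: q_def inner_diff_left)
      ultimately show "\<bar>\<nu> + q \<bullet> x\<bar> \<le> 2 * (L / d' + 1) + 2 * C" unfolding k(3,4) minus_complex.simps by linarith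
    qed
  qed
  \<comment> \<open>Both fibres must share the almost period, so they are handled together:
    \<open>True\<close> stands for the upper and \<open>False\<close> for the lower one.\<close>
  have "\<exists>a (J :: bool \<Rightarrow> int). (\<forall>x. \<forall>y\<in>D. norm (f (cvec (x + a) y) - f (cvec x y)) \<le> \<epsilon>) \<and>
     (\<forall>i\<in>UNIV. \<bar>(if i then c1 else c0) \<bullet> a - \<psi> (if i then c1 else c0) - 2 * pi * of_int (J i)\<bar> \<le> \<eta>) \<and>
     (\<forall>i\<in>UNIV. \<forall>x. 4 * \<epsilon> \<le> norm (f (cvec x (if i then y1 else y0))) \<longrightarrow>
        (if i then h1 else h0) (x + a) - (if i then h1 else h0) x = Ln (f (cvec (x + a) (if i then y1 else y0)) / f (cvec x (if i then y1 else y0))) + 2 * pi * of_int (J i) * \<i>)"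
    by (rule almost_period_with_drift[OF D(1) _ _ \<delta>(1) _ _ _ _ add A sw e \<eta>, where C = C])
       (use y(1) y1D \<delta>(2) \<delta>1 h0 h1(1,3) h1' in \<open>auto split: if_splits\<close>)
  then obtain a and J :: "bool \<Rightarrow> int" where a: "\<forall>x. \<forall>y\<in>D. norm (f (cvec (x + a) y) - f (cvec x y)) \<le> \<epsilon>"
    and J: "\<forall>i\<in>UNIV. \<bar>(if i then c1 else c0) \<bullet> a - \<psi> (if i then c1 else c0) - 2 * pi * of_int (J i)\<bar> \<le> \<eta>"
    and hJ: "\<forall>i\<in>UNIV. \<forall>x. 4 * \<epsilon> \<le> norm (f (cvec x (if i then y1 else y0))) \<longrightarrow>
        (if i then h1 else h0) (x + a) - (if i then h1 else h0) x = Ln (f (cvec (x + a) (if i then y1 else y0)) / f (cvec x (if i then y1 else y0))) + 2 * pi * of_int (J i) * \<i>"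
    by (elim exE conjE)
  have J0: "\<bar>c0 \<bullet> a - \<psi> c0 - 2 * pi * of_int (J False)\<bar> \<le> \<eta>" and J1: "\<bar>c1 \<bullet> a - \<psi> c1 - 2 * pi * of_int (J True)\<bar> \<le> \<eta>"
    using J[rule_format, of False] J[rule_format, of True] by simp_all
  have hJ0: "h0 (x + a) - h0 x = Ln (f (cvec (x + a) y0) / f (cvec x y0)) + 2 * pi * of_int (J False) * \<i>" if "4 * \<epsilon> \<le> norm (f (cvec x y0))" for x
    using hJ[rule_format, of False] that by simp
  have hJ1: "h1 (x + a) - h1 x = Ln (f (cvec (x + a) y1) / f (cvec x y1)) + 2 * pi * of_int (J True) * \<i>" if "4 * \<epsilon> \<le> norm (f (cvec x y1))" for x
    using hJ[rule_format, of True] that by simp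
  define M where "M = 2 * pi * of_int (J False) - 2 * pi * of_int (J True)"
  \<comment> \<open>Along the whole column the ratio of translated to original values is near 1, so
    its principal logarithm is continuous there. At both ends it is the one occurring in
    \<open>hJ0\<close> and \<open>hJ1\<close>, and only the two integers remain.\<close>
  have N3: "NN (x + a) (\<nu> + M)" if NN: "NN x \<nu>" and ok: "col_ok x" for x \<nu>
  proof -
    obtain k where k: "continuous_on {0..L} k" "\<forall>v\<in>{0..L}. f (cvec x (y0 + v *\<^sub>R e)) = exp (k v)" "k 0 = h0 x" "\<nu> = Im (k L - h1 x)"
      using NN unfolding NN_def by (elim exE conjE)
    let ?r = "\<lambda>v. f (cvec (x + a) (y0 + v *\<^sub>R e)) / f (cvec x (y0 + v *\<^sub>R e))"
    let ?k = "\<lambda>v. k v + Ln (?r v) + 2 * pi * of_int (J False) * \<i>"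
    have ok4: "4 * \<epsilon> \<le> norm (f (cvec x (y0 + v *\<^sub>R e)))" if "v \<in> {0..L}" for v using ok that unfolding col_ok_def by blast
    have nz: "f (cvec x (y0 + v *\<^sub>R e)) \<noteq> 0" if "v \<in> {0..L}" for v using ok4[OF that] e by auto
    have near: "norm (?r v - 1) \<le> 1/4" if v: "v \<in> {0..L}" for v
    proof (rule norm_divide_minus_one_le[OF _ nz[OF v]])
      have "norm (f (cvec (x + a) (y0 + v *\<^sub>R e)) - f (cvec x (y0 + v *\<^sub>R e))) \<le> \<epsilon>" using a seg[OF v] by blast
      then show "norm (f (cvec (x + a) (y0 + v *\<^sub>R e)) - f (cvec x (y0 + v *\<^sub>R e))) \<le> 1/4 * norm (f (cvec x (y0 + v *\<^sub>R e)))"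
        using ok4[OF v] by linarith
    qed
    have rnz: "?r v \<notin> \<real>\<^sub>\<le>\<^sub>0" if v: "v \<in> {0..L}" for v
    proof
      assume "?r v \<in> \<real>\<^sub>\<le>\<^sub>0"
      then have "Re (?r v) \<le> 0" by (simp add: complex_nonpos_Reals_iff)
      moreover have "\<bar>Re (?r v - 1)\<bar> \<le> 1/4" using near[OF v] abs_Re_le_cmod order_trans by blast
      ultimately show False by simp
    qed
    have cr: "continuous_on {0..L} ?r" by (intro continuous_on_divide contF) (use nz in auto)
    have "continuous_on {0..L} (\<lambda>v. Ln (?r v))" by (rule continuous_on_Ln'[OF cr rnz])
    then have c1: "continuous_on {0..L} ?k" by (intro continuous_on_add continuous_on_const k(1))
    have "exp (?k v) = f (cvec (x + a) (y0 + v *\<^sub>R e))" if v: "v \<in> {0..L}" for v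
    proof -
      have "exp (2 * pi * of_int (J False) * \<i>) = 1" by (metis exp_integer_2pi Ints_of_int mult.assoc mult.commute of_real_mult of_real_numeral of_real_of_int_eq)
      moreover have "?r v \<noteq> 0" using rnz[OF v] by auto
      then have "exp (Ln (?r v)) = ?r v" by (rule exp_Ln)
      ultimately have "exp (?k v) = exp (k v) * ?r v" by (simp only: exp_add) simp
      also have "exp (k v) = f (cvec x (y0 + v *\<^sub>R e))" using k(2) v by simp
      finally show ?thesis using nz[OF v] by simp
    qed note c2 = this
    have c3: "?k 0 = h0 (x + a)" using hJ0[of x] ok4[of 0] L k(3) by (simp add: algebra_simps)
    have "h1 (x + a) - h1 x = Ln (?r L) + 2 * pi * of_int (J True) * \<i>" using hJ1[of x] ok4[of L] L by (simp add: y1_def)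
    then have "Im (h1 (x + a)) = Im (h1 x) + Im (Ln (?r L)) + 2 * pi * of_int (J True)"
      by (simp add: algebra_simps complex_eq_iff)
    then have c4: "\<nu> + M = Im (?k L - h1 (x + a))" unfolding k(4) M_def by simp
    show ?thesis unfolding NN_def by (rule exI[of _ ?k]) (use c1 c2 c3 c4 in auto)
  qed
  have "\<forall>n::nat. \<exists>u\<in>{-R..R}. col_ok (real n *\<^sub>R a + (3 * R * real n) *\<^sub>R e + u *\<^sub>R e)" using col unfolding col_ok_def by blast
  then obtain u where u: "\<And>n::nat. u n \<in> {-R..R}" "\<And>n. col_ok (real n *\<^sub>R a + (3 * R * real n) *\<^sub>R e + u n *\<^sub>R e)" by metis
  \<comment> \<open>The drift 3 R n exceeds the freedom of the offsets: consecutive columns advance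
    by at least R in direction e.\<close>
  define X where "X n = real n *\<^sub>R a + (3 * R * real n) *\<^sub>R e + u n *\<^sub>R e" for n
  note okX = u(2)[folded X_def]
  have "\<forall>n. \<exists>\<nu>. NN (X n) \<nu>" using N1[OF okX] by blast
  then obtain \<nu> where \<nu>: "\<And>n. NN (X n) (\<nu> n)" by metis
  have step: "\<nu> n + M \<le> \<nu> (Suc n)" for n
  proof -
    have "X (Suc n) = X n + a + (3 * R + u (Suc n) - u n) *\<^sub>R e" by (simp add: X_def algebra_simps)
    \<comment> \<open>Monotonicity is applied between \<open>X n + a\<close> and
      \<open>X (Suc n)\<close>. The former carries a branch by \<open>N3\<close>, although
      \<open>col_ok\<close> is not claimed for it.\<close>
    moreover have "3 * R + u (Suc n) - u n > 0" using u(1)[of n] u(1)[of "Suc n"] R by auto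
    ultimately show ?thesis using N2[OF N3[OF \<nu> okX]] \<nu>[of "Suc n"] by metis
  qed
  have grow: "\<nu> 0 + real n * M \<le> \<nu> n" for n
  proof (induction n)
    case (Suc n)
    then show ?case using step[of n] by (simp add: algebra_simps)
  qed simp
  have \<psi>q: "\<psi> q = \<psi> c1 - \<psi> c0" using add[of "c1 - c0" c0] by (simp add: q_def)
  have qa: "q \<bullet> a \<ge> \<psi> q - M - 2 * \<eta>"
  proof -
    have "q \<bullet> a = c1 \<bullet> a - c0 \<bullet> a" by (simp add: q_def inner_diff_left)
    then show ?thesis using J0 J1 \<psi>q unfolding M_def by linarith
  qed
  have bound: "real n * (\<psi> q - 2 * \<eta> - 3 * R * \<bar>q \<bullet> e\<bar>) \<le> C' - \<nu> 0 + R * \<bar>q \<bullet> e\<bar>" for n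
  proof -
    have "\<nu> n \<le> C' - q \<bullet> X n" using N4[OF \<nu> okX, of n] by linarith
    moreover have "q \<bullet> X n = real n * (q \<bullet> a) + (3 * R * real n + u n) * (q \<bullet> e)" by (simp add: X_def inner_add_right distrib_right)
    moreover have "real n * (q \<bullet> a) \<ge> real n * (\<psi> q - M - 2 * \<eta>)" by (intro mult_left_mono qa) simp
    moreover have "\<bar>(3 * R * real n + u n) * (q \<bullet> e)\<bar> \<le> (3 * R * real n + R) * \<bar>q \<bullet> e\<bar>"
    proof -
      have "3 * R * real n \<ge> 0" using R by simp
      then have "\<bar>3 * R * real n + u n\<bar> \<le> 3 * R * real n + R" using u(1)[of n] by (simp only: atLeastAtMost_iff) linarith
      then show ?thesis unfolding abs_mult by (rule mult_right_mono) simp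
    qed
    ultimately have "\<nu> 0 + real n * M \<le> C' - real n * (\<psi> q - M - 2 * \<eta>) + (3 * R * real n + R) * \<bar>q \<bullet> e\<bar>"
      using grow[of n] by linarith
    then show ?thesis by (simp add: algebra_simps)
  qed
  have "\<psi> q - 2 * \<eta> - 3 * R * \<bar>q \<bullet> e\<bar> \<le> 0"
  proof (rule ccontr)
    assume "\<not> ?thesis"
    then have p: "\<psi> q - 2 * \<eta> - 3 * R * \<bar>q \<bullet> e\<bar> > 0" by simp
    obtain n where "C' - \<nu> 0 + R * \<bar>q \<bullet> e\<bar> < real n * (\<psi> q - 2 * \<eta> - 3 * R * \<bar>q \<bullet> e\<bar>)" using ex_less_of_nat_mult[OF p] by blast
    then show False using bound[of n] by linarith
  qed
  then show "\<psi> (c1 - c0) \<le> 3 * R * \<bar>(c1 - c0) \<bullet> e\<bar> + \<eta>'" unfolding \<eta>_def q_def by simp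
qed

lemma mean_motion_difference_bound:
  fixes \<psi> :: "real^'p \<Rightarrow> real" and e :: "real^'p"
  assumes D: "compactly_in D \<Omega>" "convex D" "open D" and y: "y0 \<in> D" "y0 + L *\<^sub>R e \<in> D" and L: "L > 0"
    and \<delta>: "\<delta> > 0" "\<And>x. \<delta> \<le> norm (f (cvec x y0))" "\<And>x. \<delta> \<le> norm (f (cvec x (y0 + L *\<^sub>R e)))"
    and h0: "continuous_on UNIV h0" "\<And>x. f (cvec x y0) = exp (h0 x)" "\<And>x. \<bar>Im (h0 x) - c0 \<bullet> x\<bar> \<le> C"
    and h1: "continuous_on UNIV h1" "\<And>x. f (cvec x (y0 + L *\<^sub>R e)) = exp (h1 x)" "\<And>x. \<bar>Im (h1 x) - c1 \<bullet> x\<bar> \<le> C"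
    and col: "\<And>x. \<exists>u\<in>{-R..R}. \<forall>v\<in>{0..L}. 4 * \<epsilon> \<le> norm (f (cvec (x + u *\<^sub>R e) (y0 + v *\<^sub>R e)))" and R: "R > 0"
    and add: "\<And>a b. \<psi> (a + b) = \<psi> a + \<psi> b"
    and A: "approximant D (\<epsilon> / 4) \<Lambda> b wt" and sw: "(\<Sum>l\<in>\<Lambda>. wt l * \<bar>\<psi> l\<bar>) \<le> \<epsilon> / 4" and e: "\<epsilon> > 0"
  shows "\<bar>\<psi> (c1 - c0)\<bar> \<le> 3 * R * \<bar>(c1 - c0) \<bullet> e\<bar>"
proof -
  have "\<psi> (c1 - c0) \<le> 3 * R * \<bar>(c1 - c0) \<bullet> e\<bar>"
    by (rule mean_motion_difference_upper[OF D y L \<delta> h0 h1 col R add A sw e])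
  moreover have "- \<psi> (c1 - c0) \<le> 3 * R * \<bar>(c1 - c0) \<bullet> e\<bar>"
    by (rule mean_motion_difference_upper[OF D y L \<delta> h0 h1 col R _ A _ e, where \<psi> = "\<lambda>v. - \<psi> v"]) (use sw in \<open>auto simp: add\<close>)
  ultimately show ?thesis by linarith
qed

end

subsection \<open>Sets of directions\<close>

text \<open>The parts \<open>B n\<close> of the unit ball in slabs around the hyperplanes are
  compact and decrease to a null set, so their measures tend to 0. If every direction in S lay in a
  thin slab, the cone over S would lie in such a part.\<close>

lemma directions_avoid_slabs:
  fixes N :: "(real^'p) set"
  assumes N: "finite N" "0 \<notin> N" and \<beta>: "\<beta> > 0"
  shows "\<exists>\<kappa>>0. \<forall>S. S \<subseteq> sphere 0 1 \<longrightarrow> \<beta> \<le> sphere_mes S \<longrightarrow> (\<exists>l\<in>S. \<forall>\<nu>\<in>N. \<kappa> \<le> \<bar>\<nu> \<bullet> l\<bar>)"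
proof -
  define B where "B n = cball (0 :: real^'p) 1 \<inter> (\<Union>\<nu>\<in>N. {x. \<bar>\<nu> \<bullet> x\<bar> \<le> 1 / (real n + 1)})" for n :: nat
  have cB: "compact (B n)" for n unfolding B_def
    by (intro compact_Int_closed compact_cball closed_UN N(1) ballI closed_Collect_le continuous_intros)
  have mB: "B n \<in> lmeasurable" for n by (rule lmeasurable_compact[OF cB])
  have dec: "decseq B"
  proof (rule decseq_SucI)
    fix n
    have "1 / (real (Suc n) + 1) \<le> 1 / (real n + 1)" by (simp add: field_simps)
    then show "B (Suc n) \<subseteq> B n" unfolding B_def by fastforce
  qed
  have "(\<Inter>n. B n) \<subseteq> (\<Union>\<nu>\<in>N. {x. \<nu> \<bullet> x = 0})"
  proof
    fix x assume x: "x \<in> (\<Inter>n. B n)"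
    show "x \<in> (\<Union>\<nu>\<in>N. {x. \<nu> \<bullet> x = 0})"
    proof (rule ccontr)
      assume no: "x \<notin> (\<Union>\<nu>\<in>N. {x. \<nu> \<bullet> x = 0})"
      have "Min (insert 1 ((\<lambda>\<nu>. \<bar>\<nu> \<bullet> x\<bar>) ` N)) > 0" using N(1) no by auto
      then obtain n where n: "inverse (real (Suc n)) < Min (insert 1 ((\<lambda>\<nu>. \<bar>\<nu> \<bullet> x\<bar>) ` N))" using reals_Archimedean by blast
      have "x \<in> B n" using x by blast
      then obtain \<nu> where \<nu>: "\<nu> \<in> N" "\<bar>\<nu> \<bullet> x\<bar> \<le> 1 / (real n + 1)" unfolding B_def by auto
      have "Min (insert 1 ((\<lambda>\<nu>. \<bar>\<nu> \<bullet> x\<bar>) ` N)) \<le> \<bar>\<nu> \<bullet> x\<bar>" using N(1) \<nu>(1) by (intro Min_le) auto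
      then show False using n \<nu>(2) by (simp add: inverse_eq_divide add.commute)
    qed
  qed
  moreover have "negligible (\<Union>\<nu>\<in>N. {x. \<nu> \<bullet> x = 0})"
    using N by (intro negligible_Union) (auto intro!: negligible_hyperplane)
  ultimately have "negligible (\<Inter>n. B n)" by (rule negligible_subset[rotated])
  then have m0: "measure lebesgue (\<Inter>n. B n) = 0" by (rule negligible_imp_measure0)
  have "(\<lambda>n. measure lebesgue (B n)) \<longlonglongrightarrow> measure lebesgue (\<Inter>n. B n)"
  proof (rule Lim_measure_decseq[OF _ dec])
    show "range B \<subseteq> sets lebesgue" using mB fmeasurableD by blast
    show "emeasure lebesgue (B i) \<noteq> \<infinity>" for i using fmeasurableD2[OF mB] by (simp only: infinity_ennreal_def) simp
  qed
  then have "(\<lambda>n. real CARD('p) * measure lebesgue (B n)) \<longlonglongrightarrow> real CARD('p) * 0" unfolding m0 by (intro tendsto_mult tendsto_const)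
  then have "eventually (\<lambda>n. real CARD('p) * measure lebesgue (B n) < \<beta>) sequentially" by (intro order_tendstoD(2)) (use \<beta> in auto)
  then obtain n where n: "real CARD('p) * measure lebesgue (B n) < \<beta>" by (auto simp: eventually_sequentially)
  have "\<exists>l\<in>S. \<forall>\<nu>\<in>N. 1 / (real n + 1) \<le> \<bar>\<nu> \<bullet> l\<bar>" if S: "S \<subseteq> sphere 0 1" "\<beta> \<le> sphere_mes S" for S
  proof (rule ccontr)
    assume no: "\<not> ?thesis"
    let ?K = "{t *\<^sub>R s |t s. 0 < t \<and> t \<le> 1 \<and> s \<in> S}"
    have sub: "?K \<subseteq> B n"
    proof
      fix x assume "x \<in> ?K"
      then obtain t s where ts: "x = t *\<^sub>R s" "0 < t" "t \<le> 1" "s \<in> S" by blast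
      obtain \<nu> where \<nu>: "\<nu> \<in> N" "\<bar>\<nu> \<bullet> s\<bar> < 1 / (real n + 1)" using no ts(4) by (meson not_le)
      have "\<bar>\<nu> \<bullet> x\<bar> = t * \<bar>\<nu> \<bullet> s\<bar>" using ts by (simp add: abs_mult)
      also have "\<dots> \<le> 1 * \<bar>\<nu> \<bullet> s\<bar>" using ts by (intro mult_right_mono) auto
      finally have "\<bar>\<nu> \<bullet> x\<bar> \<le> 1 / (real n + 1)" using \<nu>(2) by simp
      moreover have "norm s = 1" using S(1) ts(4) by auto
      then have "norm x \<le> 1" using ts by simp
      ultimately show "x \<in> B n" unfolding B_def using \<nu>(1) by auto
    qed
    have "measure lebesgue ?K \<le> measure lebesgue (B n)"
    \<comment> \<open>A cone that is not measurable has \<open>measure\<close> 0 by convention, and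
      the bound holds as well.\<close>
    proof (cases "?K \<in> sets lebesgue")
      case True then show ?thesis by (rule measure_mono_fmeasurable[OF sub _ mB])
    next
      case False then show ?thesis by (simp add: measure_notin_sets)
    qed
    then have "sphere_mes S \<le> real CARD('p) * measure lebesgue (B n)" unfolding sphere_mes_def by (intro mult_left_mono) auto
    then show False using n S(2) by linarith
  qed
  then show ?thesis by (intro exI[of _ "1 / (real n + 1)"]) auto
qed

lemma directions_subset_sphere: "directions D1 D0 \<subseteq> sphere 0 1"
  by (auto simp: directions_def)

text \<open>Differences of \<open>y1\<close> and points of a ball in \<open>D0\<close> fill a ball;
  scaled into the unit ball it lies in the cone over the directions, up to the origin.\<close>

lemma sphere_mes_directions_lower:
  fixes D0 D1 :: "(real^'p) set"
  assumes D0: "open D0" "ball a \<rho> \<subseteq> D0" and \<rho>: "\<rho> > 0" and y1: "y1 \<in> D1" "norm (y1 - a) \<le> \<Delta>"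
  shows "real CARD('p) * ((\<rho> / (\<Delta> + \<rho>)) ^ CARD('p) * measure lborel (ball (0 :: real^'p) 1)) \<le> sphere_mes (directions D1 D0)"
proof -
  let ?K = "{t *\<^sub>R s |t s. 0 < t \<and> t \<le> 1 \<and> s \<in> directions D1 D0}"
  \<comment> \<open>The open cone of all x some positive multiple of which is a difference of a
    point of \<open>D1\<close> and one of \<open>D0\<close>; no assumption on \<open>D1\<close> is
    involved, since openness comes from \<open>D0\<close>.\<close>
  define V where "V = (\<Union>r\<in>{0<..}. \<Union>y\<in>D1. {x. y - r *\<^sub>R x \<in> D0})"
  have V: "x \<in> V \<longleftrightarrow> (\<exists>r>0. \<exists>y\<in>D1. y - r *\<^sub>R x \<in> D0)" for x by (auto simp: V_def)
  have oV: "open V" unfolding V_def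
  proof (intro open_UN ballI)
    fix r y
    have "open ((\<lambda>x. y - r *\<^sub>R x) -` D0)" by (rule open_vimage[OF D0(1)]) (intro continuous_intros)
    then show "open {x. y - r *\<^sub>R x \<in> D0}" by (simp add: vimage_def)
  qed
  have K: "?K = cball 0 1 \<inter> V - {0}"
  proof (intro equalityI subsetI)
    fix x assume "x \<in> ?K"
    then obtain t s where ts: "x = t *\<^sub>R s" "0 < t" "t \<le> 1" "s \<in> directions D1 D0" by blast
    then obtain y1 y0 where y: "s = (1 / norm (y1 - y0)) *\<^sub>R (y1 - y0)" "y1 \<in> D1" "y0 \<in> D0" "y1 \<noteq> y0" unfolding directions_def by blast
    have "norm x = t" using ts y by simp
    moreover have "y1 - (norm (y1 - y0) / t) *\<^sub>R x \<in> D0" using ts y by simp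
    moreover have "norm (y1 - y0) / t > 0" using ts y by simp
    ultimately have "x \<in> V" unfolding V using y(2) by blast
    then show "x \<in> cball 0 1 \<inter> V - {0}" using ts(2,3) \<open>norm x = t\<close> by auto
  next
    fix x assume x: "x \<in> cball 0 1 \<inter> V - {0}"
    then obtain r y where r: "r > 0" "y \<in> D1" "y - r *\<^sub>R x \<in> D0" using V by blast
    have "(1 / norm (y - (y - r *\<^sub>R x))) *\<^sub>R (y - (y - r *\<^sub>R x)) = (1 / norm x) *\<^sub>R x" using r by simp
    then have "(1 / norm x) *\<^sub>R x \<in> directions D1 D0" unfolding directions_def using r x by force
    moreover have "x = norm x *\<^sub>R ((1 / norm x) *\<^sub>R x)" using x by simp
    moreover have "0 < norm x" "norm x \<le> 1" using x by auto
    ultimately show "x \<in> ?K" by blast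
  qed
  \<comment> \<open>Measurability matters for a lower bound, as \<open>measure\<close> would
    otherwise be 0.\<close>
  have mK: "?K \<in> lmeasurable"
  proof -
    have "cball 0 1 \<inter> V \<in> lmeasurable"
      by (intro fmeasurable_Int_fmeasurable) (use oV in auto)
    then show ?thesis unfolding K by (intro fmeasurable_Diff) auto
  qed
  have \<Delta>: "\<Delta> \<ge> 0" using y1(2) norm_ge_zero order_trans by blast
  \<comment> \<open>The largest factor that is certain to move the ball of radius
    \<open>\<rho>\<close> around y1 - a into the unit ball.\<close>
  define c where "c = 1 / (\<Delta> + \<rho>)"
  have c: "c > 0" "c * (\<Delta> + \<rho>) = 1" using \<Delta> \<rho> by (auto simp: c_def)
  have "ball (c *\<^sub>R (y1 - a)) (c * \<rho>) \<subseteq> ?K \<union> {0}"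
  proof
    fix x assume "x \<in> ball (c *\<^sub>R (y1 - a)) (c * \<rho>)"
    then have x: "norm (c *\<^sub>R (y1 - a) - x) < c * \<rho>" by (simp add: dist_norm)
    have "norm x \<le> norm (c *\<^sub>R (y1 - a)) + norm (c *\<^sub>R (y1 - a) - x)"
      using norm_triangle_sub[of x "c *\<^sub>R (y1 - a)"] by (simp only: norm_minus_commute)
    also have "\<dots> \<le> c * \<Delta> + c * \<rho>" using x y1(2) c by (intro add_mono) (auto intro: mult_left_mono)
    also have "\<dots> = 1" using c by (simp add: distrib_left)
    finally have nx: "norm x \<le> 1" .
    have "c *\<^sub>R ((y1 - a) - (1 / c) *\<^sub>R x) = c *\<^sub>R (y1 - a) - x" using c by (simp add: algebra_simps)
    then have "c * norm ((y1 - a) - (1 / c) *\<^sub>R x) < c * \<rho>" using x c by (metis abs_of_pos norm_scaleR)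
    then have "norm ((y1 - a) - (1 / c) *\<^sub>R x) < \<rho>" using c by simp
    moreover have "dist a (y1 - (1 / c) *\<^sub>R x) = norm ((y1 - a) - (1 / c) *\<^sub>R x)"
      by (simp add: dist_norm norm_minus_commute algebra_simps)
    ultimately have "y1 - (1 / c) *\<^sub>R x \<in> D0" using D0(2) by auto
    moreover have "1 / c > 0" using c by simp
    ultimately have "x \<in> V" unfolding V using y1(1) by blast
    then show "x \<in> ?K \<union> {0}" unfolding K using nx by auto
  qed
  then have "measure lebesgue (ball (c *\<^sub>R (y1 - a)) (c * \<rho>)) \<le> measure lebesgue (?K \<union> {0})"
    by (rule measure_mono_fmeasurable) (simp, rule fmeasurable.Un[OF mK lmeasurable_compact], simp)
  also have "\<dots> = measure lebesgue ?K"
    by (rule measure_negligible_symdiff[OF mK]) (rule negligible_subset[of "{0}"], auto)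
  finally have "measure lebesgue (ball (c *\<^sub>R (y1 - a)) (c * \<rho>)) \<le> measure lebesgue ?K" by simp
  moreover have "measure lebesgue (ball (c *\<^sub>R (y1 - a)) (c * \<rho>)) = measure lborel (ball (c *\<^sub>R (y1 - a)) (c * \<rho>))" by simp
  moreover have "measure lborel (ball (c *\<^sub>R (y1 - a)) (c * \<rho>)) = (c * \<rho>) ^ DIM(real^'p) * measure lborel (ball (0 :: real^'p) 1)"
    by (rule content_ball_conv_unit_ball) (use c \<rho> in simp)
  ultimately show ?thesis unfolding sphere_mes_def by (intro mult_left_mono) (auto simp: c_def)
qed

section \<open>Mean motions of the components and estimates of their coefficients\<close>

context ap_tube begin

lemma off_amoeba_ball:
  assumes "y \<in> \<Omega>" "y \<notin> amoeba \<Omega> f"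
  shows "\<exists>\<rho>>0. ball y \<rho> \<subseteq> \<Omega> \<and> (\<forall>x. \<forall>y'\<in>ball y \<rho>. f (cvec x y') \<noteq> 0)"
proof -
  let ?Z = "{y \<in> \<Omega>. \<exists>x. f (cvec x y) = 0}"
  have "open (\<Omega> - closure ?Z)" by (intro open_Diff openO closed_closure)
  moreover have "y \<in> \<Omega> - closure ?Z" using assms by (auto simp: amoeba_def)
  ultimately obtain \<rho> where \<rho>: "\<rho> > 0" "ball y \<rho> \<subseteq> \<Omega> - closure ?Z" using open_contains_ball by blast
  have "f (cvec x y') \<noteq> 0" if "y' \<in> ball y \<rho>" for x y'
  proof
    assume "f (cvec x y') = 0"
    then have "y' \<in> ?Z" using \<rho> that by blast
    then have "y' \<in> closure ?Z" by (rule subsetD[OF closure_subset])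
    then show False using subsetD[OF \<rho>(2) that] by simp
  qed
  moreover have "ball y \<rho> \<subseteq> \<Omega>" using \<rho>(2) by (rule order_trans) simp
  ultimately show ?thesis using \<rho>(1) by (intro exI[of _ \<rho>] conjI allI ballI) simp_all
qed

lemma off_amoeba_lower_bound:
  assumes "\<exists>z\<in>tube \<Omega>. f z \<noteq> 0" "y \<in> \<Omega>" "y \<notin> amoeba \<Omega> f"
  shows "\<exists>\<delta>>0. \<forall>x. \<delta> \<le> norm (f (cvec x y))"
proof -
  from off_amoeba_ball[OF assms(2,3)] obtain \<rho> where \<rho>: "\<rho> > 0" "ball y \<rho> \<subseteq> \<Omega>" "\<forall>x. \<forall>y'\<in>ball y \<rho>. f (cvec x y') \<noteq> 0"
    by (elim exE conjE)
  show ?thesis by (rule zero_free_lower_bound[OF assms(1) \<rho>(1,2)]) (use \<rho>(3) in blast)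
qed

lemma component_mean_motion:
  assumes nz: "\<exists>z\<in>tube \<Omega>. f z \<noteq> 0" and D: "D \<subseteq> \<Omega>" and U: "U \<in> components (D - amoeba \<Omega> f)" and y: "y \<in> U"
  shows "\<exists>\<delta> h C. \<delta> > 0 \<and> (\<forall>x. \<delta> \<le> norm (f (cvec x y))) \<and> continuous_on UNIV h \<and> (\<forall>x. f (cvec x y) = exp (h x)) \<and>
     (\<forall>x. \<bar>Im (h x) - mean_motion f U \<bullet> x\<bar> \<le> C)"
proof -
  have sub: "U \<subseteq> D - amoeba \<Omega> f" by (rule in_components_subset[OF U])
  have low: "\<exists>\<delta>>0. \<forall>x. \<delta> \<le> norm (f (cvec x y'))" if "y' \<in> U" for y'
    by (rule off_amoeba_lower_bound[OF nz]) (use sub that D in auto)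
  obtain \<delta> where \<delta>: "\<delta> > 0" "\<And>x. \<delta> \<le> norm (f (cvec x y))" using low[OF y] by blast
  have yO: "y \<in> \<Omega>" using y sub D by blast
  have "f (cvec x y) \<noteq> 0" for x using \<delta>(1) \<delta>(2)[of x] by auto
  from log_exists[OF yO this] obtain h where h: "continuous_on UNIV h" "\<And>x. f (cvec x y) = exp (h x)" by blast
  obtain c C where c: "\<And>x. \<bar>Im (h x) - c \<bullet> x\<bar> \<le> C" using mean_motion_exists[OF yO \<delta> h] by blast
  have "mean_motion f U = c"
    by (rule mean_motion_eq[OF in_components_connected[OF U] _ y low h c]) (use sub D in auto)
  then show ?thesis using \<delta> h c by blast
qed

text \<open>Provides one threshold reached over every fibre of \<open>D\<close>, so that a single
  approximant can be used for all components in
  \<open>mean_motion_rational_combination\<close>.\<close>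

lemma window_everywhere:
  assumes D: "compactly_in D \<Omega>" and nz: "\<exists>z\<in>tube \<Omega>. f z \<noteq> 0"
  shows "\<exists>k>0. \<forall>y\<in>D. \<exists>x. k \<le> norm (f (cvec x y))"
proof -
  from window_lower_bound[OF D nz] obtain N k where N: "finite N" "0 \<notin> N" "k > 0"
    "\<forall>\<kappa>>0. \<exists>R>0. \<forall>h x. \<forall>y\<in>D. (\<forall>\<nu>\<in>N. \<kappa> \<le> \<bar>\<nu> \<bullet> h\<bar>) \<longrightarrow> (\<exists>u\<in>{-R..R}. k \<le> norm (f (cvec (x + u *\<^sub>R h) y)))"
    by (elim exE conjE)
  from generic_direction[OF countable_finite[OF N(1)] N(2)] obtain l where l: "\<forall>\<nu>\<in>N. \<nu> \<bullet> l \<noteq> 0" by (elim exE conjE)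
  define \<kappa> where "\<kappa> = Min (insert 1 ((\<lambda>\<nu>. \<bar>\<nu> \<bullet> l\<bar>) ` N))"
  have \<kappa>: "\<kappa> > 0" unfolding \<kappa>_def using N(1) l by auto
  have \<kappa>2: "\<forall>\<nu>\<in>N. \<kappa> \<le> \<bar>\<nu> \<bullet> l\<bar>" unfolding \<kappa>_def using N(1) by (auto intro: Min_le)
  from N(4)[rule_format, OF \<kappa>] obtain R where R: "\<forall>h x. \<forall>y\<in>D. (\<forall>\<nu>\<in>N. \<kappa> \<le> \<bar>\<nu> \<bullet> h\<bar>) \<longrightarrow> (\<exists>u\<in>{-R..R}. k \<le> norm (f (cvec (x + u *\<^sub>R h) y)))"
    by (elim exE conjE)
  have "\<exists>x. k \<le> norm (f (cvec x y))" if "y \<in> D" for y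
    using R[rule_format, OF that \<kappa>2[rule_format], of 0] by blast
  then show ?thesis using N(3) by blast
qed

text \<open>The order of the choices gives uniformity: slabs, \<open>R\<close>,
  \<open>\<epsilon>\<close> and the approximant depend on f, D and \<open>\<beta>\<close>, then the
  scale \<open>s\<close> on \<open>\<psi>\<close>; the components come last. Their lower bounds and
  phase constants vanish in \<open>mean_motion_difference_bound\<close>.\<close>

lemma coefficient_bound:
  fixes \<psi> :: "real^'p \<Rightarrow> real"
  assumes D: "compactly_in D \<Omega>" "convex D" "open D" and nz: "\<exists>z\<in>tube \<Omega>. f z \<noteq> 0"
    and add: "\<And>a b. \<psi> (a + b) = \<psi> a + \<psi> b" and \<beta>: "\<beta> > 0"
  shows "\<exists>K\<ge>0. \<forall>D0\<in>components (D - amoeba \<Omega> f). \<forall>D1\<in>components (D - amoeba \<Omega> f).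
     \<beta> \<le> sphere_mes (directions D1 D0) \<longrightarrow> \<bar>\<psi> (mean_motion f D1 - mean_motion f D0)\<bar> \<le> K * norm (mean_motion f D1 - mean_motion f D0)"
proof -
  have DO: "D \<subseteq> \<Omega>" using D(1) closure_subset by (auto simp: compactly_in_def)
  from window_lower_bound[OF D(1) nz] obtain N k where N: "finite N" "0 \<notin> N" "k > 0"
    "\<forall>\<kappa>>0. \<exists>R>0. \<forall>h x. \<forall>y\<in>D. (\<forall>\<nu>\<in>N. \<kappa> \<le> \<bar>\<nu> \<bullet> h\<bar>) \<longrightarrow> (\<exists>u\<in>{-R..R}. k \<le> norm (f (cvec (x + u *\<^sub>R h) y)))"
    by (elim exE conjE)
  from directions_avoid_slabs[OF N(1,2) \<beta>] obtain \<kappa> where \<kappa>: "\<kappa> > 0"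
    "\<forall>S. S \<subseteq> sphere 0 1 \<longrightarrow> \<beta> \<le> sphere_mes S \<longrightarrow> (\<exists>l\<in>S. \<forall>\<nu>\<in>N. \<kappa> \<le> \<bar>\<nu> \<bullet> l\<bar>)" by (elim exE conjE)
  from N(4)[rule_format, OF \<kappa>(1)] obtain R where R: "R > 0"
    "\<forall>h x. \<forall>y\<in>D. (\<forall>\<nu>\<in>N. \<kappa> \<le> \<bar>\<nu> \<bullet> h\<bar>) \<longrightarrow> (\<exists>u\<in>{-R..R}. k \<le> norm (f (cvec (x + u *\<^sub>R h) y)))" by (elim exE conjE)
  define G where "G h \<longleftrightarrow> (\<forall>\<nu>\<in>N. \<kappa> \<le> \<bar>\<nu> \<bullet> h\<bar>)" for h
  have win: "\<exists>u\<in>{-R..R}. k \<le> norm (f (cvec (x + u *\<^sub>R h) y))" if "G h" "y \<in> D" for h x y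
    using R(2)[rule_format, OF that(2)] that(1) unfolding G_def by blast
  have "\<exists>\<epsilon>1>0. \<forall>h x y L. G h \<longrightarrow> norm h = 1 \<longrightarrow> y \<in> D \<longrightarrow> L \<ge> 0 \<longrightarrow> y + L *\<^sub>R h \<in> D \<longrightarrow>
     (\<exists>u\<in>{-R..R}. \<forall>v\<in>{0..L}. \<epsilon>1 \<le> norm (f (cvec (x + u *\<^sub>R h) (y + v *\<^sub>R h))))"
    by (rule column_lower_bound[OF D(1,2) N(3) R(1)]) (rule win)
  then obtain \<epsilon>1 where \<epsilon>1: "\<epsilon>1 > 0"
    "\<forall>h x y L. G h \<longrightarrow> norm h = 1 \<longrightarrow> y \<in> D \<longrightarrow> L \<ge> 0 \<longrightarrow> y + L *\<^sub>R h \<in> D \<longrightarrow>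
     (\<exists>u\<in>{-R..R}. \<forall>v\<in>{0..L}. \<epsilon>1 \<le> norm (f (cvec (x + u *\<^sub>R h) (y + v *\<^sub>R h))))" by (elim exE conjE)
  define \<epsilon> where "\<epsilon> = \<epsilon>1 / 4"
  have \<epsilon>: "\<epsilon> > 0" "4 * \<epsilon> = \<epsilon>1" using \<epsilon>1(1) by (auto simp: \<epsilon>_def)
  have "\<epsilon> / 4 > 0" using \<epsilon> by simp
  from approximant_exists[OF D(1) this] obtain \<Lambda> b wt where A: "approximant D (\<epsilon> / 4) \<Lambda> b wt" by (elim exE conjE)
  define W where "W = (\<Sum>l\<in>\<Lambda>. wt l * \<bar>\<psi> l\<bar>)"
  have W: "W \<ge> 0" unfolding W_def using A by (intro sum_nonneg) (auto simp: approximant_def)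
  have W1: "W + 1 \<noteq> 0" using W by linarith
  \<comment> \<open>Scales \<open>\<psi>\<close> down until it is admissible for the approximant;
    the constant 3 R / s undoes the scaling.\<close>
  define s where "s = \<epsilon> / 4 / (W + 1)"
  have s: "s > 0" using \<epsilon> W by (simp add: s_def)
  have sw: "(\<Sum>l\<in>\<Lambda>. wt l * \<bar>s * \<psi> l\<bar>) \<le> \<epsilon> / 4"
  proof -
    have "(\<Sum>l\<in>\<Lambda>. wt l * \<bar>s * \<psi> l\<bar>) = s * W" using s by (simp add: W_def sum_distrib_left abs_mult mult_ac)
    also have "\<dots> \<le> s * (W + 1)" using s by simp
    also have "\<dots> = \<epsilon> / 4" by (simp only: s_def nonzero_eq_divide_eq[OF W1, symmetric])
    finally show ?thesis .
  qed
  show ?thesis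
  proof (rule exI[of _ "3 * R / s"], intro conjI ballI impI)
    show "0 \<le> 3 * R / s" using R s by simp
    fix D0 D1 assume U: "D0 \<in> components (D - amoeba \<Omega> f)" "D1 \<in> components (D - amoeba \<Omega> f)" and m: "\<beta> \<le> sphere_mes (directions D1 D0)"
    from \<kappa>(2)[rule_format, OF directions_subset_sphere m] obtain e where e: "e \<in> directions D1 D0" "\<forall>\<nu>\<in>N. \<kappa> \<le> \<bar>\<nu> \<bullet> e\<bar>" by blast
    then obtain y1 y0 where y: "e = (1 / norm (y1 - y0)) *\<^sub>R (y1 - y0)" "y1 \<in> D1" "y0 \<in> D0" "y1 \<noteq> y0" unfolding directions_def by blast
    define L where "L = norm (y1 - y0)"
    have L: "L > 0" using y by (simp add: L_def)
    have y1: "y1 = y0 + L *\<^sub>R e" using y(1,4) by (simp add: L_def)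
    have ne: "norm e = 1" using y by simp
    have yD: "y0 \<in> D" "y0 + L *\<^sub>R e \<in> D" using y(2,3) y1 in_components_subset[OF U(1)] in_components_subset[OF U(2)] by auto
    from component_mean_motion[OF nz DO U(1) y(3)] obtain \<delta>0 h0 C0 where 0: "\<delta>0 > 0" "\<forall>x. \<delta>0 \<le> norm (f (cvec x y0))" "continuous_on UNIV h0"
       "\<forall>x. f (cvec x y0) = exp (h0 x)" "\<forall>x. \<bar>Im (h0 x) - mean_motion f D0 \<bullet> x\<bar> \<le> C0" by (elim exE conjE)
    from component_mean_motion[OF nz DO U(2) y(2)] obtain \<delta>1 h1 C1 where 1: "\<delta>1 > 0" "\<forall>x. \<delta>1 \<le> norm (f (cvec x y1))" "continuous_on UNIV h1"
       "\<forall>x. f (cvec x y1) = exp (h1 x)" "\<forall>x. \<bar>Im (h1 x) - mean_motion f D1 \<bullet> x\<bar> \<le> C1" by (elim exE conjE)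
    have col: "\<exists>u\<in>{-R..R}. \<forall>v\<in>{0..L}. 4 * \<epsilon> \<le> norm (f (cvec (x + u *\<^sub>R e) (y0 + v *\<^sub>R e)))" for x
      unfolding \<epsilon>(2) by (rule \<epsilon>1(2)[rule_format]) (use e(2) ne yD L in \<open>auto simp: G_def\<close>)
    have "\<bar>s * \<psi> (mean_motion f D1 - mean_motion f D0)\<bar> \<le> 3 * R * \<bar>(mean_motion f D1 - mean_motion f D0) \<bullet> e\<bar>"
    proof (rule mean_motion_difference_bound[OF D yD L, where \<delta> = "min \<delta>0 \<delta>1" and C = "max C0 C1" and \<psi> = "\<lambda>v. s * \<psi> v" and ?h0.0 = h0 and ?h1.0 = h1, OF _ _ _ 0(3) _ _ 1(3) _ _ col R(1) _ A sw \<epsilon>(1)])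
      show "min \<delta>0 \<delta>1 > 0" using 0(1) 1(1) by simp
      show "min \<delta>0 \<delta>1 \<le> norm (f (cvec x y0))" for x using 0(2) by (simp add: min.coboundedI1)
      show "min \<delta>0 \<delta>1 \<le> norm (f (cvec x (y0 + L *\<^sub>R e)))" for x using 1(2) unfolding y1 by (simp add: min.coboundedI2)
      show "f (cvec x y0) = exp (h0 x)" for x using 0(4) by blast
      show "f (cvec x (y0 + L *\<^sub>R e)) = exp (h1 x)" for x using 1(4) unfolding y1 by blast
      show "\<bar>Im (h0 x) - mean_motion f D0 \<bullet> x\<bar> \<le> max C0 C1" for x using 0(5) by (simp add: max.coboundedI1)
      show "\<bar>Im (h1 x) - mean_motion f D1 \<bullet> x\<bar> \<le> max C0 C1" for x using 1(5) by (simp add: max.coboundedI2)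
      show "s * \<psi> (a + b) = s * \<psi> a + s * \<psi> b" for a b by (simp add: add distrib_left)
    qed
    also have "\<dots> \<le> 3 * R * norm (mean_motion f D1 - mean_motion f D0)"
      using R(1) Cauchy_Schwarz_ineq2[of "mean_motion f D1 - mean_motion f D0" e] ne by (intro mult_left_mono) auto
    finally show "\<bar>\<psi> (mean_motion f D1 - mean_motion f D0)\<bar> \<le> 3 * R / s * norm (mean_motion f D1 - mean_motion f D0)"
      using s by (simp add: abs_mult field_simps)
  qed
qed

end

section \<open>Rationality of the coefficients and the final estimates\<close>

context ap_tube begin

text \<open>The finite set \<open>\<Lambda>\<close> is chosen before the components, at an accuracy
  determined by \<open>window_everywhere\<close>; its rational basis therefore serves all of them,
  and finitely many vectors suffice even for infinitely many components.\<close>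

lemma mean_motion_rational_combination:
  assumes D: "compactly_in D \<Omega>" and nz: "\<exists>z\<in>tube \<Omega>. f z \<noteq> 0"
  shows "\<exists>(k::nat) lam (\<psi> :: nat \<Rightarrow> real^'p \<Rightarrow> real). (\<forall>j<k. lam j \<in> spec \<Omega> f) \<and>
     (\<forall>n :: nat \<Rightarrow> int. (\<Sum>j<k. of_int (n j) *\<^sub>R lam j) = 0 \<longrightarrow> (\<forall>j<k. n j = 0)) \<and>
     (\<forall>j<k. \<forall>x y. \<psi> j (x + y) = \<psi> j x + \<psi> j y) \<and>
     (\<forall>U\<in>components (D - amoeba \<Omega> f). (\<forall>j<k. \<psi> j (mean_motion f U) \<in> \<rat>) \<and>
        mean_motion f U = (\<Sum>j<k. \<psi> j (mean_motion f U) *\<^sub>R lam j))"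
proof -
  have DO: "D \<subseteq> \<Omega>" using D closure_subset by (auto simp: compactly_in_def)
  from window_everywhere[OF D nz] obtain m where m: "m > 0" "\<forall>y\<in>D. \<exists>x. m \<le> norm (f (cvec x y))" by (elim exE conjE)
  define \<epsilon> where "\<epsilon> = m / 4"
  have \<epsilon>: "\<epsilon> > 0" "\<epsilon> / 4 > 0" "4 * \<epsilon> = m" using m(1) by (auto simp: \<epsilon>_def)
  from approximant_exists[OF D \<epsilon>(2)] obtain \<Lambda> b wt where A: "\<Lambda> \<subseteq> spec \<Omega> f" "approximant D (\<epsilon> / 4) \<Lambda> b wt" by (elim exE conjE)
  have "finite \<Lambda>" using A(2) by (simp add: approximant_def)
  from rational_basis[OF this] obtain k :: nat and lam and \<psi> :: "nat \<Rightarrow> real^'p \<Rightarrow> real" where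
    lam: "\<forall>j<k. lam j \<in> \<Lambda>" "\<forall>n :: nat \<Rightarrow> int. (\<Sum>j<k. of_int (n j) *\<^sub>R lam j) = 0 \<longrightarrow> (\<forall>j<k. n j = 0)"
    and \<psi>: "\<forall>j<k. (\<forall>x y. \<psi> j (x + y) = \<psi> j x + \<psi> j y) \<and> (\<forall>i<k. \<psi> j (lam i) = (if i = j then 1 else 0))"
    and span: "\<forall>c. (\<exists>q :: nat \<Rightarrow> rat. c = (\<Sum>j<k. of_rat (q j) *\<^sub>R lam j)) \<or>
        (\<exists>\<xi> :: real^'p \<Rightarrow> real. (\<forall>x y. \<xi> (x + y) = \<xi> x + \<xi> y) \<and> \<xi> c = 1 \<and> (\<forall>l\<in>\<Lambda>. \<xi> l = 0))"
    by (elim exE conjE)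
  have rat: "(\<forall>j<k. \<psi> j (mean_motion f U) \<in> \<rat>) \<and> mean_motion f U = (\<Sum>j<k. \<psi> j (mean_motion f U) *\<^sub>R lam j)"
    if U: "U \<in> components (D - amoeba \<Omega> f)" for U
  proof -
    let ?c = "mean_motion f U"
    obtain y where y: "y \<in> U" using in_components_nonempty[OF U] by blast
    have yD: "y \<in> D" using y in_components_subset[OF U] by blast
    from component_mean_motion[OF nz DO U y] obtain \<delta> h C where h: "\<delta> > 0" "\<forall>x. \<delta> \<le> norm (f (cvec x y))" "continuous_on UNIV h"
       "\<forall>x. f (cvec x y) = exp (h x)" "\<forall>x. \<bar>Im (h x) - ?c \<bullet> x\<bar> \<le> C" by (elim exE conjE)
    obtain x where x: "4 * \<epsilon> \<le> norm (f (cvec x y))" using m(2) yD \<epsilon>(3) by auto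
    have no: "\<not> (\<exists>\<xi> :: real^'p \<Rightarrow> real. (\<forall>x y. \<xi> (x + y) = \<xi> x + \<xi> y) \<and> \<xi> ?c = 1 \<and> (\<forall>l\<in>\<Lambda>. \<xi> l = 0))"
    proof
      assume "\<exists>\<xi> :: real^'p \<Rightarrow> real. (\<forall>x y. \<xi> (x + y) = \<xi> x + \<xi> y) \<and> \<xi> ?c = 1 \<and> (\<forall>l\<in>\<Lambda>. \<xi> l = 0)"
      then obtain \<xi> :: "real^'p \<Rightarrow> real" where \<xi>: "\<forall>x y. \<xi> (x + y) = \<xi> x + \<xi> y" "\<xi> ?c = 1" "\<forall>l\<in>\<Lambda>. \<xi> l = 0" by (elim exE conjE)
      show False
        by (rule mean_motion_in_span[OF D yD h(1) h(2)[rule_format] h(3) h(4)[rule_format] h(5)[rule_format] \<xi>(1)[rule_format] \<xi>(2) \<xi>(3)[rule_format] A(2) \<epsilon>(1) x])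
    qed
    have "\<exists>q :: nat \<Rightarrow> rat. ?c = (\<Sum>j<k. of_rat (q j) *\<^sub>R lam j)"
      by (rule disjE[OF spec[OF span, of ?c]], assumption, rule notE[OF no], assumption)
    then obtain q :: "nat \<Rightarrow> rat" where q: "?c = (\<Sum>j<k. of_rat (q j) *\<^sub>R lam j)" ..
    \<comment> \<open>\<open>\<psi> j\<close> is linear over the rationals and dual to the basis,
      hence reads off the j-th coefficient.\<close>
    have \<psi>q: "\<psi> j ?c = of_rat (q j)" if j: "j < k" for j
    proof -
      have add: "\<psi> j (x + y) = \<psi> j x + \<psi> j y" for x y using \<psi> j by simp
      have "\<psi> j ?c = (\<Sum>i<k. of_rat (q i) * \<psi> j (lam i))"
        unfolding q additive_scale_int(3)[OF add] additive_scale_rat[OF add] ..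
      also have "\<dots> = (\<Sum>i<k. if i = j then of_rat (q i) else 0)" using \<psi> j by (intro sum.cong) auto
      also have "\<dots> = of_rat (q j)" using j by simp
      finally show ?thesis .
    qed
    have "?c = (\<Sum>j<k. \<psi> j ?c *\<^sub>R lam j)" by (subst q) (rule sum.cong, simp_all add: \<psi>q)
    then show ?thesis using \<psi>q by simp
  qed
  show ?thesis
    by (rule exI[of _ k], rule exI[of _ lam], rule exI[of _ \<psi>], intro conjI ballI) (use lam A(1) \<psi> rat in auto)
qed

lemma vector_coefficient_bound:
  fixes \<psi> :: "nat \<Rightarrow> real^'p \<Rightarrow> real"
  assumes D: "compactly_in D \<Omega>" "convex D" "open D" and nz: "\<exists>z\<in>tube \<Omega>. f z \<noteq> 0"
    and add: "\<And>j a b. j < k \<Longrightarrow> \<psi> j (a + b) = \<psi> j a + \<psi> j b" and \<beta>: "\<beta> > 0"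
  shows "\<exists>K. \<forall>D0\<in>components (D - amoeba \<Omega> f). \<forall>D1\<in>components (D - amoeba \<Omega> f).
     \<beta> \<le> sphere_mes (directions D1 D0) \<longrightarrow>
     sqrt (\<Sum>j<k. (\<psi> j (mean_motion f D1 - mean_motion f D0))\<^sup>2) \<le> K * norm (mean_motion f D1 - mean_motion f D0)"
proof -
  have "\<forall>j\<in>{..<k}. \<exists>K\<ge>0. \<forall>D0\<in>components (D - amoeba \<Omega> f). \<forall>D1\<in>components (D - amoeba \<Omega> f).
     \<beta> \<le> sphere_mes (directions D1 D0) \<longrightarrow> \<bar>\<psi> j (mean_motion f D1 - mean_motion f D0)\<bar> \<le> K * norm (mean_motion f D1 - mean_motion f D0)"
    by (rule ballI, rule coefficient_bound[OF D nz _ \<beta>]) (simp add: add)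
  from bchoice[OF this] obtain K where K: "\<forall>j\<in>{..<k}. 0 \<le> K j \<and> (\<forall>D0\<in>components (D - amoeba \<Omega> f). \<forall>D1\<in>components (D - amoeba \<Omega> f).
     \<beta> \<le> sphere_mes (directions D1 D0) \<longrightarrow> \<bar>\<psi> j (mean_motion f D1 - mean_motion f D0)\<bar> \<le> K j * norm (mean_motion f D1 - mean_motion f D0))" ..
  show ?thesis
  proof (rule exI[of _ "\<Sum>j<k. K j"], intro ballI impI)
    fix D0 D1 assume U: "D0 \<in> components (D - amoeba \<Omega> f)" "D1 \<in> components (D - amoeba \<Omega> f)" "\<beta> \<le> sphere_mes (directions D1 D0)"
    have "sqrt (\<Sum>j<k. (\<psi> j (mean_motion f D1 - mean_motion f D0))\<^sup>2) \<le> (\<Sum>j<k. \<bar>\<psi> j (mean_motion f D1 - mean_motion f D0)\<bar>)"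
      using L2_set_le_sum_abs[of "\<lambda>j. \<psi> j (mean_motion f D1 - mean_motion f D0)" "{..<k}"] by (simp only: L2_set_def)
    also have "\<dots> \<le> (\<Sum>j<k. K j * norm (mean_motion f D1 - mean_motion f D0))"
      by (rule sum_mono) (use K U in blast)
    also have "\<dots> = (\<Sum>j<k. K j) * norm (mean_motion f D1 - mean_motion f D0)" by (rule sum_distrib_right[symmetric])
    finally show "sqrt (\<Sum>j<k. (\<psi> j (mean_motion f D1 - mean_motion f D0))\<^sup>2) \<le> (\<Sum>j<k. K j) * norm (mean_motion f D1 - mean_motion f D0)" .
  qed
qed

lemma component_directions_lower:
  assumes D: "open D" "bounded D" "D \<subseteq> \<Omega>" and U: "D0 \<in> components (D - amoeba \<Omega> f)"
  shows "\<exists>\<beta>>0. \<forall>D1\<in>components (D - amoeba \<Omega> f). \<beta> \<le> sphere_mes (directions D1 D0)"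
proof -
  have "D - amoeba \<Omega> f = D - closure {y \<in> \<Omega>. \<exists>x. f (cvec x y) = 0}" using D(3) by (auto simp: amoeba_def)
  then have "open (D - amoeba \<Omega> f)" by (simp add: open_Diff D(1))
  then have o: "open D0" using U by (rule open_components)
  obtain a where a: "a \<in> D0" using in_components_nonempty[OF U] by blast
  obtain \<rho> where \<rho>: "\<rho> > 0" "ball a \<rho> \<subseteq> D0" using o a open_contains_ball by blast
  obtain M where M: "\<And>y. y \<in> D \<Longrightarrow> norm y \<le> M" using D(2) unfolding bounded_iff by blast
  \<comment> \<open>Bounds the distance from \<open>a\<close> to any point of \<open>D\<close>, so
    that the resulting \<open>\<beta>\<close> does not depend on the second component.\<close>
  define \<Delta> where "\<Delta> = M + norm a"
  have aD: "a \<in> D" using a in_components_subset[OF U] by blast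
  have \<Delta>0: "\<Delta> \<ge> 0" using order_trans[OF norm_ge_zero M[OF aD]] by (simp add: \<Delta>_def)
  define \<beta> where "\<beta> = real CARD('p) * ((\<rho> / (\<Delta> + \<rho>)) ^ CARD('p) * measure lborel (ball (0 :: real^'p) 1))"
  have "measure lborel (ball (0 :: real^'p) 1) > 0" by (rule content_ball_pos) simp
  moreover have "\<rho> / (\<Delta> + \<rho>) > 0" using \<rho>(1) \<Delta>0 by simp
  ultimately have "\<beta> > 0" unfolding \<beta>_def by (intro mult_pos_pos zero_less_power) auto
  moreover have "\<beta> \<le> sphere_mes (directions D1 D0)" if D1: "D1 \<in> components (D - amoeba \<Omega> f)" for D1
  proof -
    obtain y1 where y1: "y1 \<in> D1" using in_components_nonempty[OF D1] by blast
    have "y1 \<in> D" using y1 in_components_subset[OF D1] by blast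
    then have "norm (y1 - a) \<le> \<Delta>" using M[of y1] norm_triangle_ineq4[of y1 a] unfolding \<Delta>_def by linarith
    then show ?thesis unfolding \<beta>_def by (rule sphere_mes_directions_lower[OF o \<rho>(2,1) y1])
  qed
  ultimately show ?thesis by blast
qed

end

theorem mainTheorem2:
  fixes \<Omega> D :: "(real^'p) set" and f :: "complex^'p \<Rightarrow> complex"
  assumes "domain \<Omega>" and "f \<in> AP \<Omega>" and "\<exists>z\<in>tube \<Omega>. f z \<noteq> 0"
    and "domain D" and "convex D" and "compactly_in D \<Omega>"
  shows "\<exists>(k::nat) (lam :: nat \<Rightarrow> real^'p) (r :: (real^'p) set \<Rightarrow> (real^'p) set \<Rightarrow> nat \<Rightarrow> real).
     (\<forall>j<k. lam j \<in> Gf \<Omega> f) \<and>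
     (\<forall>n :: nat \<Rightarrow> int. (\<Sum>j<k. of_int (n j) *\<^sub>R lam j) = 0 \<longrightarrow> (\<forall>j<k. n j = 0)) \<and>
     (\<forall>D0\<in>components (D - amoeba \<Omega> f). \<forall>D1\<in>components (D - amoeba \<Omega> f).
        (\<forall>j<k. r D1 D0 j \<in> \<rat>) \<and>
        mean_motion f D1 - mean_motion f D0 = (\<Sum>j<k. r D1 D0 j *\<^sub>R lam j)) \<and>
     (\<forall>\<beta>>0. \<exists>K::real. \<forall>D0\<in>components (D - amoeba \<Omega> f). \<forall>D1\<in>components (D - amoeba \<Omega> f).
        sphere_mes (directions D1 D0) \<ge> \<beta> \<longrightarrow>
        sqrt (\<Sum>j<k. (r D1 D0 j)\<^sup>2) \<le> K * norm (mean_motion f D1 - mean_motion f D0)) \<and>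
     (\<forall>D0\<in>components (D - amoeba \<Omega> f). \<exists>K::real. \<forall>D1\<in>components (D - amoeba \<Omega> f).
        sqrt (\<Sum>j<k. (r D1 D0 j)\<^sup>2) \<le> K * norm (mean_motion f D1 - mean_motion f D0))"
proof -
  interpret ap_tube \<Omega> f by unfold_locales (use assms in auto)
  have oD: "open D" using assms(4) by (simp add: domain_def)
  have bD: "bounded D" and DO: "D \<subseteq> \<Omega>" using assms(6) closure_subset by (auto simp: compactly_in_def)
  from mean_motion_rational_combination[OF assms(6,3)] obtain k :: nat and lam and \<psi> :: "nat \<Rightarrow> real^'p \<Rightarrow> real" where
    lam: "\<forall>j<k. lam j \<in> spec \<Omega> f" "\<forall>n :: nat \<Rightarrow> int. (\<Sum>j<k. of_int (n j) *\<^sub>R lam j) = 0 \<longrightarrow> (\<forall>j<k. n j = 0)"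
    and add: "\<forall>j<k. \<forall>x y. \<psi> j (x + y) = \<psi> j x + \<psi> j y"
    and rat: "\<forall>U\<in>components (D - amoeba \<Omega> f). (\<forall>j<k. \<psi> j (mean_motion f U) \<in> \<rat>) \<and>
        mean_motion f U = (\<Sum>j<k. \<psi> j (mean_motion f U) *\<^sub>R lam j)"
    by (elim exE conjE)
  have sub: "\<psi> j (x - y) = \<psi> j x - \<psi> j y" if "j < k" for j x y
  proof -
    have "\<psi> j ((x - y) + y) = \<psi> j (x - y) + \<psi> j y" using add that by blast
    then show ?thesis by simp
  qed
  let ?r = "\<lambda>D1 D0 j. \<psi> j (mean_motion f D1 - mean_motion f D0)"
  have bound: "\<exists>K. \<forall>D0\<in>components (D - amoeba \<Omega> f). \<forall>D1\<in>components (D - amoeba \<Omega> f).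
        sphere_mes (directions D1 D0) \<ge> \<beta> \<longrightarrow>
        sqrt (\<Sum>j<k. (?r D1 D0 j)\<^sup>2) \<le> K * norm (mean_motion f D1 - mean_motion f D0)" if "\<beta> > 0" for \<beta>
    by (rule vector_coefficient_bound[OF assms(6,5) oD assms(3) _ that]) (simp add: add)
  show ?thesis
  proof (rule exI[of _ k], rule exI[of _ lam], rule exI[of _ ?r], intro conjI)
    \<comment> \<open>The vectors found lie in the spectrum itself, which generates the
      group.\<close>
    show "\<forall>j<k. lam j \<in> Gf \<Omega> f" using lam(1) unfolding Gf_def by (auto intro: group_closure.base)
    show "\<forall>n :: nat \<Rightarrow> int. (\<Sum>j<k. of_int (n j) *\<^sub>R lam j) = 0 \<longrightarrow> (\<forall>j<k. n j = 0)" by (rule lam(2))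
    show "\<forall>D0\<in>components (D - amoeba \<Omega> f). \<forall>D1\<in>components (D - amoeba \<Omega> f).
        (\<forall>j<k. ?r D1 D0 j \<in> \<rat>) \<and> mean_motion f D1 - mean_motion f D0 = (\<Sum>j<k. ?r D1 D0 j *\<^sub>R lam j)"
    proof (intro ballI conjI allI impI)
      fix D0 D1 assume U: "D0 \<in> components (D - amoeba \<Omega> f)" "D1 \<in> components (D - amoeba \<Omega> f)"
      note r0 = rat[rule_format, OF U(1)] and r1 = rat[rule_format, OF U(2)]
      show "?r D1 D0 j \<in> \<rat>" if "j < k" for j using r0 r1 that by (simp add: sub)
      have "(\<Sum>j<k. ?r D1 D0 j *\<^sub>R lam j) = (\<Sum>j<k. \<psi> j (mean_motion f D1) *\<^sub>R lam j - \<psi> j (mean_motion f D0) *\<^sub>R lam j)"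
        by (rule sum.cong) (simp_all add: sub scaleR_diff_left)
      also have "\<dots> = mean_motion f D1 - mean_motion f D0"
        unfolding sum_subtractf using r0 r1 by metis
      finally show "mean_motion f D1 - mean_motion f D0 = (\<Sum>j<k. ?r D1 D0 j *\<^sub>R lam j)" ..
    qed
    show "\<forall>\<beta>>0. \<exists>K::real. \<forall>D0\<in>components (D - amoeba \<Omega> f). \<forall>D1\<in>components (D - amoeba \<Omega> f).
        sphere_mes (directions D1 D0) \<ge> \<beta> \<longrightarrow>
        sqrt (\<Sum>j<k. (?r D1 D0 j)\<^sup>2) \<le> K * norm (mean_motion f D1 - mean_motion f D0)"
      using bound by (intro allI impI)
    show "\<forall>D0\<in>components (D - amoeba \<Omega> f). \<exists>K::real. \<forall>D1\<in>components (D - amoeba \<Omega> f).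
        sqrt (\<Sum>j<k. (?r D1 D0 j)\<^sup>2) \<le> K * norm (mean_motion f D1 - mean_motion f D0)"
    proof
      fix D0 assume U: "D0 \<in> components (D - amoeba \<Omega> f)"
      from component_directions_lower[OF oD bD DO U] obtain \<beta> where \<beta>: "\<beta> > 0"
        "\<forall>D1\<in>components (D - amoeba \<Omega> f). \<beta> \<le> sphere_mes (directions D1 D0)" by (elim exE conjE)
      from bound[OF \<beta>(1)] obtain K where K: "\<forall>D0\<in>components (D - amoeba \<Omega> f). \<forall>D1\<in>components (D - amoeba \<Omega> f).
        sphere_mes (directions D1 D0) \<ge> \<beta> \<longrightarrow>
        sqrt (\<Sum>j<k. (?r D1 D0 j)\<^sup>2) \<le> K * norm (mean_motion f D1 - mean_motion f D0)" by (elim exE)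
      show "\<exists>K::real. \<forall>D1\<in>components (D - amoeba \<Omega> f).
        sqrt (\<Sum>j<k. (?r D1 D0 j)\<^sup>2) \<le> K * norm (mean_motion f D1 - mean_motion f D0)"
        by (rule exI[of _ K], rule ballI) (rule K[rule_format, OF U], assumption, rule \<beta>(2)[rule_format], assumption)
    qed
  qed
qed

end
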